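(* Let $\Bbbk$ be a field and $A=\Bbbk[[x,y,z]]/(x^3+y^2-xyz)$. The classification of maximal Cohen--Macaulay $A$-modules of rank one is the following. (1) Up to isomorphism there exists exactly one maximal Cohen--Macaulay $A$-module $N$ of rank one which is not locally free on the punctured spectrum. One has $A$-module isomorphisms $N\cong I\cong R$, where $R$ is the normalization of $A$ and $I=\mathrm{Ann}_A(R/A)=(x,y)$ is the conductor ideal. (2) A rank one maximal Cohen--Macaulay $A$-module which is locally free on the punctured spectrum is either isomorphic to $A$ or has one of the following forms: $$M\bigl((1,m),1,\lambda\bigr)\cong I_{m,\lambda}\quad\text{and}\quad M\bigl((m,1),1,\lambda\bigr)\cong J_{m,\lambda},$$ where $m\ge1$, $\lambda\in\Bbbk^*$ if $m\ge2$ and $\lambda\in\Bbbk^*\setminus\{1\}$ if $m=1$, and $$I_{m,\lambda}=\bigl\langle x^{m+1},\ yx^{m-1}+\lambda(xz-y)^m\bigr\rangle\subset A,\qquad J_{m,\lambda}=\bigl\langle x^{m+1},\ y^m+\lambda x^{m-1}(xz-y)\bigr\rangle\subset A.$$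
   Context: Locally free on the punctured spectrum means that $M_{\mathfrak p}$ is free over $A_{\mathfrak p}$ for every non-maximal prime $\mathfrak p$. Notation $M((m,n),1,\lambda)$: the normalization is $R=\Bbbk[[u,v]]$, $u=y/x$, $v=(xz-y)/x$ (so $x=uv$, $y=u^2v$, $z=u+v$), $I=(x,y)A=(uv)R$, $\bar A=A/I=\Bbbk[[z]]$, $\bar R=R/I=\Bbbk[[u,v]]/(uv)$, $\mathbb K=Q(\bar A)=\Bbbk((z))$, $Q(\bar R)=\Bbbk((u))\times\Bbbk((v))$. Maximal Cohen--Macaulay $A$-modules $M$ are equivalent, via $M\mapsto\bigl((R\otimes_AM)^{**},\ Q(\bar A)\otimes_AM,\ \theta_M\bigr)$ ($\theta_M$ induced by the canonical map $R\otimes_AM\to(R\otimes_AM)^{**}$), to triples $(\widetilde M,V,\theta)$ with $\widetilde M$ a free $R$-module, $V$ a finite-dimensional $\mathbb K$-space and $\theta:Q(\bar R)\otimes_{\mathbb K}V\to Q(\bar R)\otimes_R\widetilde M$ surjective with injective adjoint $V\to Q(\bar R)\otimes_R\widetilde M$. For $\min(m,n)=1$, $M((m,n),1,\lambda)$ is the maximal Cohen--Macaulay module corresponding to the triple $(R,\mathbb K,\theta)$ with $\theta$ given by $u^m$ in the $\Bbbk((u))$-component and $\lambda v^n$ in the $\Bbbk((v))$-component. *)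

theory Defs
  imports
    "HOL-Computational_Algebra.Formal_Laurent_Series"
    "HOL-Library.Extended_Nat"
    "HOL-Algebra.Module"
    "HOL-Algebra.QuotRing"
    "HOL-Algebra.Chinese_Remainder"
    "HOL-Algebra.Free_Abelian_Groups"
    "HOL-Algebra.Generated_Groups"
    "HOL-Algebra.Algebraic_Closure_Type"
begin

section \<open>Modules over a commutative ring\<close>

text \<open>The fields \<open>mult\<close> and \<open>one\<close> of the record type of modules play no role for modules; they are
  left unspecified below whenever there is no natural choice.\<close>

definition module_hom :: "('a, 'c) ring_scheme \<Rightarrow> ('a, 'm) module \<Rightarrow> ('a, 'n) module \<Rightarrow> ('m \<Rightarrow> 'n) set" where
  "module_hom A M N = {f \<in> carrier M \<rightarrow> carrier N.
     (\<forall>x\<in>carrier M. \<forall>y\<in>carrier M. f (x \<oplus>\<^bsub>M\<^esub> y) = f x \<oplus>\<^bsub>N\<^esub> f y) \<and>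
     (\<forall>a\<in>carrier A. \<forall>x\<in>carrier M. f (a \<odot>\<^bsub>M\<^esub> x) = a \<odot>\<^bsub>N\<^esub> f x)}"

definition module_iso :: "('a, 'c) ring_scheme \<Rightarrow> ('a, 'm) module \<Rightarrow> ('a, 'n) module \<Rightarrow> ('m \<Rightarrow> 'n) set" where
  "module_iso A M N = {f \<in> module_hom A M N. bij_betw f (carrier M) (carrier N)}"

definition isomorphic :: "('a, 'c) ring_scheme \<Rightarrow> ('a, 'm) module \<Rightarrow> ('a, 'n) module \<Rightarrow> bool" where
  "isomorphic A M N \<longleftrightarrow> module_iso A M N \<noteq> {}"

definition restrict_scalars :: "('a \<Rightarrow> 'b) \<Rightarrow> ('b, 'd) ring_scheme \<Rightarrow> ('a, 'b) module" where
  "restrict_scalars f B = \<lparr>carrier = carrier B, monoid.mult = (\<otimes>\<^bsub>B\<^esub>), one = \<one>\<^bsub>B\<^esub>,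
     ring.zero = \<zero>\<^bsub>B\<^esub>, ring.add = (\<oplus>\<^bsub>B\<^esub>), module.smult = (\<lambda>a b. f a \<otimes>\<^bsub>B\<^esub> b)\<rparr>"

definition self_module :: "('a, 'c) ring_scheme \<Rightarrow> ('a, 'a) module" where
  "self_module A = restrict_scalars (\<lambda>a. a) A"

definition ideal_module :: "('a, 'c) ring_scheme \<Rightarrow> 'a set \<Rightarrow> ('a, 'a) module" where
  "ideal_module A J = self_module A \<lparr>carrier := J\<rparr>"

definition finitely_generated :: "('a, 'c) ring_scheme \<Rightarrow> ('a, 'm) module \<Rightarrow> bool" where
  "finitely_generated A M \<longleftrightarrow> (\<exists>S. finite S \<and> S \<subseteq> carrier M \<and>
     (\<forall>N. submodule N A M \<and> S \<subseteq> N \<longrightarrow> N = carrier M))"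

definition basis :: "('a, 'c) ring_scheme \<Rightarrow> ('a, 'm) module \<Rightarrow> 'm set \<Rightarrow> bool" where
  "basis A M B \<longleftrightarrow> finite B \<and> B \<subseteq> carrier M \<and>
     (\<forall>x\<in>carrier M. \<exists>!c. c \<in> B \<rightarrow>\<^sub>E carrier A \<and> x = (\<Oplus>\<^bsub>M\<^esub>b\<in>B. c b \<odot>\<^bsub>M\<^esub> b))"

definition free_of_rank :: "('a, 'c) ring_scheme \<Rightarrow> ('a, 'm) module \<Rightarrow> nat \<Rightarrow> bool" where
  "free_of_rank A M n \<longleftrightarrow> (\<exists>B. basis A M B \<and> card B = n)"

definition dual :: "('a, 'c) ring_scheme \<Rightarrow> ('a, 'm) module \<Rightarrow> ('a, 'm \<Rightarrow> 'a) module" where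
  "dual A M = \<lparr>carrier = module_hom A M (self_module A) \<inter> extensional (carrier M),
     monoid.mult = undefined, one = undefined,
     ring.zero = (\<lambda>x\<in>carrier M. \<zero>\<^bsub>A\<^esub>),
     ring.add = (\<lambda>f g. \<lambda>x\<in>carrier M. f x \<oplus>\<^bsub>A\<^esub> g x),
     module.smult = (\<lambda>a f. \<lambda>x\<in>carrier M. a \<otimes>\<^bsub>A\<^esub> f x)\<rparr>"

definition to_bidual :: "('a, 'c) ring_scheme \<Rightarrow> ('a, 'm) module \<Rightarrow> 'm \<Rightarrow> ('m \<Rightarrow> 'a) \<Rightarrow> 'a" where
  "to_bidual A M x = (\<lambda>f\<in>carrier (dual A M). f x)"


section \<open>Extension of scalars\<close>

text \<open>For a ring homomorphism \<open>f\<close> from \<open>A\<close> to \<open>B\<close> and an \<open>A\<close>-module \<open>M\<close>, the \<open>B\<close>-module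
  \<open>B \<otimes>\<^sub>A M\<close> is the free abelian group on the set of pairs \<open>(b, x)\<close> modulo the usual relations.\<close>

definition tensor_relators ::
    "('a \<Rightarrow> 'b) \<Rightarrow> ('a, 'c) ring_scheme \<Rightarrow> ('b, 'd) ring_scheme \<Rightarrow> ('a, 'm) module \<Rightarrow> (('b \<times> 'm) \<Rightarrow>\<^sub>0 int) set" where
  "tensor_relators f A B M =
     {frag_of (b \<oplus>\<^bsub>B\<^esub> b', x) - frag_of (b, x) - frag_of (b', x) | b b' x.
        b \<in> carrier B \<and> b' \<in> carrier B \<and> x \<in> carrier M} \<union>
     {frag_of (b, x \<oplus>\<^bsub>M\<^esub> x') - frag_of (b, x) - frag_of (b, x') | b x x'.
        b \<in> carrier B \<and> x \<in> carrier M \<and> x' \<in> carrier M} \<union>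
     {frag_of (b \<otimes>\<^bsub>B\<^esub> f a, x) - frag_of (b, a \<odot>\<^bsub>M\<^esub> x) | a b x.
        a \<in> carrier A \<and> b \<in> carrier B \<and> x \<in> carrier M}"

definition tensor_class ::
    "('a \<Rightarrow> 'b) \<Rightarrow> ('a, 'c) ring_scheme \<Rightarrow> ('b, 'd) ring_scheme \<Rightarrow> ('a, 'm) module \<Rightarrow>
     (('b \<times> 'm) \<Rightarrow>\<^sub>0 int) \<Rightarrow> (('b \<times> 'm) \<Rightarrow>\<^sub>0 int) set" where
  "tensor_class f A B M c =
     (let F = free_Abelian_group (carrier B \<times> carrier M)
      in generate F (tensor_relators f A B M) #>\<^bsub>F\<^esub> c)"

definition base_change ::
    "('a \<Rightarrow> 'b) \<Rightarrow> ('a, 'c) ring_scheme \<Rightarrow> ('b, 'd) ring_scheme \<Rightarrow> ('a, 'm) module \<Rightarrow>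
     ('b, (('b \<times> 'm) \<Rightarrow>\<^sub>0 int) set) module" where
  "base_change f A B M =
     (let F = free_Abelian_group (carrier B \<times> carrier M);
          H = generate F (tensor_relators f A B M)
      in \<lparr>carrier = carrier (F Mod H), monoid.mult = undefined, one = undefined,
          ring.zero = \<one>\<^bsub>F Mod H\<^esub>, ring.add = (\<otimes>\<^bsub>F Mod H\<^esub>),
          module.smult = (\<lambda>b C. \<Union>c\<in>C. tensor_class f A B M
                     (frag_extend (\<lambda>(b', x). frag_of (b \<otimes>\<^bsub>B\<^esub> b', x)) c))\<rparr>)"

definition pure_tensor ::
    "('a \<Rightarrow> 'b) \<Rightarrow> ('a, 'c) ring_scheme \<Rightarrow> ('b, 'd) ring_scheme \<Rightarrow> ('a, 'm) module \<Rightarrow>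
     'b \<Rightarrow> 'm \<Rightarrow> (('b \<times> 'm) \<Rightarrow>\<^sub>0 int) set" where
  "pure_tensor f A B M b x = tensor_class f A B M (frag_of (b, x))"

text \<open>The homomorphism into \<open>N\<close> induced by a balanced biadditive map \<open>g\<close>, i.e. the one which sends
  the class of \<open>b \<otimes> x\<close> to \<open>g (b, x)\<close>.\<close>

definition tensor_lift :: "('e, 'n) module \<Rightarrow> ('p \<Rightarrow> 'n) \<Rightarrow> ('p \<Rightarrow>\<^sub>0 int) set \<Rightarrow> 'n" where
  "tensor_lift N g C =
     the_elem ((\<lambda>c. \<Oplus>\<^bsub>N\<^esub>p\<in>Poly_Mapping.keys c. [Poly_Mapping.lookup c p] \<cdot>\<^bsub>N\<^esub> g p) ` C)"

definition base_change_map ::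
    "('a \<Rightarrow> 'b) \<Rightarrow> ('a, 'c) ring_scheme \<Rightarrow> ('b, 'd) ring_scheme \<Rightarrow> ('a, 'n) module \<Rightarrow> ('m \<Rightarrow> 'n) \<Rightarrow>
     (('b \<times> 'm) \<Rightarrow>\<^sub>0 int) set \<Rightarrow> (('b \<times> 'n) \<Rightarrow>\<^sub>0 int) set" where
  "base_change_map f A B N \<phi> =
     tensor_lift (base_change f A B N) (\<lambda>(b, x). pure_tensor f A B N b (\<phi> x))"


section \<open>Localization, rank, local freeness\<close>

definition fraction :: "('a, 'c) ring_scheme \<Rightarrow> 'a set \<Rightarrow> 'a \<Rightarrow> 'a \<Rightarrow> ('a \<times> 'a) set" where
  "fraction A S a s = {(b, t) \<in> carrier A \<times> S.
     \<exists>r\<in>S. r \<otimes>\<^bsub>A\<^esub> (a \<otimes>\<^bsub>A\<^esub> t) = r \<otimes>\<^bsub>A\<^esub> (b \<otimes>\<^bsub>A\<^esub> s)}"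

definition localization :: "('a, 'c) ring_scheme \<Rightarrow> 'a set \<Rightarrow> ('a \<times> 'a) set ring" where
  "localization A S =
     \<lparr>carrier = (\<lambda>(a, s). fraction A S a s) ` (carrier A \<times> S),
      monoid.mult = (\<lambda>C D. \<Union>(a, s)\<in>C. \<Union>(b, t)\<in>D. fraction A S (a \<otimes>\<^bsub>A\<^esub> b) (s \<otimes>\<^bsub>A\<^esub> t)),
      one = fraction A S \<one>\<^bsub>A\<^esub> \<one>\<^bsub>A\<^esub>,
      ring.zero = fraction A S \<zero>\<^bsub>A\<^esub> \<one>\<^bsub>A\<^esub>,
      ring.add = (\<lambda>C D. \<Union>(a, s)\<in>C. \<Union>(b, t)\<in>D.
               fraction A S (a \<otimes>\<^bsub>A\<^esub> t \<oplus>\<^bsub>A\<^esub> b \<otimes>\<^bsub>A\<^esub> s) (s \<otimes>\<^bsub>A\<^esub> t))\<rparr>"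

definition to_localization :: "('a, 'c) ring_scheme \<Rightarrow> 'a set \<Rightarrow> 'a \<Rightarrow> ('a \<times> 'a) set" where
  "to_localization A S a = fraction A S a \<one>\<^bsub>A\<^esub>"

definition localized_module ::
    "('a, 'c) ring_scheme \<Rightarrow> 'a set \<Rightarrow> ('a, 'm) module \<Rightarrow>
     (('a \<times> 'a) set, ((('a \<times> 'a) set \<times> 'm) \<Rightarrow>\<^sub>0 int) set) module" where
  "localized_module A S M = base_change (to_localization A S) A (localization A S) M"

definition nonzerodivisors :: "('a, 'c) ring_scheme \<Rightarrow> 'a set" where
  "nonzerodivisors A = {s \<in> carrier A. \<forall>a\<in>carrier A. s \<otimes>\<^bsub>A\<^esub> a = \<zero>\<^bsub>A\<^esub> \<longrightarrow> a = \<zero>\<^bsub>A\<^esub>}"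

definition total_quotient_ring :: "('a, 'c) ring_scheme \<Rightarrow> ('a \<times> 'a) set ring" where
  "total_quotient_ring A = localization A (nonzerodivisors A)"

definition has_rank :: "('a, 'c) ring_scheme \<Rightarrow> ('a, 'm) module \<Rightarrow> nat \<Rightarrow> bool" where
  "has_rank A M n \<longleftrightarrow>
     free_of_rank (total_quotient_ring A) (localized_module A (nonzerodivisors A) M) n"

definition locally_free_on_punctured_spectrum :: "('a, 'c) ring_scheme \<Rightarrow> ('a, 'm) module \<Rightarrow> bool" where
  "locally_free_on_punctured_spectrum A M \<longleftrightarrow>
     (\<forall>P. primeideal P A \<and> \<not> maximalideal P A \<longrightarrow>
        (\<exists>n. free_of_rank (localization A (carrier A - P)) (localized_module A (carrier A - P) M) n))"


section \<open>Maximal Cohen--Macaulay modules\<close>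

definition krull_dim :: "('a, 'c) ring_scheme \<Rightarrow> enat" where
  "krull_dim A = Sup {enat n | n. \<exists>P::nat \<Rightarrow> 'a set.
     (\<forall>i\<le>n. primeideal (P i) A) \<and> (\<forall>i<n. P i \<subset> P (Suc i))}"

text \<open>\<open>seq_multiples M [a\<^sub>1, \<dots>, a\<^sub>r]\<close> is the submodule \<open>a\<^sub>1 M + \<dots> + a\<^sub>r M\<close>.\<close>

fun seq_multiples :: "('a, 'm) module \<Rightarrow> 'a list \<Rightarrow> 'm set" where
  "seq_multiples M [] = {\<zero>\<^bsub>M\<^esub>}"
| "seq_multiples M (a # as) = {a \<odot>\<^bsub>M\<^esub> x \<oplus>\<^bsub>M\<^esub> y | x y. x \<in> carrier M \<and> y \<in> seq_multiples M as}"

definition regular_sequence :: "('a, 'm) module \<Rightarrow> 'a list \<Rightarrow> bool" where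
  "regular_sequence M as \<longleftrightarrow>
     (\<forall>i<length as. \<forall>x\<in>carrier M.
        as ! i \<odot>\<^bsub>M\<^esub> x \<in> seq_multiples M (take i as) \<longrightarrow> x \<in> seq_multiples M (take i as)) \<and>
     seq_multiples M as \<noteq> carrier M"

definition depth :: "'a set \<Rightarrow> ('a, 'm) module \<Rightarrow> enat" where
  "depth J M = Sup {enat (length as) | as. set as \<subseteq> J \<and> regular_sequence M as}"

text \<open>To be used for a Noetherian local ring \<open>A\<close>, whose maximal ideal consists of the non-units.\<close>

definition maximal_cohen_macaulay :: "('a, 'c) ring_scheme \<Rightarrow> ('a, 'm) module \<Rightarrow> bool" where
  "maximal_cohen_macaulay A M \<longleftrightarrow> Module.module A M \<and> finitely_generated A M \<and>
     depth (carrier A - Units A) M = krull_dim A"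


section \<open>Normalization and conductor\<close>

definition integral_closure :: "('a \<Rightarrow> 'b) \<Rightarrow> ('a, 'c) ring_scheme \<Rightarrow> ('b, 'd) ring_scheme \<Rightarrow> 'b set" where
  "integral_closure f A B = {b \<in> carrier B. \<exists>n::nat. \<exists>c \<in> {..<n} \<rightarrow> carrier A.
     b [^]\<^bsub>B\<^esub> n \<oplus>\<^bsub>B\<^esub> (\<Oplus>\<^bsub>B\<^esub>i\<in>{..<n}. f (c i) \<otimes>\<^bsub>B\<^esub> b [^]\<^bsub>B\<^esub> i) = \<zero>\<^bsub>B\<^esub>}"

text \<open>\<open>R\<close>, regarded as an \<open>A\<close>-algebra via \<open>f\<close>, is the integral closure of \<open>A\<close> in its total
  quotient ring.\<close>

definition is_normalization :: "('a \<Rightarrow> 'b) \<Rightarrow> ('a, 'c) ring_scheme \<Rightarrow> ('b, 'd) ring_scheme \<Rightarrow> bool" where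
  "is_normalization f A R \<longleftrightarrow> f \<in> ring_hom A R \<and>
     (let S = nonzerodivisors A; j = to_localization A S; Q = total_quotient_ring A
      in \<exists>\<phi> \<in> ring_iso R (Q \<lparr>carrier := integral_closure j A Q\<rparr>). \<forall>a\<in>carrier A. \<phi> (f a) = j a)"

text \<open>The annihilator of the \<open>A\<close>-module \<open>R / A\<close>, where \<open>A\<close> is identified with its image in \<open>R\<close>.\<close>

definition conductor :: "('a \<Rightarrow> 'b) \<Rightarrow> ('a, 'c) ring_scheme \<Rightarrow> ('b, 'd) ring_scheme \<Rightarrow> 'a set" where
  "conductor f A R = {a \<in> carrier A. \<forall>r\<in>carrier R. f a \<otimes>\<^bsub>R\<^esub> r \<in> f ` carrier A}"


section \<open>The ring \<open>\<bbbk>[[x,y,z]]/(x\<^sup>3 + y\<^sup>2 - xyz)\<close>\<close>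

text \<open>\<open>\<bbbk>[[x,y,z]]\<close> is realized as \<open>\<bbbk>[[x]][[y]][[z]]\<close>; the coefficient of
  \<open>x\<^sup>a y\<^sup>b z\<^sup>c\<close> in \<open>F\<close> is \<open>F $ c $ b $ a\<close>.\<close>

definition var_x :: "'k::field fps fps fps" where "var_x = fps_const (fps_const fps_X)"
definition var_y :: "'k::field fps fps fps" where "var_y = fps_const fps_X"
definition var_z :: "'k::field fps fps fps" where "var_z = fps_X"

abbreviation scalar :: "'k::field \<Rightarrow> 'k fps fps fps" where
  "scalar c \<equiv> fps_const (fps_const (fps_const c))"

definition relation_ideal :: "'k::field fps fps fps set" where
  "relation_ideal = Idl\<^bsub>ring_of_type_algebra\<^esub> {var_x ^ 3 + var_y ^ 2 - var_x * var_y * var_z}"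

definition ring_A :: "'k::field fps fps fps set ring" where
  "ring_A = ring_of_type_algebra Quot relation_ideal"

definition class_A :: "'k::field fps fps fps \<Rightarrow> 'k fps fps fps set" where
  "class_A F = relation_ideal +>\<^bsub>ring_of_type_algebra\<^esub> F"

definition ideal_xy :: "'k::field fps fps fps set set" where
  "ideal_xy = Idl\<^bsub>ring_A\<^esub> {class_A var_x, class_A var_y}"

definition ideal_I :: "nat \<Rightarrow> 'k::field \<Rightarrow> 'k fps fps fps set set" where
  "ideal_I m l = Idl\<^bsub>ring_A\<^esub>
     {class_A (var_x ^ (m + 1)),
      class_A (var_y * var_x ^ (m - 1) + scalar l * (var_x * var_z - var_y) ^ m)}"

definition ideal_J :: "nat \<Rightarrow> 'k::field \<Rightarrow> 'k fps fps fps set set" where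
  "ideal_J m l = Idl\<^bsub>ring_A\<^esub>
     {class_A (var_x ^ (m + 1)),
      class_A (var_y ^ m + scalar l * var_x ^ (m - 1) * (var_x * var_z - var_y))}"


section \<open>The normalization \<open>\<bbbk>[[u,v]]\<close> and the associated rings\<close>

text \<open>\<open>\<bbbk>[[u,v]]\<close> is realized as \<open>\<bbbk>[[u]][[v]]\<close>.\<close>

definition var_u :: "'k::field fps fps" where "var_u = fps_const fps_X"
definition var_v :: "'k::field fps fps" where "var_v = fps_X"

abbreviation ring_R :: "'k::field fps fps ring" where "ring_R \<equiv> ring_of_type_algebra"

text \<open>The substitution \<open>x = uv\<close>, \<open>y = u\<^sup>2v\<close>, \<open>z = u + v\<close>. The image of
  \<open>x\<^sup>a y\<^sup>b z\<^sup>c\<close> is homogeneous of degree \<open>2a + 3b + c\<close>, so only exponents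
  \<open>a, b, c \<le> i + j\<close> contribute to the coefficient of \<open>u\<^sup>i v\<^sup>j\<close>.\<close>

definition subst_uv :: "'k::field fps fps fps \<Rightarrow> 'k fps fps" where
  "subst_uv F = Abs_fps (\<lambda>j. Abs_fps (\<lambda>i.
     \<Sum>a\<le>i + j. \<Sum>b\<le>i + j. \<Sum>c\<le>i + j. F $ c $ b $ a *
       (((var_u * var_v) ^ a * (var_u ^ 2 * var_v) ^ b * (var_u + var_v) ^ c) $ j $ i)))"

definition A_to_R :: "'k::field fps fps fps set \<Rightarrow> 'k fps fps" where
  "A_to_R C = the_elem (subst_uv ` C)"

text \<open>\<open>Q(A/I) = \<bbbk>((z))\<close> with \<open>I = (x,y)\<close>, and
  \<open>Q(R/I) = \<bbbk>((u)) \<times> \<bbbk>((v))\<close> with \<open>R/I = \<bbbk>[[u,v]]/(uv)\<close>.\<close>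

abbreviation ring_K :: "'k::field fls ring" where "ring_K \<equiv> ring_of_type_algebra"

abbreviation ring_QR :: "('k::field fls \<times> 'k fls) ring" where
  "ring_QR \<equiv> RDirProd ring_of_type_algebra ring_of_type_algebra"

definition A_to_K :: "'k::field fps fps fps set \<Rightarrow> 'k fls" where
  "A_to_K C = the_elem ((\<lambda>F. fps_to_fls (Abs_fps (\<lambda>c. F $ c $ 0 $ 0))) ` C)"

definition R_to_QR :: "'k::field fps fps \<Rightarrow> 'k fls \<times> 'k fls" where
  "R_to_QR r = (fps_to_fls (r $ 0), fps_to_fls (Abs_fps (\<lambda>j. r $ j $ 0)))"

text \<open>Since \<open>z = u + v\<close>, the element \<open>z\<close> goes to \<open>(u, v)\<close>.\<close>

definition K_to_QR :: "'k::field fls \<Rightarrow> 'k fls \<times> 'k fls" where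
  "K_to_QR f = (f, f)"


section \<open>Triples\<close>

type_synonym ('k, 'm, 'v) triple =
  "('k fps fps, 'm) module \<times> ('k fls, 'v) module \<times>
   (((('k fls \<times> 'k fls) \<times> 'v) \<Rightarrow>\<^sub>0 int) set \<Rightarrow> ((('k fls \<times> 'k fls) \<times> 'm) \<Rightarrow>\<^sub>0 int) set)"

fun triple_isomorphic :: "('k::field, 'm, 'v) triple \<Rightarrow> ('k, 'n, 'w) triple \<Rightarrow> bool" where
  "triple_isomorphic (M, V, \<theta>) (N, W, \<eta>) \<longleftrightarrow>
     (\<exists>\<phi> \<in> module_iso ring_R M N. \<exists>\<psi> \<in> module_iso ring_K V W.
        \<forall>w \<in> carrier (base_change K_to_QR ring_K ring_QR V).
          base_change_map R_to_QR ring_R ring_QR N \<phi> (\<theta> w) =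
          \<eta> (base_change_map K_to_QR ring_K ring_QR W \<psi> w))"

definition R_tensor :: "('k::field fps fps fps set, 'm) module \<Rightarrow>
    ('k fps fps, (('k fps fps \<times> 'm) \<Rightarrow>\<^sub>0 int) set) module" where
  "R_tensor M = base_change A_to_R ring_A ring_R M"

definition tilde :: "('k::field fps fps fps set, 'm) module \<Rightarrow>
    ('k fps fps, ((('k fps fps \<times> 'm) \<Rightarrow>\<^sub>0 int) set \<Rightarrow> 'k fps fps) \<Rightarrow> 'k fps fps) module" where
  "tilde M = dual ring_R (dual ring_R (R_tensor M))"

definition K_tensor :: "('k::field fps fps fps set, 'm) module \<Rightarrow>
    ('k fls, (('k fls \<times> 'm) \<Rightarrow>\<^sub>0 int) set) module" where
  "K_tensor M = base_change A_to_K ring_A ring_K M"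

text \<open>The composition
  \<open>Q(R/I) \<otimes> (K \<otimes> M) \<cong> Q(R/I) \<otimes> M \<cong> Q(R/I) \<otimes> (R \<otimes> M) \<rightarrow> Q(R/I) \<otimes> (R \<otimes> M)**\<close>,
  which sends \<open>q \<otimes> (f \<otimes> x)\<close> to \<open>q f \<otimes> (1 \<otimes> x)**\<close>.\<close>

definition theta :: "('k::field fps fps fps set, 'm) module \<Rightarrow>
    ((('k fls \<times> 'k fls) \<times> (('k fls \<times> 'm) \<Rightarrow>\<^sub>0 int) set) \<Rightarrow>\<^sub>0 int) set \<Rightarrow>
    ((('k fls \<times> 'k fls) \<times> (((('k fps fps \<times> 'm) \<Rightarrow>\<^sub>0 int) set \<Rightarrow> 'k fps fps) \<Rightarrow> 'k fps fps)) \<Rightarrow>\<^sub>0 int) set" where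
  "theta M =
     (let T = base_change R_to_QR ring_R ring_QR (tilde M)
      in tensor_lift T (\<lambda>(q, w). tensor_lift T (\<lambda>(f, x).
           pure_tensor R_to_QR ring_R ring_QR (tilde M) (q \<otimes>\<^bsub>ring_QR\<^esub> K_to_QR f)
             (to_bidual ring_R (R_tensor M) (pure_tensor A_to_R ring_A ring_R M \<one>\<^bsub>ring_R\<^esub> x))) w))"

definition triple_of :: "('k::field fps fps fps set, 'm) module \<Rightarrow>
    ('k, ((('k fps fps \<times> 'm) \<Rightarrow>\<^sub>0 int) set \<Rightarrow> 'k fps fps) \<Rightarrow> 'k fps fps,
         (('k fls \<times> 'm) \<Rightarrow>\<^sub>0 int) set) triple" where
  "triple_of M = (tilde M, K_tensor M, theta M)"

text \<open>The triple \<open>(R, K, \<theta>)\<close> with \<open>\<theta>\<close> given by \<open>(u\<^sup>m, \<lambda> v\<^sup>n)\<close>.\<close>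

definition rank_one_triple :: "nat \<Rightarrow> nat \<Rightarrow> 'k::field \<Rightarrow> ('k, 'k fps fps, 'k fls) triple" where
  "rank_one_triple m n l =
     (self_module ring_R, self_module ring_K,
      tensor_lift (base_change R_to_QR ring_R ring_QR (self_module ring_R))
        (\<lambda>(q, f). pure_tensor R_to_QR ring_R ring_QR (self_module ring_R)
           (q \<otimes>\<^bsub>ring_QR\<^esub> K_to_QR f \<otimes>\<^bsub>ring_QR\<^esub> (fls_X ^ m, fls_const l * fls_X ^ n)) \<one>\<^bsub>ring_R\<^esub>))"

text \<open>\<open>M\<close> is the maximal Cohen--Macaulay module \<open>M((m,n),1,\<lambda>)\<close>, which is determined by its
  triple up to isomorphism.\<close>

definition is_M :: "nat \<times> nat \<Rightarrow> 'k::field \<Rightarrow> ('k fps fps fps set, 'm) module \<Rightarrow> bool" where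
  "is_M mn l M \<longleftrightarrow> maximal_cohen_macaulay ring_A M \<and>
     triple_isomorphic (triple_of M) (rank_one_triple (fst mn) (snd mn) l)"

definition rank_one_mcm :: "('k::field fps fps fps set, 'm) module \<Rightarrow> bool" where
  "rank_one_mcm M \<longleftrightarrow> maximal_cohen_macaulay ring_A M \<and> has_rank ring_A M 1"

abbreviation lfps :: "('k::field fps fps fps set, 'm) module \<Rightarrow> bool" where
  "lfps M \<equiv> locally_free_on_punctured_spectrum ring_A M"

definition admissible :: "nat \<Rightarrow> 'k::field \<Rightarrow> bool" where
  "admissible m l \<longleftrightarrow> 1 \<le> m \<and> l \<noteq> 0 \<and> (m = 1 \<longrightarrow> l \<noteq> 1)"

end

theory Submission
 imports Defs
begin

text \<open>The map \<open>x \<mapsto> uv\<close>, \<open>y \<mapsto> u\<^sup>2v\<close>, \<open>z \<mapsto> u + v\<close> identifies \<open>A\<close> with the subring of \<open>R = \<bbbk>[[u,v]]\<close> of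
 those \<open>r\<close> with \<open>r(t,0) = r(0,t)\<close>. A maximal Cohen--Macaulay module of rank one is torsion-free and
 hence embeds into \<open>R\<close>; depth two means that its image \<open>L\<close> contains every \<open>r\<close> with
 \<open>x\<^sup>n r, z\<^sup>n r \<in> L\<close>. Reflexive ideals of \<open>R\<close> are principal, so after scaling \<open>uv R \<subseteq> L\<close>, and \<open>L\<close> is either
 \<open>R\<close> or given by one linear condition between \<open>r(t,0)\<close> and \<open>r(0,t)\<close>, which can be normalized to
 \<open>l t\<^sup>q r(t,0) = t\<^sup>p r(0,t)\<close> with \<open>min p q = 1\<close>. This condition is exactly the gluing datum
 \<open>(u\<^sup>p, l v\<^sup>q)\<close> of the triple of the module.\<close>

section \<open>Reflexive ideals of k[[u,v]]\<close>

text \<open>A module is handled through the image of an A-linear injection into R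
  (\<open>realizes\<close>): modules with equal images are isomorphic, and the freedom in choosing
  the injection is what the scaling uses up. Restricting to v = 0 and to u = 0 turns L / uv R into a
  k[[t]]-submodule of k[[t]]^2; saturation makes L the part of R cut out by a k((t))-subspace, of
  dimension two for R and one otherwise. The line with p = q = l = 1 gives A itself, whence the
  excluded value of l for m = 1. Two points cost most. Torsion-freeness rests on depth being equal
  to dimension: it needs that A is Noetherian and has no chain of three primes starting above a
  nonzero element, and that bound comes from the finiteness over k[[x]] of the quotient of R by a
  suitable element. And triples are built from tensor products and biduals, so these are computed
  explicitly for modules realized by a line, while in the other direction the isomorphism of triples
  itself supplies the injection into R.\<close>

abbreviation uu :: "'k::field fps fps" where "uu \<equiv> var_u"
abbreviation vv :: "'k::field fps fps" where "vv \<equiv> var_v"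

text \<open>In k[[u]][[v]] the outer index is the exponent of v, so \<open>res_u\<close> puts v = 0
  and \<open>res_v\<close> puts u = 0: the name tells the surviving variable. Both take values in
  the same ring of one-variable series, so that they can be compared.\<close>

definition res_u :: "'k::field fps fps \<Rightarrow> 'k fps" where "res_u r = r $ 0"
definition res_v :: "'k::field fps fps \<Rightarrow> 'k fps" where "res_v r = Abs_fps (\<lambda>j. r $ j $ 0)"

lemma res_u_simps [simp]:
 "res_u 0 = 0" "res_u 1 = 1" "res_u (a + b) = res_u a + res_u b" "res_u (a - b) = res_u a - res_u b"
 "res_u (- a) = - res_u a" "res_u (a * b) = res_u a * res_u b"
 "res_u uu = fps_X" "res_u vv = 0"
 by (simp_all add: res_u_def var_u_def var_v_def)

lemma res_v_simps [simp]:
 "res_v 0 = 0" "res_v 1 = 1" "res_v (a + b) = res_v a + res_v b" "res_v (a - b) = res_v a - res_v b"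
 "res_v (- a) = - res_v a" "res_v (a * b) = res_v a * res_v b"
 "res_v uu = 0" "res_v vv = fps_X"
 by (simp_all add: res_v_def var_u_def var_v_def fps_eq_iff fps_mult_nth fps_sum_nth)

lemma res_u_power [simp]: "res_u (a ^ n) = res_u a ^ n" by (induction n) auto
lemma res_v_power [simp]: "res_v (a ^ n) = res_v a ^ n" by (induction n) auto

lemma res_nth_0: "res_u r $ 0 = r $ 0 $ 0" "res_v r $ 0 = r $ 0 $ 0"
 by (simp_all add: res_u_def res_v_def)

lemma var_nth [simp]:
 "uu $ j = (if j = 0 then fps_X else 0)" "vv $ j = (if j = 1 then 1 else 0)"
 by (simp_all add: var_u_def var_v_def)

lemma var_u_mult_nth: "(uu * r) $ j $ i = (if i = 0 then 0 else r $ j $ (i - 1))"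
 by (simp add: var_u_def)

lemma var_v_mult_nth: "(vv * r) $ j = (if j = 0 then 0 else r $ (j - 1))"
 by (simp add: var_v_def)

lemma var_uv_mult_nth:
 "(uu * vv * r) $ j $ i = (if i = 0 \<or> j = 0 then 0 else r $ (j - 1) $ (i - 1))"
 by (auto simp: mult.assoc var_u_mult_nth var_v_mult_nth)

lemma res_v_eq_0_iff: "res_v r = 0 \<longleftrightarrow> uu dvd r"
proof
 assume "res_v r = 0"
 then have z: "r $ j $ 0 = 0" for j by (metis res_v_def fps_nth_Abs_fps fps_zero_nth)
 have "r = uu * Abs_fps (\<lambda>j. fps_shift 1 (r $ j))"
  by (intro fps_ext) (auto simp: var_u_mult_nth z)
 then show "uu dvd r" by (metis dvd_triv_left)
qed auto

lemma res_u_eq_0_iff: "res_u r = 0 \<longleftrightarrow> vv dvd r"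
proof
 assume "res_u r = 0"
 then have z: "r $ 0 = 0" by (simp add: res_u_def)
 have "r = vv * fps_shift 1 r"
  by (intro fps_ext) (auto simp: var_v_mult_nth z)
 then show "vv dvd r" by (metis dvd_triv_left)
qed auto

lemma res_eq_0_iff: "res_u r = 0 \<and> res_v r = 0 \<longleftrightarrow> uu * vv dvd r"
proof
 assume a: "res_u r = 0 \<and> res_v r = 0"
 then obtain s where s: "r = uu * s" using res_v_eq_0_iff by (metis dvdE)
 with a have "res_u s = 0" by simp
 then show "uu * vv dvd r" using s res_u_eq_0_iff by (metis mult_dvd_mono dvd_refl)
qed auto

lemma var_uv_nonzero [simp]: "(uu :: 'k::field fps fps) \<noteq> 0" "(vv :: 'k fps fps) \<noteq> 0"
proof -
 have "res_u (uu :: 'k fps fps) \<noteq> 0" "res_v (vv :: 'k fps fps) \<noteq> 0" by simp_all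
 then show "(uu :: 'k fps fps) \<noteq> 0" "(vv :: 'k fps fps) \<noteq> 0" using res_u_simps(1) res_v_simps(1) by fastforce+
qed

text \<open>The witness is f(u) + g(v) - f(0). Thus R/(uv) is the fibre product of two power series
  rings over k.\<close>

lemma ex_res:
 assumes "f $ 0 = g $ 0"
 shows "\<exists>r. res_u r = f \<and> res_v r = g"
proof -
 define r where "r = fps_const f + Abs_fps (\<lambda>j. fps_const (g $ j)) - fps_const (fps_const (f $ 0))"
 have "res_u r = f" by (simp add: r_def res_u_def assms fps_eq_iff)
 moreover have "res_v r = g" by (auto simp: r_def res_v_def assms fps_eq_iff)
 ultimately show ?thesis by blast
qed

section \<open>Units and adic completeness of power series rings\<close>

lemma fps_unit_ex: "(f::'k::field fps) $ 0 \<noteq> 0 ==> \<exists>g. f * g = 1"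
 using inverse_mult_eq_1' by blast

lemma R_unit_ex:
 fixes r :: "'k::field fps fps"
 assumes "r $ 0 $ 0 \<noteq> 0"
 shows "\<exists>s. r * s = 1"
proof -
 obtain g where "r $ 0 * g = 1" using fps_unit_ex assms by blast
 then have "r * fps_right_inverse r g = 1" by (rule fps_right_inverse)
 then show ?thesis by blast
qed

text \<open>Completeness for the t-adic topology without a topology: the first clause provides all
  tails T n = c n + t c (n+1) + ... of a series at once, the second says that an element with
  compatible quotients by all powers of t vanishes. Every infinite approximation below sums its
  corrections by the first clause and kills the error by the second.\<close>

definition complete_at :: "'a::comm_ring_1 \<Rightarrow> bool" where
 "complete_at t \<longleftrightarrow> (\<forall>c::nat \<Rightarrow> 'a. \<exists>T. \<forall>n. T n = c n + t * T (Suc n)) \<and>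
   (\<forall>D::nat \<Rightarrow> 'a. (\<forall>n. D n = t * D (Suc n)) \<longrightarrow> D 0 = 0)"

lemma complete_atD1: "complete_at t ==> \<exists>T. \<forall>n. T n = c n + t * T (Suc n)"
 unfolding complete_at_def by blast

lemma complete_atD2: "complete_at t ==> (\<And>n. D n = t * D (Suc n)) ==> D 0 = 0"
 unfolding complete_at_def by blast

lemma complete_at_power_dvd:
 assumes "complete_at t" "\<And>n. t ^ n dvd r" "t \<noteq> (0::'a::idom)"
 shows "r = 0"
proof -
 obtain D where D: "\<And>n. r = t ^ n * D n" using assms(2) unfolding dvd_def by metis
 have "D n = t * D (Suc n)" for n
 proof -
  have "t ^ n * D n = t ^ Suc n * D (Suc n)" using D by metis
  then have "t ^ n * D n = t ^ n * (t * D (Suc n))" by (simp add: ac_simps)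
  then show ?thesis using assms(3) mult_left_cancel[of "t ^ n"] power_not_zero by blast
 qed
 then have "D 0 = 0" using complete_atD2[OF assms(1)] by blast
 then show ?thesis using D[of 0] by simp
qed

lemma complete_u: "complete_at (uu :: 'k::field fps fps)"
 unfolding complete_at_def
proof (intro conjI allI impI)
 fix c :: "nat \<Rightarrow> 'k fps fps"
 define T where "T n = Abs_fps (\<lambda>j. Abs_fps (\<lambda>i. \<Sum>k\<le>i. c (n + k) $ j $ (i - k)))" for n
 have "T n = c n + uu * T (Suc n)" for n
 proof (intro fps_ext)
  fix j i
  show "T n $ j $ i = (c n + uu * T (Suc n)) $ j $ i"
   by (cases i) (simp_all add: T_def var_u_mult_nth sum.atMost_Suc_shift del: sum.atMost_Suc)
 qed
 then show "\<exists>T. \<forall>n. T n = c n + uu * T (Suc n)" by blast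
next
 fix D :: "nat \<Rightarrow> 'k fps fps"
 assume a: "\<forall>n. D n = uu * D (Suc n)"
 have "\<forall>n j. D n $ j $ i = 0" for i
 proof (induction i)
  case 0 show ?case by (subst a) (simp add: var_u_mult_nth)
 next
  case (Suc i) show ?case by (subst a) (simp add: var_u_mult_nth Suc)
 qed
 then show "D 0 = 0" by (intro fps_ext) simp
qed

lemma complete_uv: "complete_at (uu * vv :: 'k::field fps fps)"
 unfolding complete_at_def
proof (intro conjI allI impI)
 fix c :: "nat \<Rightarrow> 'k fps fps"
 define T where "T n = Abs_fps (\<lambda>j. Abs_fps (\<lambda>i. \<Sum>k\<le>min i j. c (n + k) $ (j - k) $ (i - k)))" for n
 have "T n = c n + uu * vv * T (Suc n)" for n
 proof (intro fps_ext)
  fix j i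
  show "T n $ j $ i = (c n + uu * vv * T (Suc n)) $ j $ i"
   by (cases i; cases j)
    (simp_all add: T_def var_uv_mult_nth sum.atMost_Suc_shift del: sum.atMost_Suc)
 qed
 then show "\<exists>T. \<forall>n. T n = c n + uu * vv * T (Suc n)" by blast
next
 fix D :: "nat \<Rightarrow> 'k fps fps"
 assume a: "\<forall>n. D n = uu * vv * D (Suc n)"
 have "\<forall>n j. D n $ j $ i = 0" for i
 proof (induction i)
  case 0 show ?case by (subst a) (simp add: var_uv_mult_nth)
 next
  case (Suc i) show ?case by (subst a) (simp add: var_uv_mult_nth Suc)
 qed
 then show "D 0 = 0" by (intro fps_ext) simp
qed

lemma fps_split_X:
 fixes f :: "'k::field fps"
 assumes "f \<noteq> 0"
 obtains e w w' where "f = fps_X ^ e * w" "w * w' = 1" "e = subdegree f" "w $ 0 \<noteq> 0"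
proof -
 have "f = fps_X ^ subdegree f * unit_factor f"
  using fps_unit_factor_decompose[of f] by (simp add: mult.commute)
 moreover have "unit_factor f $ 0 \<noteq> 0" using assms by (rule fps_unit_factor_nth_0)
 ultimately show ?thesis using that fps_unit_ex[of "unit_factor f"] by metis
qed

lemma fps_dvd_of_subdegree_le:
 fixes f g :: "'k::field fps"
 assumes "f \<noteq> 0" "g \<noteq> 0 ==> subdegree f \<le> subdegree g"
 shows "f dvd g"
 using assms by (cases "g = 0") (auto simp: fps_dvd_iff)

text \<open>A reflexive ideal is free: if \<open>g \<in> L\<close> restricts to a generator of the restriction of \<open>L\<close> to
 \<open>u = 0\<close>, then \<open>L = g R + u L\<close>, because \<open>u l \<in> L\<close> forces \<open>v\<^sup>e l \<in> L\<close>.\<close>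

lemma reflexive_ideal_principal:
 fixes L :: "'k::field fps fps set"
 assumes add: "\<And>a b. a \<in> L ==> b \<in> L ==> a + b \<in> L"
  and mult: "\<And>a r. a \<in> L ==> r * a \<in> L"
  and refl: "\<And>r n. uu ^ n * r \<in> L ==> vv ^ n * r \<in> L ==> r \<in> L"
  and nz: "l0 \<in> L" "l0 \<noteq> 0"
 shows "\<exists>g. g \<noteq> 0 \<and> L = range ((*) g)"
proof -
 obtain N where N: "\<not> uu ^ N dvd l0" using complete_at_power_dvd[OF complete_u] nz var_uv_nonzero by metis
 \<comment> \<open>The largest power of u dividing all of L. It is divided out in \<open>M\<close>,
   since otherwise every element might vanish at u = 0.\<close>
 define n where "n = (LEAST n. \<exists>l\<in>L. \<not> uu ^ Suc n dvd l)"
 have ex: "\<exists>n. \<exists>l\<in>L. \<not> uu ^ Suc n dvd l" using N nz by (metis power_Suc dvd_mult_right)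
 have n1: "\<exists>l\<in>L. \<not> uu ^ Suc n dvd l" unfolding n_def using ex by (rule LeastI_ex)
 have n2: "uu ^ n dvd l" if "l \<in> L" for l
 proof (cases n)
  case (Suc m)
  then have "m < n" by simp
  then have "\<not> (\<exists>l\<in>L. \<not> uu ^ Suc m dvd l)" unfolding n_def by (rule not_less_Least)
  then show ?thesis using that Suc by blast
 qed simp
 define M where "M = {r. uu ^ n * r \<in> L}"
 have Madd: "a + b \<in> M" if "a \<in> M" "b \<in> M" for a b using that add by (auto simp: M_def algebra_simps)
 have Mmult: "r * a \<in> M" if "a \<in> M" for a r using that mult[of "uu ^ n * a" r] by (auto simp: M_def algebra_simps)
 have Mdiff: "a - b \<in> M" if "a \<in> M" "b \<in> M" for a b using Madd[OF that(1) Mmult[OF that(2), of "-1"]] by simp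
 have Mrefl: "r \<in> M" if "uu ^ k * r \<in> M" "vv ^ k * r \<in> M" for r k
  using that refl[of k "uu ^ n * r"] by (auto simp: M_def algebra_simps)
 obtain l1 where l1: "l1 \<in> M" "\<not> uu dvd l1"
 proof -
  obtain l where l: "l \<in> L" "\<not> uu ^ Suc n dvd l" using n1 by blast
  then obtain r where r: "l = uu ^ n * r" using n2 by (metis dvdE)
  have "\<not> uu dvd r" using l r by (metis mult_dvd_mono dvd_refl power_Suc2)
  then show ?thesis using that[of r] l r by (simp add: M_def)
 qed
 define P where "P e \<longleftrightarrow> (\<exists>g\<in>M. res_v g \<noteq> 0 \<and> subdegree (res_v g) = e)" for e
 have "P (subdegree (res_v l1))" using l1 unfolding P_def by (auto simp: res_v_eq_0_iff)
 then have "P (LEAST e. P e)" by (rule LeastI)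
 then obtain g where g: "g \<in> M" "res_v g \<noteq> 0" "subdegree (res_v g) = (LEAST e. P e)" unfolding P_def by blast
 have gmin: "subdegree (res_v g) \<le> subdegree (res_v h)" if "h \<in> M" "res_v h \<noteq> 0" for h
  using that g(3) by (auto simp: P_def intro: Least_le)
 obtain e w w' where ew: "res_v g = fps_X ^ e * w" "w * w' = 1" using fps_split_X[OF g(2)] by metis
 obtain W where W: "res_v W = w'" using ex_res by blast
 have "res_v (W * g - vv ^ e) = 0" using W ew by (simp add: ac_simps)
 then obtain h where h: "W * g - vv ^ e = uu * h" using res_v_eq_0_iff by (metis dvdE)
 have ucancel: "l \<in> M" if "uu * l \<in> M" for l
 proof -
  have "vv ^ e * l = (l * W) * g - h * (uu * l)"
   using arg_cong[OF h, of "\<lambda>t. t * l"] by (simp add: algebra_simps)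
  moreover have "(l * W) * g - h * (uu * l) \<in> M" using Mmult Mdiff g(1) that by blast
  ultimately have "vv ^ e * l \<in> M" by simp
  \<comment> \<open>\<open>Mrefl\<close> asks for one exponent on both variables, so v^e l and u l
    are both raised to the exponent e + 1.\<close>
  then have "vv ^ Suc e * l \<in> M" using Mmult[of "vv ^ e * l" "vv"] by (simp add: ac_simps)
  moreover have "uu ^ Suc e * l \<in> M" using Mmult[OF that, of "uu ^ e"] by (simp add: ac_simps)
  ultimately show ?thesis using Mrefl by blast
 qed
 have step: "\<exists>c l'. l' \<in> M \<and> l = g * c + uu * l'" if "l \<in> M" for l
 proof -
  have "res_v g dvd res_v l" using fps_dvd_of_subdegree_le g gmin that by blast
  then obtain c where c: "res_v l = res_v g * c" by (metis dvdE)
  obtain C where C: "res_v C = c" using ex_res by blast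
  have "res_v (l - C * g) = 0" using c C by simp
  then obtain l' where l': "l - C * g = uu * l'" using res_v_eq_0_iff by (metis dvdE)
  have "uu * l' \<in> M" using l' Mdiff Mmult that g by metis
  then have "l' \<in> M" by (rule ucancel)
  moreover have "l = g * C + uu * l'" using l' by (simp add: algebra_simps)
  ultimately show ?thesis by blast
 qed
 then obtain cf lf where clf: "\<And>l. l \<in> M ==> lf l \<in> M \<and> l = g * cf l + uu * lf l" by metis
 have Mg: "l \<in> range ((*) g)" if "l \<in> M" for l
 proof -
  \<comment> \<open>Successive remainders l = g c_0 + u s_1, s_1 = g c_1 + u s_2, and so on; the
    quotient of l by g is the u-adic sum of the c_k.\<close>
  define s where "s k = (lf ^^ k) l" for k
  have sM: "s k \<in> M" for k by (induction k) (use that clf in \<open>auto simp: s_def\<close>)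
  obtain T where T: "\<forall>k. T k = cf (s k) + uu * T (Suc k)"
   using complete_atD1[OF complete_u, of "\<lambda>k. cf (s k)"] by blast
  have "s k - g * T k = uu * (s (Suc k) - g * T (Suc k))" for k
  proof -
   have "s k = g * cf (s k) + uu * s (Suc k)" using clf[OF sM[of k]] by (simp add: s_def)
   then show ?thesis by (subst T[rule_format]) (simp add: algebra_simps)
  qed
  then have "s 0 - g * T 0 = 0" by (rule complete_atD2[OF complete_u, of "\<lambda>k. s k - g * T k"])
  then show ?thesis by (auto simp: s_def)
 qed
 have "L = range ((*) (uu ^ n * g))"
 proof (intro equalityI subsetI)
  fix l assume l: "l \<in> L"
  then obtain r where r: "l = uu ^ n * r" using n2 by (metis dvdE)
  then have "r \<in> M" using l by (simp add: M_def)
  then obtain q where "r = g * q" using Mg by blast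
  then have "l = uu ^ n * g * q" using r by (simp add: mult.assoc)
  then show "l \<in> range ((*) (uu ^ n * g))" by blast
 next
  fix l assume "l \<in> range ((*) (uu ^ n * g))"
  then obtain r where "l = uu ^ n * g * r" by blast
  then show "l \<in> L" using Mmult[OF g(1), of r] by (simp add: M_def ac_simps)
 qed
 moreover have "uu ^ n * g \<noteq> 0" using g(2) by auto
 ultimately show ?thesis by blast
qed

section \<open>Saturated submodules of the normalization\<close>

abbreviation xx :: "'k::field fps fps" where "xx \<equiv> uu * vv"
abbreviation zz :: "'k::field fps fps" where "zz \<equiv> uu + vv"

definition Asub :: "'k::field fps fps set" where "Asub = {r. res_u r = res_v r}"

definition A_stable :: "'k::field fps fps set \<Rightarrow> bool" where
 "A_stable L \<longleftrightarrow> 0 \<in> L \<and> (\<forall>a\<in>L. \<forall>b\<in>L. a + b \<in> L) \<and> (\<forall>a\<in>Asub. \<forall>l\<in>L. a * l \<in> L)"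

definition saturated :: "'k::field fps fps set \<Rightarrow> bool" where
 "saturated L \<longleftrightarrow> (\<forall>q n. xx ^ n * q \<in> L \<and> zz ^ n * q \<in> L \<longrightarrow> q \<in> L)"

definition Line :: "'k::field fps \<Rightarrow> 'k fps \<Rightarrow> 'k fps fps set" where
 "Line f g = {r. g * res_u r = f * res_v r}"

definition Lpq :: "nat \<Rightarrow> nat \<Rightarrow> 'k::field \<Rightarrow> 'k fps fps set" where
 "Lpq p q l = Line (fps_X ^ p) (fps_const l * fps_X ^ q)"

lemma Asub_closed [intro]:
 "0 \<in> Asub" "1 \<in> Asub" "a \<in> Asub ==> b \<in> Asub ==> a + b \<in> Asub"
 "a \<in> Asub ==> b \<in> Asub ==> a - b \<in> Asub" "a \<in> Asub ==> - a \<in> Asub"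
 "a \<in> Asub ==> b \<in> Asub ==> a * b \<in> Asub" "a \<in> Asub ==> a ^ n \<in> Asub"
 "xx * r \<in> Asub" "xx \<in> Asub" "zz \<in> Asub"
 by (auto simp: Asub_def)

lemma A_stableD:
 assumes "A_stable L"
 shows "0 \<in> L" "a \<in> L ==> b \<in> L ==> a + b \<in> L" "r \<in> Asub ==> a \<in> L ==> r * a \<in> L"
  "a \<in> L ==> b \<in> L ==> a - b \<in> L"
proof -
 show "a \<in> L ==> b \<in> L ==> a - b \<in> L"
  using assms Asub_closed(5)[OF Asub_closed(2)] unfolding A_stable_def
  by (metis mult_minus1 add_uminus_conv_diff)
qed (use assms in \<open>auto simp: A_stable_def\<close>)

lemma ex_Asub: "\<exists>a\<in>Asub. res_u a = c \<and> res_v a = c"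
proof -
 obtain r where "res_u r = c" "res_v r = c" using ex_res[of c c] by blast
 then show ?thesis by (intro bexI[of _ r]) (auto simp: Asub_def)
qed

text \<open>The difference of the two restrictions has no constant term, hence is t times a series
  c; subtracting u b changes only the restriction to v = 0, by t times that of b. So 1 and u
  generate R over A.\<close>

lemma R_decomp: "\<exists>a\<in>Asub. \<exists>b\<in>Asub. r = a + uu * b"
proof -
 define c where "c = fps_shift 1 (res_u r - res_v r)"
 have c: "res_u r - res_v r = fps_X * c"
  by (rule fps_ext) (auto simp: c_def res_nth_0)
 obtain b where b: "b \<in> Asub" "res_u b = c" "res_v b = c" using ex_Asub by blast
 have "r - uu * b \<in> Asub" using b c by (simp add: Asub_def algebra_simps)
 then show ?thesis using b by (intro bexI[of _ "r - uu * b"] bexI[of _ b]) auto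
qed

lemma add_power_in_ideal:
 fixes a b :: "'a::comm_ring_1"
 shows "\<exists>p q. (a + b) ^ (i + j) = a ^ i * p + b ^ j * q"
proof (induction "i + j" arbitrary: i j)
 case 0
 then show ?case by (intro exI[of _ 1] exI[of _ 0]) simp
next
 case (Suc n)
 consider "i = 0" | "j = 0" | i' j' where "i = Suc i'" "j = Suc j'" by (cases i; cases j) auto
 then show ?case
 proof cases
  case 1 then show ?thesis by (intro exI[of _ "(a + b) ^ j"] exI[of _ 0]) simp
 next
  case 2 then show ?thesis by (intro exI[of _ 0] exI[of _ "(a + b) ^ i"]) simp
 next
  case 3
  obtain p q where 1: "(a + b) ^ (i' + j) = a ^ i' * p + b ^ j * q" using Suc(1)[of i' j] Suc(2) 3 by auto
  obtain p' q' where 2: "(a + b) ^ (i + j') = a ^ i * p' + b ^ j' * q'" using Suc(1)[of i j'] Suc(2) 3 by auto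
  have "(a + b) ^ (i + j) = a * (a + b) ^ (i' + j) + b * (a + b) ^ (i + j')"
   using 3 by (simp add: algebra_simps)
  also have "\<dots> = a ^ i * (p + b * p') + b ^ j * (a * q + q')"
   unfolding 1 2 using 3 by (simp add: algebra_simps)
  finally show ?thesis by blast
 qed
qed

lemma saturatedD: "saturated L ==> xx ^ n * q \<in> L ==> zz ^ n * q \<in> L ==> q \<in> L"
 unfolding saturated_def by blast

text \<open>The R-module generated by an A-stable L; two summands suffice because R = A + u
  A.\<close>

definition R_span :: "'k::field fps fps set \<Rightarrow> 'k fps fps set" where
 "R_span L = {a + uu * b | a b. a \<in> L \<and> b \<in> L}"

lemma R_span_ideal:
 assumes "A_stable L"
 shows "a \<in> R_span L ==> b \<in> R_span L ==> a + b \<in> R_span L" "a \<in> R_span L ==> r * a \<in> R_span L"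
  "L \<subseteq> R_span L"
proof -
 note st = A_stableD(1-4)[OF assms]
 show "a \<in> R_span L ==> b \<in> R_span L ==> a + b \<in> R_span L"
 proof -
  assume "a \<in> R_span L" "b \<in> R_span L"
  then obtain a1 a2 b1 b2 where "a = a1 + uu * a2" "b = b1 + uu * b2" "a1 \<in> L" "a2 \<in> L" "b1 \<in> L" "b2 \<in> L"
   by (auto simp: R_span_def)
  then have "a + b = (a1 + b1) + uu * (a2 + b2)" "a1 + b1 \<in> L" "a2 + b2 \<in> L"
   using st by (auto simp: algebra_simps)
  then show ?thesis unfolding R_span_def by blast
 qed
 show "L \<subseteq> R_span L"
 proof
  fix l assume "l \<in> L"
  then have "l = l + uu * 0" "l \<in> L" "0 \<in> L" using st by auto
  then show "l \<in> R_span L" unfolding R_span_def by blast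
 qed
 assume "a \<in> R_span L"
 then obtain c d where cd: "a = c + uu * d" "c \<in> L" "d \<in> L" by (auto simp: R_span_def)
 obtain s t where r: "r = s + uu * t" "s \<in> Asub" "t \<in> Asub" using R_decomp by blast
 \<comment> \<open>The relation u^2 = z u - x, with x and z in A, brings the product back to the
   form L + u L.\<close>
 have "r * a = (s * c - xx * (t * d)) + uu * (t * c + s * d + zz * (t * d))"
  unfolding cd r by (simp add: algebra_simps)
 moreover have "s * c - xx * (t * d) \<in> L" "t * c + s * d + zz * (t * d) \<in> L"
  by (intro st(2-4) cd r Asub_closed)+
 ultimately show "r * a \<in> R_span L" unfolding R_span_def by blast
qed

text \<open>The reflexive hull of R L is principal, say g R, and \<open>L1\<close> is L divided by
  g. Then u^n and v^n lie in the R-span of \<open>L1\<close> for some n. As uv R is contained in A,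
  multiplying by uv moves that span into \<open>L1\<close>; saturation, with z = u + v and z^(2n) in
  (u^n, v^n), removes the powers and leaves uv R inside \<open>L1\<close>. If all of
  \<open>L1\<close> vanished on an axis, so would u^n or v^n.\<close>

lemma stable_structure:
 fixes L :: "'k::field fps fps set"
 assumes st: "A_stable L" and sat: "saturated L" and nz: "l0 \<in> L" "l0 \<noteq> 0"
 obtains g L1 where "g \<noteq> 0" "L = (*) g ` L1" "A_stable L1" "saturated L1" "\<And>r. xx * r \<in> L1"
  "\<exists>l\<in>L1. res_u l \<noteq> 0" "\<exists>l\<in>L1. res_v l \<noteq> 0"
proof -
 note id = R_span_ideal[OF st]
 define Lt where "Lt = {r. \<exists>n. uu ^ n * r \<in> R_span L \<and> vv ^ n * r \<in> R_span L}"
 have up: "t ^ (n + k) * r \<in> R_span L" if "t ^ n * r \<in> R_span L" for t n k r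
  using id(2)[OF that, of "t ^ k"] by (simp add: power_add ac_simps)
 have upm: "t ^ m * r \<in> R_span L" if "t ^ n * r \<in> R_span L" "n \<le> m" for t n m r
  using up that le_Suc_ex by metis
 have Lt_sub: "R_span L \<subseteq> Lt"
 proof
  fix r assume "r \<in> R_span L"
  then have "uu ^ 0 * r \<in> R_span L \<and> vv ^ 0 * r \<in> R_span L" by simp
  then show "r \<in> Lt" unfolding Lt_def by blast
 qed
 have "\<exists>g. g \<noteq> 0 \<and> Lt = range ((*) g)"
 proof (rule reflexive_ideal_principal)
  fix a b assume "a \<in> Lt" "b \<in> Lt"
  then obtain n m where nm: "uu ^ n * a \<in> R_span L" "vv ^ n * a \<in> R_span L"
   "uu ^ m * b \<in> R_span L" "vv ^ m * b \<in> R_span L" by (auto simp: Lt_def)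
  have "uu ^ max n m * (a + b) \<in> R_span L" "vv ^ max n m * (a + b) \<in> R_span L"
   unfolding distrib_left by (intro id(1) upm[OF nm(1)] upm[OF nm(3)] upm[OF nm(2)] upm[OF nm(4)]; simp)+
  then show "a + b \<in> Lt" unfolding Lt_def by blast
 next
  fix a r assume "a \<in> Lt"
  then obtain n where "uu ^ n * a \<in> R_span L" "vv ^ n * a \<in> R_span L" by (auto simp: Lt_def)
  then have "uu ^ n * (r * a) \<in> R_span L" "vv ^ n * (r * a) \<in> R_span L"
   using id(2)[of _ r] by (simp_all add: mult.left_commute)
  then show "r * a \<in> Lt" unfolding Lt_def by blast
 next
  fix r n assume "uu ^ n * r \<in> Lt" "vv ^ n * r \<in> Lt"
  then obtain k m where nm: "uu ^ k * (uu ^ n * r) \<in> R_span L" "vv ^ m * (vv ^ n * r) \<in> R_span L"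
   by (auto simp: Lt_def)
  then have "uu ^ (k + n) * r \<in> R_span L" "vv ^ (m + n) * r \<in> R_span L"
   by (simp_all add: power_add ac_simps)
  then have "uu ^ (k + n + m) * r \<in> R_span L" "vv ^ (k + n + m) * r \<in> R_span L"
   by (auto elim: upm)
  then show "r \<in> Lt" unfolding Lt_def by blast
 next
  show "l0 \<in> Lt" "l0 \<noteq> 0" using nz Lt_sub id(3) by auto
 qed
 then obtain g where g: "g \<noteq> 0" "Lt = range ((*) g)" by blast
 define L1 where "L1 = {r. g * r \<in> L}"
 have LL1: "L = (*) g ` L1"
 proof (intro equalityI subsetI)
  fix l assume "l \<in> L"
  then obtain r where "l = g * r" using g Lt_sub id(3) by blast
  then show "l \<in> (*) g ` L1" using \<open>l \<in> L\<close> by (auto simp: L1_def)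
 qed (auto simp: L1_def)
 have st1: "A_stable L1"
  using A_stableD(1-4)[OF st] unfolding A_stable_def L1_def by (auto simp: distrib_left mult.left_commute)
 have sat1: "saturated L1"
  using saturatedD[OF sat] unfolding saturated_def L1_def by (auto simp: mult.left_commute)
 have "g \<in> Lt" using g by (metis mult_1_right rangeI)
 then obtain n where n: "uu ^ n * g \<in> R_span L" "vv ^ n * g \<in> R_span L" by (auto simp: Lt_def)
 have dec: "\<exists>a\<in>L1. \<exists>b\<in>L1. t = a + uu * b" if tg: "t * g \<in> R_span L" for t
 proof -
  obtain a b where "t * g = a + uu * b" "a \<in> L" "b \<in> L" using tg unfolding R_span_def by blast
  then obtain a' b' where "t * g = g * a' + uu * (g * b')" "a' \<in> L1" "b' \<in> L1" using LL1 by auto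
  then have "g * t = g * (a' + uu * b')" by (simp add: algebra_simps)
  then show ?thesis using g \<open>a' \<in> L1\<close> \<open>b' \<in> L1\<close> by auto
 qed
 note st1' = A_stableD(1-4)[OF st1]
 have xr: "xx * (t * s) \<in> L1" if tg: "t * g \<in> R_span L" for t s
 proof -
  obtain a b where ab: "a \<in> L1" "b \<in> L1" "t = a + uu * b" using dec[OF tg] by blast
  have eq: "xx * (t * s) = (xx * s) * a + (xx * (uu * s)) * b" unfolding ab by (simp add: algebra_simps)
  show ?thesis unfolding eq by (intro st1'(2,3) Asub_closed(8) ab)
 qed
 have xxL: "xx * r \<in> L1" for r
 proof (rule saturatedD[OF sat1, of "n + n"])
  have "xx ^ (n + n) * (xx * r) = xx * (uu ^ n * (uu ^ n * vv ^ (n + n) * r))"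
   by (simp add: power_add power_mult_distrib ac_simps)
  then show "xx ^ (n + n) * (xx * r) \<in> L1" using xr[OF n(1)] by (simp only:)
  obtain p q where "zz ^ (n + n) = uu ^ n * p + vv ^ n * (q :: 'k fps fps)" using add_power_in_ideal by blast
  then have "zz ^ (n + n) * (xx * r) = xx * (uu ^ n * (p * r)) + xx * (vv ^ n * (q * r))"
   by (simp add: algebra_simps)
  then show "zz ^ (n + n) * (xx * r) \<in> L1" using xr[OF n(1)] xr[OF n(2)] st1'(2) by (simp only:)
 qed
 have ru: "\<exists>l\<in>L1. res_u l \<noteq> 0"
 proof (rule ccontr)
  assume a: "\<not> ?thesis"
  obtain a b where ab: "a \<in> L1" "b \<in> L1" "uu ^ n = a + uu * b" using dec[OF n(1)] by blast
  then have "res_u (uu ^ n :: 'k fps fps) = 0" using a unfolding ab(3) by simp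
  then show False by simp
 qed
 have rv: "\<exists>l\<in>L1. res_v l \<noteq> 0"
 proof (rule ccontr)
  assume a: "\<not> ?thesis"
  obtain a b where ab: "a \<in> L1" "b \<in> L1" "vv ^ n = a + uu * b" using dec[OF n(2)] by blast
  then have "res_v (vv ^ n :: 'k fps fps) = 0" using a unfolding ab(3) by simp
  then show False by simp
 qed
 show ?thesis using that[OF g(1) LL1 st1 sat1 xxL ru rv] .
qed

text \<open>For r on the line and l in L with nonzero restriction to v = 0, some z^N r - a l with a
  in A vanishes at v = 0. The line equation with f nonzero then makes it vanish at u = 0 too, so it
  lies in uv R and hence in L. Saturation removes z^N.\<close>

lemma stable_eq_Line:
 fixes L :: "'k::field fps fps set"
 assumes st: "A_stable L" and sat: "saturated L" and xr: "\<And>r. xx * r \<in> L"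
  and sub: "L \<subseteq> Line f g" and nz: "f \<noteq> 0" "l \<in> L" "res_u l \<noteq> 0"
 shows "L = Line f g"
proof
 show "Line f g \<subseteq> L"
 proof
  fix r assume r: "r \<in> Line f g"
  obtain N w w' where w: "res_u l = fps_X ^ N * w" "w * w' = 1" using fps_split_X[OF nz(3)] by metis
  obtain a where a: "a \<in> Asub" "res_u a = w' * res_u r" "res_v a = w' * res_u r" using ex_Asub by metis
  have e: "w' * res_u r * res_u l = fps_X ^ N * res_u r"
   using arg_cong[OF w(2), of "\<lambda>t. t * (fps_X ^ N * res_u r)"] unfolding w(1) by (simp add: ac_simps)
  have "res_u (zz ^ N * r - a * l) = fps_X ^ N * res_u r - w' * res_u r * res_u l" using a by simp
  then have 1: "res_u (zz ^ N * r - a * l) = 0" unfolding e by simp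
  have l: "g * res_u l = f * res_v l" and r': "g * res_u r = f * res_v r" using sub nz r by (auto simp: Line_def)
  have "f * res_v (zz ^ N * r - a * l) = fps_X ^ N * (f * res_v r) - w' * res_u r * (f * res_v l)"
   using a by (simp add: algebra_simps)
  also have "\<dots> = g * (fps_X ^ N * res_u r) - g * (w' * res_u r * res_u l)"
   unfolding l[symmetric] r'[symmetric] by (simp add: algebra_simps)
  also have "\<dots> = 0" unfolding e by simp
  finally have 2: "res_v (zz ^ N * r - a * l) = 0" using nz by simp
  then obtain s where "zz ^ N * r - a * l = xx * s" using 1 res_eq_0_iff by (metis dvdE)
  then have "zz ^ N * r = xx * s + a * l" by (simp add: algebra_simps)
  then have "zz ^ N * r \<in> L" using xr a nz A_stableD(2,3)[OF st] by (simp only:)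
  then have "zz ^ Suc N * r \<in> L" using A_stableD(3)[OF st Asub_closed(10), of "zz ^ N * r"] by (simp add: mult.assoc)
  moreover have "xx ^ Suc N * r \<in> L" using xr[of "xx ^ N * r"] by (simp add: mult.assoc)
  ultimately show "r \<in> L" using saturatedD[OF sat] by blast
 qed
qed (rule sub)

text \<open>Cramer's rule: \<open>\<alpha>\<close> and \<open>\<beta>\<close> are the minors
  expressing r by l and l' on both axes, and the determinant is a power of t times a unit. So z^N r
  is an A-combination of l and l' up to uv R, and saturation gives r.\<close>

lemma stable_eq_UNIV:
 fixes L :: "'k::field fps fps set"
 assumes st: "A_stable L" and sat: "saturated L" and xr: "\<And>r. xx * r \<in> L"
  and l: "l \<in> L" "l' \<in> L" and nz: "res_u l * res_v l' - res_u l' * res_v l \<noteq> 0"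
 shows "L = UNIV"
proof -
 have "r \<in> L" for r
 proof -
  obtain N w w' where w: "res_u l * res_v l' - res_u l' * res_v l = fps_X ^ N * w" "w * w' = 1"
   using fps_split_X[OF nz] by metis
  define \<alpha> where "\<alpha> = res_u r * res_v l' - res_u l' * res_v r"
  define \<beta> where "\<beta> = res_u l * res_v r - res_u r * res_v l"
  obtain a where a: "a \<in> Asub" "res_u a = w' * \<alpha>" "res_v a = w' * \<alpha>" using ex_Asub by metis
  obtain b where b: "b \<in> Asub" "res_u b = w' * \<beta>" "res_v b = w' * \<beta>" using ex_Asub by metis
  have e: "w' * (res_u l * res_v l' - res_u l' * res_v l) = fps_X ^ N"
   using arg_cong[OF w(2), of "\<lambda>t. t * fps_X ^ N"] unfolding w(1) by (simp add: ac_simps)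
  have "w' * \<alpha> * res_u l + w' * \<beta> * res_u l' = w' * (res_u l * res_v l' - res_u l' * res_v l) * res_u r"
   by (simp add: \<alpha>_def \<beta>_def algebra_simps)
  then have 1: "res_u (zz ^ N * r - (a * l + b * l')) = 0" using a b unfolding e by simp
  have "w' * \<alpha> * res_v l + w' * \<beta> * res_v l' = w' * (res_u l * res_v l' - res_u l' * res_v l) * res_v r"
   by (simp add: \<alpha>_def \<beta>_def algebra_simps)
  then have 2: "res_v (zz ^ N * r - (a * l + b * l')) = 0" using a b unfolding e by simp
  obtain s where "zz ^ N * r - (a * l + b * l') = xx * s" using 1 2 res_eq_0_iff by (metis dvdE)
  then have "zz ^ N * r = xx * s + (a * l + b * l')" by (simp add: algebra_simps)
  then have "zz ^ N * r \<in> L" using xr a b l A_stableD(2,3)[OF st] by (simp only:)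
  then have "zz ^ Suc N * r \<in> L" using A_stableD(3)[OF st Asub_closed(10), of "zz ^ N * r"] by (simp add: mult.assoc)
  moreover have "xx ^ Suc N * r \<in> L" using xr[of "xx ^ N * r"] by (simp add: mult.assoc)
  ultimately show "r \<in> L" using saturatedD[OF sat] by blast
 qed
 then show ?thesis by blast
qed

lemma Lpq_shift: "Lpq (p + k) (q + k) l = Lpq p q l"
proof -
 have "(fps_const l * fps_X ^ (q + k) * a = fps_X ^ (p + k) * b) \<longleftrightarrow>
  fps_X ^ k * (fps_const l * fps_X ^ q * a) = fps_X ^ k * (fps_X ^ p * (b :: 'a fps))" for a b
  by (simp add: power_add ac_simps)
 then show ?thesis by (simp add: Lpq_def Line_def)
qed

text \<open>The unit parts of f and g, both scaled to constant term 1, are the two restrictions of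
  one unit w of R; dividing by w leaves powers of t and the ratio l of the two constant
  terms.\<close>

lemma Line_eq_Lpq:
 fixes f g :: "'k::field fps"
 assumes "f \<noteq> 0" "g \<noteq> 0"
 obtains w p q l where "w \<noteq> 0" "l \<noteq> 0" "min p q = 1" "Line f g = (*) w ` Lpq p q l"
proof -
 obtain p a where f: "f = fps_X ^ p * a" "a $ 0 \<noteq> 0" using fps_split_X[OF assms(1)] by metis
 obtain q b where g: "g = fps_X ^ q * b" "b $ 0 \<noteq> 0" using fps_split_X[OF assms(2)] by metis
 define a0 b0 where "a0 = a $ 0" and "b0 = b $ 0"
 have nz: "a0 \<noteq> 0" "b0 \<noteq> 0" "a \<noteq> 0" "b \<noteq> 0" using f g by (auto simp: a0_def b0_def)
 have "\<exists>w. res_u w = a * fps_const (1 / a0) \<and> res_v w = b * fps_const (1 / b0)"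
  by (rule ex_res) (use nz in \<open>simp add: a0_def b0_def\<close>)
 then obtain w where w: "res_u w = a * fps_const (1 / a0)" "res_v w = b * fps_const (1 / b0)" by blast
 have "w $ 0 $ 0 = 1" using w(1) nz by (simp flip: res_nth_0 add: a0_def)
 then obtain w' where w': "w * w' = 1" using R_unit_ex by (metis one_neq_zero)
 define l where "l = b0 / a0"
 have mem: "w * s \<in> Line f g \<longleftrightarrow> s \<in> Lpq p q l" for s
 proof -
  have c1: "fps_const b0 * fps_const (1 / b0) = (1 :: 'k fps)" and c2: "fps_const b0 * fps_const (1 / a0) = (fps_const l :: 'k fps)"
   using nz by (simp_all add: l_def)
  have "w * s \<in> Line f g \<longleftrightarrow> g * (a * fps_const (1 / a0) * res_u s) = f * (b * fps_const (1 / b0) * res_v s)"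
   by (simp add: Line_def w)
  also have "\<dots> \<longleftrightarrow> fps_const b0 * (g * (a * fps_const (1 / a0) * res_u s)) = fps_const b0 * (f * (b * fps_const (1 / b0) * res_v s))"
   using nz by simp
  also have "\<dots> \<longleftrightarrow> a * b * ((fps_const b0 * fps_const (1 / a0)) * (fps_X ^ q * res_u s)) = a * b * ((fps_const b0 * fps_const (1 / b0)) * (fps_X ^ p * res_v s))"
   unfolding f(1) g(1) by (simp only: ac_simps)
  also have "\<dots> \<longleftrightarrow> s \<in> Lpq p q l"
   unfolding c1 c2 using nz by (simp add: Lpq_def Line_def mult.assoc)
  finally show ?thesis .
 qed
 have eq: "Line f g = (*) w ` Lpq p q l"
 proof (intro equalityI subsetI)
  fix r assume r: "r \<in> Line f g"
  have "r = w * (w' * r)" using w' by (simp flip: mult.assoc)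
  then show "r \<in> (*) w ` Lpq p q l" using mem r by (metis imageI)
 qed (use mem in auto)
 have "l \<noteq> 0" "w \<noteq> 0" using nz w' by (auto simp: l_def)
 show ?thesis
 proof (cases "p \<le> q")
  case True
  \<comment> \<open>t^p is cancelled on both sides of the equation and one factor t is put back,
    because the normal form of the triples has minimum 1 and not 0.\<close>
  then have "Lpq p q l = Lpq 1 (Suc (q - p)) l"
   using Lpq_shift[of 0 p "q - p" l] Lpq_shift[of 0 1 "q - p" l] by simp
  then show ?thesis using that[of w l 1 "Suc (q - p)"] eq \<open>l \<noteq> 0\<close> \<open>w \<noteq> 0\<close> by simp
 next
  case False
  then have "Lpq p q l = Lpq (Suc (p - q)) 1 l"
   using Lpq_shift[of "p - q" q 0 l] Lpq_shift[of "p - q" 1 0 l] by simp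
  then show ?thesis using that[of w l "Suc (p - q)" 1] eq \<open>l \<noteq> 0\<close> \<open>w \<noteq> 0\<close> by simp
 qed
qed

text \<open>The pairs of restrictions of \<open>L1\<close> span a k((t))-subspace of k((t))^2. A
  nonvanishing 2 by 2 determinant gives all of R; otherwise any element with nonzero restrictions
  determines the line.\<close>

theorem stable_classification:
 fixes L :: "'k::field fps fps set"
 assumes st: "A_stable L" and sat: "saturated L" and nz: "l0 \<in> L" "l0 \<noteq> 0"
 shows "\<exists>g. g \<noteq> 0 \<and> (L = range ((*) g) \<or> (\<exists>p q l. l \<noteq> 0 \<and> min p q = 1 \<and> L = (*) g ` Lpq p q l))"
proof -
 obtain g L1 where gL: "g \<noteq> 0" "L = (*) g ` L1" "A_stable L1" "saturated L1" "\<And>r. xx * r \<in> L1"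
  "\<exists>l\<in>L1. res_u l \<noteq> 0" "\<exists>l\<in>L1. res_v l \<noteq> 0" using stable_structure[OF assms] by metis
 show ?thesis
 proof (cases "\<exists>l\<in>L1. \<exists>l'\<in>L1. res_u l * res_v l' - res_u l' * res_v l \<noteq> 0")
  case True
  then have "L1 = UNIV" using stable_eq_UNIV[OF gL(3,4,5)] by blast
  then show ?thesis using gL by blast
 next
  case False
  obtain l where l: "l \<in> L1" "res_u l \<noteq> 0" using gL by blast
  obtain l' where l': "l' \<in> L1" "res_v l' \<noteq> 0" using gL by blast
  have det: "res_u a * res_v b = res_u b * res_v a" if "a \<in> L1" "b \<in> L1" for a b using False that by auto
  have rv: "res_v l \<noteq> 0" using det[of l l'] l l' by auto
  have "L1 \<subseteq> Line (res_u l) (res_v l)" using det l by (auto simp: Line_def ac_simps)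
  then have "L1 = Line (res_u l) (res_v l)" using stable_eq_Line[OF gL(3,4,5)] l by blast
  moreover obtain w p q c where "w \<noteq> 0" "c \<noteq> 0" "min p q = 1" "Line (res_u l) (res_v l) = (*) w ` Lpq p q c"
   using Line_eq_Lpq[OF l(2) rv] by metis
  ultimately have "L = (*) (g * w) ` Lpq p q c" "g * w \<noteq> 0" "c \<noteq> 0" "min p q = 1"
   using gL by (auto simp: image_image mult.assoc)
  then show ?thesis by blast
 qed
qed

text \<open>Needed when L is only known to lie in a line. The hypothesis \<open>full\<close> says
  that no common factor can be divided out, so the g of \<open>stable_structure\<close> is a unit,
  uv R is contained in L itself, and the inclusion in the line becomes an equality.\<close>

lemma stable_eq_Lpq:
 fixes L :: "'k::field fps fps set"
 assumes st: "A_stable L" and sat: "saturated L" and nz: "l0 \<in> L" "l0 \<noteq> 0"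
  and sub: "L \<subseteq> Lpq p q c" and full: "\<And>g. L \<subseteq> range ((*) g) ==> \<exists>h. g * h = 1"
 shows "L = Lpq p q c"
proof -
 obtain g L1 where gL: "g \<noteq> 0" "L = (*) g ` L1" "A_stable L1" "saturated L1" "\<And>r. xx * r \<in> L1"
  "\<exists>l\<in>L1. res_u l \<noteq> 0" "\<exists>l\<in>L1. res_v l \<noteq> 0" using stable_structure[OF st sat nz] by metis
 have "L \<subseteq> range ((*) g)" using gL by blast
 then obtain h where h: "g * h = 1" using full by blast
 have xr: "xx * r \<in> L" for r
 proof -
  have "xx * r = g * (xx * (h * r))"
   using h by (metis (no_types, lifting) mult.assoc mult.commute mult_1)
  then show ?thesis using gL by (metis imageI)
 qed
 obtain l1 where l1: "l1 \<in> L1" "res_u l1 \<noteq> 0" using gL by blast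
 have "res_u g * res_u h = 1" using arg_cong[OF h, of res_u] by simp
 then have "res_u (g * l1) \<noteq> 0" using l1 by auto
 moreover have "g * l1 \<in> L" using l1 gL by blast
 ultimately show ?thesis using stable_eq_Line[OF st sat xr] sub unfolding Lpq_def by (metis fps_X_neq_zero power_not_zero)
qed

section \<open>The substitution homomorphism\<close>

definition emon :: "nat \<times> nat \<times> nat \<Rightarrow> 'k::field fps fps" where
 "emon = (\<lambda>(a, b, c). (uu * vv) ^ a * (uu ^ 2 * vv) ^ b * (uu + vv) ^ c)"

definition cf :: "'k::field fps fps fps \<Rightarrow> nat \<times> nat \<times> nat \<Rightarrow> 'k" where
 "cf F = (\<lambda>(a, b, c). F $ c $ b $ a)"

definition cube :: "nat \<Rightarrow> (nat \<times> nat \<times> nat) set" where "cube N = {..N} \<times> {..N} \<times> {..N}"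

lemma finite_cube [simp]: "finite (cube N)" by (simp add: cube_def)

definition homog :: "nat \<Rightarrow> 'k::field fps fps \<Rightarrow> bool" where
 "homog d r \<longleftrightarrow> (\<forall>i j. i + j \<noteq> d \<longrightarrow> r $ j $ i = 0)"

lemma fps_fps_mult_nth:
 "(r * s) $ j $ i = (\<Sum>j'=0..j. \<Sum>i'=0..i. r $ j' $ i' * s $ (j - j') $ (i - i'))"
 for r s :: "'k::field fps fps"
 by (simp add: fps_mult_nth fps_sum_nth)

lemma homog_mult:
 assumes "homog d r" "homog d' s"
 shows "homog (d + d') (r * s)"
 unfolding homog_def
proof (intro allI impI)
 fix i j assume "i + j \<noteq> d + d'"
 then have "r $ j' $ i' * s $ (j - j') $ (i - i') = 0" if "j' \<in> {0..j}" "i' \<in> {0..i}" for i' j'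
  using that assms unfolding homog_def
  by (cases "i' + j' = d") (auto intro!: assms(2)[unfolded homog_def, rule_format])
 then show "(r * s) $ j $ i = 0" unfolding fps_fps_mult_nth by (intro sum.neutral ballI) blast
qed

lemma homog_power: "homog d r ==> homog (n * d) (r ^ n)"
proof (induction n)
 case 0 show ?case by (auto simp: homog_def)
next
 case (Suc n) then show ?case using homog_mult[of d r "n * d" "r ^ n"] by simp
qed

lemma homog_vars: "homog 1 uu" "homog 1 vv" "homog 1 (uu + vv)"
 by (auto simp: homog_def)

lemma homog_emon: "homog (2 * a + 3 * b + c) (emon (a, b, c))"
proof -
 have 1: "homog 2 (uu * vv :: 'a fps fps)" using homog_mult[OF homog_vars(1,2)] by (metis one_add_one)
 have "homog 3 (uu ^ 2 * vv :: 'a fps fps)"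
  using homog_mult[OF homog_power[OF homog_vars(1), of 2] homog_vars(2)] by simp
 from homog_mult[OF homog_mult[OF homog_power[OF 1, of a] homog_power[OF this, of b]] homog_power[OF homog_vars(3), of c]]
 show ?thesis by (simp add: emon_def mult.commute)
qed

lemma emon_nth_0: "(a, b, c) \<notin> cube (i + j) ==> emon (a, b, c) $ j $ i = 0"
 using homog_emon[of a b c, unfolded homog_def, rule_format, of i j] by (auto simp: cube_def)

lemma emon_mult: "emon (a, b, c) * emon (a', b', c') = emon (a + a', b + b', c + c')"
 by (simp add: emon_def power_add ac_simps)

text \<open>\<open>subst_uv\<close> cuts off its sums at i + j, which varies with the coefficient.
  Monomials outside the cube have too large a degree to contribute, so one bound N serves all
  coefficients of degree at most N.\<close>

lemma subst_uv_nth: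
 assumes "i + j \<le> N"
 shows "subst_uv F $ j $ i = (\<Sum>t\<in>cube N. cf F t * emon t $ j $ i)"
proof -
 have "subst_uv F $ j $ i = (\<Sum>t\<in>cube (i + j). cf F t * emon t $ j $ i)"
  by (simp add: subst_uv_def cube_def sum.cartesian_product cf_def emon_def case_prod_unfold)
 also have "\<dots> = (\<Sum>t\<in>cube N. cf F t * emon t $ j $ i)"
 proof (rule sum.mono_neutral_left)
  show "cube (i + j) \<subseteq> cube N" using assms by (auto simp: cube_def)
  show "\<forall>t\<in>cube N - cube (i + j). cf F t * emon t $ j $ i = 0"
   by (clarify, subst emon_nth_0, auto)
 qed simp
 finally show ?thesis .
qed

lemma cf_add: "cf (F + G) t = cf F t + cf G t" and cf_diff: "cf (F - G) t = cf F t - cf G t"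
 and cf_0: "cf 0 t = 0"
 by (simp_all add: cf_def case_prod_unfold)

lemma subst_uv_add [simp]: "subst_uv (F + G) = subst_uv F + subst_uv G"
 by (intro fps_ext) (simp add: subst_uv_nth[OF order_refl] cf_add sum.distrib algebra_simps)

lemma subst_uv_diff [simp]: "subst_uv (F - G) = subst_uv F - subst_uv G"
 by (intro fps_ext) (simp add: subst_uv_nth[OF order_refl] cf_diff sum_subtractf algebra_simps)

lemma subst_uv_0 [simp]: "subst_uv 0 = 0"
 by (intro fps_ext) (simp add: subst_uv_nth[OF order_refl] cf_0)

lemma cf_mult:
 "cf (F * G) (a, b, c) = (\<Sum>(a', b', c')\<in>{..a} \<times> {..b} \<times> {..c}. cf F (a', b', c') * cf G (a - a', b - b', c - c'))"
proof -
 have "cf (F * G) (a, b, c) = (\<Sum>c'\<le>c. \<Sum>b'\<le>b. \<Sum>a'\<le>a. F $ c' $ b' $ a' * G $ (c - c') $ (b - b') $ (a - a'))"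
  by (simp add: cf_def fps_mult_nth fps_sum_nth atLeast0AtMost)
 also have "\<dots> = (\<Sum>b'\<le>b. \<Sum>c'\<le>c. \<Sum>a'\<le>a. F $ c' $ b' $ a' * G $ (c - c') $ (b - b') $ (a - a'))"
  by (rule sum.swap)
 also have "\<dots> = (\<Sum>b'\<le>b. \<Sum>a'\<le>a. \<Sum>c'\<le>c. F $ c' $ b' $ a' * G $ (c - c') $ (b - b') $ (a - a'))"
  by (intro sum.cong refl sum.swap)
 also have "\<dots> = (\<Sum>a'\<le>a. \<Sum>b'\<le>b. \<Sum>c'\<le>c. F $ c' $ b' $ a' * G $ (c - c') $ (b - b') $ (a - a'))"
  by (rule sum.swap)
 finally show ?thesis by (simp add: sum.cartesian_product cf_def)
qed

lemma subst_uv_mult [simp]: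
 fixes F G :: "'k::field fps fps fps"
 shows "subst_uv (F * G) = subst_uv F * subst_uv G"
proof (intro fps_ext)
 fix j i :: nat
 define N where "N = i + j"
 \<comment> \<open>Pairs of exponents whose sum stays in the cube. All other pairs give a monomial
   of degree above i + j; reindexing \<open>S\<close> by (sum, first exponent) leads to the
   convolution \<open>cf_mult\<close>.\<close>
 define S where "S = {(t, s). t \<in> cube N \<and> s \<in> cube N \<and>
  (fst t + fst s, fst (snd t) + fst (snd s), snd (snd t) + snd (snd s)) \<in> cube N}"
 have S: "S \<subseteq> cube N \<times> cube N" by (auto simp: S_def)
 then have finS: "finite S" by (rule finite_subset) simp
 have "(subst_uv F * subst_uv G) $ j $ i =
  (\<Sum>j'=0..j. \<Sum>i'=0..i. (\<Sum>t\<in>cube N. cf F t * emon t $ j' $ i') * (\<Sum>s\<in>cube N. cf G s * emon s $ (j - j') $ (i - i')))"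
  unfolding fps_fps_mult_nth by (intro sum.cong refl arg_cong2[where f = "(*)"] subst_uv_nth) (auto simp: N_def)
 also have "\<dots> = (\<Sum>j'=0..j. \<Sum>i'=0..i. \<Sum>t\<in>cube N. \<Sum>s\<in>cube N. cf F t * cf G s * (emon t $ j' $ i' * emon s $ (j - j') $ (i - i')))"
  by (simp add: sum_product algebra_simps)
 also have "\<dots> = (\<Sum>j'=0..j. \<Sum>i'=0..i. \<Sum>q\<in>cube N\<times>cube N. cf F (fst q) * cf G (snd q) * (emon (fst q) $ j' $ i' * emon (snd q) $ (j - j') $ (i - i')))"
  by (intro sum.cong refl) (simp add: sum.cartesian_product case_prod_unfold)
 also have "\<dots> = (\<Sum>p\<in>{0..j}\<times>{0..i}. \<Sum>q\<in>cube N\<times>cube N. cf F (fst q) * cf G (snd q) * (emon (fst q) $ (fst p) $ (snd p) * emon (snd q) $ (j - fst p) $ (i - snd p)))"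
  by (subst sum.cartesian_product) (simp add: case_prod_unfold)
 also have "\<dots> = (\<Sum>q\<in>cube N\<times>cube N. \<Sum>p\<in>{0..j}\<times>{0..i}. cf F (fst q) * cf G (snd q) * (emon (fst q) $ (fst p) $ (snd p) * emon (snd q) $ (j - fst p) $ (i - snd p)))"
  by (rule sum.swap)
 also have "\<dots> = (\<Sum>q\<in>cube N\<times>cube N. cf F (fst q) * cf G (snd q) * (emon (fst q) * emon (snd q)) $ j $ i)"
  unfolding fps_fps_mult_nth by (simp add: sum_distrib_left sum.cartesian_product case_prod_unfold)
 also have "\<dots> = (\<Sum>q\<in>S. cf F (fst q) * cf G (snd q) * (emon (fst q) * emon (snd q)) $ j $ i)"
 proof (rule sum.mono_neutral_right)
  show "\<forall>q\<in>cube N \<times> cube N - S. cf F (fst q) * cf G (snd q) * (emon (fst q) * emon (snd q)) $ j $ i = 0"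
  proof
   fix q assume q: "q \<in> cube N \<times> cube N - S"
   obtain a b c a' b' c' where [simp]: "q = ((a, b, c), (a', b', c'))" by (metis prod.exhaust)
   have "(a + a', b + b', c + c') \<notin> cube N" using q by (auto simp: S_def)
   then have "emon (a + a', b + b', c + c') $ j $ i = (0 :: 'k)" by (intro emon_nth_0) (simp add: N_def)
   then show "cf F (fst q) * cf G (snd q) * (emon (fst q) * emon (snd q)) $ j $ i = 0"
    by (simp add: emon_mult)
  qed
 qed (use S in auto)
 also have "\<dots> = (\<Sum>(w, t)\<in>(SIGMA w:cube N. {..fst w} \<times> {..fst (snd w)} \<times> {..snd (snd w)}).
   cf F t * cf G (fst w - fst t, fst (snd w) - fst (snd t), snd (snd w) - snd (snd t)) * emon w $ j $ i)"
  by (rule sum.reindex_bij_witness[where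
   i = "\<lambda>(w, t). (t, (fst w - fst t, fst (snd w) - fst (snd t), snd (snd w) - snd (snd t)))" and
   j = "\<lambda>(t, s). ((fst t + fst s, fst (snd t) + fst (snd s), snd (snd t) + snd (snd s)), t)"])
   (auto simp: S_def emon_mult cube_def)
 also have "\<dots> = (\<Sum>w\<in>cube N. \<Sum>t\<in>{..fst w} \<times> {..fst (snd w)} \<times> {..snd (snd w)}.
   cf F t * cf G (fst w - fst t, fst (snd w) - fst (snd t), snd (snd w) - snd (snd t)) * emon w $ j $ i)"
  by (subst sum.Sigma) auto
 also have "\<dots> = (\<Sum>w\<in>cube N. cf (F * G) w * emon w $ j $ i)"
 proof (rule sum.cong[OF refl])
  fix w :: "nat \<times> nat \<times> nat"
  obtain a b c where "w = (a, b, c)" by (cases w) auto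
  then show "(\<Sum>t\<in>{..fst w} \<times> {..fst (snd w)} \<times> {..snd (snd w)}.
   cf F t * cf G (fst w - fst t, fst (snd w) - fst (snd t), snd (snd w) - snd (snd t)) * emon w $ j $ i)
   = cf (F * G) w * emon w $ j $ i"
   by (simp add: cf_mult sum_distrib_right case_prod_unfold)
 qed
 also have "\<dots> = subst_uv (F * G) $ j $ i" by (rule subst_uv_nth[symmetric]) (simp add: N_def)
 finally show "subst_uv (F * G) $ j $ i = (subst_uv F * subst_uv G) $ j $ i" by simp
qed

lemma subst_uv_monom:
 assumes "\<And>t. cf F t = (if t = t0 then k else 0)"
 shows "subst_uv F = fps_const (fps_const k) * emon t0"
proof (intro fps_ext)
 fix j i :: nat
 obtain N where "i + j \<le> N" and t0: "t0 \<in> cube N"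
 proof -
  obtain a b c where "t0 = (a, b, c)" by (cases t0) auto
  then show ?thesis using that[of "i + j + a + b + c"] by (auto simp: cube_def)
 qed
 then have "subst_uv F $ j $ i = (\<Sum>t\<in>cube N. cf F t * emon t $ j $ i)" by (intro subst_uv_nth)
 also have "\<dots> = (\<Sum>t\<in>cube N. if t0 = t then k * emon t0 $ j $ i else 0)"
  by (intro sum.cong) (auto simp: assms)
 also have "\<dots> = k * emon t0 $ j $ i" using t0 by simp
 finally show "subst_uv F $ j $ i = (fps_const (fps_const k) * emon t0) $ j $ i" by simp
qed

lemma subst_uv_scalar [simp]: "subst_uv (scalar k) = fps_const (fps_const k)"
 by (subst subst_uv_monom[of _ "(0, 0, 0)" k]) (auto simp: cf_def emon_def split: if_splits)

lemma subst_uv_1 [simp]: "subst_uv 1 = 1"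
 using subst_uv_scalar[of 1] by simp

lemma subst_uv_vars [simp]:
 "subst_uv var_x = uu * vv" "subst_uv var_y = uu ^ 2 * vv" "subst_uv var_z = uu + vv"
proof -
 show "subst_uv var_x = uu * vv"
  by (subst subst_uv_monom[of _ "(1, 0, 0)" 1]) (auto simp: cf_def emon_def var_x_def split: if_splits)
 show "subst_uv var_y = uu ^ 2 * vv"
  by (subst subst_uv_monom[of _ "(0, 1, 0)" 1]) (auto simp: cf_def emon_def var_y_def split: if_splits)
 show "subst_uv var_z = uu + vv"
  by (subst subst_uv_monom[of _ "(0, 0, 1)" 1]) (auto simp: cf_def emon_def var_z_def split: if_splits)
qed

lemma subst_uv_power [simp]: "subst_uv (F ^ n) = subst_uv F ^ n" by (induction n) auto

lemma res_emon: "res_u (emon (a, b, c) :: 'k::field fps fps) = (if a = 0 \<and> b = 0 then fps_X ^ c else 0)"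
 "res_v (emon (a, b, c) :: 'k fps fps) = (if a = 0 \<and> b = 0 then fps_X ^ c else 0)"
 by (auto simp: emon_def)

text \<open>x and y go to multiples of uv, and z goes to t on both axes, so only F(0,0,t)
  survives.\<close>

lemma res_subst_uv:
 fixes F :: "'k::field fps fps fps"
 shows "res_u (subst_uv F) = Abs_fps (\<lambda>i. F $ i $ 0 $ 0)" "res_v (subst_uv F) = Abs_fps (\<lambda>i. F $ i $ 0 $ 0)"
proof -
 have key: "(\<Sum>t\<in>cube i. cf F t * (if fst t = 0 \<and> fst (snd t) = 0 then (fps_X ^ snd (snd t) :: 'k fps) $ i else 0)) = F $ i $ 0 $ 0" for i
 proof -
  have "(\<Sum>t\<in>cube i. cf F t * (if fst t = 0 \<and> fst (snd t) = 0 then (fps_X ^ snd (snd t) :: 'k fps) $ i else 0))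
   = (\<Sum>t\<in>cube i. if (0, 0, i) = t then F $ i $ 0 $ 0 else 0)"
   by (intro sum.cong) (auto simp: cf_def)
  then show ?thesis by (simp add: cube_def)
 qed
 have "(emon t :: 'k fps fps) $ 0 $ i = (if fst t = 0 \<and> fst (snd t) = 0 then (fps_X ^ snd (snd t) :: 'k fps) $ i else 0)" for t i
  using res_emon(1)[where 'k = 'k] by (cases t) (auto simp: res_u_def)
 then show "res_u (subst_uv F) = Abs_fps (\<lambda>i. F $ i $ 0 $ 0)"
  using key by (intro fps_ext) (simp add: res_u_def subst_uv_nth[OF order_refl])
 have "(emon t :: 'k fps fps) $ i $ 0 = (if fst t = 0 \<and> fst (snd t) = 0 then (fps_X ^ snd (snd t) :: 'k fps) $ i else 0)" for t i
  using arg_cong[OF res_emon(2)[where 'k = 'k], of "\<lambda>r. r $ i"] by (cases t) (auto simp: res_v_def split: if_splits)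
 then show "res_v (subst_uv F) = Abs_fps (\<lambda>i. F $ i $ 0 $ 0)"
  using key by (intro fps_ext) (simp add: res_v_def subst_uv_nth[OF order_refl])
qed

section \<open>The ring A as a subring of its normalization\<close>

lemma complete_x: "complete_at (var_x :: 'k::field fps fps fps)"
proof -
 have nth: "(var_x * F) $ c $ b $ a = (if a = 0 then 0 else F $ c $ b $ (a - 1))"
  for F :: "'k fps fps fps" and a b c :: nat
  by (simp add: var_x_def)
 show ?thesis
  unfolding complete_at_def
 proof (intro conjI allI impI)
  fix G :: "nat \<Rightarrow> 'k fps fps fps"
  define T where "T n = Abs_fps (\<lambda>c. Abs_fps (\<lambda>b. Abs_fps (\<lambda>a. \<Sum>k\<le>a. G (n + k) $ c $ b $ (a - k))))" for n
  have "T n = G n + var_x * T (Suc n)" for n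
  proof (intro fps_ext)
   fix c b a
   show "T n $ c $ b $ a = (G n + var_x * T (Suc n)) $ c $ b $ a"
    by (cases a) (simp_all add: T_def nth sum.atMost_Suc_shift del: sum.atMost_Suc)
  qed
  then show "\<exists>T. \<forall>n. T n = G n + var_x * T (Suc n)" by blast
 next
  fix D :: "nat \<Rightarrow> 'k fps fps fps"
  assume a: "\<forall>n. D n = var_x * D (Suc n)"
  have "\<forall>n c b. D n $ c $ b $ a = 0" for a
  proof (induction a)
   case 0 show ?case by (subst a) (simp add: nth)
  next
   case (Suc a) show ?case by (subst a) (simp add: nth Suc)
  qed
  then show "D 0 = 0" by (intro fps_ext) simp
 qed
qed

text \<open>\<open>\<bbbk>[[x,z]]\<close> is realized as \<open>\<bbbk>[[x]][[z]]\<close>, so the variables \<open>x, z\<close> there are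
 \<^const>\<open>uu\<close> and \<^const>\<open>vv\<close>.\<close>

definition emb :: "'k::field fps fps \<Rightarrow> 'k fps fps fps" where
 "emb f = Abs_fps (\<lambda>c. fps_const (f $ c))"

lemma emb_simps [simp]:
 "emb 0 = 0" "emb 1 = 1" "emb (f + g) = emb f + emb g" "emb (f - g) = emb f - emb g"
 "emb (- f) = - emb f"
 "emb (f * g) = emb f * emb g" "emb uu = var_x" "emb vv = var_z"
proof -
 show "emb (f * g) = emb f * emb g"
 proof (rule fps_ext)
  fix n
  have "fps_const (\<Sum>i\<in>A. f $ i * g $ (n - i)) = (\<Sum>i\<in>A. fps_const (f $ i * g $ (n - i)))" if "finite A" for A
   using that by (induction A) (auto simp flip: fps_const_add)
  then show "emb (f * g) $ n = (emb f * emb g) $ n"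
   by (simp add: emb_def fps_mult_nth)
 qed
qed (auto simp: emb_def fps_eq_iff var_x_def var_z_def)

definition rel :: "'k::field fps fps fps" where
 "rel = var_x ^ 3 + var_y ^ 2 - var_x * var_y * var_z"

lemma subst_rel [simp]: "subst_uv rel = 0"
 by (simp add: rel_def) (simp add: algebra_simps power2_eq_square power3_eq_cube)

text \<open>Weierstrass division: \<open>y\<^sup>2 \<equiv> x (y z - x\<^sup>2)\<close> modulo the relation, so that higher powers of \<open>y\<close>
 can be eliminated by an \<open>x\<close>-adically convergent process.\<close>

lemma weierstrass_division:
 fixes F :: "'k::field fps fps fps"
 shows "\<exists>f g Q. F = emb f + var_y * emb g + rel * Q"
proof -
 define c0 :: "'k fps fps fps \<Rightarrow> 'k fps fps" where "c0 F = Abs_fps (\<lambda>c. F $ c $ 0)" for F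
 define c1 :: "'k fps fps fps \<Rightarrow> 'k fps fps" where "c1 F = Abs_fps (\<lambda>c. F $ c $ 1)" for F
 define c2 :: "'k fps fps fps \<Rightarrow> 'k fps fps fps" where "c2 F = Abs_fps (\<lambda>c. fps_shift 2 (F $ c))" for F
 have split: "F = emb (c0 F) + var_y * emb (c1 F) + var_y ^ 2 * c2 F" for F
 proof (rule fps_ext, rule fps_ext)
  fix c b
  consider "b = 0" | "b = 1" | b' where "b = Suc (Suc b')" by (metis One_nat_def not0_implies_Suc)
  then show "F $ c $ b = (emb (c0 F) + var_y * emb (c1 F) + var_y ^ 2 * c2 F) $ c $ b"
   by cases (simp_all add: emb_def var_y_def c0_def c1_def c2_def power2_eq_square mult.assoc)
 qed
 define E where "E F = (var_y * var_z - var_x ^ 2) * c2 F" for F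
 have step: "F = emb (c0 F) + var_y * emb (c1 F) + rel * c2 F + var_x * E F" for F
 proof -
  have "var_y ^ 2 * c2 F = rel * c2 F + var_x * E F"
   by (simp add: rel_def E_def algebra_simps power2_eq_square power3_eq_cube)
  then show ?thesis using split[of F] by (simp add: algebra_simps)
 qed
 define s where "s n = (E ^^ n) F" for n
 have s: "s n = emb (c0 (s n)) + var_y * emb (c1 (s n)) + rel * c2 (s n) + var_x * s (Suc n)" for n
  using step[of "s n"] by (simp add: s_def)
 obtain A where A: "\<forall>n. A n = c0 (s n) + uu * A (Suc n)"
  using complete_atD1[OF complete_u, of "\<lambda>n. c0 (s n)"] by blast
 obtain B where B: "\<forall>n. B n = c1 (s n) + uu * B (Suc n)"
  using complete_atD1[OF complete_u, of "\<lambda>n. c1 (s n)"] by blast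
 obtain Q where Q: "\<forall>n. Q n = c2 (s n) + var_x * Q (Suc n)"
  using complete_atD1[OF complete_x, of "\<lambda>n. c2 (s n)"] by blast
 have "s n - (emb (A n) + var_y * emb (B n) + rel * Q n) =
  var_x * (s (Suc n) - (emb (A (Suc n)) + var_y * emb (B (Suc n)) + rel * Q (Suc n)))" for n
  by (subst s, subst A[rule_format], subst B[rule_format], subst Q[rule_format]) (simp add: algebra_simps)
 then have "s 0 - (emb (A 0) + var_y * emb (B 0) + rel * Q 0) = 0"
  by (rule complete_atD2[OF complete_x, of "\<lambda>n. s n - (emb (A n) + var_y * emb (B n) + rel * Q n)"])
 then have "F = emb (A 0) + var_y * emb (B 0) + rel * Q 0" by (simp add: s_def)
 then show ?thesis by blast
qed

text \<open>This involution fixes x = uv and z = u + v; it provides conjugates and norms over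
  k[[x,z]]. Since it exchanges the two restrictions, every symmetric element lies in A.\<close>

definition swap_uv :: "'k::field fps fps \<Rightarrow> 'k fps fps" where
 "swap_uv r = Abs_fps (\<lambda>j. Abs_fps (\<lambda>i. r $ i $ j))"

lemma swap_uv_simps [simp]:
 "swap_uv 0 = 0" "swap_uv 1 = 1" "swap_uv (r + s) = swap_uv r + swap_uv s" "swap_uv (r - s) = swap_uv r - swap_uv s"
 "swap_uv (r * s) = swap_uv r * swap_uv s" "swap_uv uu = vv" "swap_uv vv = uu"
 "swap_uv (swap_uv r) = r"
proof -
 show "swap_uv (r * s) = swap_uv r * swap_uv s"
 proof (intro fps_ext)
  fix j i
  have "swap_uv (r * s) $ j $ i = (\<Sum>j'=0..i. \<Sum>i'=0..j. r $ j' $ i' * s $ (i - j') $ (j - i'))"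
   by (simp add: swap_uv_def fps_fps_mult_nth)
  also have "\<dots> = (\<Sum>i'=0..j. \<Sum>j'=0..i. r $ j' $ i' * s $ (i - j') $ (j - i'))" by (rule sum.swap)
  also have "\<dots> = (swap_uv r * swap_uv s) $ j $ i"
   by (simp add: swap_uv_def fps_fps_mult_nth)
  finally show "swap_uv (r * s) $ j $ i = (swap_uv r * swap_uv s) $ j $ i" .
 qed
qed (auto simp: swap_uv_def fps_eq_iff)

lemma swap_uv_power [simp]: "swap_uv (r ^ n) = swap_uv r ^ n" by (induction n) auto

lemma res_swap_uv [simp]: "res_u (swap_uv r) = res_v r" "res_v (swap_uv r) = res_u r"
 by (simp_all add: res_u_def res_v_def swap_uv_def fps_eq_iff)

lemma swap_subst_emb:
 fixes f :: "'k::field fps fps"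
 shows "swap_uv (subst_uv (emb f)) = subst_uv (emb f)"
proof (intro fps_ext)
 fix j i :: nat
 have "cf (emb f) t * (emon t :: 'k fps fps) $ i $ j = cf (emb f) t * emon t $ j $ i" for t
 proof -
  obtain a b c where t: "t = (a, b, c)" by (cases t) auto
  show ?thesis
  proof (cases "b = 0")
   case True
   have "swap_uv (emon t) = (emon t :: 'k fps fps)" by (simp add: t True emon_def ac_simps)
   then have "swap_uv (emon t) $ j $ i = (emon t :: 'k fps fps) $ j $ i" by simp
   then show ?thesis by (simp add: swap_uv_def)
  qed (simp add: t cf_def emb_def)
 qed
 then have "subst_uv (emb f) $ i $ j = subst_uv (emb f) $ j $ i"
  by (auto simp: subst_uv_nth[of _ _ "i + j"] add.commute intro!: sum.cong)
 then show "swap_uv (subst_uv (emb f)) $ j $ i = subst_uv (emb f) $ j $ i" by (simp add: swap_uv_def)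
qed

lemma res_subst_emb: "res_u (subst_uv (emb f)) = res_v f" "res_v (subst_uv (emb f)) = res_v f"
 unfolding res_subst_uv by (simp_all add: emb_def res_v_def)

text \<open>On an axis f(x,z) becomes f(0,t). A kernel element is therefore divisible by x, the
  quotient is again in the kernel, and x-adic separatedness ends the descent.\<close>

lemma subst_emb_eq_0:
 assumes "subst_uv (emb f) = 0"
 shows "f = 0"
proof -
 have "\<exists>g. f = uu ^ n * g \<and> subst_uv (emb g) = 0" for n
 proof (induction n)
  case (Suc n)
  then obtain g where g: "f = uu ^ n * g" "subst_uv (emb g) = 0" by blast
  have "res_v g = 0" using res_subst_emb(1)[of g] g by simp
  then obtain h where h: "g = uu * h" using res_v_eq_0_iff by (metis dvdE)
  then have "subst_uv (emb h) = 0" using g by simp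
  then show ?case using g h by (intro exI[of _ h]) (simp add: ac_simps)
 qed (use assms in auto)
 then show ?thesis using complete_at_power_dvd[OF complete_u] by (metis dvd_triv_left var_uv_nonzero(1))
qed

lemma u_neq_v: "(uu :: 'k::field fps fps) - vv \<noteq> 0"
proof
 assume "(uu :: 'k fps fps) - vv = 0"
 from arg_cong[OF this, of res_u] show False by simp
qed

text \<open>After Weierstrass division F is f + y g with f, g in k[[x,z]]. Exchanging u and v fixes
  f and g and replaces u^2 v by u v^2; the difference of the two equations is uv (u - v) g = 0, so g
  and then f vanish.\<close>

lemma subst_uv_eq_0_iff:
 fixes F :: "'k::field fps fps fps"
 shows "subst_uv F = 0 \<longleftrightarrow> (\<exists>Q. F = rel * Q)"
proof
 assume F0: "subst_uv F = 0"
 obtain f g Q where F: "F = emb f + var_y * emb g + rel * Q" using weierstrass_division by blast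
 have 1: "subst_uv (emb f) + uu ^ 2 * vv * subst_uv (emb g) = 0" using F0 F by simp
 from arg_cong[OF this, of swap_uv]
 have 2: "subst_uv (emb f) + vv ^ 2 * uu * subst_uv (emb g) = 0"
  by (simp add: swap_subst_emb)
 have "uu * vv * (uu - vv) * subst_uv (emb g) =
  (subst_uv (emb f) + uu ^ 2 * vv * subst_uv (emb g)) - (subst_uv (emb f) + vv ^ 2 * uu * subst_uv (emb g))"
  by (simp add: algebra_simps power2_eq_square)
 then have "uu * vv * (uu - vv) * subst_uv (emb g) = 0" unfolding 1 2 by simp
 then have "subst_uv (emb g) = 0" using u_neq_v by (metis mult_eq_0_iff var_uv_nonzero)
 then have "f = 0" "g = 0" using 1 by (auto intro: subst_emb_eq_0)
 then show "\<exists>Q. F = rel * Q" using F by auto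
qed auto

text \<open>R = S + u S with S = k[[x,z]]: modulo uv the two restrictions can be matched by elements
  of S and u S, and the error is divided by x = uv and treated again, with x-adic
  convergence.\<close>

lemma R_free_over_S: "\<exists>f g. r = subst_uv (emb f) + uu * subst_uv (emb g)"
proof -
 have step: "\<exists>f g r'. r = subst_uv (emb f) + uu * subst_uv (emb g) + uu * vv * r'" for r :: "'a fps fps"
 proof -
  obtain f where f: "res_v f = res_v r" using ex_res by blast
  have "res_u r - res_v r = fps_X * fps_shift 1 (res_u r - res_v r)"
   by (rule fps_ext) (auto simp: res_nth_0)
  moreover obtain g where g: "res_v g = fps_shift 1 (res_u r - res_v r)" using ex_res by blast
  ultimately have "res_u (r - subst_uv (emb f) - uu * subst_uv (emb g)) = 0"
   "res_v (r - subst_uv (emb f) - uu * subst_uv (emb g)) = 0"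
   by (auto simp: res_subst_emb f)
  then obtain r' where "r - subst_uv (emb f) - uu * subst_uv (emb g) = uu * vv * r'"
   using res_eq_0_iff by (metis dvdE)
  then have "r = subst_uv (emb f) + uu * subst_uv (emb g) + uu * vv * r'" by (simp add: algebra_simps)
  then show ?thesis by blast
 qed
 then obtain ff gf rf where fgr: "\<And>r::'a fps fps. r = subst_uv (emb (ff r)) + uu * subst_uv (emb (gf r)) + uu * vv * rf r"
  by metis
 define s where "s n = (rf ^^ n) r" for n
 have s: "s n = subst_uv (emb (ff (s n))) + uu * subst_uv (emb (gf (s n))) + uu * vv * s (Suc n)" for n
  using fgr[of "s n"] by (simp add: s_def)
 obtain A where A: "\<forall>n. A n = ff (s n) + uu * A (Suc n)"
  using complete_atD1[OF complete_u, of "\<lambda>n. ff (s n)"] by blast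
 obtain B where B: "\<forall>n. B n = gf (s n) + uu * B (Suc n)"
  using complete_atD1[OF complete_u, of "\<lambda>n. gf (s n)"] by blast
 have "s n - (subst_uv (emb (A n)) + uu * subst_uv (emb (B n))) =
  uu * vv * (s (Suc n) - (subst_uv (emb (A (Suc n))) + uu * subst_uv (emb (B (Suc n)))))" for n
  by (subst s, subst A[rule_format], subst B[rule_format]) (simp add: algebra_simps)
 then have "s 0 - (subst_uv (emb (A 0)) + uu * subst_uv (emb (B 0))) = 0"
  by (rule complete_atD2[OF complete_uv, of "\<lambda>n. s n - (subst_uv (emb (A n)) + uu * subst_uv (emb (B n)))"])
 then have "r = subst_uv (emb (A 0)) + uu * subst_uv (emb (B 0))" by (simp add: s_def)
 then show ?thesis by blast
qed

text \<open>An element with equal restrictions differs from a series in z by uv s. Writing s = g + u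
  h over k[[x,z]], one has uv s = x g + y h, because y = uv u.\<close>

lemma range_subst_uv: "range subst_uv = (Asub :: 'k::field fps fps set)"
proof (intro equalityI subsetI)
 fix r :: "'k fps fps" assume "r \<in> range subst_uv"
 then show "r \<in> Asub" by (auto simp: Asub_def res_subst_uv)
next
 fix r :: "'k fps fps" assume r: "r \<in> Asub"
 obtain f where f: "res_v f = res_v r" using ex_res by blast
 then have "res_u (r - subst_uv (emb f)) = 0" "res_v (r - subst_uv (emb f)) = 0"
  using r by (auto simp: res_subst_emb Asub_def)
 then obtain s where "r - subst_uv (emb f) = uu * vv * s" using res_eq_0_iff by (metis dvdE)
 moreover obtain g h where "s = subst_uv (emb g) + uu * subst_uv (emb h)" using R_free_over_S by blast
 ultimately have "r = subst_uv (emb f + var_x * emb g + var_y * emb h)"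
  by (simp add: algebra_simps power2_eq_square)
 then show "r \<in> range subst_uv" by blast
qed

abbreviation cA :: "'k::field fps fps fps set set" where "cA \<equiv> carrier ring_A"

lemma type_ring_simps [simp]:
 "carrier ring_of_type_algebra = UNIV" "x \<otimes>\<^bsub>ring_of_type_algebra\<^esub> y = x * y"
 "x \<oplus>\<^bsub>ring_of_type_algebra\<^esub> y = x + y"
 "\<zero>\<^bsub>ring_of_type_algebra\<^esub> = 0" "\<one>\<^bsub>ring_of_type_algebra\<^esub> = 1"
 by (simp_all add: ring_of_type_algebra_def)

lemma cring_type [simp, intro]: "cring (ring_of_type_algebra :: 'a::comm_ring_1 ring)"
 by (rule cring_from_type_algebra)

lemma type_ring_minus [simp]: "\<ominus>\<^bsub>ring_of_type_algebra\<^esub> x = - (x :: 'a::comm_ring_1)"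
proof -
 interpret cring "ring_of_type_algebra :: 'a ring" by simp
 show ?thesis by (rule minus_equality) auto
qed

lemma relation_ideal_eq: "relation_ideal = range ((*) (rel :: 'k::field fps fps fps))"
proof -
 interpret cring "ring_of_type_algebra :: 'k fps fps fps ring" by simp
 have "relation_ideal = PIdl\<^bsub>ring_of_type_algebra\<^esub> (rel :: 'k fps fps fps)"
  unfolding relation_ideal_def rel_def[symmetric] by (rule cgenideal_eq_genideal[symmetric]) simp
 then show ?thesis by (auto simp: cgenideal_def mult.commute)
qed

lemma ideal_relation_ideal: "ideal (relation_ideal :: 'k::field fps fps fps set) ring_of_type_algebra"
proof -
 interpret cring "ring_of_type_algebra :: 'k fps fps fps ring" by simp
 show ?thesis unfolding relation_ideal_def by (rule genideal_ideal) simp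
qed

lemma cring_ring_A [simp, intro]: "cring ring_A"
 unfolding ring_A_def by (rule ideal.quotient_is_cring[OF ideal_relation_ideal cring_type])

lemma class_A_hom: "class_A \<in> ring_hom ring_of_type_algebra ring_A"
 unfolding ring_A_def class_A_def
 using ideal.rcos_ring_hom[OF ideal_relation_ideal] by (simp add: ring_hom_def)

lemma class_A_simps:
 fixes F G :: "'k::field fps fps fps"
 shows "class_A F \<in> cA" "class_A F \<oplus>\<^bsub>ring_A\<^esub> class_A G = class_A (F + G)"
 "class_A F \<otimes>\<^bsub>ring_A\<^esub> class_A G = class_A (F * G)" "\<one>\<^bsub>ring_A\<^esub> = class_A (1 :: 'k fps fps fps)" "\<zero>\<^bsub>ring_A\<^esub> = class_A (0 :: 'k fps fps fps)"
proof -
 note h = class_A_hom[where 'a = 'k]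
 show "class_A F \<in> cA" using ring_hom_closed[OF h] by simp
 show "class_A F \<oplus>\<^bsub>ring_A\<^esub> class_A G = class_A (F + G)" using ring_hom_add[OF h, of F G] by simp
 show "class_A F \<otimes>\<^bsub>ring_A\<^esub> class_A G = class_A (F * G)" using ring_hom_mult[OF h, of F G] by simp
 show "\<one>\<^bsub>ring_A\<^esub> = class_A (1 :: 'k fps fps fps)" using ring_hom_one[OF h] by simp
 show "\<zero>\<^bsub>ring_A\<^esub> = class_A (0 :: 'k fps fps fps)"
  using ring_hom_zero[OF h cring.axioms(1)[OF cring_type] cring.axioms(1)[OF cring_ring_A]] by simp
qed

lemma carrier_ring_A: "cA = range class_A"
 by (auto simp: ring_A_def class_A_def FactRing_def A_RCOSETS_defs a_r_coset_def r_coset_def)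

lemma mem_class_A: "G \<in> class_A F \<longleftrightarrow> subst_uv G = subst_uv F"
proof -
 have "G \<in> class_A F \<longleftrightarrow> (\<exists>h\<in>relation_ideal. G = h + F)"
  by (auto simp: class_A_def a_r_coset_def r_coset_def)
 also have "\<dots> \<longleftrightarrow> (\<exists>Q. G - F = rel * Q)" unfolding relation_ideal_eq by (auto simp: algebra_simps)
 also have "\<dots> \<longleftrightarrow> subst_uv G = subst_uv F" unfolding subst_uv_eq_0_iff[symmetric] by simp
 finally show ?thesis .
qed

lemma class_A_eq_iff: "class_A F = class_A G \<longleftrightarrow> subst_uv F = subst_uv G"
 using mem_class_A by (metis (no_types, lifting) subsetI subset_antisym)

lemma A_to_R_class [simp]: "A_to_R (class_A F) = subst_uv F"
proof -
 have "subst_uv ` class_A F = {subst_uv F}" using mem_class_A by blast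
 then show ?thesis by (simp add: A_to_R_def)
qed

lemma A_to_K_eq:
 assumes "a \<in> cA"
 shows "A_to_K a = fps_to_fls (res_u (A_to_R a))"
proof -
 obtain F where F: "a = class_A F" using assms carrier_ring_A by blast
 have "(\<lambda>F. fps_to_fls (Abs_fps (\<lambda>c. F $ c $ 0 $ 0))) ` class_A F = {fps_to_fls (res_u (subst_uv F))}"
  using mem_class_A[of _ F] unfolding res_subst_uv(1)[symmetric] by auto
 then show ?thesis by (simp add: A_to_K_def F)
qed

lemma bij_A_to_R: "bij_betw A_to_R (cA) Asub"
 unfolding bij_betw_def
proof
 show "inj_on A_to_R (cA)" by (auto simp: carrier_ring_A inj_on_def class_A_eq_iff)
 show "A_to_R ` cA = Asub" by (simp add: carrier_ring_A image_image range_subst_uv)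
qed

lemma A_to_R_hom: "(A_to_R :: 'k::field fps fps fps set \<Rightarrow> _) \<in> ring_hom ring_A ring_R"
proof (rule ring_hom_memI)
 fix x y :: "'k fps fps fps set" assume "x \<in> cA" "y \<in> cA"
 then show "A_to_R (x \<otimes>\<^bsub>ring_A\<^esub> y) = A_to_R x \<otimes>\<^bsub>ring_R\<^esub> A_to_R y"
  "A_to_R (x \<oplus>\<^bsub>ring_A\<^esub> y) = A_to_R x \<oplus>\<^bsub>ring_R\<^esub> A_to_R y"
  by (auto simp: carrier_ring_A class_A_simps)
qed (auto simp: class_A_simps)

lemma A_to_R_simps [simp]:
 fixes x y :: "'k::field fps fps fps set"
 shows "x \<in> cA ==> y \<in> cA ==> A_to_R (x \<otimes>\<^bsub>ring_A\<^esub> y) = A_to_R x * A_to_R y"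
 "x \<in> cA ==> y \<in> cA ==> A_to_R (x \<oplus>\<^bsub>ring_A\<^esub> y) = A_to_R x + A_to_R y"
 "A_to_R \<one>\<^bsub>ring_A\<^esub> = (1 :: 'k fps fps)" "A_to_R \<zero>\<^bsub>ring_A\<^esub> = (0 :: 'k fps fps)"
 "x \<in> cA ==> A_to_R x = 0 \<longleftrightarrow> x = \<zero>\<^bsub>ring_A\<^esub>"
 "x \<in> cA ==> A_to_R x \<in> Asub"
proof -
 show "x \<in> cA ==> y \<in> cA ==> A_to_R (x \<otimes>\<^bsub>ring_A\<^esub> y) = A_to_R x * A_to_R y"
  "x \<in> cA ==> y \<in> cA ==> A_to_R (x \<oplus>\<^bsub>ring_A\<^esub> y) = A_to_R x + A_to_R y"
  "A_to_R \<one>\<^bsub>ring_A\<^esub> = (1 :: 'k fps fps)" "A_to_R \<zero>\<^bsub>ring_A\<^esub> = (0 :: 'k fps fps)"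
  by (auto simp: carrier_ring_A class_A_simps)
 show "x \<in> cA ==> A_to_R x = 0 \<longleftrightarrow> x = \<zero>\<^bsub>ring_A\<^esub>"
  unfolding carrier_ring_A class_A_simps(5) by (elim imageE) (simp only: A_to_R_class class_A_eq_iff subst_uv_0)
 show "x \<in> cA ==> A_to_R x \<in> Asub" using bij_A_to_R by (auto simp: bij_betw_def)
qed

lemma ex_A: "a \<in> Asub ==> \<exists>x\<in>cA. A_to_R x = a"
 using bij_A_to_R unfolding bij_betw_def by (metis imageE)

lemma A_to_R_inj: "x \<in> cA ==> y \<in> cA ==> A_to_R x = A_to_R y \<longleftrightarrow> x = y"
 using bij_A_to_R by (auto simp: bij_betw_def inj_on_def)

lemma domain_ring_A: "domain (ring_A :: 'k::field fps fps fps set ring)"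
proof (intro domain.intro domain_axioms.intro cring_ring_A)
 show "\<one>\<^bsub>ring_A\<^esub> \<noteq> (\<zero>\<^bsub>ring_A\<^esub> :: 'k fps fps fps set)" by (simp add: class_A_simps class_A_eq_iff)
 fix a b :: "'k fps fps fps set" assume "a \<otimes>\<^bsub>ring_A\<^esub> b = \<zero>\<^bsub>ring_A\<^esub>" "a \<in> cA" "b \<in> cA"
 then show "a = \<zero>\<^bsub>ring_A\<^esub> \<or> b = \<zero>\<^bsub>ring_A\<^esub>" by (metis A_to_R_simps(1,4,5) mult_eq_0_iff)
qed

section \<open>Base change of modules\<close>

text \<open>\<open>base_change\<close> is a quotient of a free abelian group by raw relators. The
  locale derives the usual interface once: module structure, induction over pure tensors, universal
  property. Localized modules and all tensor products occurring in triples are instances.\<close>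

locale base_change_data =
 fixes f :: "'a \<Rightarrow> 'b" and A :: "('a, 'c) ring_scheme" and B :: "('b, 'd) ring_scheme"
  and M :: "('a, 'm) module"
 assumes cring_A: "cring A" and cring_B: "cring B" and f_hom: "f \<in> ring_hom A B"
  and module_M: "Module.module A M"
begin

sublocale A: cring A by (rule cring_A)
sublocale B: cring B by (rule cring_B)
sublocale M: Module.module A M by (rule module_M)

abbreviation "F \<equiv> free_Abelian_group (carrier B \<times> carrier M)"
abbreviation "H \<equiv> generate F (tensor_relators f A B M)"
abbreviation "T \<equiv> base_change f A B M"
abbreviation "tc \<equiv> tensor_class f A B M"
abbreviation "pt \<equiv> pure_tensor f A B M"
abbreviation "FC \<equiv> {c :: ('b \<times> 'm) \<Rightarrow>\<^sub>0 int. Poly_Mapping.keys c \<subseteq> carrier B \<times> carrier M}"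

definition balanced :: "('e, 'n) module \<Rightarrow> ('b \<times> 'm \<Rightarrow> 'n) \<Rightarrow> bool" where
 "balanced N g \<longleftrightarrow>
   (\<forall>b\<in>carrier B. \<forall>x\<in>carrier M. g (b, x) \<in> carrier N) \<and>
   (\<forall>b\<in>carrier B. \<forall>b'\<in>carrier B. \<forall>x\<in>carrier M. g (b \<oplus>\<^bsub>B\<^esub> b', x) = g (b, x) \<oplus>\<^bsub>N\<^esub> g (b', x)) \<and>
   (\<forall>b\<in>carrier B. \<forall>x\<in>carrier M. \<forall>x'\<in>carrier M. g (b, x \<oplus>\<^bsub>M\<^esub> x') = g (b, x) \<oplus>\<^bsub>N\<^esub> g (b, x')) \<and>
   (\<forall>a\<in>carrier A. \<forall>b\<in>carrier B. \<forall>x\<in>carrier M. g (b \<otimes>\<^bsub>B\<^esub> f a, x) = g (b, a \<odot>\<^bsub>M\<^esub> x))"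

lemma f_closed [simp]: "a \<in> carrier A ==> f a \<in> carrier B"
 using f_hom by (rule ring_hom_closed)

lemma group_F: "group F" by simp
lemma comm_F: "comm_group F" by (rule abelian_free_Abelian_group)

lemma FC_closed [simp]: "c \<in> FC ==> d \<in> FC ==> c + d \<in> FC" "c \<in> FC ==> d \<in> FC ==> c - d \<in> FC"
 "c \<in> FC ==> - c \<in> FC" "0 \<in> FC"
 "b \<in> carrier B ==> x \<in> carrier M ==> frag_of (b, x) \<in> FC"
 using keys_add[of c d] keys_diff[of c d] by (auto simp: keys_frag_of)

lemma relators_FC: "tensor_relators f A B M \<subseteq> FC"
 unfolding tensor_relators_def
 by (intro Un_least subsetI; elim CollectE exE conjE; hypsubst; intro FC_closed; auto)

lemma subgroup_H: "subgroup H F"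
 using relators_FC by (intro group.generate_is_subgroup[OF group_F]) auto

lemma H_FC: "h \<in> H ==> h \<in> FC"
 using subsetD[OF subgroup.subset[OF subgroup_H], of h] by simp

lemma H_closed: "0 \<in> H" "h \<in> H ==> k \<in> H ==> h + k \<in> H" "h \<in> H ==> - h \<in> H"
 using subgroup.one_closed[OF subgroup_H] subgroup.m_closed[OF subgroup_H, of h k]
  subgroup.m_inv_closed[OF subgroup_H, of h] H_FC[of h] by auto

lemma H_diff: "h \<in> H ==> k \<in> H ==> h - k \<in> H"
 using H_closed(2)[of h "- k"] H_closed(3)[of k] by simp

lemma H_relator: "r \<in> tensor_relators f A B M ==> r \<in> H" by (rule generate.incl)

text \<open>Differences alone cover the other cases of the generated subgroup: an inverse is 0 - h,
  and a sum is h - (0 - k).\<close>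

lemma H_induct [consumes 1, case_names zero rel diff]:
 assumes "h \<in> H" "P 0" "\<And>r. r \<in> tensor_relators f A B M ==> P r"
  "\<And>x y. x \<in> H ==> y \<in> H ==> P x ==> P y ==> P (x - y)"
 shows "P h"
 using assms(1)
proof (induction h rule: generate.induct)
 case one then show ?case using assms(2) by simp
next
 case (incl h) then show ?case using assms(3) by simp
next
 case (inv h)
 have "inv\<^bsub>F\<^esub> h = 0 - h" using inv relators_FC by auto
 then show ?case using assms(4)[of 0 h] inv assms(2,3) H_closed(1) H_relator by metis
next
 case (eng h k)
 have "P (0 - k)" using assms(4)[of 0 k] assms(2) H_closed(1) eng by blast
 then have "P (h - (0 - k))" using assms(4)[of h "0 - k"] eng H_diff[OF H_closed(1)] by blast
 then show ?case by simp
qed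

lemma normal_H: "H \<lhd> F" using comm_group.subgroup_imp_normal[OF comm_F subgroup_H] .

lemma tc_def': "tc c = H #>\<^bsub>F\<^esub> c" by (simp add: tensor_class_def Let_def)

lemma mem_tc: "d \<in> tc c \<longleftrightarrow> d - c \<in> H"
proof -
 have "d \<in> tc c \<longleftrightarrow> (\<exists>h\<in>H. d = h + c)" by (simp add: tc_def' r_coset_def)
 also have "\<dots> \<longleftrightarrow> d - c \<in> H" by (metis add_diff_cancel diff_add_cancel)
 finally show ?thesis .
qed

lemma tc_eq_iff: "tc c = tc d \<longleftrightarrow> c - d \<in> H"
proof
 assume "tc c = tc d"
 then show "c - d \<in> H" using mem_tc[of c c] mem_tc[of c d] H_closed by simp
next
 assume a: "c - d \<in> H"
 have "e - c \<in> H \<longleftrightarrow> e - d \<in> H" for e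
  using H_closed(2)[OF _ a, of "e - c"] H_diff[OF _ a, of "e - d"] by auto
 then show "tc c = tc d" using mem_tc by blast
qed

lemma carrier_T: "carrier T = tc ` FC"
proof -
 have "carrier F = FC" by auto
 then show ?thesis by (simp add: base_change_def Let_def carrier_FactGroup tc_def' image_def)
qed

lemma T_add: "c \<in> FC ==> d \<in> FC ==> tc c \<oplus>\<^bsub>T\<^esub> tc d = tc (c + d)"
 using normal.rcos_sum[OF normal_H, of c d] by (simp add: base_change_def Let_def tc_def')

lemma T_zero: "\<zero>\<^bsub>T\<^esub> = tc 0"
 using group.coset_mult_one[OF group_F, of H] subgroup.subset[OF subgroup_H]
 by (simp add: base_change_def Let_def tc_def')

lemma abelian_group_T: "abelian_group T"
proof (rule abelian_groupI)
 fix s t u assume "s \<in> carrier T" "t \<in> carrier T" "u \<in> carrier T"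
 then obtain c d e where "s = tc c" "c \<in> FC" "t = tc d" "d \<in> FC" "u = tc e" "e \<in> FC"
  by (auto simp: carrier_T)
 then show "(s \<oplus>\<^bsub>T\<^esub> t) \<oplus>\<^bsub>T\<^esub> u = s \<oplus>\<^bsub>T\<^esub> (t \<oplus>\<^bsub>T\<^esub> u)"
  by (simp only: T_add FC_closed add.assoc)
next
 fix s t assume "s \<in> carrier T" "t \<in> carrier T"
 then obtain c d where cd: "s = tc c" "c \<in> FC" "t = tc d" "d \<in> FC" by (auto simp: carrier_T)
 then show "s \<oplus>\<^bsub>T\<^esub> t = t \<oplus>\<^bsub>T\<^esub> s" by (simp only: T_add FC_closed add.commute)
 show "s \<oplus>\<^bsub>T\<^esub> t \<in> carrier T" unfolding carrier_T cd(1,3) T_add[OF cd(2,4)] using cd by (intro imageI FC_closed)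
next
 show "\<zero>\<^bsub>T\<^esub> \<in> carrier T" unfolding carrier_T T_zero by (intro imageI FC_closed)
next
 fix s assume "s \<in> carrier T"
 then obtain c where c: "s = tc c" "c \<in> FC" by (auto simp: carrier_T)
 then show "\<zero>\<^bsub>T\<^esub> \<oplus>\<^bsub>T\<^esub> s = s" by (simp only: T_zero T_add FC_closed add_0)
 have "tc (- c) \<in> carrier T" unfolding carrier_T using c by (intro imageI FC_closed)
 moreover have "tc (- c) \<oplus>\<^bsub>T\<^esub> s = \<zero>\<^bsub>T\<^esub>" using c by (simp only: T_zero T_add FC_closed add.left_inverse)
 ultimately show "\<exists>y\<in>carrier T. y \<oplus>\<^bsub>T\<^esub> s = \<zero>\<^bsub>T\<^esub>" by blast
qed

sublocale T: abelian_group T by (rule abelian_group_T)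

definition act :: "'b \<Rightarrow> (('b \<times> 'm) \<Rightarrow>\<^sub>0 int) \<Rightarrow> (('b \<times> 'm) \<Rightarrow>\<^sub>0 int)" where
 "act b = frag_extend (\<lambda>(b', x). frag_of (b \<otimes>\<^bsub>B\<^esub> b', x))"

lemma act_simps [simp]: "act b 0 = 0" "act b (c + d) = act b c + act b d" "act b (c - d) = act b c - act b d"
 "act b (frag_of (b', x)) = frag_of (b \<otimes>\<^bsub>B\<^esub> b', x)"
 by (simp_all add: act_def frag_extend_add frag_extend_diff)

lemma FC_induct [consumes 1, case_names zero one diff]:
 assumes "c \<in> FC" "P 0" "\<And>b x. b \<in> carrier B ==> x \<in> carrier M ==> P (frag_of (b, x))"
  "\<And>c d. c \<in> FC ==> d \<in> FC ==> P c ==> P d ==> P (c - d)"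
 shows "P c"
proof -
 have "c \<in> FC \<and> P c"
 proof (rule frag_induction[of c "carrier B \<times> carrier M"])
  fix p assume "p \<in> carrier B \<times> carrier M"
  then show "frag_of p \<in> FC \<and> P (frag_of p)" using FC_closed(5) assms(3) by (cases p) blast
 next
  fix c d assume "c \<in> FC \<and> P c" "d \<in> FC \<and> P d"
  then show "c - d \<in> FC \<and> P (c - d)" using FC_closed(2) assms(4) by blast
 qed (use assms FC_closed(4) in auto)
 then show ?thesis by blast
qed

lemma act_FC: "c \<in> FC ==> b \<in> carrier B ==> act b c \<in> FC"
proof (induction c rule: FC_induct)
 case (one b' x)
 have "frag_of (b \<otimes>\<^bsub>B\<^esub> b', x) \<in> FC" using one by (intro FC_closed) auto
 then show ?case by (simp only: act_simps)
next
 case (diff c d)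
 then show ?case unfolding act_simps by (intro FC_closed(2)) auto
qed auto

lemma act_relator:
 assumes "r \<in> tensor_relators f A B M" "b \<in> carrier B"
 shows "act b r \<in> tensor_relators f A B M"
proof -
 from assms(1) consider
  (1) b1 b2 x where "r = frag_of (b1 \<oplus>\<^bsub>B\<^esub> b2, x) - frag_of (b1, x) - frag_of (b2, x)"
   "b1 \<in> carrier B" "b2 \<in> carrier B" "x \<in> carrier M"
  | (2) b1 x x' where "r = frag_of (b1, x \<oplus>\<^bsub>M\<^esub> x') - frag_of (b1, x) - frag_of (b1, x')"
   "b1 \<in> carrier B" "x \<in> carrier M" "x' \<in> carrier M"
  | (3) a b1 x where "r = frag_of (b1 \<otimes>\<^bsub>B\<^esub> f a, x) - frag_of (b1, a \<odot>\<^bsub>M\<^esub> x)"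
   "a \<in> carrier A" "b1 \<in> carrier B" "x \<in> carrier M"
  unfolding tensor_relators_def by blast
 then show ?thesis
 proof cases
  case 1
  have "act b r = frag_of ((b \<otimes>\<^bsub>B\<^esub> b1) \<oplus>\<^bsub>B\<^esub> (b \<otimes>\<^bsub>B\<^esub> b2), x) - frag_of (b \<otimes>\<^bsub>B\<^esub> b1, x) - frag_of (b \<otimes>\<^bsub>B\<^esub> b2, x)"
   using 1 assms(2) by (simp add: B.r_distr)
  then show ?thesis unfolding tensor_relators_def using 1 assms(2) B.m_closed by blast
 next
  case 2
  have "act b r = frag_of (b \<otimes>\<^bsub>B\<^esub> b1, x \<oplus>\<^bsub>M\<^esub> x') - frag_of (b \<otimes>\<^bsub>B\<^esub> b1, x) - frag_of (b \<otimes>\<^bsub>B\<^esub> b1, x')"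
   using 2 by simp
  then show ?thesis unfolding tensor_relators_def using 2 assms(2) B.m_closed by blast
 next
  case 3
  have "act b r = frag_of ((b \<otimes>\<^bsub>B\<^esub> b1) \<otimes>\<^bsub>B\<^esub> f a, x) - frag_of (b \<otimes>\<^bsub>B\<^esub> b1, a \<odot>\<^bsub>M\<^esub> x)"
   using 3 assms(2) by (simp add: B.m_assoc)
  then show ?thesis unfolding tensor_relators_def using 3 assms(2) B.m_closed by blast
 qed
qed

lemma act_H: "h \<in> H ==> b \<in> carrier B ==> act b h \<in> H"
proof (induction h rule: H_induct)
 case (rel r) then show ?case using act_relator H_relator by blast
next
 case (diff x y) then show ?case using H_diff by simp
qed (simp add: H_closed)

lemma T_smult:
 assumes "b \<in> carrier B"
 shows "b \<odot>\<^bsub>T\<^esub> tc c = tc (act b c)"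
proof -
 have "b \<odot>\<^bsub>T\<^esub> tc c = (\<Union>d\<in>tc c. tc (act b d))"
  by (simp add: base_change_def Let_def act_def)
 moreover have "tc (act b d) = tc (act b c)" if "d \<in> tc c" for d
  using that act_H[OF _ assms, of "d - c"] by (simp add: mem_tc tc_eq_iff)
 moreover have "c \<in> tc c" by (simp add: mem_tc H_closed)
 ultimately show ?thesis by blast
qed

lemma pt_def': "pt b x = tc (frag_of (b, x))" by (simp add: pure_tensor_def)

lemma pt_closed [simp]: "b \<in> carrier B ==> x \<in> carrier M ==> pt b x \<in> carrier T"
 unfolding carrier_T pt_def' by (intro imageI FC_closed)

lemma pt_add_left:
 assumes "b \<in> carrier B" "b' \<in> carrier B" "x \<in> carrier M"
 shows "pt (b \<oplus>\<^bsub>B\<^esub> b') x = pt b x \<oplus>\<^bsub>T\<^esub> pt b' x"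
proof -
 have "frag_of (b \<oplus>\<^bsub>B\<^esub> b', x) - frag_of (b, x) - frag_of (b', x) \<in> H"
  by (rule H_relator) (use assms in \<open>auto simp: tensor_relators_def\<close>)
 then show ?thesis unfolding pt_def' using assms by (simp only: T_add FC_closed tc_eq_iff diff_diff_eq)
qed

lemma pt_add_right:
 assumes "b \<in> carrier B" "x \<in> carrier M" "x' \<in> carrier M"
 shows "pt b (x \<oplus>\<^bsub>M\<^esub> x') = pt b x \<oplus>\<^bsub>T\<^esub> pt b x'"
proof -
 have "frag_of (b, x \<oplus>\<^bsub>M\<^esub> x') - frag_of (b, x) - frag_of (b, x') \<in> H"
  by (rule H_relator) (use assms in \<open>auto simp: tensor_relators_def\<close>)
 then show ?thesis unfolding pt_def' using assms by (simp only: T_add FC_closed tc_eq_iff diff_diff_eq)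
qed

lemma pt_balanced:
 assumes "a \<in> carrier A" "b \<in> carrier B" "x \<in> carrier M"
 shows "pt (b \<otimes>\<^bsub>B\<^esub> f a) x = pt b (a \<odot>\<^bsub>M\<^esub> x)"
proof -
 have "frag_of (b \<otimes>\<^bsub>B\<^esub> f a, x) - frag_of (b, a \<odot>\<^bsub>M\<^esub> x) \<in> H"
  by (rule H_relator) (use assms in \<open>auto simp: tensor_relators_def\<close>)
 then show ?thesis unfolding pt_def' by (simp only: tc_eq_iff)
qed

lemma pt_smult: "b \<in> carrier B ==> b \<odot>\<^bsub>T\<^esub> pt b' x = pt (b \<otimes>\<^bsub>B\<^esub> b') x"
 unfolding pt_def' by (simp add: T_smult)

lemma pt_zero_left: "x \<in> carrier M ==> pt \<zero>\<^bsub>B\<^esub> x = \<zero>\<^bsub>T\<^esub>"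
 using pt_add_left[of "\<zero>\<^bsub>B\<^esub>" "\<zero>\<^bsub>B\<^esub>" x]
 by (metis B.l_zero B.zero_closed T.add.l_cancel_one pt_closed)

text \<open>Elements of the free abelian group are built by differences, whereas the rule has sums
  only. The inner induction therefore carries c and - c together, and the negative of a pure tensor
  is again pure, namely (- b) \<otimes> x.\<close>

lemma T_induct [consumes 1, case_names pure add]:
 assumes "t \<in> carrier T"
  and pure: "\<And>b x. b \<in> carrier B ==> x \<in> carrier M ==> P (pt b x)"
  and add: "\<And>s t. s \<in> carrier T ==> t \<in> carrier T ==> P s ==> P t ==> P (s \<oplus>\<^bsub>T\<^esub> t)"
 shows "P t"
proof -
 obtain c where c: "t = tc c" "c \<in> FC" using assms(1) by (auto simp: carrier_T)
 have Pa: "P (tc (c + d))" if "c \<in> FC" "d \<in> FC" "P (tc c)" "P (tc d)" for c d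
 proof -
  have "tc c \<in> carrier T" "tc d \<in> carrier T" using that(1,2) unfolding carrier_T by blast+
  then have "P (tc c \<oplus>\<^bsub>T\<^esub> tc d)" using add that(3,4) by blast
  then show ?thesis unfolding T_add[OF that(1,2)] .
 qed
 from c(2) have "P (tc c) \<and> P (tc (- c))"
 proof (induction c rule: FC_induct)
  case zero
  then show ?case using pure[of "\<zero>\<^bsub>B\<^esub>" "\<zero>\<^bsub>M\<^esub>"] pt_zero_left T_zero by simp
 next
  case (one b x)
  have "frag_of (b \<oplus>\<^bsub>B\<^esub> (\<ominus>\<^bsub>B\<^esub> b), x) - frag_of (b, x) - frag_of (\<ominus>\<^bsub>B\<^esub> b, x) \<in> H"
   by (rule H_relator) (use one in \<open>auto simp: tensor_relators_def\<close>)
  moreover have "tc (frag_of (b \<oplus>\<^bsub>B\<^esub> (\<ominus>\<^bsub>B\<^esub> b), x)) = tc 0"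
   using pt_zero_left[of x] one by (simp add: pt_def' T_zero B.r_neg)
  then have "frag_of (b \<oplus>\<^bsub>B\<^esub> (\<ominus>\<^bsub>B\<^esub> b), x) - 0 \<in> H" unfolding tc_eq_iff .
  ultimately have "(frag_of (b \<oplus>\<^bsub>B\<^esub> (\<ominus>\<^bsub>B\<^esub> b), x) - frag_of (b, x) - frag_of (\<ominus>\<^bsub>B\<^esub> b, x)) - (frag_of (b \<oplus>\<^bsub>B\<^esub> (\<ominus>\<^bsub>B\<^esub> b), x) - 0) \<in> H"
   by (rule H_diff)
  then have "tc (- frag_of (b, x)) = tc (frag_of (\<ominus>\<^bsub>B\<^esub> b, x))" by (simp add: tc_eq_iff)
  then show ?case using pure[of b x] pure[of "\<ominus>\<^bsub>B\<^esub> b" x] one by (simp add: pt_def')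
 next
  case (diff c d)
  have "- c \<in> FC" "- d \<in> FC" using diff FC_closed(3) by blast+
  then have "P (tc (c + - d))" "P (tc (- c + d))" using diff Pa by blast+
  then show ?case by simp
 qed
 then show ?thesis using c by simp
qed

lemma module_T: "Module.module B T"
proof (rule moduleI)
 show "cring B" by (rule cring_B)
 show "abelian_group T" by (rule abelian_group_T)
 fix a t assume at: "a \<in> carrier B" "t \<in> carrier T"
 then obtain c where c: "t = tc c" "c \<in> FC" by (auto simp: carrier_T)
 show "a \<odot>\<^bsub>T\<^esub> t \<in> carrier T" unfolding c(1) T_smult[OF at(1)] carrier_T using act_FC[OF c(2) at(1)] by blast
 fix s assume "s \<in> carrier T"
 then obtain d where d: "s = tc d" "d \<in> FC" by (auto simp: carrier_T)
 show "a \<odot>\<^bsub>T\<^esub> (t \<oplus>\<^bsub>T\<^esub> s) = a \<odot>\<^bsub>T\<^esub> t \<oplus>\<^bsub>T\<^esub> a \<odot>\<^bsub>T\<^esub> s"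
  unfolding c(1) d(1) T_add[OF c(2) d(2)] T_smult[OF at(1)] T_add[OF act_FC[OF c(2) at(1)] act_FC[OF d(2) at(1)]] by simp
next
 fix a b t assume ab: "a \<in> carrier B" "b \<in> carrier B"
 assume t: "t \<in> carrier T"
 then obtain c where c: "t = tc c" "c \<in> FC" by (auto simp: carrier_T)
 have "act (a \<otimes>\<^bsub>B\<^esub> b) c = act a (act b c)"
  using c(2) by (induction c rule: FC_induct) (use ab in \<open>auto simp: B.m_assoc\<close>)
 then show "(a \<otimes>\<^bsub>B\<^esub> b) \<odot>\<^bsub>T\<^esub> t = a \<odot>\<^bsub>T\<^esub> (b \<odot>\<^bsub>T\<^esub> t)" using ab by (simp add: c(1) T_smult)
 have "act (a \<oplus>\<^bsub>B\<^esub> b) c - (act a c + act b c) \<in> H"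
  using c(2)
 proof (induction c rule: FC_induct)
  case (one b' x)
  have "frag_of ((a \<otimes>\<^bsub>B\<^esub> b') \<oplus>\<^bsub>B\<^esub> (b \<otimes>\<^bsub>B\<^esub> b'), x) - frag_of (a \<otimes>\<^bsub>B\<^esub> b', x) - frag_of (b \<otimes>\<^bsub>B\<^esub> b', x) \<in> H"
   by (rule H_relator) (use one ab B.m_closed in \<open>unfold tensor_relators_def, blast\<close>)
  then show ?case using one ab by (simp add: B.l_distr diff_diff_eq)
 next
  case (diff c d)
  have "act (a \<oplus>\<^bsub>B\<^esub> b) (c - d) - (act a (c - d) + act b (c - d)) =
   (act (a \<oplus>\<^bsub>B\<^esub> b) c - (act a c + act b c)) - (act (a \<oplus>\<^bsub>B\<^esub> b) d - (act a d + act b d))"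
   by simp
  then show ?case using H_diff diff by metis
 qed (simp add: H_closed)
 then show "(a \<oplus>\<^bsub>B\<^esub> b) \<odot>\<^bsub>T\<^esub> t = a \<odot>\<^bsub>T\<^esub> t \<oplus>\<^bsub>T\<^esub> b \<odot>\<^bsub>T\<^esub> t"
  unfolding c(1) using ab act_FC[OF c(2)] by (simp only: T_smult B.add.m_closed T_add tc_eq_iff)
next
 fix t assume "t \<in> carrier T"
 then obtain c where c: "t = tc c" "c \<in> FC" by (auto simp: carrier_T)
 have "act \<one>\<^bsub>B\<^esub> c = c" using c(2) by (induction c rule: FC_induct) auto
 then show "\<one>\<^bsub>B\<^esub> \<odot>\<^bsub>T\<^esub> t = t" by (simp add: c(1) T_smult)
qed

sublocale T: Module.module B T by (rule module_T)

definition evl :: "('e, 'n) module \<Rightarrow> ('b \<times> 'm \<Rightarrow> 'n) \<Rightarrow> (('b \<times> 'm) \<Rightarrow>\<^sub>0 int) \<Rightarrow> 'n" where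
 "evl N g c = (\<Oplus>\<^bsub>N\<^esub>p\<in>Poly_Mapping.keys c. [Poly_Mapping.lookup c p] \<cdot>\<^bsub>N\<^esub> g p)"

lemma evl_hom:
 fixes N :: "('e, 'n) module"
 assumes "abelian_group N" "\<And>b x. b \<in> carrier B ==> x \<in> carrier M ==> g (b, x) \<in> carrier N"
 shows "evl N g \<in> hom F (add_monoid N)" "b \<in> carrier B ==> x \<in> carrier M ==> evl N g (frag_of (b, x)) = g (b, x)"
proof -
 interpret N: abelian_group N by fact
 have "g ` (carrier B \<times> carrier M) \<subseteq> carrier (add_monoid N)" using assms(2) by auto
 from comm_group.free_Abelian_group_universal[OF N.a_comm_group this]
 obtain h where h: "h \<in> hom F (add_monoid N)" "\<And>p. p \<in> carrier B \<times> carrier M ==> h (frag_of p) = g p" by metis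
 have hh: "h (c + d) = h c \<oplus>\<^bsub>N\<^esub> h d" if "c \<in> FC" "d \<in> FC" for c d
  using hom_mult[OF h(1), of c d] that by simp
 have hc: "h c \<in> carrier N" if "c \<in> FC" for c using hom_in_carrier[OF h(1), of c] that by simp
 interpret hg: group_hom F "add_monoid N" h
  using h(1) by (intro group_hom.intro group_F N.a_group group_hom_axioms.intro)
 have pw: "h (frag_cmul k (frag_of p)) = [k] \<cdot>\<^bsub>N\<^esub> g p" if "p \<in> carrier B \<times> carrier M" for k p
 proof -
  have "frag_cmul k (frag_of p) = frag_of p [^]\<^bsub>F\<^esub> k" using that by (simp add: keys_frag_of)
  then show ?thesis using hg.hom_int_pow[of "frag_of p" k] h(2)[OF that] that
   by (simp add: keys_frag_of add_pow_def)
 qed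
 have s: "h (\<Sum>p\<in>I. frag_cmul (k p) (frag_of p)) = (\<Oplus>\<^bsub>N\<^esub>p\<in>I. [k p] \<cdot>\<^bsub>N\<^esub> g p) \<and> (\<Sum>p\<in>I. frag_cmul (k p) (frag_of p)) \<in> FC"
  if "finite I" "I \<subseteq> carrier B \<times> carrier M" for I k
  using that
 proof (induction I)
  case empty
  have "h 0 = \<zero>\<^bsub>N\<^esub>" using hg.hom_one by simp
  then show ?case by simp
 next
  case (insert p I)
  then have IH: "h (\<Sum>p\<in>I. frag_cmul (k p) (frag_of p)) = (\<Oplus>\<^bsub>N\<^esub>p\<in>I. [k p] \<cdot>\<^bsub>N\<^esub> g p)"
   "(\<Sum>p\<in>I. frag_cmul (k p) (frag_of p)) \<in> FC" by auto
  have p: "frag_cmul (k p) (frag_of p) \<in> FC" using insert keys_cmul[of "k p" "frag_of p"] by (auto simp: keys_frag_of)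
  have gc: "[k q] \<cdot>\<^bsub>N\<^esub> g q \<in> carrier N" if "q \<in> insert p I" for q
   using that insert assms(2) by (cases q) (auto intro!: N.add.int_pow_closed)
  have "h (\<Sum>p\<in>insert p I. frag_cmul (k p) (frag_of p)) = [k p] \<cdot>\<^bsub>N\<^esub> g p \<oplus>\<^bsub>N\<^esub> (\<Oplus>\<^bsub>N\<^esub>p\<in>I. [k p] \<cdot>\<^bsub>N\<^esub> g p)"
   using insert hh[OF p IH(2)] IH(1) pw[of p "k p"] by simp
  also have "\<dots> = (\<Oplus>\<^bsub>N\<^esub>p\<in>insert p I. [k p] \<cdot>\<^bsub>N\<^esub> g p)"
   using insert gc by (subst N.finsum_insert) auto
  moreover have "(\<Sum>p\<in>insert p I. frag_cmul (k p) (frag_of p)) \<in> FC"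
   using FC_closed(1)[OF p IH(2)] insert by simp
  ultimately show ?case by simp
 qed
 have eq: "evl N g c = h c" if "c \<in> FC" for c
 proof -
  have "(\<Sum>p\<in>Poly_Mapping.keys c. frag_cmul (Poly_Mapping.lookup c p) (frag_of p)) = c"
   using frag_expansion[of c] by (simp add: frag_extend_def)
  then show ?thesis using s[of "Poly_Mapping.keys c" "Poly_Mapping.lookup c"] that by (simp add: evl_def)
 qed
 show "evl N g \<in> hom F (add_monoid N)"
  unfolding hom_def using eq hh hc FC_closed(1) by (auto simp: Pi_def)
 show "b \<in> carrier B ==> x \<in> carrier M ==> evl N g (frag_of (b, x)) = g (b, x)"
  using eq[of "frag_of (b, x)"] h(2)[of "(b, x)"] FC_closed(5) by auto
qed

text \<open>\<open>tensor_lift\<close> picks the unique value on a coset. It is well defined because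
  evaluation is a homomorphism on the free abelian group and sends every relator of a balanced map
  to zero.\<close>

lemma tensor_lift_tc:
 fixes N :: "('e, 'n) module"
 assumes "abelian_group N" "balanced N g" "c \<in> FC"
 shows "tensor_lift N g (tc c) = evl N g c"
proof -
 interpret N: abelian_group N by fact
 have g: "g (b, x) \<in> carrier N" if "b \<in> carrier B" "x \<in> carrier M" for b x
  using assms(2) that by (auto simp: balanced_def)
 note ev = evl_hom[where g = g, OF assms(1) g]
 have ev_add: "evl N g (c + d) = evl N g c \<oplus>\<^bsub>N\<^esub> evl N g d" if "c \<in> FC" "d \<in> FC" for c d
  using hom_mult[OF ev(1), of c d] that by simp
 have ev_c: "evl N g c \<in> carrier N" if "c \<in> FC" for c using hom_in_carrier[OF ev(1), of c] that by simp
 have ev_diff: "evl N g (c - d) \<oplus>\<^bsub>N\<^esub> evl N g d = evl N g c" if "c \<in> FC" "d \<in> FC" for c d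
  using ev_add[OF FC_closed(2)[OF that] that(2)] by simp
 \<comment> \<open>Relators are differences of generators; adding the subtracted part d turns the
   claim into an equality of two values, and cancellation in N avoids subtraction there.\<close>
 have ev0: "evl N g c = \<zero>\<^bsub>N\<^esub>" if "c \<in> FC" "d \<in> FC" "evl N g (c + d) = evl N g d" for c d
 proof -
  have "evl N g c \<oplus>\<^bsub>N\<^esub> evl N g d = \<zero>\<^bsub>N\<^esub> \<oplus>\<^bsub>N\<^esub> evl N g d"
   using ev_add[OF that(1,2)] that(3) ev_c[OF that(2)] by simp
  then show ?thesis using N.add.right_cancel[OF ev_c[OF that(2)] ev_c[OF that(1)] N.zero_closed] by blast
 qed
 have "h \<in> H ==> evl N g h = \<zero>\<^bsub>N\<^esub>" for h
 proof (induction h rule: H_induct)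
  case zero then show ?case using ev0[of 0 0] FC_closed(4) by simp
 next
  case (rel r)
  have rF: "r \<in> FC" using rel relators_FC by blast
  from rel consider
   (1) b1 b2 x where "r = frag_of (b1 \<oplus>\<^bsub>B\<^esub> b2, x) - frag_of (b1, x) - frag_of (b2, x)"
    "b1 \<in> carrier B" "b2 \<in> carrier B" "x \<in> carrier M"
   | (2) b1 x x' where "r = frag_of (b1, x \<oplus>\<^bsub>M\<^esub> x') - frag_of (b1, x) - frag_of (b1, x')"
    "b1 \<in> carrier B" "x \<in> carrier M" "x' \<in> carrier M"
   | (3) a b1 x where "r = frag_of (b1 \<otimes>\<^bsub>B\<^esub> f a, x) - frag_of (b1, a \<odot>\<^bsub>M\<^esub> x)"
    "a \<in> carrier A" "b1 \<in> carrier B" "x \<in> carrier M"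
   unfolding tensor_relators_def by blast
  then show ?case
  proof cases
   case 1
   let ?d = "frag_of (b1, x) + frag_of (b2, x)"
   have d: "?d \<in> FC" using 1 by (intro FC_closed)
   have "evl N g ?d = g (b1, x) \<oplus>\<^bsub>N\<^esub> g (b2, x)"
    using ev_add[of "frag_of (b1, x)" "frag_of (b2, x)"] ev(2) 1 FC_closed(5) by simp
   also have "\<dots> = g (b1 \<oplus>\<^bsub>B\<^esub> b2, x)" using 1 assms(2) by (auto simp: balanced_def)
   also have "\<dots> = evl N g (r + ?d)" using 1 ev(2)[of "b1 \<oplus>\<^bsub>B\<^esub> b2" x] by simp
   finally show ?thesis using ev0[OF rF d] by simp
  next
   case 2
   let ?d = "frag_of (b1, x) + frag_of (b1, x')"
   have d: "?d \<in> FC" using 2 by (intro FC_closed)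
   have "evl N g ?d = g (b1, x) \<oplus>\<^bsub>N\<^esub> g (b1, x')"
    using ev_add[of "frag_of (b1, x)" "frag_of (b1, x')"] ev(2) 2 FC_closed(5) by simp
   also have "\<dots> = g (b1, x \<oplus>\<^bsub>M\<^esub> x')" using 2 assms(2) by (auto simp: balanced_def)
   also have "\<dots> = evl N g (r + ?d)" using 2 ev(2)[of b1 "x \<oplus>\<^bsub>M\<^esub> x'"] by simp
   finally show ?thesis using ev0[OF rF d] by simp
  next
   case 3
   let ?d = "frag_of (b1, a \<odot>\<^bsub>M\<^esub> x)"
   have d: "?d \<in> FC" using 3 by (intro FC_closed) auto
   have "evl N g ?d = g (b1, a \<odot>\<^bsub>M\<^esub> x)" using ev(2) 3 by simp
   also have "\<dots> = g (b1 \<otimes>\<^bsub>B\<^esub> f a, x)" using 3 assms(2) by (auto simp: balanced_def)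
   also have "\<dots> = evl N g (r + ?d)" using 3 ev(2)[of "b1 \<otimes>\<^bsub>B\<^esub> f a" x] by simp
   finally show ?thesis using ev0[OF rF d] by simp
  qed
 next
  case (diff x y)
  then have "x \<in> FC" "y \<in> FC" using H_FC by blast+
  then have "evl N g (x - y) \<oplus>\<^bsub>N\<^esub> \<zero>\<^bsub>N\<^esub> = \<zero>\<^bsub>N\<^esub>" "evl N g (x - y) \<in> carrier N"
   using ev_diff[of x y] diff ev_c[OF FC_closed(2)] by simp_all
  then show ?case by simp
 qed
 then have "evl N g d = evl N g c" if "d \<in> tc c" for d
  using that ev_add[of "d - c" c] assms(3) H_FC ev_c by (simp add: mem_tc)
 moreover have "c \<in> tc c" by (simp add: mem_tc H_closed)
 ultimately have "evl N g ` tc c = {evl N g c}" by blast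
 then show ?thesis by (simp add: tensor_lift_def evl_def[abs_def])
qed

lemma tensor_lift_pure:
 fixes N :: "('e, 'n) module"
 assumes "abelian_group N" "balanced N g" "b \<in> carrier B" "x \<in> carrier M"
 shows "tensor_lift N g (pt b x) = g (b, x)"
 unfolding pt_def' tensor_lift_tc[OF assms(1,2) FC_closed(5)[OF assms(3,4)]]
 using assms by (intro evl_hom) (auto simp: balanced_def)

lemma tensor_lift_add:
 fixes N :: "('e, 'n) module"
 assumes "abelian_group N" "balanced N g" "s \<in> carrier T" "t \<in> carrier T"
 shows "tensor_lift N g (s \<oplus>\<^bsub>T\<^esub> t) = tensor_lift N g s \<oplus>\<^bsub>N\<^esub> tensor_lift N g t"
proof -
 obtain c d where cd: "s = tc c" "c \<in> FC" "t = tc d" "d \<in> FC" using assms by (auto simp: carrier_T)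
 have "evl N g \<in> hom F (add_monoid N)" using assms by (intro evl_hom) (auto simp: balanced_def)
 then have "evl N g (c + d) = evl N g c \<oplus>\<^bsub>N\<^esub> evl N g d" using hom_mult[of "evl N g" F "add_monoid N" c d] cd by simp
 then show ?thesis unfolding cd(1,3) T_add[OF cd(2,4)]
  unfolding tensor_lift_tc[OF assms(1,2) cd(2)] tensor_lift_tc[OF assms(1,2) cd(4)]
   tensor_lift_tc[OF assms(1,2) FC_closed(1)[OF cd(2,4)]] .
qed

lemma tensor_lift_closed:
 fixes N :: "('e, 'n) module"
 assumes "abelian_group N" "balanced N g" "t \<in> carrier T"
 shows "tensor_lift N g t \<in> carrier N"
proof -
 obtain c where c: "t = tc c" "c \<in> FC" using assms by (auto simp: carrier_T)
 have "evl N g \<in> hom F (add_monoid N)" using assms by (intro evl_hom) (auto simp: balanced_def)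
 then show ?thesis using hom_in_carrier[of "evl N g" F "add_monoid N" c] c tensor_lift_tc[OF assms(1,2)] by simp
qed

lemma tensor_lift_smult:
 fixes N :: "('b, 'n) module"
 assumes "Module.module B N" "balanced N g" "t \<in> carrier T" "b \<in> carrier B"
  and g: "\<And>b' x. b' \<in> carrier B ==> x \<in> carrier M ==> g (b \<otimes>\<^bsub>B\<^esub> b', x) = b \<odot>\<^bsub>N\<^esub> g (b', x)"
 shows "tensor_lift N g (b \<odot>\<^bsub>T\<^esub> t) = b \<odot>\<^bsub>N\<^esub> tensor_lift N g t"
 using assms(3)
proof (induction t rule: T_induct)
 case (pure b' x)
 then show ?case
  using assms tensor_lift_pure[OF module.axioms(2)[OF assms(1)] assms(2)] by (simp add: pt_smult)
next
 case (add s t)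
 note ab = module.axioms(2)[OF assms(1)]
 have "tensor_lift N g (b \<odot>\<^bsub>T\<^esub> (s \<oplus>\<^bsub>T\<^esub> t)) = tensor_lift N g (b \<odot>\<^bsub>T\<^esub> s \<oplus>\<^bsub>T\<^esub> b \<odot>\<^bsub>T\<^esub> t)"
  using add assms(4) by (simp add: T.smult_r_distr)
 also have "\<dots> = b \<odot>\<^bsub>N\<^esub> tensor_lift N g s \<oplus>\<^bsub>N\<^esub> b \<odot>\<^bsub>N\<^esub> tensor_lift N g t"
  using add assms(4) tensor_lift_add[OF ab assms(2)] by simp
 also have "\<dots> = b \<odot>\<^bsub>N\<^esub> tensor_lift N g (s \<oplus>\<^bsub>T\<^esub> t)"
  using add assms(4) tensor_lift_add[OF ab assms(2)] tensor_lift_closed[OF ab assms(2)]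
   module.smult_r_distr[OF assms(1)] by simp
 finally show ?case .
qed

end

section \<open>Depth and Krull dimension\<close>

lemma (in cring) ideal_criterion:
 assumes "I \<subseteq> carrier R" "\<zero> \<in> I" "\<And>a b. a \<in> I ==> b \<in> I ==> a \<oplus> b \<in> I"
  "\<And>r a. r \<in> carrier R ==> a \<in> I ==> r \<otimes> a \<in> I"
 shows "ideal I R"
proof (rule idealI[OF ring_axioms])
 show "subgroup I (add_monoid R)"
 proof (rule add.subgroupI)
  fix a assume a: "a \<in> I"
  have "\<ominus> a = (\<ominus> \<one>) \<otimes> a" using a assms(1) by (auto simp: l_minus)
  then show "\<ominus> a \<in> I" using assms(4)[OF _ a, of "\<ominus> \<one>"] by simp
 qed (use assms in auto)
 show "x \<otimes> a \<in> I" if "a \<in> I" "x \<in> carrier R" for a x using that assms(4) by blast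
 show "a \<otimes> x \<in> I" if "a \<in> I" "x \<in> carrier R" for a x using that assms(1,4) m_comm by (metis subsetD)
qed

lemma ideal_closed:
 assumes "ideal I R"
 shows "I \<subseteq> carrier R" "\<zero>\<^bsub>R\<^esub> \<in> I" "a \<in> I ==> b \<in> I ==> a \<oplus>\<^bsub>R\<^esub> b \<in> I"
  "r \<in> carrier R ==> a \<in> I ==> r \<otimes>\<^bsub>R\<^esub> a \<in> I" "r \<in> carrier R ==> a \<in> I ==> a \<otimes>\<^bsub>R\<^esub> r \<in> I"
 using ideal.Icarr[OF assms] additive_subgroup.zero_closed[OF ideal.axioms(1)[OF assms]]
  additive_subgroup.a_closed[OF ideal.axioms(1)[OF assms]] ideal.I_l_closed[OF assms] ideal.I_r_closed[OF assms]
 by auto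

text \<open>An ideal maximal among those containing I and disjoint from W is prime: if a and b are
  outside, then both P + (a) and P + (b) meet W, hence so does P + (a b).\<close>

lemma (in cring) prime_ideal_avoiding:
 assumes I: "ideal I R" and W: "W \<subseteq> carrier R" "\<one> \<in> W" "\<And>a b. a \<in> W ==> b \<in> W ==> a \<otimes> b \<in> W"
  and disj: "I \<inter> W = {}"
 shows "\<exists>P. primeideal P R \<and> I \<subseteq> P \<and> P \<inter> W = {}"
proof -
 define Fam where "Fam = {J. ideal J R \<and> I \<subseteq> J \<and> J \<inter> W = {}}"
 have "\<exists>Y\<in>Fam. \<forall>Z\<in>Fam. Y \<subseteq> Z \<longrightarrow> Z = Y"
 proof (rule subset_Zorn_nonempty)
  show "Fam \<noteq> {}" using I disj by (auto simp: Fam_def)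
  fix C assume C: "C \<noteq> {}" "subset.chain Fam C"
  then have "subset.chain {I. ideal I R} C" by (auto simp: subset.chain_def Fam_def)
  from chain_Union_is_ideal[OF this] have "ideal (\<Union>C) R" using C by simp
  then show "\<Union>C \<in> Fam" using C by (auto simp: subset.chain_def Fam_def)
 qed
 then obtain P where P: "ideal P R" "I \<subseteq> P" "P \<inter> W = {}"
  and max: "\<And>Z. ideal Z R ==> I \<subseteq> Z ==> Z \<inter> W = {} ==> P \<subseteq> Z ==> Z = P" by (auto simp: Fam_def)
 note Pc = ideal_closed[OF P(1)]
 have meet: "\<exists>p\<in>P. \<exists>r\<in>carrier R. p \<oplus> r \<otimes> a \<in> W" if a: "a \<in> carrier R" "a \<notin> P" for a
 proof -
  define Z where "Z = {p \<oplus> r \<otimes> a | p r. p \<in> P \<and> r \<in> carrier R}"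
  have mem: "p \<oplus> r \<otimes> a \<in> Z" if "p \<in> P" "r \<in> carrier R" for p r using that by (auto simp: Z_def)
  have PX: "P \<subseteq> Z" using mem[of _ \<zero>] Pc(1) a by force
  have aX: "a \<in> Z" using mem[OF Pc(2), of \<one>] a by simp
  have "ideal Z R"
  proof (rule ideal_criterion)
   show "Z \<subseteq> carrier R" using Pc(1) a by (auto simp: Z_def)
   show "\<zero> \<in> Z" using PX Pc by blast
  next
   fix x y assume "x \<in> Z" "y \<in> Z"
   then obtain p r q s where xy: "x = p \<oplus> r \<otimes> a" "y = q \<oplus> s \<otimes> a" "p \<in> P" "q \<in> P" "r \<in> carrier R" "s \<in> carrier R"
    by (auto simp: Z_def)
   moreover have "p \<in> carrier R" "q \<in> carrier R" using xy Pc(1) by auto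
   ultimately have "x \<oplus> y = (p \<oplus> q) \<oplus> (r \<oplus> s) \<otimes> a" using a by (simp add: l_distr a_ac)
   then show "x \<oplus> y \<in> Z" using mem[OF Pc(3)] xy by auto
  next
   fix t x assume t: "t \<in> carrier R" and "x \<in> Z"
   then obtain p r where x: "x = p \<oplus> r \<otimes> a" "p \<in> P" "r \<in> carrier R" by (auto simp: Z_def)
   moreover have "p \<in> carrier R" using x Pc(1) by auto
   ultimately have "t \<otimes> x = t \<otimes> p \<oplus> (t \<otimes> r) \<otimes> a" using a t by (simp add: r_distr m_assoc)
   then show "t \<otimes> x \<in> Z" using mem[OF Pc(4)[OF t]] x t by auto
  qed
  moreover have "Z \<noteq> P" using aX a by blast
  ultimately have "Z \<inter> W \<noteq> {}" using max P(2) PX by blast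
  then show ?thesis by (auto simp: Z_def)
 qed
 have "primeideal P R"
 proof (rule primeidealI[OF P(1) is_cring])
  show "carrier R \<noteq> P" using P(3) W by blast
  fix a b assume ab: "a \<in> carrier R" "b \<in> carrier R" "a \<otimes> b \<in> P"
  show "a \<in> P \<or> b \<in> P"
  proof (rule ccontr)
   assume "\<not> ?thesis"
   then obtain p r q s where pr: "p \<in> P" "r \<in> carrier R" "p \<oplus> r \<otimes> a \<in> W" and qs: "q \<in> P" "s \<in> carrier R" "q \<oplus> s \<otimes> b \<in> W"
    using meet ab by metis
   have pq: "p \<in> carrier R" "q \<in> carrier R" using pr qs Pc(1) by auto
   have "(p \<oplus> r \<otimes> a) \<otimes> (q \<oplus> s \<otimes> b) = (p \<otimes> (q \<oplus> s \<otimes> b) \<oplus> (r \<otimes> a) \<otimes> q) \<oplus> (r \<otimes> s) \<otimes> (a \<otimes> b)"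
    using pq pr qs ab by (simp add: l_distr r_distr m_ac a_ac)
   also have "\<dots> \<in> P" proof (intro Pc(3))
    show "p \<otimes> (q \<oplus> s \<otimes> b) \<in> P" by (rule Pc(5)) (use pr(1) qs pq ab in auto)
    show "r \<otimes> a \<otimes> q \<in> P" by (rule Pc(4)) (use pr qs(1) ab in auto)
    show "r \<otimes> s \<otimes> (a \<otimes> b) \<in> P" by (rule Pc(4)) (use pr qs ab in auto)
   qed
   finally show False using W(3)[OF pr(3) qs(3)] P(3) by blast
  qed
 qed
 then show ?thesis using P by blast
qed

lemma seq_multiples_closed:
 assumes "Module.module A M" "set as \<subseteq> carrier A"
 shows "seq_multiples M as \<subseteq> carrier M" "\<zero>\<^bsub>M\<^esub> \<in> seq_multiples M as"
  "x \<in> seq_multiples M as ==> y \<in> seq_multiples M as ==> x \<oplus>\<^bsub>M\<^esub> y \<in> seq_multiples M as"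
  "r \<in> carrier A ==> x \<in> seq_multiples M as ==> r \<odot>\<^bsub>M\<^esub> x \<in> seq_multiples M as"
proof -
 interpret Module.module A M by fact
 have "seq_multiples M as \<subseteq> carrier M \<and> \<zero>\<^bsub>M\<^esub> \<in> seq_multiples M as \<and>
  (\<forall>x\<in>seq_multiples M as. \<forall>y\<in>seq_multiples M as. x \<oplus>\<^bsub>M\<^esub> y \<in> seq_multiples M as) \<and>
  (\<forall>r\<in>carrier A. \<forall>x\<in>seq_multiples M as. r \<odot>\<^bsub>M\<^esub> x \<in> seq_multiples M as)"
  using assms(2)
 proof (induction as)
  case (Cons a as)
  let ?N = "seq_multiples M as"
  have a: "a \<in> carrier A" and IH: "?N \<subseteq> carrier M" "\<zero>\<^bsub>M\<^esub> \<in> ?N" "\<And>x y. x \<in> ?N ==> y \<in> ?N ==> x \<oplus>\<^bsub>M\<^esub> y \<in> ?N"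
   "\<And>r x. r \<in> carrier A ==> x \<in> ?N ==> r \<odot>\<^bsub>M\<^esub> x \<in> ?N" using Cons by auto
  have mem: "a \<odot>\<^bsub>M\<^esub> x \<oplus>\<^bsub>M\<^esub> y \<in> seq_multiples M (a # as)" if "x \<in> carrier M" "y \<in> ?N" for x y
   using that by auto
  show ?case
  proof (intro conjI ballI)
   show "seq_multiples M (a # as) \<subseteq> carrier M" using IH(1) a by auto
   show "\<zero>\<^bsub>M\<^esub> \<in> seq_multiples M (a # as)" using mem[OF M.zero_closed IH(2)] a by simp
  next
   fix x y assume "x \<in> seq_multiples M (a # as)" "y \<in> seq_multiples M (a # as)"
   then obtain x1 x2 y1 y2 where xy: "x = a \<odot>\<^bsub>M\<^esub> x1 \<oplus>\<^bsub>M\<^esub> x2" "y = a \<odot>\<^bsub>M\<^esub> y1 \<oplus>\<^bsub>M\<^esub> y2"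
    "x1 \<in> carrier M" "y1 \<in> carrier M" "x2 \<in> ?N" "y2 \<in> ?N" by auto
   moreover have "x2 \<in> carrier M" "y2 \<in> carrier M" using xy IH(1) by auto
   ultimately have "x \<oplus>\<^bsub>M\<^esub> y = a \<odot>\<^bsub>M\<^esub> (x1 \<oplus>\<^bsub>M\<^esub> y1) \<oplus>\<^bsub>M\<^esub> (x2 \<oplus>\<^bsub>M\<^esub> y2)"
    using a by (simp add: smult_r_distr M.a_ac)
   then show "x \<oplus>\<^bsub>M\<^esub> y \<in> seq_multiples M (a # as)" using mem[OF _ IH(3)] xy by auto
  next
   fix r x assume r: "r \<in> carrier A" and "x \<in> seq_multiples M (a # as)"
   then obtain x1 x2 where x: "x = a \<odot>\<^bsub>M\<^esub> x1 \<oplus>\<^bsub>M\<^esub> x2" "x1 \<in> carrier M" "x2 \<in> ?N" by auto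
   moreover have "x2 \<in> carrier M" using x IH(1) by auto
   ultimately have "r \<odot>\<^bsub>M\<^esub> x = a \<odot>\<^bsub>M\<^esub> (r \<odot>\<^bsub>M\<^esub> x1) \<oplus>\<^bsub>M\<^esub> r \<odot>\<^bsub>M\<^esub> x2"
    using a r by (simp add: smult_r_distr smult_assoc1[symmetric] R.m_comm)
   then show "r \<odot>\<^bsub>M\<^esub> x \<in> seq_multiples M (a # as)" using mem[OF _ IH(4)[OF r]] x r by auto
  qed
 qed auto
 then show "seq_multiples M as \<subseteq> carrier M" "\<zero>\<^bsub>M\<^esub> \<in> seq_multiples M as"
  "x \<in> seq_multiples M as ==> y \<in> seq_multiples M as ==> x \<oplus>\<^bsub>M\<^esub> y \<in> seq_multiples M as"
  "r \<in> carrier A ==> x \<in> seq_multiples M as ==> r \<odot>\<^bsub>M\<^esub> x \<in> seq_multiples M as" by auto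
qed

text \<open>\<open>seq_multiples\<close> recurses on the head of the list, whereas the prefixes in
  \<open>regular_sequence\<close> grow at the end.\<close>

lemma seq_multiples_snoc:
 assumes "Module.module A M" "set as \<subseteq> carrier A" "a \<in> carrier A"
 shows "seq_multiples M as \<subseteq> seq_multiples M (as @ [a])"
  "x \<in> carrier M ==> a \<odot>\<^bsub>M\<^esub> x \<in> seq_multiples M (as @ [a])"
proof -
 interpret Module.module A M by fact
 have mem: "b \<odot>\<^bsub>M\<^esub> x \<oplus>\<^bsub>M\<^esub> y \<in> seq_multiples M (b # bs)" if "x \<in> carrier M" "y \<in> seq_multiples M bs" for b bs x y
  using that by auto
 have "seq_multiples M as \<subseteq> seq_multiples M (as @ [a]) \<and> (\<forall>x\<in>carrier M. a \<odot>\<^bsub>M\<^esub> x \<in> seq_multiples M (as @ [a]))"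
  using assms(2)
 proof (induction as)
  case Nil
  have "a \<odot>\<^bsub>M\<^esub> x \<in> seq_multiples M [a]" if "x \<in> carrier M" for x
   using mem[of x "\<zero>\<^bsub>M\<^esub>" "[]" a] that assms(3) by simp
  then have "(\<forall>x\<in>carrier M. a \<odot>\<^bsub>M\<^esub> x \<in> seq_multiples M [a]) \<and> \<zero>\<^bsub>M\<^esub> \<in> seq_multiples M [a]"
   using smult_r_null[OF assms(3)] M.zero_closed by metis
  then show ?case by (simp del: seq_multiples.simps(2))
 next
  case (Cons b as)
  then have b: "b \<in> carrier A" and IH: "seq_multiples M as \<subseteq> seq_multiples M (as @ [a])"
   "\<And>x. x \<in> carrier M ==> a \<odot>\<^bsub>M\<^esub> x \<in> seq_multiples M (as @ [a])" by auto
  have "a \<odot>\<^bsub>M\<^esub> x \<in> seq_multiples M (b # as @ [a])" if "x \<in> carrier M" for x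
   using mem[OF M.zero_closed IH(2)[OF that], of b] that b assms(3) by (simp del: seq_multiples.simps(2))
  moreover have "seq_multiples M (b # as) \<subseteq> seq_multiples M (b # as @ [a])" using IH(1) by auto
  ultimately show ?case by (simp del: seq_multiples.simps(2))
 qed
 then show "seq_multiples M as \<subseteq> seq_multiples M (as @ [a])"
  "x \<in> carrier M ==> a \<odot>\<^bsub>M\<^esub> x \<in> seq_multiples M (as @ [a])" by auto
qed

text \<open>If \<open>a\<close> is regular on \<open>M / N\<close> and \<open>Q\<close> is a prime containing \<open>a\<close> and \<open>Ann (M / N)\<close>, then the
 multiplicative set of all \<open>s a\<^sup>n\<close> with \<open>s \<notin> Q\<close> avoids \<open>Ann (M / N)\<close>, which gives a smaller prime.
 Hence a regular sequence of length \<open>r\<close> produces a chain of primes of length \<open>r\<close>.\<close>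

lemma regular_sequence_prime_chain:
 assumes M: "Module.module A M" and as: "set as \<subseteq> carrier A" and reg: "regular_sequence M as"
 obtains P where "\<And>i. i \<le> length as ==> primeideal (P i) A" "\<And>i. i < length as ==> P i \<subset> P (Suc i)"
  "{a \<in> carrier A. \<forall>x\<in>carrier M. a \<odot>\<^bsub>M\<^esub> x = \<zero>\<^bsub>M\<^esub>} \<subseteq> P 0"
proof -
 interpret Module.module A M by fact
 define N where "N i = seq_multiples M (take i as)" for i
 have tk: "set (take i as) \<subseteq> carrier A" for i using as set_take_subset by fast
 note Nc = seq_multiples_closed[OF M tk, folded N_def]
 define ann where "ann i = {a \<in> carrier A. \<forall>x\<in>carrier M. a \<odot>\<^bsub>M\<^esub> x \<in> N i}" for i
 have ann_ideal: "ideal (ann i) A" for i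
  by (rule R.ideal_criterion)
   (auto simp: ann_def Nc(2) smult_l_distr smult_assoc1 intro: Nc(3,4))
 have step: "\<exists>P. primeideal P A \<and> P \<subset> Q \<and> ann i \<subseteq> P" if i: "i < length as" and Q: "primeideal Q A" "ann (Suc i) \<subseteq> Q" for i Q
 proof -
  define a where "a = as ! i"
  have a: "a \<in> carrier A" using as i by (auto simp: a_def)
  have snoc: "take (Suc i) as = take i as @ [a]" using i by (simp add: a_def take_Suc_conv_app_nth)
  have ann_sub: "ann i \<subseteq> ann (Suc i)"
   using seq_multiples_snoc(1)[OF M tk[of i] a] by (auto simp: ann_def N_def snoc)
  have aQ: "a \<in> Q" using seq_multiples_snoc(2)[OF M tk[of i] a] Q(2) a by (auto simp: ann_def N_def snoc)
  interpret Q: primeideal Q A by fact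
  have regi: "x \<in> N i" if "x \<in> carrier M" "a \<odot>\<^bsub>M\<^esub> x \<in> N i" for x
   using reg that i by (auto simp: regular_sequence_def N_def a_def)
  have regp: "a [^]\<^bsub>A\<^esub> (n::nat) \<odot>\<^bsub>M\<^esub> x \<in> N i ==> x \<in> carrier M ==> x \<in> N i" for n x
  proof (induction n arbitrary: x)
   case (Suc n)
   then have "a [^]\<^bsub>A\<^esub> n \<odot>\<^bsub>M\<^esub> (a \<odot>\<^bsub>M\<^esub> x) \<in> N i" using a by (simp add: smult_assoc1)
   then show ?case using Suc regi a by blast
  qed simp
  define W where "W = {s \<otimes>\<^bsub>A\<^esub> a [^]\<^bsub>A\<^esub> (n::nat) | s n. s \<in> carrier A \<and> s \<notin> Q}"
  have one: "\<one>\<^bsub>A\<^esub> \<notin> Q" using Q.one_imp_carrier Q.I_notcarr by blast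
  have W_mem: "s \<otimes>\<^bsub>A\<^esub> a [^]\<^bsub>A\<^esub> (n::nat) \<in> W" if "s \<in> carrier A" "s \<notin> Q" for s n using that by (auto simp: W_def)
  have "\<exists>P. primeideal P A \<and> ann i \<subseteq> P \<and> P \<inter> W = {}"
  proof (rule R.prime_ideal_avoiding[OF ann_ideal])
   show "W \<subseteq> carrier A" using a by (auto simp: W_def)
   show "\<one>\<^bsub>A\<^esub> \<in> W" using W_mem[OF R.one_closed one, of 0] by simp
  next
   fix w w' assume "w \<in> W" "w' \<in> W"
   then obtain s s' and n n' :: nat where w: "w = s \<otimes>\<^bsub>A\<^esub> a [^]\<^bsub>A\<^esub> n" "w' = s' \<otimes>\<^bsub>A\<^esub> a [^]\<^bsub>A\<^esub> n'" "s \<in> carrier A" "s \<notin> Q" "s' \<in> carrier A" "s' \<notin> Q"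
    by (auto simp: W_def)
   have "w \<otimes>\<^bsub>A\<^esub> w' = (s \<otimes>\<^bsub>A\<^esub> s') \<otimes>\<^bsub>A\<^esub> (a [^]\<^bsub>A\<^esub> n \<otimes>\<^bsub>A\<^esub> a [^]\<^bsub>A\<^esub> n')"
    unfolding w(1,2) using w(3,5) a by (simp add: R.m_ac)
   also have "\<dots> = (s \<otimes>\<^bsub>A\<^esub> s') \<otimes>\<^bsub>A\<^esub> a [^]\<^bsub>A\<^esub> (n + n')" using a by (simp add: R.nat_pow_mult)
   finally show "w \<otimes>\<^bsub>A\<^esub> w' \<in> W" using W_mem[of "s \<otimes>\<^bsub>A\<^esub> s'" "n + n'"] w Q.I_prime by auto
  next
   have False if "s \<in> carrier A" "s \<notin> Q" "s \<otimes>\<^bsub>A\<^esub> a [^]\<^bsub>A\<^esub> (n::nat) \<in> ann i" for s n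
   proof -
    have "s \<odot>\<^bsub>M\<^esub> x \<in> N i" if x: "x \<in> carrier M" for x
    proof (rule regp[of n])
     have "a [^]\<^bsub>A\<^esub> n \<odot>\<^bsub>M\<^esub> (s \<odot>\<^bsub>M\<^esub> x) = (s \<otimes>\<^bsub>A\<^esub> a [^]\<^bsub>A\<^esub> n) \<odot>\<^bsub>M\<^esub> x"
      using \<open>s \<in> carrier A\<close> a x by (simp add: smult_assoc1[symmetric] R.m_comm)
     then show "a [^]\<^bsub>A\<^esub> n \<odot>\<^bsub>M\<^esub> (s \<odot>\<^bsub>M\<^esub> x) \<in> N i" using \<open>s \<otimes>\<^bsub>A\<^esub> a [^]\<^bsub>A\<^esub> n \<in> ann i\<close> x by (simp add: ann_def)
     show "s \<odot>\<^bsub>M\<^esub> x \<in> carrier M" using \<open>s \<in> carrier A\<close> x by simp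
    qed
    then have "s \<in> ann i" using that(1) by (simp add: ann_def)
    then show False using ann_sub Q(2) that(2) by blast
   qed
   then show "ann i \<inter> W = {}" by (auto simp: W_def)
  qed
  then obtain P where P: "primeideal P A" "ann i \<subseteq> P" "P \<inter> W = {}" by blast
  interpret P: primeideal P A by fact
  \<comment> \<open>Exponent 0 puts the complement of Q into W, so P stays inside Q; the element a,
    with s = 1 and exponent 1, lies in W, so the inclusion is strict.\<close>
  have "P \<subseteq> Q"
  proof
   fix s assume s: "s \<in> P"
   then have "s \<in> carrier A" by (rule P.Icarr)
   then show "s \<in> Q" using W_mem[of s 0] P(3) s by auto
  qed
  moreover have "a \<notin> P" using W_mem[OF R.one_closed one, of 1] P(3) a by auto
  ultimately show ?thesis using P aQ by blast
 qed
 \<comment> \<open>The chain grows downwards: it starts with a prime above the annihilator of M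
   modulo the whole sequence, which is proper since that quotient is nonzero, and each further step
   prepends a smaller prime.\<close>
 have "\<exists>P. (\<forall>i\<le>j. primeideal (P i) A) \<and> (\<forall>i<j. P i \<subset> P (Suc i)) \<and> ann (length as - j) \<subseteq> P 0" if "j \<le> length as" for j
  using that
 proof (induction j)
  case 0
  have "\<one>\<^bsub>A\<^esub> \<notin> ann (length as)"
   using reg Nc(1)[of "length as"] by (auto simp: regular_sequence_def ann_def N_def)
  then have "\<exists>P. primeideal P A \<and> ann (length as) \<subseteq> P \<and> P \<inter> {\<one>\<^bsub>A\<^esub>} = {}"
   by (intro R.prime_ideal_avoiding[OF ann_ideal]) auto
  then obtain P where "primeideal P A" "ann (length as) \<subseteq> P" by blast
  then show ?case by (intro exI[of _ "\<lambda>_. P"]) simp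
 next
  case (Suc j)
  then obtain P where P: "\<forall>i\<le>j. primeideal (P i) A" "\<forall>i<j. P i \<subset> P (Suc i)" "ann (length as - j) \<subseteq> P 0" by auto
  have "Suc (length as - Suc j) = length as - j" using Suc by simp
  moreover have "length as - Suc j < length as" using Suc by simp
  ultimately have "\<exists>Q. primeideal Q A \<and> Q \<subset> P 0 \<and> ann (length as - Suc j) \<subseteq> Q"
   using step[of "length as - Suc j" "P 0"] P(1,3) by simp
  then obtain Q where "primeideal Q A" "Q \<subset> P 0" "ann (length as - Suc j) \<subseteq> Q" by blast
  then show ?case using P
   by (intro exI[of _ "case_nat Q P"]) (auto split: nat.split)
 qed
 from this[of "length as"] obtain P where P: "\<forall>i\<le>length as. primeideal (P i) A" "\<forall>i<length as. P i \<subset> P (Suc i)" "ann 0 \<subseteq> P 0"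
  by auto
 show ?thesis using that[of P] P by (auto simp: ann_def N_def)
qed

lemma depth_le_krull_dim:
 assumes "Module.module A M" "J \<subseteq> carrier A"
 shows "depth J M \<le> krull_dim A"
 unfolding depth_def
proof (rule Sup_least)
 fix e assume "e \<in> {enat (length as) |as. set as \<subseteq> J \<and> regular_sequence M as}"
 then obtain as where as: "e = enat (length as)" "set as \<subseteq> J" "regular_sequence M as" by blast
 have "set as \<subseteq> carrier A" using as(2) assms(2) by blast
 then have "\<exists>P. (\<forall>i\<le>length as. primeideal (P i) A) \<and> (\<forall>i<length as. P i \<subset> P (Suc i))"
  by (rule regular_sequence_prime_chain[OF assms(1) _ as(3)]) blast
 then show "e \<le> krull_dim A" unfolding krull_dim_def as(1) by (intro Sup_upper) blast
qed

section \<open>Localization of domains\<close>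

text \<open>The ring axioms are pulled back from an injective map that respects the operations, so
  that none has to be checked on classes of fractions.\<close>

lemma cring_via_injection:
 fixes L :: "('x, 'c) ring_scheme" and h :: "'x \<Rightarrow> 'f::comm_ring_1"
 assumes inj: "inj_on h (carrier L)"
  and add: "\<And>x y. x \<in> carrier L ==> y \<in> carrier L ==> x \<oplus>\<^bsub>L\<^esub> y \<in> carrier L \<and> h (x \<oplus>\<^bsub>L\<^esub> y) = h x + h y"
  and mult: "\<And>x y. x \<in> carrier L ==> y \<in> carrier L ==> x \<otimes>\<^bsub>L\<^esub> y \<in> carrier L \<and> h (x \<otimes>\<^bsub>L\<^esub> y) = h x * h y"
  and zero: "\<zero>\<^bsub>L\<^esub> \<in> carrier L" "h \<zero>\<^bsub>L\<^esub> = 0" and one: "\<one>\<^bsub>L\<^esub> \<in> carrier L" "h \<one>\<^bsub>L\<^esub> = 1"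
  and neg: "\<And>x. x \<in> carrier L ==> \<exists>y\<in>carrier L. h y = - h x"
 shows "cring L"
proof -
 have eqI: "x = y" if "h x = h y" "x \<in> carrier L" "y \<in> carrier L" for x y
  using inj_onD[OF inj] that by blast
 show ?thesis
 proof (rule cringI)
  show "abelian_group L"
  proof (rule abelian_groupI)
   fix x assume x: "x \<in> carrier L"
   then obtain y where y: "y \<in> carrier L" "h y = - h x" using neg by blast
   have "y \<oplus>\<^bsub>L\<^esub> x = \<zero>\<^bsub>L\<^esub>" by (rule eqI) (use add x y zero in simp_all)
   then show "\<exists>y\<in>carrier L. y \<oplus>\<^bsub>L\<^esub> x = \<zero>\<^bsub>L\<^esub>" using y by blast
  qed (use add zero in \<open>auto intro!: eqI\<close>)
  show "Group.comm_monoid L"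
   by (rule comm_monoidI) (use mult one in \<open>auto intro!: eqI\<close>)
 qed (use add mult in \<open>auto intro!: eqI simp: algebra_simps\<close>)
qed

lemma UN_const2:
 assumes "\<And>a s b t. (a, s) \<in> C ==> (b, t) \<in> D ==> f a s b t = E" "C \<noteq> {}" "D \<noteq> {}"
 shows "(\<Union>(a, s)\<in>C. \<Union>(b, t)\<in>D. f a s b t) = E"
proof -
 have "(\<Union>(a, s)\<in>C. \<Union>(b, t)\<in>D. f a s b t) = (\<Union>p\<in>C. \<Union>q\<in>D. E)"
  using assms(1) by (intro SUP_cong refl) (auto split: prod.splits)
 then show ?thesis using assms(2,3) by simp
qed

text \<open>With A embedded in a field by \<open>\<iota>\<close>, a class of fractions is determined
  by its quotient \<open>val\<close>, and the localization becomes a subring of the field. The total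
  quotient ring and the localizations at primes are both instances.\<close>

locale fraction_data =
 fixes A :: "('a, 'c) ring_scheme" and S :: "'a set" and \<iota> :: "'a \<Rightarrow> 'f::field"
 assumes cring_base: "cring A" and S_sub: "S \<subseteq> carrier A" and S_one: "\<one>\<^bsub>A\<^esub> \<in> S"
  and S_mult: "s \<in> S ==> t \<in> S ==> s \<otimes>\<^bsub>A\<^esub> t \<in> S" and S_zero: "\<zero>\<^bsub>A\<^esub> \<notin> S"
  and \<iota>_add: "a \<in> carrier A ==> b \<in> carrier A ==> \<iota> (a \<oplus>\<^bsub>A\<^esub> b) = \<iota> a + \<iota> b"
  and \<iota>_mult: "a \<in> carrier A ==> b \<in> carrier A ==> \<iota> (a \<otimes>\<^bsub>A\<^esub> b) = \<iota> a * \<iota> b"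
  and \<iota>_one: "\<iota> \<one>\<^bsub>A\<^esub> = 1" and \<iota>_eq_0: "a \<in> carrier A ==> \<iota> a = 0 \<longleftrightarrow> a = \<zero>\<^bsub>A\<^esub>"
begin

interpretation A: cring A by (rule cring_base)

abbreviation "L \<equiv> localization A S"
abbreviation "frc \<equiv> fraction A S"

definition val :: "('a \<times> 'a) set \<Rightarrow> 'f" where
 "val C = the_elem ((\<lambda>(a, s). \<iota> a / \<iota> s) ` C)"

lemma \<iota>_zero: "\<iota> \<zero>\<^bsub>A\<^esub> = 0" using \<iota>_eq_0 by simp

lemma \<iota>_neg: "a \<in> carrier A ==> \<iota> (\<ominus>\<^bsub>A\<^esub> a) = - \<iota> a"
 using \<iota>_add[of a "\<ominus>\<^bsub>A\<^esub> a"] by (simp add: A.r_neg \<iota>_zero eq_neg_iff_add_eq_0 add.commute)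

lemma \<iota>_inj: "a \<in> carrier A ==> b \<in> carrier A ==> \<iota> a = \<iota> b \<longleftrightarrow> a = b"
 using \<iota>_eq_0[of "a \<ominus>\<^bsub>A\<^esub> b"] \<iota>_add[of a "\<ominus>\<^bsub>A\<^esub> b"] \<iota>_neg[of b] A.r_right_minus_eq[of a b]
 by (auto simp: A.minus_eq)

lemma S_closed: "s \<in> S ==> s \<in> carrier A" using S_sub by blast
lemma \<iota>_S: "s \<in> S ==> \<iota> s \<noteq> 0" using \<iota>_eq_0 S_zero S_closed by metis

lemma mem_frac:
 assumes "a \<in> carrier A" "s \<in> S"
 shows "(b, t) \<in> frc a s \<longleftrightarrow> b \<in> carrier A \<and> t \<in> S \<and> \<iota> b / \<iota> t = \<iota> a / \<iota> s"
proof -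
 have "(\<exists>r\<in>S. r \<otimes>\<^bsub>A\<^esub> (a \<otimes>\<^bsub>A\<^esub> t) = r \<otimes>\<^bsub>A\<^esub> (b \<otimes>\<^bsub>A\<^esub> s)) \<longleftrightarrow> \<iota> b / \<iota> t = \<iota> a / \<iota> s"
  if bt: "b \<in> carrier A" "t \<in> S"
 proof -
  have "r \<otimes>\<^bsub>A\<^esub> (a \<otimes>\<^bsub>A\<^esub> t) = r \<otimes>\<^bsub>A\<^esub> (b \<otimes>\<^bsub>A\<^esub> s) \<longleftrightarrow> \<iota> b / \<iota> t = \<iota> a / \<iota> s" if r: "r \<in> S" for r
  proof -
   have "r \<otimes>\<^bsub>A\<^esub> (a \<otimes>\<^bsub>A\<^esub> t) = r \<otimes>\<^bsub>A\<^esub> (b \<otimes>\<^bsub>A\<^esub> s) \<longleftrightarrow> \<iota> (r \<otimes>\<^bsub>A\<^esub> (a \<otimes>\<^bsub>A\<^esub> t)) = \<iota> (r \<otimes>\<^bsub>A\<^esub> (b \<otimes>\<^bsub>A\<^esub> s))"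
    using assms bt r S_closed by (intro \<iota>_inj[symmetric]) auto
   also have "\<dots> \<longleftrightarrow> \<iota> b / \<iota> t = \<iota> a / \<iota> s"
    using assms bt r S_closed \<iota>_S by (auto simp: \<iota>_mult field_simps)
   finally show ?thesis .
  qed
  then show ?thesis using S_one by blast
 qed
 then show ?thesis using assms by (auto simp: fraction_def)
qed

lemma val_frac: "a \<in> carrier A ==> s \<in> S ==> val (frc a s) = \<iota> a / \<iota> s"
proof -
 assume as: "a \<in> carrier A" "s \<in> S"
 then have "(\<lambda>(a, s). \<iota> a / \<iota> s) ` frc a s = {\<iota> a / \<iota> s}"
  using mem_frac[OF as] by (auto simp: image_iff Bex_def)
 then show ?thesis by (simp add: val_def)
qed

lemma frac_eq_iff:
 assumes "a \<in> carrier A" "s \<in> S" "b \<in> carrier A" "t \<in> S"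
 shows "frc a s = frc b t \<longleftrightarrow> \<iota> a / \<iota> s = \<iota> b / \<iota> t"
proof
 assume "\<iota> a / \<iota> s = \<iota> b / \<iota> t"
 then have "p \<in> frc a s \<longleftrightarrow> p \<in> frc b t" for p by (cases p) (simp add: mem_frac assms)
 then show "frc a s = frc b t" by blast
qed (metis val_frac assms)

lemma carrier_L: "carrier L = {frc a s | a s. a \<in> carrier A \<and> s \<in> S}"
 by (auto simp: localization_def)

lemma inj_val: "inj_on val (carrier L)"
proof (rule inj_onI)
 fix x y assume "x \<in> carrier L" "y \<in> carrier L" and v: "val x = val y"
 then obtain a s b t where "x = frc a s" "y = frc b t" "a \<in> carrier A" "s \<in> S" "b \<in> carrier A" "t \<in> S"
  by (auto simp: carrier_L)
 then show "x = y" using v by (simp only: val_frac frac_eq_iff)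
qed

lemma frac_closed: "a \<in> carrier A ==> s \<in> S ==> frc a s \<in> carrier L" by (auto simp: carrier_L)

lemma L_mult:
 assumes "a \<in> carrier A" "s \<in> S" "b \<in> carrier A" "t \<in> S"
 shows "frc a s \<otimes>\<^bsub>L\<^esub> frc b t = frc (a \<otimes>\<^bsub>A\<^esub> b) (s \<otimes>\<^bsub>A\<^esub> t)"
proof -
 have fr: "\<iota> (a' \<otimes>\<^bsub>A\<^esub> b') / \<iota> (s' \<otimes>\<^bsub>A\<^esub> t') = (\<iota> a' / \<iota> s') * (\<iota> b' / \<iota> t')"
  if "a' \<in> carrier A" "s' \<in> S" "b' \<in> carrier A" "t' \<in> S" for a' s' b' t'
  using that S_closed by (simp add: \<iota>_mult)
 have "frc (a' \<otimes>\<^bsub>A\<^esub> b') (s' \<otimes>\<^bsub>A\<^esub> t') = frc (a \<otimes>\<^bsub>A\<^esub> b) (s \<otimes>\<^bsub>A\<^esub> t)"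
  if "(a', s') \<in> frc a s" "(b', t') \<in> frc b t" for a' s' b' t'
 proof -
  have m: "a' \<in> carrier A" "s' \<in> S" "\<iota> a' / \<iota> s' = \<iota> a / \<iota> s" "b' \<in> carrier A" "t' \<in> S" "\<iota> b' / \<iota> t' = \<iota> b / \<iota> t"
   using that mem_frac assms by blast+
  then have "\<iota> (a' \<otimes>\<^bsub>A\<^esub> b') / \<iota> (s' \<otimes>\<^bsub>A\<^esub> t') = \<iota> (a \<otimes>\<^bsub>A\<^esub> b) / \<iota> (s \<otimes>\<^bsub>A\<^esub> t)"
   using fr[OF m(1,2,4,5)] fr[OF assms] by simp
  then show ?thesis using m assms S_mult by (subst frac_eq_iff) auto
 qed
 moreover have "(a, s) \<in> frc a s" "(b, t) \<in> frc b t" using mem_frac assms by auto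
 ultimately have "(\<Union>(a', s')\<in>frc a s. \<Union>(b', t')\<in>frc b t. frc (a' \<otimes>\<^bsub>A\<^esub> b') (s' \<otimes>\<^bsub>A\<^esub> t')) = frc (a \<otimes>\<^bsub>A\<^esub> b) (s \<otimes>\<^bsub>A\<^esub> t)"
  by (intro UN_const2) blast+
 then show ?thesis by (simp add: localization_def)
qed

lemma L_add:
 assumes "a \<in> carrier A" "s \<in> S" "b \<in> carrier A" "t \<in> S"
 shows "frc a s \<oplus>\<^bsub>L\<^esub> frc b t = frc (a \<otimes>\<^bsub>A\<^esub> t \<oplus>\<^bsub>A\<^esub> b \<otimes>\<^bsub>A\<^esub> s) (s \<otimes>\<^bsub>A\<^esub> t)"
proof -
 have fr: "\<iota> (a' \<otimes>\<^bsub>A\<^esub> t' \<oplus>\<^bsub>A\<^esub> b' \<otimes>\<^bsub>A\<^esub> s') / \<iota> (s' \<otimes>\<^bsub>A\<^esub> t') = \<iota> a' / \<iota> s' + \<iota> b' / \<iota> t'"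
  if "a' \<in> carrier A" "s' \<in> S" "b' \<in> carrier A" "t' \<in> S" for a' s' b' t'
  using that S_closed \<iota>_S by (simp add: \<iota>_mult \<iota>_add field_simps)
 have "frc (a' \<otimes>\<^bsub>A\<^esub> t' \<oplus>\<^bsub>A\<^esub> b' \<otimes>\<^bsub>A\<^esub> s') (s' \<otimes>\<^bsub>A\<^esub> t') = frc (a \<otimes>\<^bsub>A\<^esub> t \<oplus>\<^bsub>A\<^esub> b \<otimes>\<^bsub>A\<^esub> s) (s \<otimes>\<^bsub>A\<^esub> t)"
  if "(a', s') \<in> frc a s" "(b', t') \<in> frc b t" for a' s' b' t'
 proof -
  have m: "a' \<in> carrier A" "s' \<in> S" "\<iota> a' / \<iota> s' = \<iota> a / \<iota> s" "b' \<in> carrier A" "t' \<in> S" "\<iota> b' / \<iota> t' = \<iota> b / \<iota> t"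
   using that mem_frac assms by blast+
  then have "\<iota> (a' \<otimes>\<^bsub>A\<^esub> t' \<oplus>\<^bsub>A\<^esub> b' \<otimes>\<^bsub>A\<^esub> s') / \<iota> (s' \<otimes>\<^bsub>A\<^esub> t') = \<iota> (a \<otimes>\<^bsub>A\<^esub> t \<oplus>\<^bsub>A\<^esub> b \<otimes>\<^bsub>A\<^esub> s) / \<iota> (s \<otimes>\<^bsub>A\<^esub> t)"
   using fr[OF m(1,2,4,5)] fr[OF assms] by simp
  then show ?thesis using m assms S_mult S_closed by (subst frac_eq_iff) auto
 qed
 moreover have "(a, s) \<in> frc a s" "(b, t) \<in> frc b t" using mem_frac assms by auto
 ultimately have "(\<Union>(a', s')\<in>frc a s. \<Union>(b', t')\<in>frc b t. frc (a' \<otimes>\<^bsub>A\<^esub> t' \<oplus>\<^bsub>A\<^esub> b' \<otimes>\<^bsub>A\<^esub> s') (s' \<otimes>\<^bsub>A\<^esub> t')) = frc (a \<otimes>\<^bsub>A\<^esub> t \<oplus>\<^bsub>A\<^esub> b \<otimes>\<^bsub>A\<^esub> s) (s \<otimes>\<^bsub>A\<^esub> t)"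
  by (intro UN_const2) blast+
 then show ?thesis by (simp add: localization_def)
qed

lemma val_hom:
 "x \<in> carrier L ==> y \<in> carrier L ==> x \<oplus>\<^bsub>L\<^esub> y \<in> carrier L \<and> val (x \<oplus>\<^bsub>L\<^esub> y) = val x + val y"
 "x \<in> carrier L ==> y \<in> carrier L ==> x \<otimes>\<^bsub>L\<^esub> y \<in> carrier L \<and> val (x \<otimes>\<^bsub>L\<^esub> y) = val x * val y"
 "\<zero>\<^bsub>L\<^esub> \<in> carrier L \<and> val \<zero>\<^bsub>L\<^esub> = 0" "\<one>\<^bsub>L\<^esub> \<in> carrier L \<and> val \<one>\<^bsub>L\<^esub> = 1"
proof -
 assume "x \<in> carrier L" "y \<in> carrier L"
 then obtain a s b t where xy: "x = frc a s" "y = frc b t" and m: "a \<in> carrier A" "s \<in> S" "b \<in> carrier A" "t \<in> S"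
  by (auto simp: carrier_L)
 show "x \<oplus>\<^bsub>L\<^esub> y \<in> carrier L \<and> val (x \<oplus>\<^bsub>L\<^esub> y) = val x + val y"
  using m S_closed S_mult \<iota>_S unfolding xy L_add[OF m]
  by (intro conjI frac_closed) (auto simp: val_frac \<iota>_mult \<iota>_add field_simps)
 show "x \<otimes>\<^bsub>L\<^esub> y \<in> carrier L \<and> val (x \<otimes>\<^bsub>L\<^esub> y) = val x * val y"
  using m S_closed S_mult \<iota>_S unfolding xy L_mult[OF m]
  by (intro conjI frac_closed) (auto simp: val_frac \<iota>_mult)
next
 have "\<zero>\<^bsub>L\<^esub> = frc \<zero>\<^bsub>A\<^esub> \<one>\<^bsub>A\<^esub>" "\<one>\<^bsub>L\<^esub> = frc \<one>\<^bsub>A\<^esub> \<one>\<^bsub>A\<^esub>" by (simp_all add: localization_def)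
 then show "\<zero>\<^bsub>L\<^esub> \<in> carrier L \<and> val \<zero>\<^bsub>L\<^esub> = 0" "\<one>\<^bsub>L\<^esub> \<in> carrier L \<and> val \<one>\<^bsub>L\<^esub> = 1"
  using S_one frac_closed by (auto simp: val_frac \<iota>_zero \<iota>_one)
qed

lemma cring_L: "cring L"
proof (rule cring_via_injection[OF inj_val])
 fix x assume "x \<in> carrier L"
 then obtain a s where x: "x = frc a s" "a \<in> carrier A" "s \<in> S" by (auto simp: carrier_L)
 then have "frc (\<ominus>\<^bsub>A\<^esub> a) s \<in> carrier L" "val (frc (\<ominus>\<^bsub>A\<^esub> a) s) = - val x"
  by (auto simp: val_frac \<iota>_neg frac_closed)
 then show "\<exists>y\<in>carrier L. val y = - val x" by blast
qed (use val_hom in auto)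

lemma to_loc_hom: "to_localization A S \<in> ring_hom A L"
proof (rule ring_hom_memI)
 fix x y assume xy: "x \<in> carrier A" "y \<in> carrier A"
 show "to_localization A S x \<in> carrier L" using xy frac_closed S_one by (simp add: to_localization_def)
 show "to_localization A S (x \<otimes>\<^bsub>A\<^esub> y) = to_localization A S x \<otimes>\<^bsub>L\<^esub> to_localization A S y"
  using xy S_one by (simp add: to_localization_def L_mult)
 show "to_localization A S (x \<oplus>\<^bsub>A\<^esub> y) = to_localization A S x \<oplus>\<^bsub>L\<^esub> to_localization A S y"
  using xy S_one by (simp add: to_localization_def L_add)
qed (simp add: to_localization_def localization_def)

lemma val_to_loc: "a \<in> carrier A ==> val (to_localization A S a) = \<iota> a"
 using S_one by (simp add: to_localization_def val_frac \<iota>_one)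

end

locale fraction_module = fraction_data A S \<iota>
 for A :: "('a, 'c) ring_scheme" and S and \<iota> :: "'a \<Rightarrow> 'f::field" +
 fixes M :: "('a, 'm) module"
 assumes module_base: "Module.module A M"
begin

sublocale base_change_data "to_localization A S" A L M
 by (intro base_change_data.intro cring_base cring_L to_loc_hom module_base)

definition linear :: "('m \<Rightarrow> 'f) \<Rightarrow> bool" where
 "linear \<phi> \<longleftrightarrow> (\<forall>x\<in>carrier M. \<forall>y\<in>carrier M. \<phi> (x \<oplus>\<^bsub>M\<^esub> y) = \<phi> x + \<phi> y) \<and>
   (\<forall>a\<in>carrier A. \<forall>x\<in>carrier M. \<phi> (a \<odot>\<^bsub>M\<^esub> x) = \<iota> a * \<phi> x)"

definition N :: "(('a \<times> 'a) set, 'f) module" where "N = restrict_scalars val ring_of_type_algebra"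

definition extend :: "('m \<Rightarrow> 'f) \<Rightarrow> _ \<Rightarrow> 'f" where
 "extend \<phi> = tensor_lift N (\<lambda>(b, x). val b * \<phi> x)"

lemma N_simps [simp]: "carrier N = UNIV" "x \<oplus>\<^bsub>N\<^esub> y = x + y" "b \<odot>\<^bsub>N\<^esub> x = val b * x" "\<zero>\<^bsub>N\<^esub> = 0"
 by (simp_all add: N_def restrict_scalars_def)

lemma module_N: "Module.module L N"
proof (rule moduleI[OF cring_L])
 show "abelian_group N" by (rule abelian_groupI) (auto intro: exI[of _ "- _"] simp: algebra_simps)
qed (use val_hom in \<open>auto simp: algebra_simps\<close>)

lemma extend_props:
 assumes "linear \<phi>"
 shows "b \<in> carrier L ==> x \<in> carrier M ==> extend \<phi> (pt b x) = val b * \<phi> x"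
  "s \<in> carrier T ==> t \<in> carrier T ==> extend \<phi> (s \<oplus>\<^bsub>T\<^esub> t) = extend \<phi> s + extend \<phi> t"
  "b \<in> carrier L ==> t \<in> carrier T ==> extend \<phi> (b \<odot>\<^bsub>T\<^esub> t) = val b * extend \<phi> t"
proof -
 have bal: "balanced N (\<lambda>(b, x). val b * \<phi> x)"
  using assms val_hom ring_hom_closed[OF to_loc_hom]
  by (auto simp: balanced_def linear_def algebra_simps val_to_loc)
 note ab = module.axioms(2)[OF module_N]
 show "b \<in> carrier L ==> x \<in> carrier M ==> extend \<phi> (pt b x) = val b * \<phi> x"
  using tensor_lift_pure[OF ab bal] by (simp add: extend_def)
 show "s \<in> carrier T ==> t \<in> carrier T ==> extend \<phi> (s \<oplus>\<^bsub>T\<^esub> t) = extend \<phi> s + extend \<phi> t"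
  using tensor_lift_add[OF ab bal] by (simp add: extend_def)
 show "b \<in> carrier L ==> t \<in> carrier T ==> extend \<phi> (b \<odot>\<^bsub>T\<^esub> t) = val b * extend \<phi> t"
  using tensor_lift_smult[OF module_N bal, of t b] val_hom(2) by (simp add: extend_def mult.assoc)
qed

lemma L_eqI: "val x = val y ==> x \<in> carrier L ==> y \<in> carrier L ==> x = y"
 using inj_val by (auto simp: inj_on_def)

lemma pt_frac:
 assumes "a \<in> carrier A" "s \<in> S" "x \<in> carrier M"
 shows "pt (frc a s) x = pt (frc \<one>\<^bsub>A\<^esub> s) (a \<odot>\<^bsub>M\<^esub> x)"
proof -
 have "frc \<one>\<^bsub>A\<^esub> s \<otimes>\<^bsub>L\<^esub> to_localization A S a = frc a s"
  using assms S_one S_closed by (simp add: to_localization_def L_mult)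
 then show ?thesis using pt_balanced[of a "frc \<one>\<^bsub>A\<^esub> s" x] assms frac_closed by simp
qed

lemma pt_common:
 assumes "s \<in> S" "t \<in> S" "x \<in> carrier M"
 shows "pt (frc \<one>\<^bsub>A\<^esub> s) x = pt (frc \<one>\<^bsub>A\<^esub> (s \<otimes>\<^bsub>A\<^esub> t)) (t \<odot>\<^bsub>M\<^esub> x)"
proof -
 have "frc \<one>\<^bsub>A\<^esub> s = frc t (s \<otimes>\<^bsub>A\<^esub> t)"
  using assms S_mult S_closed \<iota>_S by (subst frac_eq_iff) (auto simp: \<iota>_one \<iota>_mult)
 then show ?thesis using pt_frac[of t "s \<otimes>\<^bsub>A\<^esub> t" x] assms S_mult S_closed by simp
qed

text \<open>Common denominators: a sum of two such tensors is brought over the product of the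
  denominators by \<open>pt_common\<close>.\<close>

lemma T_elements:
 assumes "t \<in> carrier T"
 shows "\<exists>s\<in>S. \<exists>x\<in>carrier M. t = pt (frc \<one>\<^bsub>A\<^esub> s) x"
 using assms
proof (induction t rule: T_induct)
 case (pure b x)
 then obtain a s where "b = frc a s" "a \<in> carrier A" "s \<in> S" by (auto simp: carrier_L)
 then show ?case using pt_frac[of a s x] pure by (auto intro!: bexI[of _ s] bexI[of _ "a \<odot>\<^bsub>M\<^esub> x"])
next
 case (add u v)
 then obtain s x t y where 1: "s \<in> S" "x \<in> carrier M" "u = pt (frc \<one>\<^bsub>A\<^esub> s) x" "t \<in> S" "y \<in> carrier M" "v = pt (frc \<one>\<^bsub>A\<^esub> t) y"
  by metis
 have "v = pt (frc \<one>\<^bsub>A\<^esub> (s \<otimes>\<^bsub>A\<^esub> t)) (s \<odot>\<^bsub>M\<^esub> y)"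
  using pt_common[of t s y] 1 S_closed by (simp add: A.m_comm)
 moreover have "u = pt (frc \<one>\<^bsub>A\<^esub> (s \<otimes>\<^bsub>A\<^esub> t)) (t \<odot>\<^bsub>M\<^esub> x)" using pt_common[of s t x] 1 by simp
 ultimately have "u \<oplus>\<^bsub>T\<^esub> v = pt (frc \<one>\<^bsub>A\<^esub> (s \<otimes>\<^bsub>A\<^esub> t)) (t \<odot>\<^bsub>M\<^esub> x \<oplus>\<^bsub>M\<^esub> s \<odot>\<^bsub>M\<^esub> y)"
  using pt_add_right[of "frc \<one>\<^bsub>A\<^esub> (s \<otimes>\<^bsub>A\<^esub> t)" "t \<odot>\<^bsub>M\<^esub> x" "s \<odot>\<^bsub>M\<^esub> y"] 1 S_mult S_closed frac_closed by simp
 then show ?case using 1 S_mult S_closed by (intro bexI[of _ "s \<otimes>\<^bsub>A\<^esub> t"] bexI[of _ "t \<odot>\<^bsub>M\<^esub> x \<oplus>\<^bsub>M\<^esub> s \<odot>\<^bsub>M\<^esub> y"]) auto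
qed

lemma extend_inj:
 assumes lin: "linear \<phi>" and inj: "inj_on \<phi> (carrier M)"
 shows "inj_on (extend \<phi>) (carrier T)"
proof (rule inj_onI)
 fix u v assume uv: "u \<in> carrier T" "v \<in> carrier T" "extend \<phi> u = extend \<phi> v"
 obtain s x t y where 1: "s \<in> S" "x \<in> carrier M" "u = pt (frc \<one>\<^bsub>A\<^esub> s) x" "t \<in> S" "y \<in> carrier M" "v = pt (frc \<one>\<^bsub>A\<^esub> t) y"
  using T_elements uv by metis
 have "\<phi> x / \<iota> s = \<phi> y / \<iota> t"
  using uv(3) extend_props(1)[OF lin] 1 frac_closed by (simp add: val_frac \<iota>_one)
 then have "\<phi> (t \<odot>\<^bsub>M\<^esub> x) = \<phi> (s \<odot>\<^bsub>M\<^esub> y)"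
  using lin 1 S_closed \<iota>_S by (simp add: linear_def field_simps)
 then have "t \<odot>\<^bsub>M\<^esub> x = s \<odot>\<^bsub>M\<^esub> y" using inj 1 S_closed by (auto simp: inj_on_def)
 then show "u = v" using pt_common[of s t x] pt_common[of t s y] 1 S_closed by (simp add: A.m_comm)
qed

lemma finsum_T_single:
 assumes "t \<in> carrier T" "c t \<in> carrier L"
 shows "(\<Oplus>\<^bsub>T\<^esub>b\<in>{t}. c b \<odot>\<^bsub>T\<^esub> b) = c t \<odot>\<^bsub>T\<^esub> t"
 using assms by (subst T.finsum_insert) auto

text \<open>The assumption \<open>gen\<close> says that g generates after inverting S, and the
  functional \<open>\<phi>\<close>, nonzero at g, separates the multiples of g.\<close>

lemma free_of_rank_1I:
 assumes g: "g \<in> carrier M" and lin: "linear \<phi>" and ng: "\<phi> g \<noteq> 0"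
  and gen: "\<And>x. x \<in> carrier M ==> \<exists>t\<in>S. \<exists>a\<in>carrier A. t \<odot>\<^bsub>M\<^esub> x = a \<odot>\<^bsub>M\<^esub> g"
 shows "free_of_rank L T 1"
proof -
 define e where "e = pt \<one>\<^bsub>L\<^esub> g"
 have e: "e \<in> carrier T" using g val_hom(4) by (simp add: e_def)
 have sm: "b \<odot>\<^bsub>T\<^esub> e = pt b g" if "b \<in> carrier L" for b using that by (simp add: e_def pt_smult)
 have ex: "\<exists>b\<in>carrier L. t = b \<odot>\<^bsub>T\<^esub> e" if "t \<in> carrier T" for t
 proof -
  obtain s x where sx: "s \<in> S" "x \<in> carrier M" "t = pt (frc \<one>\<^bsub>A\<^esub> s) x" using T_elements[OF \<open>t \<in> carrier T\<close>] by blast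
  obtain r a where ra: "r \<in> S" "a \<in> carrier A" "r \<odot>\<^bsub>M\<^esub> x = a \<odot>\<^bsub>M\<^esub> g" using gen sx by blast
  have "t = pt (frc a (s \<otimes>\<^bsub>A\<^esub> r)) g"
   using pt_common[of s r x] pt_frac[of a "s \<otimes>\<^bsub>A\<^esub> r" g] sx ra S_mult g by simp
  then show ?thesis using sm frac_closed[of a "s \<otimes>\<^bsub>A\<^esub> r"] sx ra S_mult by metis
 qed
 have un: "b = b'" if "b \<in> carrier L" "b' \<in> carrier L" "b \<odot>\<^bsub>T\<^esub> e = b' \<odot>\<^bsub>T\<^esub> e" for b b'
 proof (rule L_eqI)
  have "val b * \<phi> g = val b' * \<phi> g" using that sm extend_props(1)[OF lin _ g] by metis
  then show "val b = val b'" using ng by simp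
 qed (use that in auto)
 have "basis L T {e}"
  unfolding basis_def
 proof (intro conjI ballI)
  fix t assume t: "t \<in> carrier T"
  then obtain b where b: "b \<in> carrier L" "t = b \<odot>\<^bsub>T\<^esub> e" using ex by blast
  show "\<exists>!c. c \<in> {e} \<rightarrow>\<^sub>E carrier L \<and> t = (\<Oplus>\<^bsub>T\<^esub>b\<in>{e}. c b \<odot>\<^bsub>T\<^esub> b)"
  proof (rule ex1I[of _ "\<lambda>x\<in>{e}. b"])
   show "(\<lambda>x\<in>{e}. b) \<in> {e} \<rightarrow>\<^sub>E carrier L \<and> t = (\<Oplus>\<^bsub>T\<^esub>x\<in>{e}. (\<lambda>x\<in>{e}. b) x \<odot>\<^bsub>T\<^esub> x)"
    using b finsum_T_single[OF e, of "\<lambda>x\<in>{e}. b"] by auto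
   fix c assume c: "c \<in> {e} \<rightarrow>\<^sub>E carrier L \<and> t = (\<Oplus>\<^bsub>T\<^esub>b\<in>{e}. c b \<odot>\<^bsub>T\<^esub> b)"
   then have ce: "c e \<in> carrier L" by auto
   have "b = c e" using un[OF b(1) ce] c finsum_T_single[where c = c, OF e ce] b by simp
   then show "c = (\<lambda>x\<in>{e}. b)" using c by (auto simp: PiE_def extensional_def restrict_def fun_eq_iff)
  qed
 qed (use e in auto)
 then show ?thesis unfolding free_of_rank_def by (intro exI[of _ "{e}"]) simp
qed

lemma basis_1D:
 assumes "free_of_rank L T 1"
 obtains e where "e \<in> carrier T" "\<And>t. t \<in> carrier T ==> \<exists>b\<in>carrier L. t = b \<odot>\<^bsub>T\<^esub> e"
proof -
 obtain B where "basis L T B" "card B = 1" using assms by (auto simp: free_of_rank_def)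
 then obtain e where e: "basis L T {e}" using card_1_singletonE by metis
 then have eT: "e \<in> carrier T" by (auto simp: basis_def)
 have "\<exists>b\<in>carrier L. t = b \<odot>\<^bsub>T\<^esub> e" if "t \<in> carrier T" for t
 proof -
  have "\<exists>!c. c \<in> {e} \<rightarrow>\<^sub>E carrier L \<and> t = (\<Oplus>\<^bsub>T\<^esub>b\<in>{e}. c b \<odot>\<^bsub>T\<^esub> b)"
   using e[unfolded basis_def, THEN conjunct2, THEN conjunct2, rule_format, OF \<open>t \<in> carrier T\<close>] .
  then obtain c where "c \<in> {e} \<rightarrow>\<^sub>E carrier L" "t = (\<Oplus>\<^bsub>T\<^esub>b\<in>{e}. c b \<odot>\<^bsub>T\<^esub> b)"
   by (elim ex1E conjE)
  then show ?thesis using finsum_T_single[OF eT, of c] by auto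
 qed
 then show ?thesis using that[OF eT] by blast
qed

text \<open>With respect to a basis element e every functional is its value at e times the
  coordinate. Since \<open>\<phi>\<close> is nonzero at y, its value at e is nonzero; so
  \<open>\<phi> x = 0\<close> makes the coordinate of x vanish, and with it every other functional
  at x.\<close>

lemma rank_1_kernel:
 assumes free: "free_of_rank L T 1" and lin: "linear \<phi>" "linear \<psi>"
  and x: "x \<in> carrier M" "\<phi> x = 0" and y: "y \<in> carrier M" "\<phi> y \<noteq> 0"
 shows "\<psi> x = 0"
proof -
 obtain e where e: "e \<in> carrier T" "\<And>t. t \<in> carrier T ==> \<exists>b\<in>carrier L. t = b \<odot>\<^bsub>T\<^esub> e" using basis_1D[OF free] by blast
 have one: "\<one>\<^bsub>L\<^esub> \<in> carrier L" "val \<one>\<^bsub>L\<^esub> = 1" using val_hom(4) by auto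
 obtain b where b: "b \<in> carrier L" "pt \<one>\<^bsub>L\<^esub> x = b \<odot>\<^bsub>T\<^esub> e" using e(2)[OF pt_closed[OF one(1) x(1)]] by blast
 obtain c where c: "c \<in> carrier L" "pt \<one>\<^bsub>L\<^esub> y = c \<odot>\<^bsub>T\<^esub> e" using e(2)[OF pt_closed[OF one(1) y(1)]] by blast
 have "val b * extend \<phi> e = \<phi> x"
  using extend_props(3)[OF lin(1) b(1) e(1)] extend_props(1)[OF lin(1) one(1) x(1)] b one by simp
 moreover have "val c * extend \<phi> e = \<phi> y"
  using extend_props(3)[OF lin(1) c(1) e(1)] extend_props(1)[OF lin(1) one(1) y(1)] c one by simp
 ultimately have "val b = 0" using x y by auto
 moreover have "val b * extend \<psi> e = \<psi> x"
  using extend_props(3)[OF lin(2) b(1) e(1)] extend_props(1)[OF lin(2) one(1) x(1)] b one by simp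
 ultimately show ?thesis by simp
qed

text \<open>In a free module any two distinct elements of a basis are independent, so a module which embeds
 into a field can only be free of rank zero or one.\<close>

lemma free_imp_rank_le_1:
 assumes free: "free_of_rank L T n" and lin: "linear \<phi>" and inj: "inj_on \<phi> (carrier M)"
  and dep: "\<And>x y. x \<in> carrier M ==> y \<in> carrier M ==> \<phi> x \<noteq> 0 ==> \<exists>a\<in>carrier A. \<exists>b\<in>carrier A. \<iota> a * \<phi> x = \<iota> b * \<phi> y \<and> \<iota> b \<noteq> 0"
 shows "n \<le> 1"
proof (rule ccontr)
 assume "\<not> n \<le> 1"
 obtain B where B: "basis L T B" "card B = n" using free by (auto simp: free_of_rank_def)
 then have fin: "finite B" and sub: "B \<subseteq> carrier T" by (auto simp: basis_def)
 have uniq: "c = c'" if "c \<in> B \<rightarrow>\<^sub>E carrier L" "c' \<in> B \<rightarrow>\<^sub>E carrier L"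
  "(\<Oplus>\<^bsub>T\<^esub>b\<in>B. c b \<odot>\<^bsub>T\<^esub> b) = (\<Oplus>\<^bsub>T\<^esub>b\<in>B. c' b \<odot>\<^bsub>T\<^esub> b)" for c c'
 proof -
  have "(\<Oplus>\<^bsub>T\<^esub>b\<in>B. c b \<odot>\<^bsub>T\<^esub> b) \<in> carrier T" using that sub by (intro T.finsum_closed) auto
  then have "\<exists>!d. d \<in> B \<rightarrow>\<^sub>E carrier L \<and> (\<Oplus>\<^bsub>T\<^esub>b\<in>B. c b \<odot>\<^bsub>T\<^esub> b) = (\<Oplus>\<^bsub>T\<^esub>b\<in>B. d b \<odot>\<^bsub>T\<^esub> b)"
   using B by (auto simp: basis_def)
  then show ?thesis using that by blast
 qed
 define un where "un e b = (\<lambda>x\<in>B. if x = e then b else \<zero>\<^bsub>L\<^esub>)" for e b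
 have zL: "\<zero>\<^bsub>L\<^esub> \<in> carrier L" using val_hom(3) by blast
 have un_sum: "(\<Oplus>\<^bsub>T\<^esub>x\<in>B. un e b x \<odot>\<^bsub>T\<^esub> x) = b \<odot>\<^bsub>T\<^esub> e" if "e \<in> B" "b \<in> carrier L" for e b
 proof -
  have "(\<Oplus>\<^bsub>T\<^esub>x\<in>B. un e b x \<odot>\<^bsub>T\<^esub> x) = (\<Oplus>\<^bsub>T\<^esub>x\<in>B. if e = x then b \<odot>\<^bsub>T\<^esub> x else \<zero>\<^bsub>T\<^esub>)"
   using sub that by (intro T.finsum_cong') (auto simp: un_def)
  also have "\<dots> = b \<odot>\<^bsub>T\<^esub> e" using that sub fin by (intro T.add.finprod_singleton) auto
  finally show ?thesis .
 qed
 have un_mem: "un e b \<in> B \<rightarrow>\<^sub>E carrier L" if "b \<in> carrier L" for e b using that zL by (auto simp: un_def)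
 have un_eq: "un e b = un e' b'" if "e \<in> B" "e' \<in> B" "b \<in> carrier L" "b' \<in> carrier L" "b \<odot>\<^bsub>T\<^esub> e = b' \<odot>\<^bsub>T\<^esub> e'" for e e' b b'
  by (rule uniq[OF un_mem[OF that(3)] un_mem[OF that(4)]]) (simp only: un_sum[OF that(1,3)] un_sum[OF that(2,4)] that(5))
 obtain e where "e \<in> B" using \<open>\<not> n \<le> 1\<close> B by fastforce
 obtain e' where "e' \<in> B" "e' \<noteq> e"
 proof -
  have "card (B - {e}) \<noteq> 0" using \<open>\<not> n \<le> 1\<close> B fin \<open>e \<in> B\<close> by simp
  then have "B - {e} \<noteq> {}" by fastforce
  then show ?thesis using that by blast
 qed
 have eT: "e \<in> carrier T" "e' \<in> carrier T" using sub \<open>e \<in> B\<close> \<open>e' \<in> B\<close> by auto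
 have one: "\<one>\<^bsub>L\<^esub> \<in> carrier L" "val \<one>\<^bsub>L\<^esub> = 1" using val_hom(4) by auto
 have nz: "extend \<phi> e \<noteq> 0"
 proof
  assume a: "extend \<phi> e = 0"
  have "extend \<phi> (\<one>\<^bsub>L\<^esub> \<odot>\<^bsub>T\<^esub> e) = extend \<phi> (\<zero>\<^bsub>L\<^esub> \<odot>\<^bsub>T\<^esub> e)"
   unfolding extend_props(3)[OF lin one(1) eT(1)] extend_props(3)[OF lin zL eT(1)] using a by simp
  then have "\<one>\<^bsub>L\<^esub> \<odot>\<^bsub>T\<^esub> e = \<zero>\<^bsub>L\<^esub> \<odot>\<^bsub>T\<^esub> e" using extend_inj[OF lin inj] one zL eT by (auto simp: inj_on_def)
  then have "un e \<one>\<^bsub>L\<^esub> = un e \<zero>\<^bsub>L\<^esub>" by (rule un_eq[OF \<open>e \<in> B\<close> \<open>e \<in> B\<close> one(1) zL])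
  then have "un e \<one>\<^bsub>L\<^esub> e = un e \<zero>\<^bsub>L\<^esub> e" by simp
  then have "\<one>\<^bsub>L\<^esub> = \<zero>\<^bsub>L\<^esub>" using \<open>e \<in> B\<close> by (simp add: un_def)
  then show False using one val_hom(3) by auto
 qed
 obtain s x t y where 1: "s \<in> S" "x \<in> carrier M" "e = pt (frc \<one>\<^bsub>A\<^esub> s) x" "t \<in> S" "y \<in> carrier M" "e' = pt (frc \<one>\<^bsub>A\<^esub> t) y"
  using T_elements eT by metis
 have ex: "extend \<phi> e = \<phi> x / \<iota> s" "extend \<phi> e' = \<phi> y / \<iota> t"
  using 1 extend_props(1)[OF lin] frac_closed by (auto simp: val_frac \<iota>_one)
 then obtain a b where ab: "a \<in> carrier A" "b \<in> carrier A" "\<iota> a * \<phi> x = \<iota> b * \<phi> y" "\<iota> b \<noteq> 0"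
  using dep[of x y] 1 nz by auto
 \<comment> \<open>Clearing the denominators s and t turns the relation between x and y into an
   equality between a multiple of e and a nonzero multiple of e'.\<close>
 define c d where "c = frc (a \<otimes>\<^bsub>A\<^esub> s) \<one>\<^bsub>A\<^esub>" and "d = frc (b \<otimes>\<^bsub>A\<^esub> t) \<one>\<^bsub>A\<^esub>"
 have cd: "c \<in> carrier L" "d \<in> carrier L" "val c = \<iota> a * \<iota> s" "val d = \<iota> b * \<iota> t"
  using ab 1 S_one S_closed frac_closed by (auto simp: c_def d_def val_frac \<iota>_mult \<iota>_one)
 have "extend \<phi> (c \<odot>\<^bsub>T\<^esub> e) = extend \<phi> (d \<odot>\<^bsub>T\<^esub> e')"
  using extend_props(3)[OF lin] cd eT ex ab 1 \<iota>_S by simp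
 then have "c \<odot>\<^bsub>T\<^esub> e = d \<odot>\<^bsub>T\<^esub> e'" using extend_inj[OF lin inj] cd eT by (auto simp: inj_on_def)
 then have "un e c = un e' d" by (rule un_eq[OF \<open>e \<in> B\<close> \<open>e' \<in> B\<close> cd(1,2)])
 then have "un e c e' = un e' d e'" by simp
 then have "d = \<zero>\<^bsub>L\<^esub>" using \<open>e' \<in> B\<close> \<open>e' \<noteq> e\<close> by (simp add: un_def)
 then show False using cd ab 1 \<iota>_S val_hom(3) by auto
qed

end

section \<open>Prime ideals of A\<close>

definition prime_sub :: "'k::field fps fps set \<Rightarrow> bool" where
 "prime_sub P \<longleftrightarrow> P \<subseteq> Asub \<and> 0 \<in> P \<and> 1 \<notin> P \<and> (\<forall>a\<in>P. \<forall>b\<in>P. a + b \<in> P) \<and>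
   (\<forall>a\<in>Asub. \<forall>p\<in>P. a * p \<in> P) \<and> (\<forall>a\<in>Asub. \<forall>b\<in>Asub. a * b \<in> P \<longrightarrow> a \<in> P \<or> b \<in> P)"

definition max_A :: "'k::field fps fps set" where "max_A = {a \<in> Asub. a $ 0 $ 0 = 0}"
definition cond_A :: "'k::field fps fps set" where "cond_A = range ((*) xx)"

lemma prime_subD:
 assumes "prime_sub P"
 shows "P \<subseteq> Asub" "0 \<in> P" "1 \<notin> P" "a \<in> P ==> b \<in> P ==> a + b \<in> P" "r \<in> Asub ==> a \<in> P ==> r * a \<in> P"
  "r \<in> Asub ==> s \<in> Asub ==> r * s \<in> P ==> r \<in> P \<or> s \<in> P"
  "a \<in> P ==> b \<in> P ==> a - b \<in> P"
proof -
 show "a \<in> P ==> b \<in> P ==> a - b \<in> P"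
  using assms Asub_closed(5)[OF Asub_closed(2)] unfolding prime_sub_def
  by (metis mult_minus1 add_uminus_conv_diff)
qed (use assms in \<open>auto simp: prime_sub_def\<close>)

lemma prime_sub_power: "prime_sub P ==> r \<in> Asub ==> r ^ n \<in> P ==> r \<in> P"
proof (induction n)
 case (Suc n)
 then show ?case using prime_subD(6)[OF Suc(2,3), of "r ^ n"] Asub_closed(7) by auto
qed (use prime_subD(3) in auto)

lemma Asub_unit:
 assumes "a \<in> Asub" "a $ 0 $ 0 \<noteq> 0"
 shows "\<exists>b\<in>Asub. a * b = 1"
proof -
 obtain b where b: "a * b = 1" using R_unit_ex[OF assms(2)] by blast
 have "res_u a * res_u b = 1" "res_v a * res_v b = 1"
  using arg_cong[OF b, of res_u] arg_cong[OF b, of res_v] by simp_all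
 moreover have "res_u a = res_v a" using assms by (simp add: Asub_def)
 ultimately have "res_v a * res_u b = res_v a * res_v b" "res_v a \<noteq> 0" by auto
 then have "res_u b = res_v b" by simp
 then show ?thesis using b by (auto simp: Asub_def)
qed

lemma prime_sub_max: "prime_sub P ==> P \<subseteq> max_A"
proof
 fix a assume P: "prime_sub P" and a: "a \<in> P"
 have aA: "a \<in> Asub" using a prime_subD(1)[OF P] by blast
 show "a \<in> max_A"
 proof (rule ccontr)
  assume "a \<notin> max_A"
  then obtain b where "b \<in> Asub" "a * b = 1" using Asub_unit[OF aA] aA by (auto simp: max_A_def)
  then show False using prime_subD(3,5)[OF P] a by (metis mult.commute)
 qed
qed

text \<open>An element of \<^const>\<open>Asub\<close> outside the conductor agrees with a power of \<open>z\<close> up to a unit and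
 the conductor.\<close>

lemma z_power_mod_cond:
 assumes "f \<in> Asub" "f \<notin> cond_A"
 obtains d b s where "b \<in> Asub" "f * b = zz ^ d - xx * s" "res_u f \<noteq> 0"
proof -
 have e: "res_u f = res_v f" using assms by (simp add: Asub_def)
 have nz: "res_u f \<noteq> 0"
 proof
  assume "res_u f = 0"
  then have "xx dvd f" using e res_eq_0_iff by metis
  then show False using assms(2) by (auto simp: cond_A_def dvd_def)
 qed
 obtain d w w' where w: "res_u f = fps_X ^ d * w" "w * w' = 1" using fps_split_X[OF nz] by metis
 obtain b where b: "b \<in> Asub" "res_u b = w'" "res_v b = w'" using ex_Asub by metis
 have "res_u f * w' = fps_X ^ d" unfolding w(1) using w(2) by (simp add: mult.assoc)
 then have "res_u (zz ^ d - f * b) = 0" "res_v (zz ^ d - f * b) = 0" using b e by simp_all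
 then obtain s where "zz ^ d - f * b = xx * s" using res_eq_0_iff by (metis dvdE)
 then have "f * b = zz ^ d - xx * s" by (simp add: algebra_simps)
 then show ?thesis using that b nz by blast
qed

text \<open>Since y^2 = (uv u)^2 is a multiple of x in A, the prime also contains y, hence uv R = x
  A + y A. The quotient of A by uv R is k[[z]], a discrete valuation ring, which has only two
  primes.\<close>

lemma prime_sub_containing_x:
 fixes P :: "'k::field fps fps set"
 assumes P: "prime_sub P" and x: "xx \<in> P"
 shows "P = cond_A \<or> P = max_A"
proof -
 have "(xx * uu) * (xx * uu) = (xx * (uu * uu)) * xx" by (simp add: ac_simps)
 then have "(xx * uu) * (xx * uu) \<in> P" using prime_subD(5)[OF P _ x] Asub_closed(8) by metis
 then have y: "xx * uu \<in> P" using prime_subD(6)[OF P, of "xx * uu" "xx * uu"] Asub_closed(8) by blast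
 have "xx * r \<in> P" for r
 proof -
  obtain a b where ab: "a \<in> Asub" "b \<in> Asub" "r = a + uu * b" using R_decomp by blast
  have "xx * r = a * xx + b * (xx * uu)" unfolding ab by (simp add: algebra_simps)
  then show ?thesis using prime_subD(4)[OF P prime_subD(5)[OF P ab(1) x] prime_subD(5)[OF P ab(2) y]] by simp
 qed
 then have cP: "cond_A \<subseteq> P" by (auto simp: cond_A_def)
 show ?thesis
 proof (cases "P = cond_A")
  case False
  then obtain f where f: "f \<in> P" "f \<notin> cond_A" using cP by blast
  moreover have "f \<in> Asub" using f prime_subD(1)[OF P] by blast
  ultimately obtain d b s where b: "b \<in> Asub" "f * b = zz ^ d - xx * s" using z_power_mod_cond by metis
  have "zz ^ d = b * f + xx * s" using b(2) by (simp add: algebra_simps)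
  then have "zz ^ d \<in> P" using prime_subD(4)[OF P prime_subD(5)[OF P b(1) f(1)]] cP by (auto simp: cond_A_def)
  then have z: "zz \<in> P" using prime_sub_power[OF P] Asub_closed(10) by blast
  have "max_A \<subseteq> P"
  proof
   fix a :: "'k fps fps" assume a: "a \<in> max_A"
   obtain g where g: "g \<in> Asub" "res_u g = fps_shift 1 (res_u a)" "res_v g = fps_shift 1 (res_u a)" using ex_Asub by metis
   have "res_u a = fps_X * fps_shift 1 (res_u a)" using a by (intro fps_ext) (auto simp: max_A_def res_nth_0)
   then have "res_u (a - g * zz) = 0" "res_v (a - g * zz) = 0"
    using g a by (simp_all add: max_A_def Asub_def mult.commute)
   then obtain s where "a - g * zz = xx * s" using res_eq_0_iff by (metis dvdE)
   then have "a = g * zz + xx * s" by (simp add: algebra_simps)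
   then show "a \<in> P" using prime_subD(4)[OF P prime_subD(5)[OF P g(1) z]] cP by (auto simp: cond_A_def)
  qed
  then show ?thesis using prime_sub_max[OF P] by blast
 qed simp
qed

section \<open>Finiteness over k[[x]] and the height of primes\<close>

lemma linear_dependence:
 fixes c :: "'i \<Rightarrow> nat \<Rightarrow> 'a::idom"
 assumes "finite I" "card I > n"
 shows "\<exists>b. (\<exists>i\<in>I. b i \<noteq> 0) \<and> (\<forall>j<n. (\<Sum>i\<in>I. b i * c i j) = 0)"
 using assms
proof (induction n arbitrary: I c)
 case 0
 then have "I \<noteq> {}" by auto
 then show ?case by (intro exI[of _ "\<lambda>_. 1"]) auto
next
 case (Suc n)
 show ?case
 proof (cases "\<exists>p\<in>I. c p n \<noteq> 0")
  case False
  then obtain b where "\<exists>i\<in>I. b i \<noteq> 0" "\<forall>j<n. (\<Sum>i\<in>I. b i * c i j) = 0" using Suc(1)[OF Suc(2), of c] Suc(3) by auto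
  then show ?thesis using False by (intro exI[of _ b]) (auto simp: less_Suc_eq)
 next
  case True
  then obtain p where p: "p \<in> I" "c p n \<noteq> 0" by blast
  define c' where "c' i j = c p n * c i j - c i n * c p j" for i j
  have "finite (I - {p})" "card (I - {p}) > n" using Suc(2,3) p by auto
  from Suc(1)[OF this, of c'] obtain b where b: "\<exists>i\<in>I - {p}. b i \<noteq> 0" "\<forall>j<n. (\<Sum>i\<in>I - {p}. b i * c' i j) = 0" by blast
  define d where "d i = (if i = p then - (\<Sum>i\<in>I - {p}. b i * c i n) else b i * c p n)" for i
  have s: "(\<Sum>i\<in>I. d i * c i j) = (\<Sum>i\<in>I - {p}. b i * c' i j)" for j
  proof -
   have "(\<Sum>i\<in>I. d i * c i j) = d p * c p j + (\<Sum>i\<in>I - {p}. d i * c i j)"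
    using Suc(2) p by (simp add: sum.remove)
   also have "(\<Sum>i\<in>I - {p}. d i * c i j) = (\<Sum>i\<in>I - {p}. b i * (c p n * c i j))"
    by (intro sum.cong) (auto simp: d_def mult.assoc)
   also have "d p * c p j = - (\<Sum>i\<in>I - {p}. b i * (c i n * c p j))"
    by (simp add: d_def sum_distrib_right mult.assoc)
   finally show ?thesis by (simp add: c'_def right_diff_distrib sum_subtractf)
  qed
  have "(\<Sum>i\<in>I. d i * c i j) = 0" if "j < Suc n" for j
  proof (cases "j = n")
   case True
   have "c' i n = 0" for i by (simp add: c'_def)
   then show ?thesis using True s by simp
  qed (use that s b in auto)
  moreover have "\<exists>i\<in>I. d i \<noteq> 0" using b(1) p(2) by (auto simp: d_def)
  ultimately show ?thesis by blast
 qed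
qed

text \<open>The series b(x), i.e. the embedding of k[[x]] into A, viewed inside R.\<close>

definition xser :: "'k::field fps \<Rightarrow> 'k fps fps" where
 "xser b = subst_uv (fps_const (fps_const b))"

lemma xser_simps [simp]:
 "xser 0 = 0" "xser 1 = 1" "xser (a + b) = xser a + xser b" "xser (a * b) = xser a * xser b"
 "xser fps_X = xx" "xser (fps_const k) = fps_const (fps_const k)" "xser b \<in> Asub"
proof -
 show "xser (a + b) = xser a + xser b" "xser (a * b) = xser a * xser b"
  by (simp_all add: xser_def flip: subst_uv_add subst_uv_mult)
 show "xser fps_X = xx" by (simp add: xser_def flip: var_x_def)
 show "xser (fps_const k) = fps_const (fps_const k)" unfolding xser_def by (rule subst_uv_scalar)
 show "xser b \<in> Asub" using range_subst_uv unfolding xser_def by blast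
qed (simp_all add: xser_def)

lemma xser_sum: "finite I ==> xser (\<Sum>i\<in>I. g i) = (\<Sum>i\<in>I. xser (g i))"
 by (induction I rule: finite_induct) auto

lemma xser_power [simp]: "xser (a ^ n) = xser a ^ n" by (induction n) auto

text \<open>Modulo F and x the power z^d vanishes, so R/(F,x) is spanned over k by z^i and u z^i for
  i < d; this is \<open>step\<close>, obtained by matching both restrictions. Iterating it on the
  remainder divided by x turns the scalars into series in x.\<close>

lemma finite_mod_z_power:
 fixes F s r :: "'k::field fps fps"
 assumes F: "zz ^ d = F + xx * s"
 defines "e \<equiv> (\<lambda>j. if j < d then zz ^ j else uu * zz ^ (j - d))"
 shows "\<exists>c h. r = (\<Sum>j<2 * d. xser (c j) * e j) + F * h"
proof -
 have poly: "\<exists>q p' h r'. q \<in> Asub \<and> res_u q = p \<and> q = (\<Sum>i<d. fps_const (fps_const (p' i)) * zz ^ i) + F * h + xx * r'" for p :: "'k fps"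
 proof -
  have split: "p = (\<Sum>i<d. fps_const (p $ i) * fps_X ^ i) + fps_X ^ d * fps_shift d p"
   by (rule fps_ext) (auto simp: fps_sum_nth fps_X_power_mult_nth if_distrib cong: if_cong)
  obtain g where g: "g \<in> Asub" "res_u g = fps_shift d p" "res_v g = fps_shift d p" using ex_Asub by metis
  define q where "q = (\<Sum>i<d. fps_const (fps_const (p $ i)) * zz ^ i) + zz ^ d * g"
  have c: "res_u (fps_const (fps_const k)) = fps_const k" "res_v (fps_const (fps_const k)) = fps_const k" for k :: 'k
   by (simp_all add: res_u_def res_v_def fps_eq_iff)
  have ru: "res_u (\<Sum>i\<in>I. h i) = (\<Sum>i\<in>I. res_u (h i))" "res_v (\<Sum>i\<in>I. h i) = (\<Sum>i\<in>I. res_v (h i))" if "finite I" for I :: "nat set" and h :: "nat \<Rightarrow> 'k fps fps"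
   using that by (induction I) auto
  have "res_u q = p" "res_v q = p" using split g by (simp_all add: q_def ru c)
  moreover have "q = (\<Sum>i<d. fps_const (fps_const (p $ i)) * zz ^ i) + F * g + xx * (s * g)"
   by (simp add: q_def F algebra_simps)
  moreover from calculation have "q \<in> Asub" by (simp add: Asub_def)
  ultimately show ?thesis by blast
 qed
 have esum: "(\<Sum>j<2 * d. g j * e j) = (\<Sum>i<d. g i * zz ^ i) + uu * (\<Sum>i<d. g (d + i) * zz ^ i)" for g
 proof -
  have u: "{..<2 * d} = {..<d} \<union> {d..<2 * d}" by auto
  have "(\<Sum>j<2 * d. g j * e j) = (\<Sum>i<d. g i * e i) + (\<Sum>i\<in>{d..<2 * d}. g i * e i)"
   unfolding u by (rule sum.union_disjoint) auto
  also have "(\<Sum>i\<in>{d..<2 * d}. g i * e i) = (\<Sum>i<d. g (d + i) * e (d + i))"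
   by (rule sum.reindex_bij_witness[of _ "\<lambda>i. d + i" "\<lambda>i. i - d"]) auto
  finally show ?thesis by (simp add: e_def sum_distrib_left ac_simps)
 qed
 have step: "\<exists>p h r'. r = (\<Sum>j<2 * d. fps_const (fps_const (p j)) * e j) + F * h + xx * r'" for r :: "'k fps fps"
 proof -
  obtain q p h r1 where q: "q \<in> Asub" "res_u q = res_v r" "q = (\<Sum>i<d. fps_const (fps_const (p i)) * zz ^ i) + F * h + xx * r1"
   using poly by blast
  define t where "t = fps_shift 1 (res_u r - res_v r)"
  have "res_u r - res_v r = fps_X * t" by (rule fps_ext) (auto simp: t_def res_nth_0)
  then have t: "res_u r = res_v r + fps_X * t" by (simp add: algebra_simps)
  obtain q' p' h' r2 where q': "q' \<in> Asub" "res_u q' = t" "q' = (\<Sum>i<d. fps_const (fps_const (p' i)) * zz ^ i) + F * h' + xx * r2"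
   using poly by blast
  have "res_u (r - (q + uu * q')) = 0" "res_v (r - (q + uu * q')) = 0"
   using q(1,2) q'(1,2) by (simp_all add: Asub_def t)
  then obtain r3 where "r - (q + uu * q') = xx * r3" using res_eq_0_iff by (metis dvdE)
  then have "r = q + uu * q' + xx * r3" by (simp add: algebra_simps)
  also have "\<dots> = (\<Sum>j<2 * d. fps_const (fps_const (if j < d then p j else p' (j - d))) * e j) + F * (h + uu * h') + xx * (r1 + uu * r2 + r3)"
   unfolding esum by (subst q(3), subst q'(3)) (simp add: algebra_simps)
  finally show ?thesis
   by (intro exI[of _ "\<lambda>j. if j < d then p j else p' (j - d)"] exI[of _ "h + uu * h'"] exI[of _ "r1 + uu * r2 + r3"])
 qed
 define St where "St r x \<longleftrightarrow> r = (\<Sum>j<2 * d. fps_const (fps_const (fst x j)) * e j) + F * fst (snd x) + xx * snd (snd x)"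
  for r and x :: "(nat \<Rightarrow> 'k) \<times> 'k fps fps \<times> 'k fps fps"
 have "\<exists>x. St r x" for r
 proof -
  obtain p h r' where "r = (\<Sum>j<2 * d. fps_const (fps_const (p j)) * e j) + F * h + xx * r'" using step by blast
  then have "St r (p, h, r')" by (simp add: St_def)
  then show ?thesis by blast
 qed
 then obtain sf where sf: "\<And>r. St r (sf r)" by metis
 define pf hf rf where "pf r = fst (sf r)" and "hf r = fst (snd (sf r))" and "rf r = snd (snd (sf r))" for r
 have st: "r = (\<Sum>j<2 * d. fps_const (fps_const (pf r j)) * e j) + F * hf r + xx * rf r" for r
  using sf[of r] unfolding St_def pf_def hf_def rf_def .
 define R where "R n = (rf ^^ n) r" for n
 have R: "R n = (\<Sum>j<2 * d. fps_const (fps_const (pf (R n) j)) * e j) + F * hf (R n) + xx * R (Suc n)" for n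
  using st[of "R n"] by (simp add: R_def)
 define C where "C n j = Abs_fps (\<lambda>k. pf (R (n + k)) j)" for n j
 have C: "C n j = fps_const (pf (R n) j) + fps_X * C (Suc n) j" for n j
  by (rule fps_ext) (auto simp: C_def)
 obtain T where T: "\<forall>n. T n = hf (R n) + xx * T (Suc n)"
  using complete_atD1[OF complete_uv, of "\<lambda>n. hf (R n)"] by blast
 have E: "(\<Sum>j<2 * d. xser (C n j) * e j) = (\<Sum>j<2 * d. fps_const (fps_const (pf (R n) j)) * e j) + xx * (\<Sum>j<2 * d. xser (C (Suc n) j) * e j)" for n
  by (subst C) (simp add: algebra_simps sum.distrib sum_distrib_left)
 have "R n - ((\<Sum>j<2 * d. xser (C n j) * e j) + F * T n) =
  xx * (R (Suc n) - ((\<Sum>j<2 * d. xser (C (Suc n) j) * e j) + F * T (Suc n)))" for n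
  by (subst R, subst E, subst T[rule_format]) (simp add: algebra_simps)
 then have "R 0 - ((\<Sum>j<2 * d. xser (C 0 j) * e j) + F * T 0) = 0"
  by (rule complete_atD2[OF complete_uv, of "\<lambda>n. R n - ((\<Sum>j<2 * d. xser (C n j) * e j) + F * T n)"])
 then have "r = (\<Sum>j<2 * d. xser (C 0 j) * e j) + F * T 0" by (simp add: R_def)
 then show ?thesis by blast
qed

text \<open>The norm n0 of f0 is a symmetric element of P. Stripping powers of x leaves G in P
  outside the conductor, and a multiple F of G equals z^d up to x R. Then R/FR is spanned by 2d
  elements over k[[x]], so 2d + 1 powers of some g in Q but not in P satisfy a relation modulo F
  over k[[x]]. Its lowest nonzero coefficient ends up in Q; being a unit times a power of x, it puts
  x into Q.\<close>

lemma prime_sub_height_2: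
 fixes P Q :: "'k::field fps fps set"
 assumes P1: "prime_sub P" and P2: "prime_sub Q" and sub: "P \<subset> Q" and nz: "f0 \<in> P" "f0 \<noteq> 0" and x: "xx \<notin> P"
 shows "Q = max_A"
proof -
 have f0A: "f0 \<in> Asub" using nz prime_subD(1)[OF P1] by blast
 define n0 where "n0 = f0 * swap_uv f0"
 have "swap_uv f0 \<noteq> 0" using nz by (metis swap_uv_simps(1,8))
 then have n0: "n0 \<noteq> 0" "swap_uv n0 = n0" using nz by (auto simp: n0_def mult.commute)
 have "swap_uv f0 \<in> Asub" using f0A by (simp add: Asub_def)
 then have n0P: "n0 \<in> P" using prime_subD(5)[OF P1, of "swap_uv f0" f0] nz by (simp add: n0_def mult.commute)
 obtain N where N: "\<not> xx ^ N dvd n0" using complete_at_power_dvd[OF complete_uv, of n0] n0(1) by auto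
 define m where "m = (LEAST m. \<not> xx ^ Suc m dvd n0)"
 have ex: "\<not> xx ^ Suc N dvd n0" using N by (metis power_Suc dvd_mult_right)
 have m1: "\<not> xx ^ Suc m dvd n0" unfolding m_def using ex by (rule LeastI)
 have m2: "xx ^ m dvd n0"
 proof (cases m)
  case (Suc m')
  then have "m' < m" by simp
  then have "\<not> \<not> xx ^ Suc m' dvd n0" unfolding m_def by (rule not_less_Least)
  then show ?thesis using Suc by simp
 qed simp
 then obtain G where G: "n0 = xx ^ m * G" by (metis dvdE)
 have "xx ^ m * swap_uv G = xx ^ m * G" using n0(2) unfolding G by (simp add: mult.commute)
 then have "swap_uv G = G" by simp
 then have "res_u G = res_v G" using res_swap_uv(1)[of G] by simp
 then have GA: "G \<in> Asub" by (simp add: Asub_def)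
 have "G \<in> P" using prime_subD(6)[OF P1, of "xx ^ m" G] n0P GA x Asub_closed(7,9) prime_sub_power[OF P1, of xx m] by (auto simp: G)
 have Gc: "G \<notin> cond_A"
 proof
  assume "G \<in> cond_A"
  then have "n0 = xx ^ Suc m * h" if "G = xx * h" for h using that G by (simp add: ac_simps)
  then show False using m1 \<open>G \<in> cond_A\<close> by (auto simp: cond_A_def dvd_def)
 qed
 obtain d b s where b: "b \<in> Asub" "G * b = zz ^ d - xx * s" using z_power_mod_cond[OF GA Gc] by metis
 define F where "F = G * b"
 have F: "zz ^ d = F + xx * s" using b(2) by (simp add: F_def)
 have FP: "F \<in> P" using prime_subD(5)[OF P1 b(1) \<open>G \<in> P\<close>] by (simp add: F_def mult.commute)
 obtain g where g: "g \<in> Q" "g \<notin> P" using sub by blast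
 have gA: "g \<in> Asub" using g prime_subD(1)[OF P2] by blast
 define e where "e = (\<lambda>j. if j < d then zz ^ j else uu * zz ^ (j - d) :: 'k fps fps)"
 have "\<exists>c h. g ^ i = (\<Sum>j<2 * d. xser (c j) * e j) + F * h" for i
  unfolding e_def by (rule finite_mod_z_power[OF F])
 then obtain c h where ch: "\<And>i. g ^ i = (\<Sum>j<2 * d. xser (c i j) * e j) + F * h i" by metis
 obtain \<beta> where \<beta>: "\<exists>i\<in>{..2 * d}. \<beta> i \<noteq> 0" "\<forall>j<2 * d. (\<Sum>i\<in>{..2 * d}. \<beta> i * c i j) = 0"
  using linear_dependence[of "{..2 * d}" "2 * d" c] by auto
 have "(\<Sum>i\<le>2 * d. xser (\<beta> i) * g ^ i) = (\<Sum>i\<le>2 * d. \<Sum>j<2 * d. xser (\<beta> i * c i j) * e j) + F * (\<Sum>i\<le>2 * d. xser (\<beta> i) * h i)"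
  unfolding sum_distrib_left sum.distrib[symmetric]
  by (intro sum.cong refl, subst ch) (simp add: algebra_simps sum_distrib_left)
 also have "(\<Sum>i\<le>2 * d. \<Sum>j<2 * d. xser (\<beta> i * c i j) * e j) = (\<Sum>j<2 * d. xser (\<Sum>i\<le>2 * d. \<beta> i * c i j) * e j)"
  by (subst sum.swap) (simp add: xser_sum sum_distrib_right del: xser_simps(4))
 also have "\<dots> = 0" using \<beta>(2) by (intro sum.neutral) auto
 finally have eq: "(\<Sum>i\<le>2 * d. xser (\<beta> i) * g ^ i) = F * (\<Sum>i\<le>2 * d. xser (\<beta> i) * h i)" by simp
 have sumA: "(\<Sum>i\<in>I. xser (\<gamma> i) * g ^ i) \<in> Asub" if "finite I" for I :: "nat set" and \<gamma>
  using that gA by (induction I) (auto intro!: Asub_closed xser_simps(7))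
 \<comment> \<open>The cofactor of F is only known to lie in R. The extra factor x brings it into A
   and can be cancelled afterwards, as x is not in P.\<close>
 have eq': "xx * (\<Sum>i\<le>2 * d. xser (\<beta> i) * g ^ i) = (xx * (\<Sum>i\<le>2 * d. xser (\<beta> i) * h i)) * F"
  unfolding eq by (simp add: ac_simps)
 have "xx * (\<Sum>i\<le>2 * d. xser (\<beta> i) * g ^ i) \<in> P"
  unfolding eq' by (rule prime_subD(5)[OF P1 Asub_closed(8) FP])
 then have relP: "(\<Sum>i\<le>2 * d. xser (\<beta> i) * g ^ i) \<in> P"
  using prime_subD(6)[OF P1 Asub_closed(9) sumA[OF finite_atMost]] x by blast
 define Q' where "Q' j \<longleftrightarrow> \<beta> j \<noteq> 0 \<and> j \<le> 2 * d" for j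
 obtain j0 where j0: "Q' j0" using \<beta>(1) by (auto simp: Q'_def)
 \<comment> \<open>g is not in P, so g^j may be cancelled and the relation starts with a nonzero
   coefficient.\<close>
 define j where "j = (LEAST j. Q' j)"
 have "Q' j" unfolding j_def using j0 by (rule LeastI)
 then have j: "\<beta> j \<noteq> 0" "j \<le> 2 * d" by (auto simp: Q'_def)
 have jl: "\<beta> i = 0" if "i < j" for i
 proof -
  have "\<not> Q' i" using that unfolding j_def by (rule not_less_Least)
  then show ?thesis using that j by (auto simp: Q'_def)
 qed
 have "(\<Sum>i\<le>2 * d. xser (\<beta> i) * g ^ i) = (\<Sum>i\<in>{j..2 * d}. xser (\<beta> i) * g ^ i)"
  by (rule sum.mono_neutral_right) (use jl in auto)
 also have "\<dots> = g ^ j * (\<Sum>i\<in>{j..2 * d}. xser (\<beta> i) * g ^ (i - j))"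
  unfolding sum_distrib_left by (intro sum.cong refl) (simp add: mult.left_commute flip: power_add)
 also have "(\<Sum>i\<in>{j..2 * d}. xser (\<beta> i) * g ^ (i - j)) = (\<Sum>i\<le>2 * d - j. xser (\<beta> (i + j)) * g ^ i)"
  using j by (intro sum.reindex_bij_witness[of _ "\<lambda>i. i + j" "\<lambda>i. i - j"]) auto
 finally have "g ^ j * (\<Sum>i\<le>2 * d - j. xser (\<beta> (i + j)) * g ^ i) \<in> P" using relP by simp
 then have "(\<Sum>i\<le>2 * d - j. xser (\<beta> (i + j)) * g ^ i) \<in> P"
  using prime_subD(6)[OF P1 Asub_closed(7)[OF gA] sumA[OF finite_atMost[of "2 * d - j"], of "\<lambda>i. \<beta> (i + j)"], of j]
   prime_sub_power[OF P1 gA, of j] g(2) by blast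
 then have inQ: "(\<Sum>i\<le>2 * d - j. xser (\<beta> (i + j)) * g ^ i) \<in> Q" using sub by blast
 have expand: "(\<Sum>i\<le>2 * d - j. xser (\<beta> (i + j)) * g ^ i) = xser (\<beta> j) + (\<Sum>i\<in>{1..2 * d - j}. xser (\<beta> (i + j)) * g ^ (i - 1)) * g"
 proof -
  have "{..2 * d - j} = insert 0 {1..2 * d - j}" by auto
  then have "(\<Sum>i\<le>2 * d - j. xser (\<beta> (i + j)) * g ^ i) = xser (\<beta> j) + (\<Sum>i\<in>{1..2 * d - j}. xser (\<beta> (i + j)) * g ^ i)" by simp
  also have "(\<Sum>i\<in>{1..2 * d - j}. xser (\<beta> (i + j)) * g ^ i) = (\<Sum>i\<in>{1..2 * d - j}. xser (\<beta> (i + j)) * g ^ (i - 1)) * g"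
   unfolding sum_distrib_right by (intro sum.cong refl) (auto simp: mult.assoc simp flip: power_Suc2)
  finally show ?thesis .
 qed
 have restQ: "(\<Sum>i\<in>{1..2 * d - j}. xser (\<beta> (i + j)) * g ^ (i - 1)) * g \<in> Q"
 proof (rule prime_subD(5)[OF P2 _ g(1)])
  show "(\<Sum>i\<in>{1..2 * d - j}. xser (\<beta> (i + j)) * g ^ (i - 1)) \<in> Asub"
  proof -
   have "(\<Sum>i\<in>I. xser (\<beta> (i + j)) * g ^ (i - 1)) \<in> Asub" if "finite I" for I :: "nat set"
    using that gA by (induction I rule: finite_induct) (auto intro!: Asub_closed xser_simps(7))
   then show ?thesis by simp
  qed
 qed
 have bQ: "xser (\<beta> j) \<in> Q"
  using prime_subD(7)[OF P2 inQ restQ] unfolding expand by (simp only: add_diff_cancel_right')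
 obtain k w w' where w: "\<beta> j = fps_X ^ k * w" "w * w' = 1" using fps_split_X j by metis
 have "xser w * xser w' = 1" using w(2) by (metis xser_simps(2,4))
 then have "xx ^ k = xser w' * xser (\<beta> j)" unfolding w(1) by (simp add: ac_simps)
 then have "xx ^ k \<in> Q" using prime_subD(5)[OF P2 xser_simps(7) bQ] by simp
 then have "xx \<in> Q" using prime_sub_power[OF P2 Asub_closed(9)] by blast
 moreover have "Q \<noteq> cond_A" using \<open>G \<in> P\<close> sub Gc by blast
 ultimately show ?thesis using prime_sub_containing_x[OF P2] by blast
qed

lemma no_prime_sub_chain:
 assumes "prime_sub P1" "prime_sub P2" "prime_sub P3" "P1 \<subset> P2" "P2 \<subset> P3" "f \<in> P1" "f \<noteq> 0"
 shows False
proof (cases "xx \<in> P1")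
 case True
 have "P1 = cond_A \<or> P1 = max_A" "P2 = cond_A \<or> P2 = max_A" "P3 = cond_A \<or> P3 = max_A"
  using prime_sub_containing_x assms True by blast+
 then show False using assms(4,5) by blast
next
 case False
 then have "P2 = max_A" using prime_sub_height_2 assms by blast
 then show False using prime_sub_max[OF assms(3)] assms(5) by blast
qed

lemma prime_sub_image:
 fixes P :: "'k::field fps fps fps set set"
 assumes "primeideal P ring_A"
 shows "prime_sub (A_to_R ` P)"
proof -
 interpret primeideal P "ring_A :: 'k fps fps fps set ring" by fact
 note c = ideal_closed[OF is_ideal]
 show ?thesis
  unfolding prime_sub_def
 proof (intro conjI ballI impI)
  show "A_to_R ` P \<subseteq> Asub" using c(1) by auto
  show "0 \<in> A_to_R ` P" using c(2) A_to_R_simps(4) by (metis imageI)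
  show "1 \<notin> A_to_R ` P"
  proof
   assume "1 \<in> A_to_R ` P"
   then obtain p where "p \<in> P" "A_to_R p = 1" by auto
   then have "p = \<one>\<^bsub>ring_A\<^esub>" using A_to_R_inj[of p "\<one>\<^bsub>ring_A\<^esub>"] c(1) by auto
   then show False using one_imp_carrier \<open>p \<in> P\<close> I_notcarr by blast
  qed
 next
  fix a b :: "'k fps fps" assume "a \<in> A_to_R ` P" "b \<in> A_to_R ` P"
  then obtain p q where pq: "a = A_to_R p" "b = A_to_R q" "p \<in> P" "q \<in> P" by auto
  then have "a + b = A_to_R (p \<oplus>\<^bsub>ring_A\<^esub> q)" using c(1) by auto
  then show "a + b \<in> A_to_R ` P" using c(3) pq by blast
 next
  fix a b :: "'k fps fps" assume "a \<in> Asub" "b \<in> A_to_R ` P"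
  then obtain p q where pq: "a = A_to_R p" "b = A_to_R q" "p \<in> cA" "q \<in> P" using ex_A by blast
  then have "a * b = A_to_R (p \<otimes>\<^bsub>ring_A\<^esub> q)" using c(1) by auto
  then show "a * b \<in> A_to_R ` P" using c(4) pq by blast
 next
  fix a b :: "'k fps fps" assume "a \<in> Asub" "b \<in> Asub" and ab: "a * b \<in> A_to_R ` P"
  then obtain p q where pq: "a = A_to_R p" "b = A_to_R q" "p \<in> cA" "q \<in> cA" using ex_A by metis
  obtain r where r: "r \<in> P" "a * b = A_to_R r" using ab by blast
  then have "p \<otimes>\<^bsub>ring_A\<^esub> q = r" using pq c(1) A_to_R_inj[of "p \<otimes>\<^bsub>ring_A\<^esub> q" r] by auto
  then show "a \<in> A_to_R ` P \<or> b \<in> A_to_R ` P" using I_prime pq r by blast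
 qed
qed

lemma image_psubset: "P \<subseteq> cA ==> Q \<subseteq> cA ==> P \<subset> Q ==> A_to_R ` P \<subset> A_to_R ` Q"
 using bij_A_to_R unfolding bij_betw_def by (metis inj_on_image_eq_iff psubset_eq image_mono)

lemma no_prime_chain_over_nonzero:
 fixes P :: "nat \<Rightarrow> 'k::field fps fps fps set set"
 assumes "\<And>i. i \<le> 2 ==> primeideal (P i) ring_A" "\<And>i. i < 2 ==> P i \<subset> P (Suc i)"
  "s \<in> P 0" "s \<noteq> \<zero>\<^bsub>ring_A\<^esub>"
 shows False
proof -
 have sub: "P i \<subseteq> cA" if "i \<le> 2" for i
  using assms(1)[OF that] ideal_closed(1) primeideal.axioms(1) by metis
 have pr: "prime_sub (A_to_R ` P i)" if "i \<le> 2" for i using prime_sub_image assms(1)[OF that] by blast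
 have "A_to_R ` P 0 \<subset> A_to_R ` P 1" "A_to_R ` P 1 \<subset> A_to_R ` P 2"
  using image_psubset[OF sub sub, of 0 1] image_psubset[OF sub sub, of 1 2] assms(2)[of 0] assms(2)[of 1]
  by (simp_all add: numeral_2_eq_2)
 moreover have "A_to_R s \<noteq> 0" using assms(3,4) sub[of 0] by auto
 ultimately show False using no_prime_sub_chain[OF pr[of 0] pr[of 1] pr[of 2]] assms(3) by auto
qed

text \<open>In a chain of four primes the second one is nonzero, so its last three members
  contradict \<open>no_prime_chain_over_nonzero\<close>.\<close>

lemma krull_dim_le_2: "krull_dim (ring_A :: 'k::field fps fps fps set ring) \<le> 2"
 unfolding krull_dim_def
proof (rule Sup_least)
 fix e assume "e \<in> {enat n |n. \<exists>P::nat \<Rightarrow> 'k fps fps fps set set. (\<forall>i\<le>n. primeideal (P i) ring_A) \<and> (\<forall>i<n. P i \<subset> P (Suc i))}"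
 then obtain n and P :: "nat \<Rightarrow> 'k fps fps fps set set" where e: "e = enat n"
  "\<And>i. i \<le> n ==> primeideal (P i) ring_A" "\<And>i. i < n ==> P i \<subset> P (Suc i)" by blast
 have "n \<le> 2"
 proof (rule ccontr)
  assume n: "\<not> n \<le> 2"
  then have "P 0 \<subset> P 1" using e(3)[of 0] by auto
  then obtain s where s: "s \<in> P 1" "s \<notin> P 0" by blast
  have "\<zero>\<^bsub>ring_A\<^esub> \<in> P 0" using e(2)[of 0] ideal_closed(2) primeideal.axioms(1) by blast
  then have "s \<noteq> \<zero>\<^bsub>ring_A\<^esub>" using s by auto
  then show False using no_prime_chain_over_nonzero[of "\<lambda>i. P (Suc i)" s] e n s by auto
 qed
 then show "e \<le> 2" using e(1) by (metis enat_ord_simps(1) numeral_eq_enat)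
qed

section \<open>Noetherian modules\<close>

lemma complete_v: "complete_at (vv :: 'k::field fps fps)"
 unfolding complete_at_def
proof (intro conjI allI impI)
 fix c :: "nat \<Rightarrow> 'k fps fps"
 obtain T where T: "\<forall>n. T n = swap_uv (c n) + uu * T (Suc n)"
  using complete_atD1[OF complete_u, of "\<lambda>n. swap_uv (c n)"] by blast
 have "swap_uv (T n) = c n + vv * swap_uv (T (Suc n))" for n
  by (subst T[rule_format]) simp
 then show "\<exists>T. \<forall>n. T n = c n + vv * T (Suc n)" by (intro exI[of _ "\<lambda>n. swap_uv (T n)"]) blast
next
 fix D :: "nat \<Rightarrow> 'k fps fps"
 assume a: "\<forall>n. D n = vv * D (Suc n)"
 have "swap_uv (D n) = uu * swap_uv (D (Suc n))" for n by (subst a[rule_format]) simp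
 then have "swap_uv (D 0) = 0" by (rule complete_atD2[OF complete_u, of "\<lambda>n. swap_uv (D n)"])
 then show "D 0 = 0" by (metis swap_uv_simps(1,8))
qed

definition ideal_set :: "'a::comm_ring_1 set \<Rightarrow> bool" where
 "ideal_set L \<longleftrightarrow> 0 \<in> L \<and> (\<forall>a\<in>L. \<forall>b\<in>L. a + b \<in> L) \<and> (\<forall>r. \<forall>a\<in>L. r * a \<in> L)"

lemma ideal_setD:
 assumes "ideal_set L"
 shows "0 \<in> L" "a \<in> L ==> b \<in> L ==> a + b \<in> L" "a \<in> L ==> r * a \<in> L" "a \<in> L ==> b \<in> L ==> a - b \<in> L"
proof -
 show "a \<in> L ==> b \<in> L ==> a - b \<in> L"
  using assms unfolding ideal_set_def by (metis mult_minus1 add_uminus_conv_diff)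
qed (use assms in \<open>auto simp: ideal_set_def\<close>)

text \<open>The leading coefficients of the elements of order at least \<open>d\<close> in \<open>z\<close> form an ideal of the
 discrete valuation ring \<open>\<bbbk>[[x]]\<close>; these ideals increase with \<open>d\<close>, so the smallest valuation is
 attained for some \<open>d\<close>, and one generator for each smaller degree completes a generating set.\<close>

lemma ideal_set_finitely_generated:
 fixes L :: "'k::field fps fps set"
 assumes L: "ideal_set L"
 shows "\<exists>G. finite G \<and> G \<subseteq> L \<and> (\<forall>L'. ideal_set L' \<and> G \<subseteq> L' \<longrightarrow> L \<subseteq> L')"
proof (cases "L = {0}")
 case True
 then show ?thesis by (intro exI[of _ "{}"]) (auto simp: ideal_set_def)
next
 case False
 note Lc = ideal_setD[OF L]
 define lead where "lead d r \<longleftrightarrow> r \<in> L \<and> (\<forall>i<d. r $ i = 0) \<and> r $ d \<noteq> 0" for d r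
 define Q where "Q e \<longleftrightarrow> (\<exists>d r. lead d r \<and> subdegree (r $ d) = e)" for e
 obtain r0 where r0: "r0 \<in> L" "r0 \<noteq> 0" using False Lc(1) by blast
 have "lead (subdegree r0) r0" using r0 nth_subdegree_nonzero[of r0] by (auto simp: lead_def)
 then have "Q (LEAST e. Q e)" by (intro LeastI[of Q "subdegree (r0 $ subdegree r0)"]) (auto simp: Q_def)
 then obtain D F where F: "lead D F" "subdegree (F $ D) = (LEAST e. Q e)" unfolding Q_def by blast
 have Fmin: "subdegree (F $ D) \<le> subdegree (r $ d)" if "lead d r" for d r
  unfolding F(2) using that by (intro Least_le) (auto simp: Q_def)
 have "\<exists>f. (\<exists>r. lead d r) \<longrightarrow> lead d f \<and> (\<forall>r. lead d r \<longrightarrow> subdegree (f $ d) \<le> subdegree (r $ d))" for d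
 proof (cases "\<exists>r. lead d r")
  case True
  then obtain r where r: "lead d r" by blast
  define Q' where "Q' e \<longleftrightarrow> (\<exists>r. lead d r \<and> subdegree (r $ d) = e)" for e
  have "Q' (LEAST e. Q' e)" using r by (intro LeastI[of Q' "subdegree (r $ d)"]) (auto simp: Q'_def)
  then obtain f where f: "lead d f" "subdegree (f $ d) = (LEAST e. Q' e)" unfolding Q'_def by blast
  have "subdegree (f $ d) \<le> subdegree (r $ d)" if "lead d r" for r
   unfolding f(2) using that by (intro Least_le) (auto simp: Q'_def)
  then show ?thesis using f by blast
 qed blast
 then obtain f where f: "\<And>d. (\<exists>r. lead d r) \<longrightarrow> lead d (f d) \<and> (\<forall>r. lead d r \<longrightarrow> subdegree (f d $ d) \<le> subdegree (r $ d))"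
  by metis
 define G where "G = insert F (f ` {d. d < D \<and> (\<exists>r. lead d r)})"
 have GL: "finite G" "G \<subseteq> L" using F f by (auto simp: G_def lead_def)
 have "L \<subseteq> L'" if L': "ideal_set L'" "G \<subseteq> L'" for L'
 proof -
  note L'c = ideal_setD[OF L'(1)]
  have FL': "F \<in> L'" using L' by (auto simp: G_def)
  \<comment> \<open>From order D on F alone suffices: its leading coefficient divides all the
    others, and repeated subtraction gives a v-adically convergent quotient.\<close>
  have main: "r \<in> L'" if r: "r \<in> L" "\<forall>i<D. r $ i = 0" for r
  proof -
   define Z where "Z n = {r. vv ^ n * r \<in> L}" for n
   have vp: "(vv ^ n * r) $ i = (if i < n then 0 else r $ (i - n))" for n i and r :: "'k fps fps"
    by (simp add: var_v_def fps_X_power_mult_nth)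
   have dec: "r = vv ^ n * fps_shift n r" if "\<forall>i<n. r $ i = 0" for n and r :: "'k fps fps"
    by (rule fps_ext) (use that in \<open>simp add: vp\<close>)
   define F1 where "F1 = fps_shift D F"
   have F1: "F = vv ^ D * F1" "F1 $ 0 = F $ D" using F dec[of D F] by (auto simp: F1_def lead_def)
   have step: "\<exists>c s'. s' \<in> Z (Suc n) \<and> s = F1 * c + vv * s'" if n: "D \<le> n" and s: "s \<in> Z n" for n s
   proof -
    have "F1 $ 0 dvd s $ 0"
    proof (rule fps_dvd_of_subdegree_le)
     show "F1 $ 0 \<noteq> 0" using F F1 by (simp add: lead_def)
     assume "s $ 0 \<noteq> 0"
     then have "lead n (vv ^ n * s)" using s by (auto simp: lead_def Z_def vp)
     from Fmin[OF this] show "subdegree (F1 $ 0) \<le> subdegree (s $ 0)" using F1(2) by (simp add: vp)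
    qed
    then obtain c where c: "s $ 0 = F1 $ 0 * c" by (metis dvdE)
    define s' where "s' = fps_shift 1 (s - F1 * fps_const c)"
    have s': "s - F1 * fps_const c = vv * s'"
     using dec[of 1 "s - F1 * fps_const c"] c by (simp add: s'_def)
    have "vv ^ n * s - (vv ^ (n - D) * fps_const c) * F = vv ^ n * (s - F1 * fps_const c)"
     using n by (simp add: F1(1) algebra_simps flip: power_add)
    also have "\<dots> = vv ^ Suc n * s'" unfolding s' by (simp add: ac_simps)
    finally have "vv ^ Suc n * s' \<in> L" using Lc(4)[OF _ Lc(3)] s F by (metis Z_def mem_Collect_eq lead_def)
    moreover have "s = F1 * fps_const c + vv * s'" using s' by (simp add: algebra_simps)
    ultimately show ?thesis unfolding Z_def by blast
   qed
   then obtain cf sf where csf: "\<And>n s. D \<le> n ==> s \<in> Z n ==> sf n s \<in> Z (Suc n) \<and> s = F1 * cf n s + vv * sf n s" by metis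
   define s where "s = rec_nat (fps_shift D r) (\<lambda>n t. sf (D + n) t)"
   have s_simps: "s 0 = fps_shift D r" "\<And>n. s (Suc n) = sf (D + n) (s n)" by (simp_all add: s_def)
   have sZ: "s n \<in> Z (D + n)" for n
   proof (induction n)
    case 0 then show ?case using r dec[of D r] by (simp add: s_simps Z_def)
   next
    case (Suc n) then show ?case using csf[of "D + n" "s n"] by (simp add: s_simps)
   qed
   have s_eq: "s n = F1 * cf (D + n) (s n) + vv * s (Suc n)" for n
    using csf[of "D + n" "s n"] sZ[of n] by (simp add: s_simps)
   obtain T where T: "\<forall>n. T n = cf (D + n) (s n) + vv * T (Suc n)"
    using complete_atD1[OF complete_v, of "\<lambda>n. cf (D + n) (s n)"] by blast
   have "s n - F1 * T n = vv * (s (Suc n) - F1 * T (Suc n))" for n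
    by (subst s_eq, subst T[rule_format]) (simp add: algebra_simps)
   then have "s 0 - F1 * T 0 = 0" by (rule complete_atD2[OF complete_v, of "\<lambda>n. s n - F1 * T n"])
   then have "r = vv ^ D * (F1 * T 0)" using dec[OF r(2)] by (simp add: s_simps)
   then have "r = T 0 * F" by (simp add: F1(1) ac_simps)
   then show ?thesis using L'c(3)[OF FL'] by simp
  qed
  \<comment> \<open>Descending induction on the order: below D the leading coefficient is removed
    with the generator \<open>f d\<close> of that degree, which raises the order by one.\<close>
  have "\<forall>r\<in>L. (\<forall>i<D - k. r $ i = 0) \<longrightarrow> r \<in> L'" for k
  proof (induction k)
   case 0 then show ?case using main by simp
  next
   case (Suc k)
   show ?case
   proof (cases "D - k = 0")
    case True then show ?thesis using Suc by simp
   next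
    case False
    define d where "d = D - Suc k"
    have d: "D - k = Suc d" "d < D" using False by (auto simp: d_def)
    show ?thesis
    proof (intro ballI impI)
     fix r assume r: "r \<in> L" "\<forall>i<D - Suc k. r $ i = 0"
     show "r \<in> L'"
     proof (cases "r $ d = 0")
      case True
      then show ?thesis using Suc r d by (auto simp: less_Suc_eq simp flip: d_def)
     next
      case False
      then have lr: "lead d r" using r by (simp add: lead_def d_def)
      then have fd: "lead d (f d)" "subdegree (f d $ d) \<le> subdegree (r $ d)" using f by blast+
      have "f d $ d dvd r $ d" using fd by (intro fps_dvd_of_subdegree_le) (auto simp: lead_def)
      then obtain c where c: "r $ d = f d $ d * c" by (metis dvdE)
      have "f d \<in> L" "f d \<in> L'" using fd lr d L' by (auto simp: lead_def G_def)
      have "r - fps_const c * f d \<in> L" using Lc(4)[OF r(1) Lc(3)[OF \<open>f d \<in> L\<close>]] .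
      moreover have "\<forall>i<Suc d. (r - fps_const c * f d) $ i = 0"
       using lr fd c by (auto simp: less_Suc_eq lead_def mult.commute)
      ultimately have "r - fps_const c * f d \<in> L'" using Suc d by simp
      then have "(r - fps_const c * f d) + fps_const c * f d \<in> L'" using L'c(2)[OF _ L'c(3)[OF \<open>f d \<in> L'\<close>]] by blast
      then show ?thesis by simp
     qed
    qed
   qed
  qed
  from this[of D] show ?thesis by auto
 qed
 then show ?thesis using GL by blast
qed

section \<open>Submodules of finitely generated modules\<close>

definition span_of :: "('a, 'c) ring_scheme \<Rightarrow> ('a, 'm, 'e) module_scheme \<Rightarrow> 'm set \<Rightarrow> 'm set" where
 "span_of A M E = \<Inter> {N. submodule N A M \<and> E \<subseteq> N}"

context Module.module
begin

lemma submodule_closed: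
 assumes "submodule N R M"
 shows "N \<subseteq> carrier M" "\<zero>\<^bsub>M\<^esub> \<in> N" "x \<in> N ==> y \<in> N ==> x \<oplus>\<^bsub>M\<^esub> y \<in> N"
  "a \<in> carrier R ==> x \<in> N ==> a \<odot>\<^bsub>M\<^esub> x \<in> N" "x \<in> N ==> y \<in> N ==> x \<ominus>\<^bsub>M\<^esub> y \<in> N"
proof -
 note e = submoduleE[OF assms]
 show "N \<subseteq> carrier M" by (rule e)
 show "x \<in> N ==> y \<in> N ==> x \<oplus>\<^bsub>M\<^esub> y \<in> N" by (rule e)
 show "a \<in> carrier R ==> x \<in> N ==> a \<odot>\<^bsub>M\<^esub> x \<in> N" by (rule e)
 show "x \<in> N ==> y \<in> N ==> x \<ominus>\<^bsub>M\<^esub> y \<in> N" unfolding a_minus_def using e by blast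
 obtain n where "n \<in> N" using e(2) by blast
 then have "\<zero>\<^bsub>R\<^esub> \<odot>\<^bsub>M\<^esub> n \<in> N" using e(4) by blast
 then show "\<zero>\<^bsub>M\<^esub> \<in> N" using \<open>n \<in> N\<close> e(1) by auto
qed

lemma submodule_criterion:
 assumes "N \<subseteq> carrier M" "\<zero>\<^bsub>M\<^esub> \<in> N" "\<And>x y. x \<in> N ==> y \<in> N ==> x \<oplus>\<^bsub>M\<^esub> y \<in> N"
  "\<And>a x. a \<in> carrier R ==> x \<in> N ==> a \<odot>\<^bsub>M\<^esub> x \<in> N"
 shows "submodule N R M"
proof (rule submoduleI)
 fix a assume a: "a \<in> N"
 have "\<ominus>\<^bsub>M\<^esub> a = (\<ominus>\<^bsub>R\<^esub> \<one>\<^bsub>R\<^esub>) \<odot>\<^bsub>M\<^esub> a" using a assms(1) by (auto simp: smult_l_minus)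
 then show "\<ominus>\<^bsub>M\<^esub> a \<in> N" using assms(4)[OF _ a, of "\<ominus>\<^bsub>R\<^esub> \<one>\<^bsub>R\<^esub>"] by simp
qed (use assms in auto)

lemma span_of_min: "submodule N R M ==> E \<subseteq> N ==> span_of R M E \<subseteq> N"
 by (auto simp: span_of_def)

lemma span_of_incl: "E \<subseteq> span_of R M E" by (auto simp: span_of_def)

lemma span_of_submodule:
 assumes "E \<subseteq> carrier M"
 shows "submodule (span_of R M E) R M"
proof (rule submodule_criterion)
 show "span_of R M E \<subseteq> carrier M" by (rule span_of_min[OF carrier_is_submodule assms])
qed (auto simp: span_of_def intro: submodule_closed)

lemma span_of_insert:
 assumes "g \<in> carrier M" "E \<subseteq> carrier M" "x \<in> span_of R M (insert g E)"
 obtains a w where "a \<in> carrier R" "w \<in> span_of R M E" "x = a \<odot>\<^bsub>M\<^esub> g \<oplus>\<^bsub>M\<^esub> w"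
proof -
 note S = submodule_closed[OF span_of_submodule[OF assms(2)]]
 define N where "N = {a \<odot>\<^bsub>M\<^esub> g \<oplus>\<^bsub>M\<^esub> w | a w. a \<in> carrier R \<and> w \<in> span_of R M E}"
 have mem: "a \<odot>\<^bsub>M\<^esub> g \<oplus>\<^bsub>M\<^esub> w \<in> N" if "a \<in> carrier R" "w \<in> span_of R M E" for a w using that by (auto simp: N_def)
 have "submodule N R M"
 proof (rule submodule_criterion)
  show "N \<subseteq> carrier M" using assms(1) S(1) by (auto simp: N_def)
  show "\<zero>\<^bsub>M\<^esub> \<in> N" using mem[OF R.zero_closed S(2)] assms(1) by simp
 next
  fix x y assume "x \<in> N" "y \<in> N"
  then obtain a w b v where xy: "x = a \<odot>\<^bsub>M\<^esub> g \<oplus>\<^bsub>M\<^esub> w" "y = b \<odot>\<^bsub>M\<^esub> g \<oplus>\<^bsub>M\<^esub> v" "a \<in> carrier R" "b \<in> carrier R"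
   "w \<in> span_of R M E" "v \<in> span_of R M E" by (auto simp: N_def)
  moreover have "w \<in> carrier M" "v \<in> carrier M" using xy S(1) by auto
  ultimately have "x \<oplus>\<^bsub>M\<^esub> y = (a \<oplus>\<^bsub>R\<^esub> b) \<odot>\<^bsub>M\<^esub> g \<oplus>\<^bsub>M\<^esub> (w \<oplus>\<^bsub>M\<^esub> v)" using assms(1) by (simp add: smult_l_distr M.a_ac)
  then show "x \<oplus>\<^bsub>M\<^esub> y \<in> N" using mem[OF _ S(3)] xy by auto
 next
  fix c x assume c: "c \<in> carrier R" "x \<in> N"
  then obtain a w where x: "x = a \<odot>\<^bsub>M\<^esub> g \<oplus>\<^bsub>M\<^esub> w" "a \<in> carrier R" "w \<in> span_of R M E" by (auto simp: N_def)
  moreover have "w \<in> carrier M" using x S(1) by auto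
  ultimately have "c \<odot>\<^bsub>M\<^esub> x = (c \<otimes>\<^bsub>R\<^esub> a) \<odot>\<^bsub>M\<^esub> g \<oplus>\<^bsub>M\<^esub> c \<odot>\<^bsub>M\<^esub> w" using c assms(1) by (simp add: smult_r_distr smult_assoc1)
  then show "c \<odot>\<^bsub>M\<^esub> x \<in> N" using mem[OF _ S(4)] x c by auto
 qed
 moreover have "insert g E \<subseteq> N"
 proof -
  have "g \<in> N" using mem[OF R.one_closed S(2)] assms(1) by simp
  moreover have "w \<in> N" if "w \<in> E" for w
  proof -
   have "w \<in> span_of R M E" using that span_of_incl by blast
   then show ?thesis using mem[OF R.zero_closed, of w] S(1) assms(1) by auto
  qed
  ultimately show ?thesis by blast
 qed
 ultimately have "x \<in> N" using span_of_min assms(3) by blast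
 then show ?thesis using that by (auto simp: N_def)
qed

text \<open>Induction on the generators of the ambient span. The coefficients of g that occur in N
  form an ideal, finitely generated by assumption; lifts of its generators, together with generators
  of the part of N in the span of E, generate N. To see this, the coefficient ideals of N and of its
  intersection with a submodule N' containing these elements are compared.\<close>

lemma noetherian_submodule:
 assumes noeth: "\<And>J. ideal J R ==> \<exists>G. finite G \<and> G \<subseteq> J \<and> (\<forall>J'. ideal J' R \<and> G \<subseteq> J' \<longrightarrow> J \<subseteq> J')"
  and E: "finite E" "E \<subseteq> carrier M" and N: "submodule N R M" "N \<subseteq> span_of R M E"
 shows "\<exists>G. finite G \<and> G \<subseteq> N \<and> N \<subseteq> span_of R M G"
 using E N
proof (induction E arbitrary: N rule: finite_induct)
 case empty
 have "submodule {\<zero>\<^bsub>M\<^esub>} R M" by (rule submodule_criterion) auto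
 then have "N \<subseteq> {\<zero>\<^bsub>M\<^esub>}" using empty span_of_min[of "{\<zero>\<^bsub>M\<^esub>}" "{}"] by blast
 then have "N \<subseteq> span_of R M {}" using submodule_closed(2)[OF span_of_submodule[of "{}"]] by auto
 then show ?case by blast
next
 case (insert g E)
 then have g: "g \<in> carrier M" and E: "E \<subseteq> carrier M" by auto
 let ?S = "span_of R M E"
 note S = submodule_closed[OF span_of_submodule[OF E]]
 define coef where "coef N' = {a \<in> carrier R. \<exists>w\<in>?S. a \<odot>\<^bsub>M\<^esub> g \<oplus>\<^bsub>M\<^esub> w \<in> N'}" for N'
 have coef_ideal: "ideal (coef N') R" if N': "submodule N' R M" for N'
 proof (rule R.ideal_criterion)
  note c = submodule_closed[OF N']
  show "coef N' \<subseteq> carrier R" by (auto simp: coef_def)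
  show "\<zero>\<^bsub>R\<^esub> \<in> coef N'" using S(2) c(2) g by (auto simp: coef_def intro!: bexI[of _ "\<zero>\<^bsub>M\<^esub>"])
 next
  note c = submodule_closed[OF N']
  fix a b assume "a \<in> coef N'" "b \<in> coef N'"
  then obtain w v where wv: "a \<in> carrier R" "b \<in> carrier R" "w \<in> ?S" "v \<in> ?S" "a \<odot>\<^bsub>M\<^esub> g \<oplus>\<^bsub>M\<^esub> w \<in> N'" "b \<odot>\<^bsub>M\<^esub> g \<oplus>\<^bsub>M\<^esub> v \<in> N'"
   by (auto simp: coef_def)
  moreover have "w \<in> carrier M" "v \<in> carrier M" using wv S(1) by auto
  ultimately have "(a \<odot>\<^bsub>M\<^esub> g \<oplus>\<^bsub>M\<^esub> w) \<oplus>\<^bsub>M\<^esub> (b \<odot>\<^bsub>M\<^esub> g \<oplus>\<^bsub>M\<^esub> v) = (a \<oplus>\<^bsub>R\<^esub> b) \<odot>\<^bsub>M\<^esub> g \<oplus>\<^bsub>M\<^esub> (w \<oplus>\<^bsub>M\<^esub> v)"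
   using g by (simp add: smult_l_distr M.a_ac)
  then have "(a \<oplus>\<^bsub>R\<^esub> b) \<odot>\<^bsub>M\<^esub> g \<oplus>\<^bsub>M\<^esub> (w \<oplus>\<^bsub>M\<^esub> v) \<in> N'" using c(3) wv by metis
  then show "a \<oplus>\<^bsub>R\<^esub> b \<in> coef N'" using wv S(3) by (auto simp: coef_def)
 next
  note c = submodule_closed[OF N']
  fix r a assume r: "r \<in> carrier R" "a \<in> coef N'"
  then obtain w where w: "a \<in> carrier R" "w \<in> ?S" "a \<odot>\<^bsub>M\<^esub> g \<oplus>\<^bsub>M\<^esub> w \<in> N'" by (auto simp: coef_def)
  moreover have "w \<in> carrier M" using w S(1) by auto
  ultimately have "r \<odot>\<^bsub>M\<^esub> (a \<odot>\<^bsub>M\<^esub> g \<oplus>\<^bsub>M\<^esub> w) = (r \<otimes>\<^bsub>R\<^esub> a) \<odot>\<^bsub>M\<^esub> g \<oplus>\<^bsub>M\<^esub> r \<odot>\<^bsub>M\<^esub> w"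
   using g r by (simp add: smult_r_distr smult_assoc1)
  then have "(r \<otimes>\<^bsub>R\<^esub> a) \<odot>\<^bsub>M\<^esub> g \<oplus>\<^bsub>M\<^esub> r \<odot>\<^bsub>M\<^esub> w \<in> N'" using c(4) w r by metis
  then show "r \<otimes>\<^bsub>R\<^esub> a \<in> coef N'" using w r S(4) by (auto simp: coef_def)
 qed
 obtain J where J: "finite J" "J \<subseteq> coef N" "\<And>J'. ideal J' R ==> J \<subseteq> J' ==> coef N \<subseteq> J'"
  using noeth[OF coef_ideal[OF insert(5)]] by metis
 have "\<exists>w. w \<in> ?S \<and> a \<odot>\<^bsub>M\<^esub> g \<oplus>\<^bsub>M\<^esub> w \<in> N" if "a \<in> J" for a using that J(2) by (auto simp: coef_def)
 then obtain w where w: "\<And>a. a \<in> J ==> w a \<in> ?S \<and> a \<odot>\<^bsub>M\<^esub> g \<oplus>\<^bsub>M\<^esub> w a \<in> N" by metis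
 note Nc = submodule_closed[OF insert(5)]
 have "submodule (N \<inter> ?S) R M"
  by (rule submodule_criterion) (use Nc S in auto)
 then obtain G where G: "finite G" "G \<subseteq> N \<inter> ?S" "N \<inter> ?S \<subseteq> span_of R M G"
  using insert(3)[OF E, of "N \<inter> ?S"] by blast
 define H where "H = (\<lambda>a. a \<odot>\<^bsub>M\<^esub> g \<oplus>\<^bsub>M\<^esub> w a) ` J \<union> G"
 have H: "finite H" "H \<subseteq> N" using J(1) G w by (auto simp: H_def)
 have "N \<subseteq> N'" if N': "submodule N' R M" "H \<subseteq> N'" for N'
 proof
  fix n assume n: "n \<in> N"
  note c' = submodule_closed[OF N'(1)]
  have NN: "submodule (N \<inter> N') R M" by (rule submodule_criterion) (use Nc c' in auto)
  have "coef N \<subseteq> coef (N \<inter> N')"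
  proof (rule J(3)[OF coef_ideal[OF NN]])
   show "J \<subseteq> coef (N \<inter> N')"
   proof
    fix a assume a: "a \<in> J"
    then have "a \<odot>\<^bsub>M\<^esub> g \<oplus>\<^bsub>M\<^esub> w a \<in> N \<inter> N'" using w N'(2) by (auto simp: H_def)
    moreover have "a \<in> carrier R" using a J(2) by (auto simp: coef_def)
    ultimately show "a \<in> coef (N \<inter> N')" using w a unfolding coef_def by blast
   qed
  qed
  obtain a v where av: "a \<in> carrier R" "v \<in> ?S" "n = a \<odot>\<^bsub>M\<^esub> g \<oplus>\<^bsub>M\<^esub> v"
   using span_of_insert[OF g E] n insert(6) by blast
  then have "a \<in> coef N" using n by (auto simp: coef_def)
  then have "a \<in> coef (N \<inter> N')" using \<open>coef N \<subseteq> coef (N \<inter> N')\<close> by blast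
  then obtain v' where v': "v' \<in> ?S" "a \<odot>\<^bsub>M\<^esub> g \<oplus>\<^bsub>M\<^esub> v' \<in> N" "a \<odot>\<^bsub>M\<^esub> g \<oplus>\<^bsub>M\<^esub> v' \<in> N'" by (auto simp: coef_def)
  have vM: "v \<in> carrier M" "v' \<in> carrier M" using av v' S(1) by auto
  have eq: "n \<ominus>\<^bsub>M\<^esub> (a \<odot>\<^bsub>M\<^esub> g \<oplus>\<^bsub>M\<^esub> v') = v \<ominus>\<^bsub>M\<^esub> v'"
   unfolding av(3) a_minus_def using vM g av(1) by (simp add: M.minus_add M.a_ac M.r_neg1 M.r_neg)
  have "v \<ominus>\<^bsub>M\<^esub> v' \<in> N \<inter> ?S" using Nc(5)[OF n v'(2)] S(5)[OF av(2) v'(1)] unfolding eq by blast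
  then have "v \<ominus>\<^bsub>M\<^esub> v' \<in> N'" using G(3) span_of_min[OF N'(1), of G] N'(2) by (auto simp: H_def)
  then have "(v \<ominus>\<^bsub>M\<^esub> v') \<oplus>\<^bsub>M\<^esub> (a \<odot>\<^bsub>M\<^esub> g \<oplus>\<^bsub>M\<^esub> v') \<in> N'" using c'(3) v'(3) by blast
  moreover have "n \<in> carrier M" "a \<odot>\<^bsub>M\<^esub> g \<oplus>\<^bsub>M\<^esub> v' \<in> carrier M" using n v'(2) Nc(1) by auto
  then have "(n \<ominus>\<^bsub>M\<^esub> (a \<odot>\<^bsub>M\<^esub> g \<oplus>\<^bsub>M\<^esub> v')) \<oplus>\<^bsub>M\<^esub> (a \<odot>\<^bsub>M\<^esub> g \<oplus>\<^bsub>M\<^esub> v') = n"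
   by (simp add: a_minus_def M.a_assoc M.l_neg)
  then have "(v \<ominus>\<^bsub>M\<^esub> v') \<oplus>\<^bsub>M\<^esub> (a \<odot>\<^bsub>M\<^esub> g \<oplus>\<^bsub>M\<^esub> v') = n" unfolding eq .
  ultimately show "n \<in> N'" by simp
 qed
 then have "N \<subseteq> span_of R M H" unfolding span_of_def by blast
 then show ?case using H by blast
qed

text \<open>Generators are removed one at a time: the equation for g reads (1 - c) g = z with c in J
  and z in the span of the others, and 1 - c is invertible. Two elements of J are enough because the
  lemma serves regular sequences of length two.\<close>

lemma nakayama:
 assumes local: "\<And>a. a \<in> J ==> a \<in> carrier R" "\<And>a b. a \<in> J ==> b \<in> J ==> a \<oplus>\<^bsub>R\<^esub> b \<in> J"
   "\<And>r a. r \<in> carrier R ==> a \<in> J ==> a \<otimes>\<^bsub>R\<^esub> r \<in> J" "\<And>a. a \<in> J ==> \<exists>b\<in>carrier R. b \<otimes>\<^bsub>R\<^esub> (\<one>\<^bsub>R\<^esub> \<ominus>\<^bsub>R\<^esub> a) = \<one>\<^bsub>R\<^esub>"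
  and T: "submodule T R M" "finite G" "G \<subseteq> T" "T \<subseteq> span_of R M G"
  and a: "a1 \<in> J" "a2 \<in> J" and eq: "\<And>t. t \<in> T ==> \<exists>x\<in>T. \<exists>y\<in>T. t = a1 \<odot>\<^bsub>M\<^esub> x \<oplus>\<^bsub>M\<^esub> a2 \<odot>\<^bsub>M\<^esub> y"
 shows "T = {\<zero>\<^bsub>M\<^esub>}"
proof -
 note Tc = submodule_closed[OF T(1)]
 have span_T: "span_of R M E = T" if "E \<subseteq> T" "T \<subseteq> span_of R M E" for E
  using that span_of_min[OF T(1)] by blast
 have "finite G ==> G \<subseteq> T ==> T \<subseteq> span_of R M G ==> T \<subseteq> span_of R M {}" for G
 proof (induction G rule: finite_induct)
  case (insert g E)
  have gM: "g \<in> carrier M" and EM: "E \<subseteq> carrier M" using insert Tc(1) by auto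
  note S = submodule_closed[OF span_of_submodule[OF EM]]
  obtain x y where xy: "x \<in> T" "y \<in> T" "g = a1 \<odot>\<^bsub>M\<^esub> x \<oplus>\<^bsub>M\<^esub> a2 \<odot>\<^bsub>M\<^esub> y" using eq[of g] insert by auto
  obtain p w where pw: "p \<in> carrier R" "w \<in> span_of R M E" "x = p \<odot>\<^bsub>M\<^esub> g \<oplus>\<^bsub>M\<^esub> w"
   using span_of_insert[OF gM EM, of x] xy insert by blast
  obtain q v where qv: "q \<in> carrier R" "v \<in> span_of R M E" "y = q \<odot>\<^bsub>M\<^esub> g \<oplus>\<^bsub>M\<^esub> v"
   using span_of_insert[OF gM EM, of y] xy insert by blast
  have wv: "w \<in> carrier M" "v \<in> carrier M" using pw qv S(1) by auto
  define c where "c = a1 \<otimes>\<^bsub>R\<^esub> p \<oplus>\<^bsub>R\<^esub> a2 \<otimes>\<^bsub>R\<^esub> q"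
  define z where "z = a1 \<odot>\<^bsub>M\<^esub> w \<oplus>\<^bsub>M\<^esub> a2 \<odot>\<^bsub>M\<^esub> v"
  have aR: "a1 \<in> carrier R" "a2 \<in> carrier R" using a local(1) by auto
  have cJ: "c \<in> J" unfolding c_def using local a pw qv by blast
  have cR: "c \<in> carrier R" using local(1)[OF cJ] .
  have zS: "z \<in> span_of R M E" unfolding z_def using S(3,4) aR pw qv by blast
  have zM: "z \<in> carrier M" using zS S(1) by auto
  have "g = c \<odot>\<^bsub>M\<^esub> g \<oplus>\<^bsub>M\<^esub> z"
   using xy(3) aR pw(1) qv(1) gM wv unfolding pw(3) qv(3) c_def z_def
   by (simp add: smult_r_distr smult_l_distr smult_assoc1 M.a_ac)
  then have gz: "(\<one>\<^bsub>R\<^esub> \<ominus>\<^bsub>R\<^esub> c) \<odot>\<^bsub>M\<^esub> g = z"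
   using cR gM zM by (simp add: a_minus_def smult_l_distr smult_l_minus) (metis M.a_comm M.minus_closed M.r_neg2 M.a_inv_closed smult_closed M.a_assoc M.r_neg1)
  obtain b where b: "b \<in> carrier R" "b \<otimes>\<^bsub>R\<^esub> (\<one>\<^bsub>R\<^esub> \<ominus>\<^bsub>R\<^esub> c) = \<one>\<^bsub>R\<^esub>" using local(4)[OF cJ] by blast
  have "g = b \<odot>\<^bsub>M\<^esub> z" unfolding gz[symmetric] using b cR gM by (simp flip: smult_assoc1)
  then have "g \<in> span_of R M E" using S(4)[OF b(1) zS] by simp
  then have "insert g E \<subseteq> span_of R M E" using span_of_incl by blast
  then have "span_of R M (insert g E) \<subseteq> span_of R M E" by (rule span_of_min[OF span_of_submodule[OF EM]])
  then show ?case using insert by blast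
 qed simp
 then have "T \<subseteq> span_of R M {}" using T by blast
 moreover have "submodule {\<zero>\<^bsub>M\<^esub>} R M" by (rule submodule_criterion) auto
 then have "span_of R M {} \<subseteq> {\<zero>\<^bsub>M\<^esub>}" by (rule span_of_min) simp
 ultimately show ?thesis using Tc(2) by blast
qed

end

section \<open>Maximal Cohen--Macaulay modules over A\<close>

lemma class_A_cases:
 fixes j :: "'k::field fps fps fps set"
 assumes "j \<in> cA"
 obtains f g where "j = class_A (emb f + var_y * emb g)"
proof -
 obtain F where F: "j = class_A F" using assms carrier_ring_A by blast
 obtain f g Q where "F = emb f + var_y * emb g + rel * Q" using weierstrass_division by blast
 then have "class_A F = class_A (emb f + var_y * emb g)" unfolding class_A_eq_iff by simp
 then show ?thesis using that F by blast
qed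

text \<open>A = S + y S with S = k[[x,z]]. An ideal J is controlled by two ideals of S: its elements
  without y (\<open>J0\<close>) and its coefficients of y (\<open>J1\<close>). Both are finitely
  generated, and lifting the generators of \<open>J1\<close> gives generators of J.\<close>

lemma ring_A_noetherian:
 fixes J :: "'k::field fps fps fps set set"
 assumes J: "ideal J ring_A"
 shows "\<exists>G. finite G \<and> G \<subseteq> J \<and> (\<forall>J'. ideal J' ring_A \<and> G \<subseteq> J' \<longrightarrow> J \<subseteq> J')"
proof -
 define J0 where "J0 K = {f :: 'k fps fps. class_A (emb f) \<in> K}" for K
 define J1 where "J1 K = {g :: 'k fps fps. \<exists>f. class_A (emb f + var_y * emb g) \<in> K}" for K
 have cl: "class_A (F + G) \<in> K" if "ideal K ring_A" "class_A F \<in> K" "class_A G \<in> K" for K and F G :: "'k fps fps fps"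
  using ideal_closed(3)[OF that] by (simp add: class_A_simps)
 have cm: "class_A (F * G) \<in> K" if "ideal K ring_A" "class_A G \<in> K" for K and F G :: "'k fps fps fps"
  using ideal_closed(4)[OF that(1) class_A_simps(1) that(2), of F] by (simp add: class_A_simps)
 have c0: "class_A 0 \<in> K" if "ideal K ring_A" for K :: "'k fps fps fps set set"
  using ideal_closed(2)[OF that] by (simp add: class_A_simps)
 have i0: "ideal_set (J0 K)" if K: "ideal K ring_A" for K
  using cl[OF K] cm[OF K] c0[OF K] by (auto simp: ideal_set_def J0_def)
 have i1: "ideal_set (J1 K)" if K: "ideal K ring_A" for K
  unfolding ideal_set_def
 proof (intro conjI ballI allI)
  have "class_A (emb 0 + var_y * emb 0) \<in> K" using c0[OF K] by simp
  then show "0 \<in> J1 K" unfolding J1_def by blast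
 next
  fix a b assume "a \<in> J1 K" "b \<in> J1 K"
  then obtain f f' where "class_A (emb f + var_y * emb a) \<in> K" "class_A (emb f' + var_y * emb b) \<in> K" by (auto simp: J1_def)
  from cl[OF K this] have "class_A (emb (f + f') + var_y * emb (a + b)) \<in> K" by (simp add: algebra_simps)
  then show "a + b \<in> J1 K" unfolding J1_def by blast
 next
  fix r a assume "a \<in> J1 K"
  then obtain f where "class_A (emb f + var_y * emb a) \<in> K" by (auto simp: J1_def)
  from cm[OF K this, of "emb r"] have "class_A (emb (r * f) + var_y * emb (r * a)) \<in> K" by (simp add: algebra_simps)
  then show "r * a \<in> J1 K" unfolding J1_def by blast
 qed
 obtain G0 where G0: "finite G0" "G0 \<subseteq> J0 J" "\<And>L'. ideal_set L' ==> G0 \<subseteq> L' ==> J0 J \<subseteq> L'"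
  using ideal_set_finitely_generated[OF i0[OF J]] by metis
 obtain G1 where G1: "finite G1" "G1 \<subseteq> J1 J" "\<And>L'. ideal_set L' ==> G1 \<subseteq> L' ==> J1 J \<subseteq> L'"
  using ideal_set_finitely_generated[OF i1[OF J]] by metis
 have "\<exists>f. class_A (emb f + var_y * emb g) \<in> J" if "g \<in> G1" for g using G1(2) that by (auto simp: J1_def)
 then obtain f where f: "\<And>g. g \<in> G1 ==> class_A (emb (f g) + var_y * emb g) \<in> J" by metis
 define G where "G = (\<lambda>g. class_A (emb g)) ` G0 \<union> (\<lambda>g. class_A (emb (f g) + var_y * emb g)) ` G1"
 have "finite G" "G \<subseteq> J" using G0 G1(1) f by (auto simp: G_def J0_def)
 moreover have "J \<subseteq> J'" if J': "ideal J' ring_A" "G \<subseteq> J'" for J'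
 proof
  fix j assume j: "j \<in> J"
  then have "j \<in> cA" using ideal_closed(1)[OF J] by blast
  then obtain a b where ab: "j = class_A (emb a + var_y * emb b)" using class_A_cases by blast
  have JJ: "ideal (J \<inter> J') ring_A"
   by (rule cring.ideal_criterion[OF cring_ring_A]) (use ideal_closed[OF J] ideal_closed[OF J'(1)] in auto)
  have "G1 \<subseteq> J1 (J \<inter> J')"
  proof
   fix g assume "g \<in> G1"
   then have "class_A (emb (f g) + var_y * emb g) \<in> J \<inter> J'" using f J'(2) by (auto simp: G_def)
   then show "g \<in> J1 (J \<inter> J')" unfolding J1_def by blast
  qed
  then have "b \<in> J1 (J \<inter> J')" using G1(3)[OF i1[OF JJ]] j ab by (auto simp: J1_def)
  then obtain a' where a': "class_A (emb a' + var_y * emb b) \<in> J" "class_A (emb a' + var_y * emb b) \<in> J'" by (auto simp: J1_def)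
  have "class_A ((emb a + var_y * emb b) + (- 1) * (emb a' + var_y * emb b)) \<in> J"
   using cl[OF J _ cm[OF J a'(1)]] j ab by blast
  then have "a - a' \<in> J0 J" by (simp add: J0_def)
  moreover have "G0 \<subseteq> J0 J'" using J'(2) by (auto simp: G_def J0_def)
  ultimately have "a - a' \<in> J0 J'" using G0(3)[OF i0[OF J'(1)]] by blast
  then have "class_A (emb (a - a')) \<in> J'" by (simp add: J0_def)
  from cl[OF J'(1) this a'(2)] show "j \<in> J'" by (simp add: ab)
 qed
 ultimately show ?thesis by blast
qed

lemma image_A: "A_to_R ` cA = (Asub :: 'k::field fps fps set)"
 using bij_A_to_R unfolding bij_betw_def by blast

lemma A_to_R_neg:
 fixes x y :: "'k::field fps fps fps set"
 assumes "x \<in> cA"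
 shows "A_to_R (\<ominus>\<^bsub>ring_A\<^esub> x) = - A_to_R x"
  "y \<in> cA ==> A_to_R (y \<ominus>\<^bsub>ring_A\<^esub> x) = A_to_R y - A_to_R x"
proof -
 interpret cring "ring_A :: 'k fps fps fps set ring" by simp
 have "A_to_R (\<ominus>\<^bsub>ring_A\<^esub> x) + A_to_R x = 0"
  using A_to_R_simps(2)[of "\<ominus>\<^bsub>ring_A\<^esub> x" x] assms by (simp only: a_inv_closed l_neg A_to_R_simps(4))
 then show 1: "A_to_R (\<ominus>\<^bsub>ring_A\<^esub> x) = - A_to_R x" by (rule eq_neg_iff_add_eq_0[THEN iffD2])
 show "y \<in> cA ==> A_to_R (y \<ominus>\<^bsub>ring_A\<^esub> x) = A_to_R y - A_to_R x"
  using assms 1 by (simp add: a_minus_def)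
qed

lemma non_unit_A: "a \<in> cA - Units ring_A \<longleftrightarrow> a \<in> cA \<and> A_to_R a $ 0 $ 0 = 0"
proof -
 have "a \<in> Units ring_A \<longleftrightarrow> A_to_R a $ 0 $ 0 \<noteq> 0" if a: "a \<in> cA"
 proof
  assume "a \<in> Units ring_A"
  then obtain b where "b \<in> cA" "a \<otimes>\<^bsub>ring_A\<^esub> b = \<one>\<^bsub>ring_A\<^esub>" by (auto simp: Units_def)
  then have "A_to_R a * A_to_R b = 1" using a by (metis A_to_R_simps(1,3))
  from arg_cong[OF this, of "\<lambda>r. r $ 0 $ 0"] show "A_to_R a $ 0 $ 0 \<noteq> 0" by auto
 next
  assume "A_to_R a $ 0 $ 0 \<noteq> 0"
  then obtain b where b: "b \<in> Asub" "A_to_R a * b = 1" using Asub_unit A_to_R_simps(6)[OF a] by blast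
  then obtain c where c: "c \<in> cA" "A_to_R c = b" using ex_A by blast
  have "a \<otimes>\<^bsub>ring_A\<^esub> c = \<one>\<^bsub>ring_A\<^esub>" "c \<otimes>\<^bsub>ring_A\<^esub> a = \<one>\<^bsub>ring_A\<^esub>"
   using A_to_R_inj[of "a \<otimes>\<^bsub>ring_A\<^esub> c" "\<one>\<^bsub>ring_A\<^esub>"] A_to_R_inj[of "c \<otimes>\<^bsub>ring_A\<^esub> a" "\<one>\<^bsub>ring_A\<^esub>"] a b c
    cring.cring_simprules(5,6)[OF cring_ring_A] by (auto simp: mult.commute)
  then show "a \<in> Units ring_A" using a c by (auto simp: Units_def)
 qed
 then show ?thesis by blast
qed

locale A_module =
 fixes M :: "('k::field fps fps fps set, 'm) module"
 assumes module_A: "Module.module ring_A M"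
begin

sublocale M: Module.module ring_A M by (rule module_A)

definition linear_R :: "('m \<Rightarrow> 'k fps fps) \<Rightarrow> bool" where
 "linear_R \<phi> \<longleftrightarrow> (\<forall>x\<in>carrier M. \<forall>y\<in>carrier M. \<phi> (x \<oplus>\<^bsub>M\<^esub> y) = \<phi> x + \<phi> y) \<and>
   (\<forall>a\<in>cA. \<forall>x\<in>carrier M. \<phi> (a \<odot>\<^bsub>M\<^esub> x) = A_to_R a * \<phi> x)"

lemma linear_RD:
 assumes "linear_R \<phi>"
 shows "x \<in> carrier M ==> y \<in> carrier M ==> \<phi> (x \<oplus>\<^bsub>M\<^esub> y) = \<phi> x + \<phi> y"
  "a \<in> cA ==> x \<in> carrier M ==> \<phi> (a \<odot>\<^bsub>M\<^esub> x) = A_to_R a * \<phi> x"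
  "\<phi> \<zero>\<^bsub>M\<^esub> = 0" "x \<in> carrier M ==> y \<in> carrier M ==> \<phi> (x \<ominus>\<^bsub>M\<^esub> y) = \<phi> x - \<phi> y"
proof -
 show add: "\<phi> (x \<oplus>\<^bsub>M\<^esub> y) = \<phi> x + \<phi> y" if "x \<in> carrier M" "y \<in> carrier M" for x y
  using assms that by (auto simp: linear_R_def)
 show "a \<in> cA ==> x \<in> carrier M ==> \<phi> (a \<odot>\<^bsub>M\<^esub> x) = A_to_R a * \<phi> x" using assms by (auto simp: linear_R_def)
 have "\<phi> \<zero>\<^bsub>M\<^esub> + 0 = \<phi> \<zero>\<^bsub>M\<^esub> + \<phi> \<zero>\<^bsub>M\<^esub>"
  using add[OF M.M.zero_closed M.M.zero_closed] unfolding M.M.l_zero[OF M.M.zero_closed] by (simp only: add_0_right)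
 then show "\<phi> \<zero>\<^bsub>M\<^esub> = 0" by (simp only: add_left_cancel)
 assume xy: "x \<in> carrier M" "y \<in> carrier M"
 have "(x \<ominus>\<^bsub>M\<^esub> y) \<oplus>\<^bsub>M\<^esub> y = x" using xy by (simp add: a_minus_def M.M.a_assoc M.M.l_neg)
 then show "\<phi> (x \<ominus>\<^bsub>M\<^esub> y) = \<phi> x - \<phi> y" using add[of "x \<ominus>\<^bsub>M\<^esub> y" y] xy by simp
qed

lemma linear_R_inj:
 assumes "linear_R \<phi>" "\<And>x. x \<in> carrier M ==> \<phi> x = 0 ==> x = \<zero>\<^bsub>M\<^esub>"
 shows "inj_on \<phi> (carrier M)"
proof (rule inj_onI)
 fix x y assume xy: "x \<in> carrier M" "y \<in> carrier M" "\<phi> x = \<phi> y"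
 then have "x \<ominus>\<^bsub>M\<^esub> y = \<zero>\<^bsub>M\<^esub>" using assms(2)[of "x \<ominus>\<^bsub>M\<^esub> y"] linear_RD(4)[OF assms(1)] by simp
 moreover have "(x \<ominus>\<^bsub>M\<^esub> y) \<oplus>\<^bsub>M\<^esub> y = x" using xy by (simp add: a_minus_def M.M.a_assoc M.M.l_neg)
 ultimately show "x = y" using xy by simp
qed

lemma seq_multiples_single:
 assumes "a \<in> cA"
 shows "seq_multiples M [a] = {a \<odot>\<^bsub>M\<^esub> x | x. x \<in> carrier M}"
proof -
 have "a \<odot>\<^bsub>M\<^esub> x \<oplus>\<^bsub>M\<^esub> \<zero>\<^bsub>M\<^esub> = a \<odot>\<^bsub>M\<^esub> x" if "x \<in> carrier M" for x using that assms by simp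
 then have "{a \<odot>\<^bsub>M\<^esub> x \<oplus>\<^bsub>M\<^esub> \<zero>\<^bsub>M\<^esub> | x. x \<in> carrier M} = {a \<odot>\<^bsub>M\<^esub> x | x. x \<in> carrier M}"
  unfolding Setcompr_eq_image by (intro image_cong refl)
 then show ?thesis by simp
qed

lemma image_A_stable:
 assumes "linear_R \<phi>"
 shows "A_stable (\<phi> ` carrier M)"
 unfolding A_stable_def
proof (intro conjI ballI)
 show "0 \<in> \<phi> ` carrier M" using linear_RD(3)[OF assms] M.M.zero_closed by (metis imageI)
next
 fix a b :: "'k fps fps" assume "a \<in> \<phi> ` carrier M" "b \<in> \<phi> ` carrier M"
 then obtain x y where "a = \<phi> x" "b = \<phi> y" "x \<in> carrier M" "y \<in> carrier M" by blast
 then show "a + b \<in> \<phi> ` carrier M" using linear_RD(1)[OF assms, symmetric] by auto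
next
 fix r a :: "'k fps fps" assume r: "r \<in> Asub" "a \<in> \<phi> ` carrier M"
 then obtain x where x: "a = \<phi> x" "x \<in> carrier M" by blast
 obtain s where s: "s \<in> cA" "A_to_R s = r" using ex_A r by blast
 then have "\<phi> (s \<odot>\<^bsub>M\<^esub> x) = r * a" using linear_RD(2)[OF assms] x by simp
 then show "r * a \<in> \<phi> ` carrier M" using s x by (metis M.smult_closed imageI)
qed

text \<open>The regular sequence is x, z. If z m lies in x M, both restrictions of
  \<open>\<phi> m\<close> vanish, so \<open>\<phi> m\<close> = x r; then x r and z r lie in the
  image and saturation gives r. If x M + z M were all of M, induction on the degree would kill every
  coefficient of every element of the image.\<close>

lemma depth_ge_2:
 assumes lin: "linear_R \<phi>" and inj: "inj_on \<phi> (carrier M)" and sat: "saturated (\<phi> ` carrier M)"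
  and nz: "x0 \<in> carrier M" "\<phi> x0 \<noteq> 0"
 shows "2 \<le> depth (cA - Units ring_A) M"
proof -
 define xA :: "'k fps fps fps set" where "xA = class_A var_x"
 define zA :: "'k fps fps fps set" where "zA = class_A var_z"
 have XZ: "xA \<in> cA" "zA \<in> cA" "A_to_R xA = xx" "A_to_R zA = zz"
  by (auto simp: xA_def zA_def class_A_simps)
 have nu: "set [xA, zA] \<subseteq> cA - Units ring_A"
 proof -
  have "xA \<in> cA - Units ring_A" "zA \<in> cA - Units ring_A"
   unfolding non_unit_A XZ(3,4) using XZ(1,2) by simp_all
  then show ?thesis by simp
 qed
 note lr = linear_RD[OF lin]
 note sX = seq_multiples_single[OF XZ(1)]
 have sXZ: "seq_multiples M [xA, zA] = {xA \<odot>\<^bsub>M\<^esub> x \<oplus>\<^bsub>M\<^esub> zA \<odot>\<^bsub>M\<^esub> y | x y. x \<in> carrier M \<and> y \<in> carrier M}"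
  using seq_multiples_single[OF XZ(2)] by auto
 have inj': "x = y" if "\<phi> x = \<phi> y" "x \<in> carrier M" "y \<in> carrier M" for x y using inj that by (auto simp: inj_on_def)
 have "regular_sequence M [xA, zA]"
  unfolding regular_sequence_def
 proof (intro conjI allI impI ballI)
  fix i x assume i: "i < length [xA, zA]" and x: "x \<in> carrier M" and m: "[xA, zA] ! i \<odot>\<^bsub>M\<^esub> x \<in> seq_multiples M (take i [xA, zA])"
  from i consider "i = 0" | "i = 1" by fastforce
  then show "x \<in> seq_multiples M (take i [xA, zA])"
  proof cases
   case 1
   then have "\<phi> (xA \<odot>\<^bsub>M\<^esub> x) = 0" using m lr(3) by simp
   then have "\<phi> x = \<phi> \<zero>\<^bsub>M\<^esub>" using lr(2)[OF XZ(1) x] lr(3) by (simp add: XZ)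
   then show ?thesis using inj'[OF _ x M.M.zero_closed] 1 by simp
  next
   case 2
   then have "zA \<odot>\<^bsub>M\<^esub> x \<in> seq_multiples M [xA]" using m by simp
   then obtain y where y: "y \<in> carrier M" "zA \<odot>\<^bsub>M\<^esub> x = xA \<odot>\<^bsub>M\<^esub> y" unfolding sX by blast
   then have e: "zz * \<phi> x = xx * \<phi> y" using lr(2) XZ x by metis
   have "fps_X * res_u (\<phi> x) = 0" "fps_X * res_v (\<phi> x) = 0"
    using arg_cong[OF e, of res_u] arg_cong[OF e, of res_v] by simp_all
   then have "res_u (\<phi> x) = 0" "res_v (\<phi> x) = 0" by simp_all
   then obtain r where r: "\<phi> x = xx * r" using res_eq_0_iff by (metis dvdE)
   have "xx * (zz * r) = xx * \<phi> y" using e r by (simp add: mult.left_commute)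
   then have "zz * r = \<phi> y" by simp
   then have "r \<in> \<phi> ` carrier M" using saturatedD[OF sat, of 1 r] r x y by (metis imageI power_one_right)
   then obtain w where w: "w \<in> carrier M" "r = \<phi> w" by blast
   have "\<phi> (xA \<odot>\<^bsub>M\<^esub> w) = \<phi> x" using lr(2)[OF XZ(1) w(1)] r w by (simp add: XZ)
   then have "x = xA \<odot>\<^bsub>M\<^esub> w" using inj'[of "xA \<odot>\<^bsub>M\<^esub> w" x] XZ(1) w(1) x by simp
   then have "x \<in> seq_multiples M [xA]" unfolding sX using w by blast
   then show ?thesis using 2 by simp
  qed
 next
  show "seq_multiples M [xA, zA] \<noteq> carrier M"
  proof
   assume a: "seq_multiples M [xA, zA] = carrier M"
   have "\<forall>x\<in>carrier M. \<forall>i j. i + j < n \<longrightarrow> \<phi> x $ j $ i = 0" for n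
   proof (induction n)
    case (Suc n)
    show ?case
    proof (intro ballI allI impI)
     fix x i j assume x: "x \<in> carrier M" and ij: "i + j < Suc n"
     then obtain y w where "x = xA \<odot>\<^bsub>M\<^esub> y \<oplus>\<^bsub>M\<^esub> zA \<odot>\<^bsub>M\<^esub> w" "y \<in> carrier M" "w \<in> carrier M" using a sXZ by blast
     then have e: "\<phi> x = uu * (vv * \<phi> y) + uu * \<phi> w + vv * \<phi> w" and yw: "y \<in> carrier M" "w \<in> carrier M"
      using lr XZ by (simp_all add: algebra_simps)
     have yw0: "\<phi> y $ j' $ i' = 0" "\<phi> w $ j' $ i' = 0" if "i' + j' < n" for i' j' using Suc yw that by blast+
     show "\<phi> x $ j $ i = 0"
      unfolding e using ij by (simp add: var_u_mult_nth var_v_mult_nth yw0)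
    qed
   qed simp
   then have "\<phi> x0 $ j $ i = 0" for i j using nz(1) lessI by blast
   then have "\<phi> x0 = 0" by (intro fps_ext) simp
   then show False using nz by simp
  qed
 qed
 then have "enat (length [xA, zA]) \<in> {enat (length as) |as. set as \<subseteq> cA - Units ring_A \<and> regular_sequence M as}"
  using nu by blast
 then have "enat (length [xA, zA]) \<le> depth (cA - Units ring_A) M" unfolding depth_def by (rule Sup_upper)
 then show ?thesis by (simp add: numeral_eq_enat numeral_2_eq_2)
qed

end

lemma module_restrict_scalars:
 assumes "cring A" "cring B" "f \<in> ring_hom A B"
 shows "Module.module A (restrict_scalars f B)"
proof -
 interpret B: cring B by fact
 have "abelian_group (restrict_scalars f B)"
 proof (rule abelian_groupI)
  fix x assume "x \<in> carrier (restrict_scalars f B)"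
  then have "\<ominus>\<^bsub>B\<^esub> x \<in> carrier B" "\<ominus>\<^bsub>B\<^esub> x \<oplus>\<^bsub>B\<^esub> x = \<zero>\<^bsub>B\<^esub>"
   by (auto simp: restrict_scalars_def B.l_neg)
  then show "\<exists>y\<in>carrier (restrict_scalars f B). y \<oplus>\<^bsub>restrict_scalars f B\<^esub> x = \<zero>\<^bsub>restrict_scalars f B\<^esub>"
   by (auto simp: restrict_scalars_def)
 qed (auto simp: restrict_scalars_def B.a_ac)
 then show ?thesis
  using assms ring_hom_closed[OF assms(3)] ring_hom_add[OF assms(3)] ring_hom_mult[OF assms(3)] ring_hom_one[OF assms(3)]
  by (intro moduleI) (auto simp: restrict_scalars_def B.l_distr B.r_distr B.m_assoc)
qed

lemma module_self: "cring A ==> Module.module A (self_module A)"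
 unfolding self_module_def by (rule module_restrict_scalars) (auto simp: ring_hom_def)

lemma saturated_Asub: "saturated (Asub :: 'k::field fps fps set)"
 unfolding saturated_def
proof (intro allI impI)
 fix q :: "'k fps fps" and n assume "xx ^ n * q \<in> Asub \<and> zz ^ n * q \<in> Asub"
 then have "fps_X ^ n * res_u q = fps_X ^ n * res_v q" by (simp add: Asub_def)
 then show "q \<in> Asub" by (simp add: Asub_def)
qed

text \<open>The lower bound is the depth of A as a module over itself, x, z being a regular
  sequence; no explicit chain of primes is written down.\<close>

lemma krull_dim_ring_A: "krull_dim (ring_A :: 'k::field fps fps fps set ring) = 2"
proof -
 interpret A_module "self_module (ring_A :: 'k fps fps fps set ring)"
  by (rule A_module.intro[OF module_self[OF cring_ring_A]])
 have c: "carrier (self_module (ring_A :: 'k fps fps fps set ring)) = cA"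
  by (simp add: self_module_def restrict_scalars_def)
 have "2 \<le> depth (cA - Units ring_A) (self_module (ring_A :: 'k fps fps fps set ring))"
 proof (rule depth_ge_2[of A_to_R "\<one>\<^bsub>ring_A\<^esub>"])
  show "linear_R A_to_R" unfolding linear_R_def by (simp add: self_module_def restrict_scalars_def)
  show "inj_on A_to_R (carrier (self_module (ring_A :: 'k fps fps fps set ring)))" "saturated (A_to_R ` carrier (self_module (ring_A :: 'k fps fps fps set ring)))"
   using saturated_Asub bij_A_to_R[unfolded bij_betw_def, THEN conjunct1] unfolding c image_A by simp_all
  show "\<one>\<^bsub>ring_A\<^esub> \<in> carrier (self_module (ring_A :: 'k fps fps fps set ring))" unfolding c
   using class_A_simps(1,4) by metis
 qed simp
 also have "\<dots> \<le> krull_dim (ring_A :: 'k fps fps fps set ring)"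
  by (rule depth_le_krull_dim[OF module_A]) auto
 finally show ?thesis using krull_dim_le_2 by (rule antisym[rotated])
qed

context A_module
begin

lemma mcm_iff:
 "maximal_cohen_macaulay ring_A M \<longleftrightarrow> finitely_generated ring_A M \<and> 2 \<le> depth (cA - Units ring_A) M"
proof -
 have "depth (cA - Units ring_A) M \<le> 2"
  using depth_le_krull_dim[OF module_A Diff_subset] unfolding krull_dim_ring_A .
 then have "depth (cA - Units ring_A) M = 2 \<longleftrightarrow> 2 \<le> depth (cA - Units ring_A) M" by auto
 then show ?thesis unfolding maximal_cohen_macaulay_def krull_dim_ring_A using module_A by blast
qed

lemma finitely_generated_span: "finitely_generated ring_A M \<longleftrightarrow> (\<exists>E. finite E \<and> E \<subseteq> carrier M \<and> carrier M \<subseteq> span_of ring_A M E)"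
proof -
 have "(\<forall>N. submodule N ring_A M \<and> E \<subseteq> N \<longrightarrow> N = carrier M) \<longleftrightarrow> carrier M \<subseteq> span_of ring_A M E" for E
  using M.submodule_closed(1) unfolding span_of_def by blast
 then show ?thesis by (auto simp: finitely_generated_def)
qed

lemma regular_pair:
 assumes "2 \<le> depth (cA - Units ring_A) M"
 obtains a1 a2 where "a1 \<in> cA" "a2 \<in> cA" "A_to_R a1 $ 0 $ 0 = 0" "A_to_R a2 $ 0 $ 0 = 0"
  "\<And>x. x \<in> carrier M ==> a1 \<odot>\<^bsub>M\<^esub> x = \<zero>\<^bsub>M\<^esub> ==> x = \<zero>\<^bsub>M\<^esub>"
  "\<And>x y. x \<in> carrier M ==> y \<in> carrier M ==> a2 \<odot>\<^bsub>M\<^esub> x = a1 \<odot>\<^bsub>M\<^esub> y ==> \<exists>w\<in>carrier M. x = a1 \<odot>\<^bsub>M\<^esub> w"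
  "carrier M \<noteq> {\<zero>\<^bsub>M\<^esub>}"
proof -
 have "enat 1 < Sup {enat (length as) |as. set as \<subseteq> cA - Units ring_A \<and> regular_sequence M as}"
  using assms unfolding depth_def by (rule less_le_trans[rotated]) (simp add: numeral_eq_enat)
 then obtain as where as: "length as > 1" "set as \<subseteq> cA - Units ring_A" "regular_sequence M as"
  unfolding less_Sup_iff by auto
 obtain a1 as1 where as1: "as = a1 # as1" using as(1) by (cases as) auto
 obtain a2 bs where "as1 = a2 # bs" using as(1) as1 by (cases as1) auto
 then have as': "as = a1 # a2 # bs" using as1 by simp
 have a: "a1 \<in> cA - Units ring_A" "a2 \<in> cA - Units ring_A" using as(2) as' by auto
 have reg: "x \<in> seq_multiples M (take i as)" if "i < length as" "x \<in> carrier M" "as ! i \<odot>\<^bsub>M\<^esub> x \<in> seq_multiples M (take i as)" for i x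
  using as(3) that by (auto simp: regular_sequence_def)
 have s1: "seq_multiples M [a1] = {a1 \<odot>\<^bsub>M\<^esub> x | x. x \<in> carrier M}" using a(1) by (intro seq_multiples_single) auto
 have 1: "x = \<zero>\<^bsub>M\<^esub>" if "x \<in> carrier M" "a1 \<odot>\<^bsub>M\<^esub> x = \<zero>\<^bsub>M\<^esub>" for x
  using reg[of 0 x] that by (simp add: as')
 have 2: "\<exists>w\<in>carrier M. x = a1 \<odot>\<^bsub>M\<^esub> w" if "x \<in> carrier M" "y \<in> carrier M" "a2 \<odot>\<^bsub>M\<^esub> x = a1 \<odot>\<^bsub>M\<^esub> y" for x y
 proof -
  have "a2 \<odot>\<^bsub>M\<^esub> x \<in> seq_multiples M [a1]" unfolding s1 using that by blast
  then have "x \<in> seq_multiples M [a1]" using reg[of 1 x] that(1) by (simp add: as')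
  then show ?thesis unfolding s1 by blast
 qed
 have "set as \<subseteq> cA" using as(2) by blast
 from seq_multiples_closed(1,2)[OF module_A this] have 3: "carrier M \<noteq> {\<zero>\<^bsub>M\<^esub>}"
  using as(3) by (auto simp: regular_sequence_def)
 show ?thesis using that[of a1 a2] a 1 2 3 unfolding non_unit_A by blast
qed

text \<open>If \<open>s \<noteq> 0\<close> had a nonzero kernel \<open>T\<close>, then \<open>T\<close> would inherit a regular sequence of length two,
 hence there would be a chain of primes of length two above \<open>s\<close>.\<close>

lemma mcm_torsion_free:
 assumes mcm: "maximal_cohen_macaulay ring_A M" and s: "s \<in> cA" "s \<noteq> \<zero>\<^bsub>ring_A\<^esub>"
  and x: "x \<in> carrier M" "s \<odot>\<^bsub>M\<^esub> x = \<zero>\<^bsub>M\<^esub>"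
 shows "x = \<zero>\<^bsub>M\<^esub>"
proof (rule ccontr)
 assume xn: "x \<noteq> \<zero>\<^bsub>M\<^esub>"
 obtain a1 a2 where a: "a1 \<in> cA" "a2 \<in> cA" "A_to_R a1 $ 0 $ 0 = 0" "A_to_R a2 $ 0 $ 0 = 0"
  and a1: "\<And>x. x \<in> carrier M ==> a1 \<odot>\<^bsub>M\<^esub> x = \<zero>\<^bsub>M\<^esub> ==> x = \<zero>\<^bsub>M\<^esub>"
  and a2: "\<And>x y. x \<in> carrier M ==> y \<in> carrier M ==> a2 \<odot>\<^bsub>M\<^esub> x = a1 \<odot>\<^bsub>M\<^esub> y ==> \<exists>w\<in>carrier M. x = a1 \<odot>\<^bsub>M\<^esub> w"
  by (rule regular_pair[OF mcm[unfolded mcm_iff, THEN conjunct2]]) (rule that; blast)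
 define T where "T = {x \<in> carrier M. s \<odot>\<^bsub>M\<^esub> x = \<zero>\<^bsub>M\<^esub>}"
 have sc: "s \<odot>\<^bsub>M\<^esub> (b \<odot>\<^bsub>M\<^esub> y) = b \<odot>\<^bsub>M\<^esub> (s \<odot>\<^bsub>M\<^esub> y)" if "b \<in> cA" "y \<in> carrier M" for b y
  using that s by (simp add: M.smult_assoc1[symmetric] M.R.m_comm)
 have T: "submodule T ring_A M"
  by (rule M.submodule_criterion) (use s sc in \<open>auto simp: T_def M.smult_r_distr\<close>)
 note Tc = M.submodule_closed[OF T]
 let ?MT = "M\<lparr>carrier := T\<rparr>"
 have MT: "Module.module ring_A ?MT" by (rule submodule.submodule_is_module[OF T module_A])
 obtain E where E: "finite E" "E \<subseteq> carrier M" "carrier M \<subseteq> span_of ring_A M E" using mcm mcm_iff finitely_generated_span by metis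
 obtain G where G: "finite G" "G \<subseteq> T" "T \<subseteq> span_of ring_A M G"
  using M.noetherian_submodule[OF ring_A_noetherian E(1,2) T] Tc(1) E(3) by blast
 have T0: "T \<noteq> {\<zero>\<^bsub>M\<^esub>}" using x xn by (auto simp: T_def)
 \<comment> \<open>Properness of the sequence on T is Nakayama's lemma, for which T has to be
   finitely generated.\<close>
 have notall: "\<exists>t\<in>T. \<forall>x\<in>T. \<forall>y\<in>T. t \<noteq> a1 \<odot>\<^bsub>M\<^esub> x \<oplus>\<^bsub>M\<^esub> a2 \<odot>\<^bsub>M\<^esub> y"
 proof (rule ccontr)
  assume "\<not> ?thesis"
  then have eq: "\<And>t. t \<in> T ==> \<exists>x\<in>T. \<exists>y\<in>T. t = a1 \<odot>\<^bsub>M\<^esub> x \<oplus>\<^bsub>M\<^esub> a2 \<odot>\<^bsub>M\<^esub> y" by blast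
  have "T = {\<zero>\<^bsub>M\<^esub>}"
  proof (rule M.nakayama[where J = "{b \<in> cA. A_to_R b $ 0 $ 0 = 0}", OF _ _ _ _ T G _ _ eq])
   fix b :: "'k fps fps fps set" assume "b \<in> {b \<in> cA. A_to_R b $ 0 $ 0 = 0}"
   then have b: "b \<in> cA" "A_to_R b $ 0 $ 0 = 0" by auto
   have "A_to_R (\<one>\<^bsub>ring_A\<^esub> \<ominus>\<^bsub>ring_A\<^esub> b) $ 0 $ 0 \<noteq> 0" using A_to_R_neg(2)[OF b(1) M.R.one_closed] b(2) by simp
   then have "\<one>\<^bsub>ring_A\<^esub> \<ominus>\<^bsub>ring_A\<^esub> b \<in> Units ring_A" using non_unit_A[of "\<one>\<^bsub>ring_A\<^esub> \<ominus>\<^bsub>ring_A\<^esub> b"] b(1) by auto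
   then show "\<exists>c\<in>cA. c \<otimes>\<^bsub>ring_A\<^esub> (\<one>\<^bsub>ring_A\<^esub> \<ominus>\<^bsub>ring_A\<^esub> b) = \<one>\<^bsub>ring_A\<^esub>" by (auto simp: Units_def)
  qed (use a in auto)
  then show False using T0 by simp
 qed
 interpret MT: A_module ?MT by (rule A_module.intro[OF MT])
 have s1: "seq_multiples ?MT [a1] = {a1 \<odot>\<^bsub>M\<^esub> x | x. x \<in> T}"
  using MT.seq_multiples_single[OF a(1)] by simp
 have s2: "seq_multiples ?MT [a1, a2] = {a1 \<odot>\<^bsub>M\<^esub> x \<oplus>\<^bsub>M\<^esub> a2 \<odot>\<^bsub>M\<^esub> y | x y. x \<in> T \<and> y \<in> T}"
  using MT.seq_multiples_single[OF a(2)] by auto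
 have reg: "regular_sequence ?MT [a1, a2]"
  unfolding regular_sequence_def
 proof (intro conjI allI impI ballI)
  fix i y assume i: "i < length [a1, a2]" and y: "y \<in> carrier ?MT" and m: "[a1, a2] ! i \<odot>\<^bsub>?MT\<^esub> y \<in> seq_multiples ?MT (take i [a1, a2])"
  from y have yT: "y \<in> T" "y \<in> carrier M" using Tc(1) by auto
  from i consider "i = 0" | "i = 1" by fastforce
  then show "y \<in> seq_multiples ?MT (take i [a1, a2])"
  proof cases
   case 1 then show ?thesis using m a1 yT by simp
  next
   case 2
   then have "a2 \<odot>\<^bsub>M\<^esub> y \<in> seq_multiples ?MT [a1]" using m by simp
   then obtain w where w: "w \<in> T" "a2 \<odot>\<^bsub>M\<^esub> y = a1 \<odot>\<^bsub>M\<^esub> w" unfolding s1 by blast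
   then obtain v where v: "v \<in> carrier M" "y = a1 \<odot>\<^bsub>M\<^esub> v" using a2[of y w] yT Tc(1) by blast
   \<comment> \<open>The quotient v is found in M only; as a1 is regular on M, s v vanishes and v
     lies in T.\<close>
   have "a1 \<odot>\<^bsub>M\<^esub> (s \<odot>\<^bsub>M\<^esub> v) = \<zero>\<^bsub>M\<^esub>" using yT(1) v sc[OF a(1) v(1)] by (simp add: T_def)
   then have "s \<odot>\<^bsub>M\<^esub> v = \<zero>\<^bsub>M\<^esub>" using a1 s(1) v(1) by simp
   then have "v \<in> T" using v(1) by (simp add: T_def)
   then have "y \<in> seq_multiples ?MT [a1]" unfolding s1 using v by blast
   then show ?thesis using 2 by simp
  qed
 next
  show "seq_multiples ?MT [a1, a2] \<noteq> carrier ?MT"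
  proof -
   obtain t where t: "t \<in> T" "\<forall>x\<in>T. \<forall>y\<in>T. t \<noteq> a1 \<odot>\<^bsub>M\<^esub> x \<oplus>\<^bsub>M\<^esub> a2 \<odot>\<^bsub>M\<^esub> y" using notall by blast
   then have "T \<noteq> seq_multiples ?MT [a1, a2]" unfolding s2 by blast
   then show ?thesis by (simp del: seq_multiples.simps)
  qed
 qed
 show False
 proof (rule regular_sequence_prime_chain[OF MT _ reg])
  show "set [a1, a2] \<subseteq> cA" using a by simp
  fix P assume P: "\<And>i. i \<le> length [a1, a2] ==> primeideal (P i) ring_A" "\<And>i. i < length [a1, a2] ==> P i \<subset> P (Suc i)"
   "{b \<in> cA. \<forall>x\<in>carrier ?MT. b \<odot>\<^bsub>?MT\<^esub> x = \<zero>\<^bsub>?MT\<^esub>} \<subseteq> P 0"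
  have "s \<in> P 0" using P(3) s(1) by (auto simp: T_def)
  then show False using no_prime_chain_over_nonzero[of P s] P(1,2) s(2) by simp
 qed
qed

text \<open>N is maximal among the submodules that omit m and have torsion-free quotient. By
  maximality every w is proportional to m modulo N, so M/N is torsion-free of rank one. With a
  common denominator d for finitely many generators, sending w to the unique s with d w - s m in N
  is a functional with values in A, and its value at m is d.\<close>

lemma ex_functional:
 assumes fg: "finitely_generated ring_A M"
  and tf: "\<And>s x. s \<in> cA ==> s \<noteq> \<zero>\<^bsub>ring_A\<^esub> ==> x \<in> carrier M ==> s \<odot>\<^bsub>M\<^esub> x = \<zero>\<^bsub>M\<^esub> ==> x = \<zero>\<^bsub>M\<^esub>"
  and m: "m \<in> carrier M" "m \<noteq> \<zero>\<^bsub>M\<^esub>"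
 shows "\<exists>\<phi>. linear_R \<phi> \<and> \<phi> m \<noteq> 0"
proof -
 interpret Dom: domain "ring_A :: 'k fps fps fps set ring" by (rule domain_ring_A)
 let ?Z = "\<zero>\<^bsub>ring_A\<^esub> :: 'k fps fps fps set"
 define pure where "pure N \<longleftrightarrow> submodule N ring_A M \<and> m \<notin> N \<and>
  (\<forall>s\<in>cA. \<forall>x\<in>carrier M. s \<noteq> ?Z \<longrightarrow> s \<odot>\<^bsub>M\<^esub> x \<in> N \<longrightarrow> x \<in> N)" for N
 have "\<exists>N\<in>Collect pure. \<forall>K\<in>Collect pure. N \<subseteq> K \<longrightarrow> K = N"
 proof (rule subset_Zorn_nonempty)
  have "submodule {\<zero>\<^bsub>M\<^esub>} ring_A M" by (rule M.submodule_criterion) auto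
  then have "pure {\<zero>\<^bsub>M\<^esub>}" using tf m by (auto simp: pure_def)
  then show "Collect pure \<noteq> {}" by blast
 next
  fix C assume C: "C \<noteq> {}" "subset.chain (Collect pure) C"
  have Cp: "pure N" if "N \<in> C" for N using C(2) that by (auto simp: subset.chain_def)
  have Cc: "N \<subseteq> K \<or> K \<subseteq> N" if "N \<in> C" "K \<in> C" for N K using C(2) that unfolding subset_chain_def by blast
  have sub: "submodule N ring_A M" if "N \<in> C" for N using Cp[OF that] by (simp add: pure_def)
  note c = M.submodule_closed[OF sub]
  obtain N0 where N0: "N0 \<in> C" using C(1) by blast
  have "submodule (\<Union>C) ring_A M"
  proof (rule M.submodule_criterion)
   show "\<Union>C \<subseteq> carrier M" using c(1) by blast
   show "\<zero>\<^bsub>M\<^esub> \<in> \<Union>C" using c(2)[OF N0] N0 by blast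
  next
   fix x y assume "x \<in> \<Union>C" "y \<in> \<Union>C"
   then obtain N K where NK: "N \<in> C" "K \<in> C" "x \<in> N" "y \<in> K" by blast
   from Cc[OF NK(1,2)] show "x \<oplus>\<^bsub>M\<^esub> y \<in> \<Union>C"
   proof
    assume "N \<subseteq> K" then show ?thesis using c(3)[OF NK(2), of x y] NK by blast
   next
    assume "K \<subseteq> N" then show ?thesis using c(3)[OF NK(1), of x y] NK by blast
   qed
  next
   fix a :: "'k fps fps fps set" and x assume "a \<in> cA" "x \<in> \<Union>C"
   then show "a \<odot>\<^bsub>M\<^esub> x \<in> \<Union>C" using c(4) by blast
  qed
  then have "pure (\<Union>C)" using Cp unfolding pure_def by blast
  then show "\<Union>C \<in> Collect pure" by simp
 qed
 then obtain N where N: "pure N" and max: "\<And>K. pure K ==> N \<subseteq> K ==> K = N" by blast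
 have Nsub: "submodule N ring_A M" and mN: "m \<notin> N"
  and Npure: "\<And>s x. s \<in> cA ==> x \<in> carrier M ==> s \<noteq> ?Z ==> s \<odot>\<^bsub>M\<^esub> x \<in> N ==> x \<in> N"
  using N by (auto simp: pure_def)
 note Nc = M.submodule_closed[OF Nsub]
 have comparable: "\<exists>a\<in>cA. \<exists>s\<in>cA. a \<noteq> ?Z \<and> a \<odot>\<^bsub>M\<^esub> w \<ominus>\<^bsub>M\<^esub> s \<odot>\<^bsub>M\<^esub> m \<in> N" if w: "w \<in> carrier M" for w
 proof (cases "w \<in> N")
  case True
  then have "\<one>\<^bsub>ring_A\<^esub> \<odot>\<^bsub>M\<^esub> w \<ominus>\<^bsub>M\<^esub> ?Z \<odot>\<^bsub>M\<^esub> m \<in> N" using w m Nc(2,5) by simp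
  then show ?thesis using Dom.one_not_zero by blast
 next
  case False
  \<comment> \<open>The elements having a nonzero multiple in N + A w. This submodule again has
    torsion-free quotient and is strictly larger than N, so maximality forces m into it.\<close>
  define K where "K = {x \<in> carrier M. \<exists>a\<in>cA. \<exists>b\<in>cA. a \<noteq> ?Z \<and> a \<odot>\<^bsub>M\<^esub> x \<ominus>\<^bsub>M\<^esub> b \<odot>\<^bsub>M\<^esub> w \<in> N}"
  have Kmem: "x \<in> K" if "x \<in> carrier M" "a \<in> cA" "b \<in> cA" "a \<noteq> ?Z" "a \<odot>\<^bsub>M\<^esub> x \<ominus>\<^bsub>M\<^esub> b \<odot>\<^bsub>M\<^esub> w \<in> N" for x a b
   using that unfolding K_def by blast
  have nzm: "a \<otimes>\<^bsub>ring_A\<^esub> b \<noteq> ?Z" if "a \<in> cA" "b \<in> cA" "a \<noteq> ?Z" "b \<noteq> ?Z" for a b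
   using that Dom.integral by blast
  have "submodule K ring_A M"
  proof (rule M.submodule_criterion)
   show "K \<subseteq> carrier M" by (auto simp: K_def)
   have "\<one>\<^bsub>ring_A\<^esub> \<odot>\<^bsub>M\<^esub> \<zero>\<^bsub>M\<^esub> \<ominus>\<^bsub>M\<^esub> ?Z \<odot>\<^bsub>M\<^esub> w \<in> N" using w Nc(2) Nc(5)[OF Nc(2) Nc(2)] by simp
   then show "\<zero>\<^bsub>M\<^esub> \<in> K" using Dom.one_not_zero by (intro Kmem[of _ "\<one>\<^bsub>ring_A\<^esub>" ?Z]) auto
  next
   fix x y assume "x \<in> K" "y \<in> K"
   then obtain a b a' b' where ab: "a \<in> cA" "b \<in> cA" "a \<noteq> ?Z" "a \<odot>\<^bsub>M\<^esub> x \<ominus>\<^bsub>M\<^esub> b \<odot>\<^bsub>M\<^esub> w \<in> N"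
    "a' \<in> cA" "b' \<in> cA" "a' \<noteq> ?Z" "a' \<odot>\<^bsub>M\<^esub> y \<ominus>\<^bsub>M\<^esub> b' \<odot>\<^bsub>M\<^esub> w \<in> N" and xy: "x \<in> carrier M" "y \<in> carrier M"
    unfolding K_def by blast
   have "a' \<odot>\<^bsub>M\<^esub> (a \<odot>\<^bsub>M\<^esub> x \<ominus>\<^bsub>M\<^esub> b \<odot>\<^bsub>M\<^esub> w) \<oplus>\<^bsub>M\<^esub> a \<odot>\<^bsub>M\<^esub> (a' \<odot>\<^bsub>M\<^esub> y \<ominus>\<^bsub>M\<^esub> b' \<odot>\<^bsub>M\<^esub> w) \<in> N"
    using ab Nc(3,4) by blast
   also have "a' \<odot>\<^bsub>M\<^esub> (a \<odot>\<^bsub>M\<^esub> x \<ominus>\<^bsub>M\<^esub> b \<odot>\<^bsub>M\<^esub> w) \<oplus>\<^bsub>M\<^esub> a \<odot>\<^bsub>M\<^esub> (a' \<odot>\<^bsub>M\<^esub> y \<ominus>\<^bsub>M\<^esub> b' \<odot>\<^bsub>M\<^esub> w) =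
    (a \<otimes>\<^bsub>ring_A\<^esub> a') \<odot>\<^bsub>M\<^esub> (x \<oplus>\<^bsub>M\<^esub> y) \<ominus>\<^bsub>M\<^esub> (a' \<otimes>\<^bsub>ring_A\<^esub> b \<oplus>\<^bsub>ring_A\<^esub> a \<otimes>\<^bsub>ring_A\<^esub> b') \<odot>\<^bsub>M\<^esub> w"
    using ab xy w by (simp add: a_minus_def M.smult_r_distr M.smult_l_distr M.smult_r_minus M.smult_assoc1[symmetric] M.M.minus_add M.M.a_ac M.R.m_comm)
   finally show "x \<oplus>\<^bsub>M\<^esub> y \<in> K" by (rule Kmem[rotated 4]) (use ab xy nzm in auto)
  next
   fix c :: "'k fps fps fps set" and x assume c: "c \<in> cA" and "x \<in> K"
   then obtain a b where ab: "a \<in> cA" "b \<in> cA" "a \<noteq> ?Z" "a \<odot>\<^bsub>M\<^esub> x \<ominus>\<^bsub>M\<^esub> b \<odot>\<^bsub>M\<^esub> w \<in> N" and x: "x \<in> carrier M"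
    unfolding K_def by blast
   have "c \<odot>\<^bsub>M\<^esub> (a \<odot>\<^bsub>M\<^esub> x \<ominus>\<^bsub>M\<^esub> b \<odot>\<^bsub>M\<^esub> w) \<in> N" using ab c Nc(4) by blast
   also have "c \<odot>\<^bsub>M\<^esub> (a \<odot>\<^bsub>M\<^esub> x \<ominus>\<^bsub>M\<^esub> b \<odot>\<^bsub>M\<^esub> w) = a \<odot>\<^bsub>M\<^esub> (c \<odot>\<^bsub>M\<^esub> x) \<ominus>\<^bsub>M\<^esub> (c \<otimes>\<^bsub>ring_A\<^esub> b) \<odot>\<^bsub>M\<^esub> w"
    using ab x w c by (simp add: a_minus_def M.smult_r_distr M.smult_r_minus M.smult_assoc1[symmetric] M.R.m_comm)
   finally show "c \<odot>\<^bsub>M\<^esub> x \<in> K" by (rule Kmem[rotated 4]) (use ab x c in auto)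
  qed
  moreover have "N \<subseteq> K"
  proof
   fix n assume n: "n \<in> N"
   have "\<one>\<^bsub>ring_A\<^esub> \<odot>\<^bsub>M\<^esub> n \<ominus>\<^bsub>M\<^esub> ?Z \<odot>\<^bsub>M\<^esub> w \<in> N" using n w Nc(1) Nc(5)[OF n Nc(2)] by auto
   then show "n \<in> K" using Dom.one_not_zero n Nc(1) by (intro Kmem[of _ "\<one>\<^bsub>ring_A\<^esub>" ?Z]) auto
  qed
  moreover have "w \<in> K"
  proof -
   have "\<one>\<^bsub>ring_A\<^esub> \<odot>\<^bsub>M\<^esub> w \<ominus>\<^bsub>M\<^esub> \<one>\<^bsub>ring_A\<^esub> \<odot>\<^bsub>M\<^esub> w \<in> N" using w Nc(2) by (simp add: a_minus_def M.M.r_neg)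
   then show ?thesis using Dom.one_not_zero w by (intro Kmem[of _ "\<one>\<^bsub>ring_A\<^esub>" "\<one>\<^bsub>ring_A\<^esub>"]) auto
  qed
  moreover have "x \<in> K" if "s \<in> cA" "x \<in> carrier M" "s \<noteq> ?Z" "s \<odot>\<^bsub>M\<^esub> x \<in> K" for s x
  proof -
   obtain a b where ab: "a \<in> cA" "b \<in> cA" "a \<noteq> ?Z" "a \<odot>\<^bsub>M\<^esub> (s \<odot>\<^bsub>M\<^esub> x) \<ominus>\<^bsub>M\<^esub> b \<odot>\<^bsub>M\<^esub> w \<in> N"
    using \<open>s \<odot>\<^bsub>M\<^esub> x \<in> K\<close> unfolding K_def by blast
   then have "(a \<otimes>\<^bsub>ring_A\<^esub> s) \<odot>\<^bsub>M\<^esub> x \<ominus>\<^bsub>M\<^esub> b \<odot>\<^bsub>M\<^esub> w \<in> N" using that(1,2) by (simp add: M.smult_assoc1)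
   moreover have "a \<otimes>\<^bsub>ring_A\<^esub> s \<in> cA" "a \<otimes>\<^bsub>ring_A\<^esub> s \<noteq> ?Z" using ab \<open>s \<in> cA\<close> \<open>s \<noteq> ?Z\<close> Dom.integral by blast+
   ultimately show ?thesis using \<open>x \<in> carrier M\<close> ab(2) by (intro Kmem)
  qed
  ultimately have "m \<in> K" using max[of K] False unfolding pure_def by blast
  then obtain a b where ab: "a \<in> cA" "b \<in> cA" "a \<noteq> ?Z" "a \<odot>\<^bsub>M\<^esub> m \<ominus>\<^bsub>M\<^esub> b \<odot>\<^bsub>M\<^esub> w \<in> N" unfolding K_def by blast
  have "b \<noteq> ?Z"
  proof
   assume "b = ?Z"
   then have "a \<odot>\<^bsub>M\<^esub> m \<ominus>\<^bsub>M\<^esub> \<zero>\<^bsub>M\<^esub> \<in> N" using ab(4) w by simp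
   moreover have "(a \<odot>\<^bsub>M\<^esub> m \<ominus>\<^bsub>M\<^esub> \<zero>\<^bsub>M\<^esub>) \<oplus>\<^bsub>M\<^esub> \<zero>\<^bsub>M\<^esub> = a \<odot>\<^bsub>M\<^esub> m"
    unfolding a_minus_def using ab(1) m(1) by (subst M.M.a_assoc) (auto simp: M.M.l_neg)
   ultimately have "a \<odot>\<^bsub>M\<^esub> m \<in> N" using Nc(3)[OF _ Nc(2)] by metis
   then show False using Npure[OF ab(1) m(1) ab(3)] mN by blast
  qed
  have "(\<ominus>\<^bsub>ring_A\<^esub> \<one>\<^bsub>ring_A\<^esub>) \<odot>\<^bsub>M\<^esub> (a \<odot>\<^bsub>M\<^esub> m \<ominus>\<^bsub>M\<^esub> b \<odot>\<^bsub>M\<^esub> w) \<in> N" using Nc(4)[OF _ ab(4)] by simp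
  also have "(\<ominus>\<^bsub>ring_A\<^esub> \<one>\<^bsub>ring_A\<^esub>) \<odot>\<^bsub>M\<^esub> (a \<odot>\<^bsub>M\<^esub> m \<ominus>\<^bsub>M\<^esub> b \<odot>\<^bsub>M\<^esub> w) = b \<odot>\<^bsub>M\<^esub> w \<ominus>\<^bsub>M\<^esub> a \<odot>\<^bsub>M\<^esub> m"
   using ab m w by (simp add: a_minus_def M.smult_l_minus M.M.minus_add M.M.a_comm)
  finally show ?thesis using ab \<open>b \<noteq> ?Z\<close> by blast
 qed
 obtain E where E: "finite E" "E \<subseteq> carrier M" "carrier M \<subseteq> span_of ring_A M E" using fg finitely_generated_span by blast
 define den where "den d E' \<longleftrightarrow> d \<in> cA \<and> d \<noteq> ?Z \<and> (\<forall>w\<in>E'. \<exists>s\<in>cA. d \<odot>\<^bsub>M\<^esub> w \<ominus>\<^bsub>M\<^esub> s \<odot>\<^bsub>M\<^esub> m \<in> N)" for d E'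
 have scale: "\<exists>s'\<in>cA. (c \<otimes>\<^bsub>ring_A\<^esub> d) \<odot>\<^bsub>M\<^esub> w \<ominus>\<^bsub>M\<^esub> s' \<odot>\<^bsub>M\<^esub> m \<in> N"
  if "c \<in> cA" "d \<in> cA" "w \<in> carrier M" "s \<in> cA" "d \<odot>\<^bsub>M\<^esub> w \<ominus>\<^bsub>M\<^esub> s \<odot>\<^bsub>M\<^esub> m \<in> N" for c d w s
 proof -
  have "c \<odot>\<^bsub>M\<^esub> (d \<odot>\<^bsub>M\<^esub> w \<ominus>\<^bsub>M\<^esub> s \<odot>\<^bsub>M\<^esub> m) \<in> N" using Nc(4) that by blast
  also have "c \<odot>\<^bsub>M\<^esub> (d \<odot>\<^bsub>M\<^esub> w \<ominus>\<^bsub>M\<^esub> s \<odot>\<^bsub>M\<^esub> m) = (c \<otimes>\<^bsub>ring_A\<^esub> d) \<odot>\<^bsub>M\<^esub> w \<ominus>\<^bsub>M\<^esub> (c \<otimes>\<^bsub>ring_A\<^esub> s) \<odot>\<^bsub>M\<^esub> m"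
   using that m by (simp add: a_minus_def M.smult_r_distr M.smult_r_minus M.smult_assoc1)
  finally show ?thesis using that by blast
 qed
 have "\<exists>d. den d E" using E(1,2)
 proof (induction E rule: finite_induct)
  case empty
  then show ?case using Dom.one_not_zero by (auto simp: den_def)
 next
  case (insert g E)
  then obtain d where d: "den d E" by auto
  have gM: "g \<in> carrier M" using insert by auto
  obtain a s where as: "a \<in> cA" "s \<in> cA" "a \<noteq> ?Z" "a \<odot>\<^bsub>M\<^esub> g \<ominus>\<^bsub>M\<^esub> s \<odot>\<^bsub>M\<^esub> m \<in> N"
   using comparable[OF gM] by blast
  have dA: "d \<in> cA" "d \<noteq> ?Z" using d by (auto simp: den_def)
  have "\<exists>s\<in>cA. (a \<otimes>\<^bsub>ring_A\<^esub> d) \<odot>\<^bsub>M\<^esub> w \<ominus>\<^bsub>M\<^esub> s \<odot>\<^bsub>M\<^esub> m \<in> N" if w: "w \<in> insert g E" for w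
  proof (cases "w = g")
   case True
   then show ?thesis using scale[OF dA(1) as(1) _ as(2), of g] as(4) insert M.R.m_comm[OF as(1) dA(1)] by auto
  next
   case False
   then obtain t where "t \<in> cA" "d \<odot>\<^bsub>M\<^esub> w \<ominus>\<^bsub>M\<^esub> t \<odot>\<^bsub>M\<^esub> m \<in> N" using d w unfolding den_def by blast
   then show ?thesis using scale[OF as(1) dA(1), of w t] w insert by blast
  qed
  moreover have "a \<otimes>\<^bsub>ring_A\<^esub> d \<in> cA" "a \<otimes>\<^bsub>ring_A\<^esub> d \<noteq> ?Z" using as dA Dom.integral by blast+
  ultimately show ?case unfolding den_def by blast
 qed
 then obtain d where d: "d \<in> cA" "d \<noteq> ?Z" "\<And>w. w \<in> E ==> \<exists>s\<in>cA. d \<odot>\<^bsub>M\<^esub> w \<ominus>\<^bsub>M\<^esub> s \<odot>\<^bsub>M\<^esub> m \<in> N"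
  unfolding den_def by blast
 define rl where "rl w s \<longleftrightarrow> s \<in> cA \<and> d \<odot>\<^bsub>M\<^esub> w \<ominus>\<^bsub>M\<^esub> s \<odot>\<^bsub>M\<^esub> m \<in> N" for w s
 have rl_add: "rl (x \<oplus>\<^bsub>M\<^esub> y) (s \<oplus>\<^bsub>ring_A\<^esub> t)" if "x \<in> carrier M" "y \<in> carrier M" "rl x s" "rl y t" for x y s t
 proof -
  have st: "s \<in> cA" "t \<in> cA" using that by (auto simp: rl_def)
  have "(d \<odot>\<^bsub>M\<^esub> x \<ominus>\<^bsub>M\<^esub> s \<odot>\<^bsub>M\<^esub> m) \<oplus>\<^bsub>M\<^esub> (d \<odot>\<^bsub>M\<^esub> y \<ominus>\<^bsub>M\<^esub> t \<odot>\<^bsub>M\<^esub> m) \<in> N" using that Nc(3) by (simp add: rl_def)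
  also have "(d \<odot>\<^bsub>M\<^esub> x \<ominus>\<^bsub>M\<^esub> s \<odot>\<^bsub>M\<^esub> m) \<oplus>\<^bsub>M\<^esub> (d \<odot>\<^bsub>M\<^esub> y \<ominus>\<^bsub>M\<^esub> t \<odot>\<^bsub>M\<^esub> m) = d \<odot>\<^bsub>M\<^esub> (x \<oplus>\<^bsub>M\<^esub> y) \<ominus>\<^bsub>M\<^esub> (s \<oplus>\<^bsub>ring_A\<^esub> t) \<odot>\<^bsub>M\<^esub> m"
   using that(1,2) st d(1) m by (simp add: a_minus_def M.smult_r_distr M.smult_l_distr M.M.minus_add M.M.a_ac)
  finally show ?thesis using st by (simp add: rl_def)
 qed
 have rl_smult: "rl (a \<odot>\<^bsub>M\<^esub> x) (a \<otimes>\<^bsub>ring_A\<^esub> s)" if "x \<in> carrier M" "a \<in> cA" "rl x s" for a x s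
 proof -
  have s: "s \<in> cA" using that by (auto simp: rl_def)
  have "a \<odot>\<^bsub>M\<^esub> (d \<odot>\<^bsub>M\<^esub> x \<ominus>\<^bsub>M\<^esub> s \<odot>\<^bsub>M\<^esub> m) \<in> N" using that Nc(4) by (simp add: rl_def)
  also have "a \<odot>\<^bsub>M\<^esub> (d \<odot>\<^bsub>M\<^esub> x \<ominus>\<^bsub>M\<^esub> s \<odot>\<^bsub>M\<^esub> m) = d \<odot>\<^bsub>M\<^esub> (a \<odot>\<^bsub>M\<^esub> x) \<ominus>\<^bsub>M\<^esub> (a \<otimes>\<^bsub>ring_A\<^esub> s) \<odot>\<^bsub>M\<^esub> m"
   using that(1,2) s d(1) m by (simp add: a_minus_def M.smult_r_distr M.smult_r_minus M.smult_assoc1[symmetric] M.R.m_comm)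
  finally show ?thesis using s that(2) by (simp add: rl_def)
 qed
 have "submodule {w \<in> carrier M. \<exists>s. rl w s} ring_A M"
 proof (rule M.submodule_criterion)
  have "rl \<zero>\<^bsub>M\<^esub> ?Z" using d(1) m Nc(5)[OF Nc(2) Nc(2)] by (simp add: rl_def)
  then show "\<zero>\<^bsub>M\<^esub> \<in> {w \<in> carrier M. \<exists>s. rl w s}" by blast
 qed (use rl_add rl_smult in \<open>blast+\<close>)
 then have "span_of ring_A M E \<subseteq> {w \<in> carrier M. \<exists>s. rl w s}"
  by (rule M.span_of_min) (use d(3) E(2) in \<open>auto simp: rl_def\<close>)
 then have ex: "\<exists>s. rl w s" if "w \<in> carrier M" for w using E(3) that by blast
 have un: "s = t" if st: "rl w s" "rl w t" and w: "w \<in> carrier M" for w s t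
 proof (rule ccontr)
  assume "s \<noteq> t"
  have A: "s \<in> cA" "t \<in> cA" using st by (auto simp: rl_def)
  have "(d \<odot>\<^bsub>M\<^esub> w \<ominus>\<^bsub>M\<^esub> t \<odot>\<^bsub>M\<^esub> m) \<ominus>\<^bsub>M\<^esub> (d \<odot>\<^bsub>M\<^esub> w \<ominus>\<^bsub>M\<^esub> s \<odot>\<^bsub>M\<^esub> m) \<in> N" using st Nc(5) by (simp add: rl_def)
  also have "(d \<odot>\<^bsub>M\<^esub> w \<ominus>\<^bsub>M\<^esub> t \<odot>\<^bsub>M\<^esub> m) \<ominus>\<^bsub>M\<^esub> (d \<odot>\<^bsub>M\<^esub> w \<ominus>\<^bsub>M\<^esub> s \<odot>\<^bsub>M\<^esub> m) = (s \<ominus>\<^bsub>ring_A\<^esub> t) \<odot>\<^bsub>M\<^esub> m"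
   using A w d(1) m by (simp add: a_minus_def M.smult_l_distr M.smult_l_minus M.M.minus_add M.M.a_ac M.M.r_neg1 M.M.r_neg2)
  finally have "(s \<ominus>\<^bsub>ring_A\<^esub> t) \<odot>\<^bsub>M\<^esub> m \<in> N" .
  moreover have "s \<ominus>\<^bsub>ring_A\<^esub> t \<noteq> ?Z" using \<open>s \<noteq> t\<close> A by (simp add: M.R.r_right_minus_eq)
  ultimately show False using Npure[of "s \<ominus>\<^bsub>ring_A\<^esub> t" m] A m mN by simp
 qed
 obtain \<phi>0 where \<phi>0: "\<And>w. w \<in> carrier M ==> rl w (\<phi>0 w)" using ex by metis
 have \<phi>0A: "\<phi>0 w \<in> cA" if "w \<in> carrier M" for w using \<phi>0[OF that] by (simp add: rl_def)
 have "linear_R (\<lambda>w. A_to_R (\<phi>0 w))"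
  unfolding linear_R_def
 proof (intro conjI ballI)
  fix x y assume xy: "x \<in> carrier M" "y \<in> carrier M"
  have "\<phi>0 (x \<oplus>\<^bsub>M\<^esub> y) = \<phi>0 x \<oplus>\<^bsub>ring_A\<^esub> \<phi>0 y"
   using un[OF \<phi>0 rl_add[OF xy \<phi>0[OF xy(1)] \<phi>0[OF xy(2)]]] xy by simp
  then show "A_to_R (\<phi>0 (x \<oplus>\<^bsub>M\<^esub> y)) = A_to_R (\<phi>0 x) + A_to_R (\<phi>0 y)" using xy \<phi>0A by simp
 next
  fix a :: "'k fps fps fps set" and x assume ax: "a \<in> cA" "x \<in> carrier M"
  have "\<phi>0 (a \<odot>\<^bsub>M\<^esub> x) = a \<otimes>\<^bsub>ring_A\<^esub> \<phi>0 x" using un[OF \<phi>0 rl_smult[OF ax(2,1) \<phi>0[OF ax(2)]]] ax by simp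
  then show "A_to_R (\<phi>0 (a \<odot>\<^bsub>M\<^esub> x)) = A_to_R a * A_to_R (\<phi>0 x)" using ax \<phi>0A by simp
 qed
 moreover have "\<phi>0 m = d"
 proof (rule un[OF \<phi>0[OF m(1)] _ m(1)])
  show "rl m d" using d(1) m Nc(2) by (simp add: rl_def a_minus_def M.M.r_neg)
 qed
 then have "A_to_R (\<phi>0 m) \<noteq> 0" using d by simp
 ultimately show ?thesis by blast
qed

end

section \<open>Rank and local freeness\<close>

definition iota :: "'k::field fps fps fps set \<Rightarrow> 'k fps fps fract" where
 "iota a = to_fract (A_to_R a)"

lemma fraction_data_A:
 assumes "S \<subseteq> cA" "\<one>\<^bsub>ring_A\<^esub> \<in> S" "\<And>s t. s \<in> S ==> t \<in> S ==> s \<otimes>\<^bsub>ring_A\<^esub> t \<in> S" "\<zero>\<^bsub>ring_A\<^esub> \<notin> S"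
 shows "fraction_data ring_A S (iota :: 'k::field fps fps fps set \<Rightarrow> _)"
 by (rule fraction_data.intro) (use assms in \<open>auto simp: iota_def\<close>)

lemma nonzerodivisors_A: "nonzerodivisors ring_A = carrier (ring_A :: 'k::field fps fps fps set ring) - {\<zero>\<^bsub>ring_A\<^esub>}"
proof -
 interpret domain "ring_A :: 'k fps fps fps set ring" by (rule domain_ring_A)
 show ?thesis
 proof (intro equalityI subsetI)
  fix s :: "'k fps fps fps set" assume s: "s \<in> nonzerodivisors ring_A"
  then have "s \<noteq> \<zero>\<^bsub>ring_A\<^esub>" using one_not_zero unfolding nonzerodivisors_def by fastforce
  then show "s \<in> cA - {\<zero>\<^bsub>ring_A\<^esub>}" using s unfolding nonzerodivisors_def by blast
 qed (use integral in \<open>auto simp: nonzerodivisors_def\<close>)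
qed

lemma Asub_add_power:
 assumes c: "c \<in> Asub" and d: "d \<in> Asub"
 shows "\<exists>p\<in>Asub. \<exists>q\<in>Asub. (c + d) ^ (i + j) = c ^ i * p + d ^ j * (q :: 'k::field fps fps)"
proof (induction "i + j" arbitrary: i j)
 case 0
 then show ?case using Asub_closed(1,2) by (intro bexI[of _ 1] bexI[of _ 0]) auto
next
 case (Suc k)
 have cd: "c + d \<in> Asub" using c d by (rule Asub_closed(3))
 consider "i = 0" | "j = 0" | i' j' where "i = Suc i'" "j = Suc j'" by (cases i; cases j) blast+
 then show ?case
 proof cases
  case 1
  show ?thesis by (rule bexI[OF _ Asub_closed(7)[OF cd, of j]], rule bexI[OF _ Asub_closed(1)]) (simp add: 1)
 next
  case 2
  show ?thesis by (rule bexI[OF _ Asub_closed(1)], rule bexI[OF _ Asub_closed(7)[OF cd, of i]]) (simp add: 2)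
 next
  case 3
  obtain p q where 1: "p \<in> Asub" "q \<in> Asub" "(c + d) ^ (i' + j) = c ^ i' * p + d ^ j * q" using Suc(1)[of i' j] Suc(2) 3 by auto
  obtain p' q' where 2: "p' \<in> Asub" "q' \<in> Asub" "(c + d) ^ (i + j') = c ^ i * p' + d ^ j' * q'" using Suc(1)[of i j'] Suc(2) 3 by auto
  have "i + j = Suc (i' + j)" "i' + j = i + j'" using 3 by auto
  then have "(c + d) ^ (i + j) = c * (c + d) ^ (i' + j) + d * (c + d) ^ (i + j')" by (simp only: power_Suc distrib_right)
  also have "\<dots> = (c * c ^ i') * p + d ^ j * (c * q) + (c ^ i * (d * p') + (d * d ^ j') * q')"
   unfolding 1(3) 2(3) by (simp only: distrib_left mult.assoc mult.left_commute)
  also have "\<dots> = c ^ i * (p + d * p') + d ^ j * (c * q + q')" unfolding 3 power_Suc by (simp only: distrib_left ac_simps)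
  finally have e: "(c + d) ^ (i + j) = c ^ i * (p + d * p') + d ^ j * (c * q + q')" .
  show ?thesis
   by (rule bexI[OF _ Asub_closed(3)[OF 1(1) Asub_closed(6)[OF d 2(1)]]], rule bexI[OF _ Asub_closed(3)[OF Asub_closed(6)[OF c 1(2)] 2(2)]]) (rule e)
 qed
qed

text \<open>Write a = b z + x s with b in A. Here s is only in R, so one factor x is spent on x
  s^(n+1), which lies in A, and the other n act on q. This is why the exponent is n + (n + 1) and
  not 2 n.\<close>

lemma max_A_power_mem:
 fixes L :: "'k::field fps fps set"
 assumes L: "A_stable L" and q: "xx ^ n * q \<in> L" "zz ^ n * q \<in> L" and a: "a \<in> Asub" "a $ 0 $ 0 = 0"
 shows "a ^ (n + (n + 1)) * q \<in> L"
proof -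
 note st = A_stableD(1-4)[OF L]
 obtain b :: "'k fps fps" where b: "b \<in> Asub" "res_u b = fps_shift 1 (res_u a)" "res_v b = fps_shift 1 (res_u a)" using ex_Asub by metis
 have "res_u a = fps_X * fps_shift 1 (res_u a)" using a by (intro fps_ext) (auto simp: res_nth_0)
 then have "res_u (a - b * zz) = 0" "res_v (a - b * zz) = 0" using a b by (simp_all add: Asub_def mult.commute)
 then have "xx dvd a - b * zz" using res_eq_0_iff by blast
 then obtain s where "a - b * zz = xx * s" by (rule dvdE)
 then have ae: "a = b * zz + xx * s" by (simp add: algebra_simps)
 obtain P Q where PQ: "P \<in> Asub" "Q \<in> Asub" "(b * zz + xx * s) ^ (n + (n + 1)) = (b * zz) ^ n * P + (xx * s) ^ (n + 1) * Q"
  using Asub_add_power[OF Asub_closed(6)[OF b(1) Asub_closed(10)] Asub_closed(8)[of s], of n "n + 1"] by blast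
 have "(b * zz) ^ n * P * q = (b ^ n * P) * (zz ^ n * q)" by (simp only: power_mult_distrib ac_simps)
 then have 1: "(b * zz) ^ n * P * q \<in> L" using st(3)[OF Asub_closed(6)[OF Asub_closed(7)[OF b(1)] PQ(1)] q(2)] by (simp only:)
 have "(xx * s) ^ (n + 1) * Q * q = ((xx * s ^ (n + 1)) * Q) * (xx ^ n * q)" by (simp only: power_mult_distrib power_add power_one_right ac_simps)
 then have 2: "(xx * s) ^ (n + 1) * Q * q \<in> L" using st(3)[OF Asub_closed(6)[OF Asub_closed(8)[of "s ^ (n + 1)"] PQ(2)] q(1)] by (simp only:)
 show ?thesis using st(2)[OF 1 2] unfolding ae PQ(3) by (simp only: distrib_right)
qed

context A_module
begin

lemma fraction_module_A:
 assumes "fraction_data ring_A S (iota :: 'k fps fps fps set \<Rightarrow> _)"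
 shows "fraction_module ring_A S iota M"
 by (intro fraction_module.intro assms fraction_module_axioms.intro module_A)

lemma fraction_data_nzd: "fraction_data ring_A (nonzerodivisors ring_A) (iota :: 'k fps fps fps set \<Rightarrow> _)"
proof -
 interpret domain "ring_A :: 'k fps fps fps set ring" by (rule domain_ring_A)
 show ?thesis unfolding nonzerodivisors_A by (rule fraction_data_A) (use integral in auto)
qed

lemma linear_to_fract:
 assumes "fraction_module ring_A S (iota :: 'k fps fps fps set \<Rightarrow> _) M" "linear_R \<phi>"
 shows "fraction_module.linear ring_A iota M (\<lambda>x. to_fract (\<phi> x))"
 unfolding fraction_module.linear_def[OF assms(1)] using linear_RD[OF assms(2)] by (simp add: iota_def)

lemma inj_eqI:
 fixes \<phi> :: "'m \<Rightarrow> 'k fps fps" and a b :: "'k fps fps fps set"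
 assumes "inj_on \<phi> (carrier M)" "linear_R \<phi>" "a \<in> cA" "b \<in> cA" "x \<in> carrier M" "y \<in> carrier M"
  "A_to_R a * \<phi> x = A_to_R b * \<phi> y"
 shows "a \<odot>\<^bsub>M\<^esub> x = b \<odot>\<^bsub>M\<^esub> y"
 using assms linear_RD(2)[OF assms(2)] by (intro inj_onD[OF assms(1)]) auto

text \<open>Elements of R become elements of A after multiplication by x = uv; hence x
  \<open>\<phi> g\<close> times m equals x \<open>\<phi> m\<close> times g for every m, with both
  coefficients in A.\<close>

lemma rank_1I:
 assumes lin: "linear_R \<phi>" and inj: "inj_on \<phi> (carrier M)" and g: "g \<in> carrier M" "\<phi> g \<noteq> 0"
 shows "has_rank ring_A M 1"
proof -
 note fm = fraction_module_A[OF fraction_data_nzd]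
 show ?thesis
  unfolding has_rank_def total_quotient_ring_def localized_module_def
 proof (rule fraction_module.free_of_rank_1I[OF fm g(1) linear_to_fract[OF fm lin]])
  show "to_fract (\<phi> g) \<noteq> 0" using g by simp
  fix x assume x: "x \<in> carrier M"
  obtain t where t: "t \<in> cA" "A_to_R t = xx * \<phi> g" using ex_A Asub_closed(8) by metis
  obtain a where a: "a \<in> cA" "A_to_R a = xx * \<phi> x" using ex_A Asub_closed(8) by metis
  have "A_to_R t \<noteq> 0" using t g by simp
  then have "t \<in> nonzerodivisors ring_A" using t unfolding nonzerodivisors_A by auto
  moreover have "t \<odot>\<^bsub>M\<^esub> x = a \<odot>\<^bsub>M\<^esub> g" by (rule inj_eqI[OF inj lin]) (use t a x g in \<open>auto simp: ac_simps\<close>)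
  ultimately show "\<exists>t\<in>nonzerodivisors ring_A. \<exists>a\<in>cA. t \<odot>\<^bsub>M\<^esub> x = a \<odot>\<^bsub>M\<^esub> g" using a by blast
 qed
qed

lemma ex_nonzero: "2 \<le> depth (cA - Units ring_A) M ==> \<exists>m\<in>carrier M. m \<noteq> \<zero>\<^bsub>M\<^esub>"
proof (rule ccontr)
 assume d: "2 \<le> depth (cA - Units ring_A) M" and n: "\<not> ?thesis"
 have "carrier M \<noteq> {\<zero>\<^bsub>M\<^esub>}" using d by (rule regular_pair)
 moreover have "carrier M = {\<zero>\<^bsub>M\<^esub>}" using n M.M.zero_closed by auto
 ultimately show False by (rule notE)
qed

lemma mcm_functional:
 assumes mcm: "maximal_cohen_macaulay ring_A M" and x: "x \<in> carrier M" "x \<noteq> \<zero>\<^bsub>M\<^esub>"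
 obtains \<psi> where "linear_R \<psi>" "\<psi> x \<noteq> 0"
proof -
 have fg: "finitely_generated ring_A M" using mcm unfolding mcm_iff by (rule conjunct1)
 have "\<exists>\<psi>. linear_R \<psi> \<and> \<psi> x \<noteq> 0" by (rule ex_functional[OF fg _ x]) (rule mcm_torsion_free[OF mcm])
 then show ?thesis by (elim exE conjE) (rule that)
qed

lemma mcm_depth: "maximal_cohen_macaulay ring_A M ==> 2 \<le> depth (cA - Units ring_A) M"
 unfolding mcm_iff by (rule conjunct2)

text \<open>A functional that is nonzero somewhere is injective in rank one: a nonzero kernel
  element would be detected by another functional, against \<open>rank_1_kernel\<close>.\<close>

lemma mcm_rank_1_embedding:
 assumes mcm: "maximal_cohen_macaulay ring_A M" and rank: "has_rank ring_A M 1"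
 obtains \<phi> where "linear_R \<phi>" "inj_on \<phi> (carrier M)"
proof -
 note fm = fraction_module_A[OF fraction_data_nzd]
 obtain m where m: "m \<in> carrier M" "m \<noteq> \<zero>\<^bsub>M\<^esub>" using ex_nonzero[OF mcm_depth[OF mcm]] by (rule bexE)
 obtain \<phi> where \<phi>: "linear_R \<phi>" "\<phi> m \<noteq> 0" using mcm m by (rule mcm_functional)
 note r = rank[unfolded has_rank_def total_quotient_ring_def localized_module_def]
 have "x = \<zero>\<^bsub>M\<^esub>" if x: "x \<in> carrier M" "\<phi> x = 0" for x
 proof (rule ccontr)
  assume xn: "x \<noteq> \<zero>\<^bsub>M\<^esub>"
  obtain \<psi> where \<psi>: "linear_R \<psi>" "\<psi> x \<noteq> 0" using mcm x(1) xn by (rule mcm_functional)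
  have "to_fract (\<psi> x) = 0"
   by (rule fraction_module.rank_1_kernel[OF fm r linear_to_fract[OF fm \<phi>(1)] linear_to_fract[OF fm \<psi>(1)] x(1) _ m(1)])
    (simp_all add: x \<phi>)
  then show False using \<psi> by simp
 qed
 then show ?thesis by (intro that[OF \<phi>(1)] linear_R_inj[OF \<phi>(1)])
qed

text \<open>Depth supplies some regular pair a1, a2, not necessarily x, z. By
  \<open>max_A_power_mem\<close> high powers of both carry q into the image. Regularity of a2 modulo
  a1 removes the power of a2 in the presence of a single a1 (\<open>step\<close>); then the factors
  a1 are removed one by one (\<open>power\<close>).\<close>

lemma mcm_saturated:
 assumes lin: "linear_R \<phi>" and inj: "inj_on \<phi> (carrier M)" and d: "2 \<le> depth (cA - Units ring_A) M"
 shows "saturated (\<phi> ` carrier M)"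
 unfolding saturated_def
proof (intro allI impI)
 fix q :: "'k fps fps" and n assume q: "xx ^ n * q \<in> \<phi> ` carrier M \<and> zz ^ n * q \<in> \<phi> ` carrier M"
 let ?L = "\<phi> ` carrier M"
 note st = A_stableD(1-4)[OF image_A_stable[OF lin]]
 have mem: "a ^ (n + (n + 1)) * q \<in> ?L" if "a \<in> Asub" "a $ 0 $ 0 = 0" for a
  using max_A_power_mem[OF image_A_stable[OF lin]] q that by blast
 obtain a1 a2 where a: "a1 \<in> cA" "a2 \<in> cA" "A_to_R a1 $ 0 $ 0 = 0" "A_to_R a2 $ 0 $ 0 = 0"
  and a1: "\<And>x. x \<in> carrier M ==> a1 \<odot>\<^bsub>M\<^esub> x = \<zero>\<^bsub>M\<^esub> ==> x = \<zero>\<^bsub>M\<^esub>"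
  and a2: "\<And>x y. x \<in> carrier M ==> y \<in> carrier M ==> a2 \<odot>\<^bsub>M\<^esub> x = a1 \<odot>\<^bsub>M\<^esub> y ==> \<exists>w\<in>carrier M. x = a1 \<odot>\<^bsub>M\<^esub> w"
  and nz: "carrier M \<noteq> {\<zero>\<^bsub>M\<^esub>}"
  by (rule regular_pair[OF d]) (rule that; blast)
 define r1 r2 where "r1 = A_to_R a1" and "r2 = A_to_R a2"
 have rA: "r1 \<in> Asub" "r2 \<in> Asub" using a by (auto simp: r1_def r2_def)
 have r1n: "r1 \<noteq> 0"
 proof
  assume "r1 = 0"
  then have "a1 = \<zero>\<^bsub>ring_A\<^esub>" using a(1) by (simp add: r1_def)
  then have "x = \<zero>\<^bsub>M\<^esub>" if "x \<in> carrier M" for x using a1[OF that] that by simp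
  then show False using nz M.M.zero_closed by blast
 qed
 have step: "t \<in> ?L" if t: "r1 * t \<in> ?L" "r2 ^ j * t \<in> ?L" for t j
  using t
 proof (induction j)
  case (Suc j)
  have "r2 * (r2 ^ j * t) \<in> ?L" using Suc(3) by (simp add: mult.assoc)
  then obtain y where y: "y \<in> carrier M" "r2 * (r2 ^ j * t) = \<phi> y" by blast
  have "r2 ^ j * (r1 * t) \<in> ?L" using st(3)[OF Asub_closed(7)[OF rA(2)] Suc(2)] .
  then obtain x where x: "x \<in> carrier M" "r2 ^ j * (r1 * t) = \<phi> x" by blast
  have "a2 \<odot>\<^bsub>M\<^esub> x = a1 \<odot>\<^bsub>M\<^esub> y"
   by (rule inj_eqI[OF inj lin]) (use a x y in \<open>auto simp: r1_def r2_def simp flip: x(2) y(2) intro: mult.left_commute\<close>)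
  then obtain w where w: "w \<in> carrier M" "x = a1 \<odot>\<^bsub>M\<^esub> w" using a2 x y by blast
  then have "r1 * (r2 ^ j * t) = r1 * \<phi> w" using x(2) linear_RD(2)[OF lin a(1) w(1)] by (simp add: r1_def mult.left_commute)
  then have "r2 ^ j * t = \<phi> w" using r1n by simp
  then show ?case using Suc w by blast
 qed simp
 have power: "r1 ^ i * t \<in> ?L ==> r2 ^ j * t \<in> ?L ==> t \<in> ?L" for i j t
 proof (induction i arbitrary: t)
  case (Suc i)
  have "r2 ^ j * (r1 ^ i * t) \<in> ?L" using st(3)[OF Asub_closed(7)[OF rA(1)] Suc(3), of i] by (simp add: mult.left_commute)
  moreover have "r1 * (r1 ^ i * t) \<in> ?L" using Suc(2) by (simp add: mult.assoc)
  ultimately have "r1 ^ i * t \<in> ?L" using step by blast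
  then show ?case using Suc by blast
 qed simp
 show "q \<in> ?L"
  by (rule power[OF mem[OF rA(1)] mem[OF rA(2)]]) (use a in \<open>simp_all add: r1_def r2_def\<close>)
qed

lemma rescale:
 assumes lin: "linear_R \<phi>" and inj: "inj_on \<phi> (carrier M)" and g: "g \<noteq> 0" and im: "\<phi> ` carrier M = (*) g ` L"
 shows "\<exists>\<psi>. linear_R \<psi> \<and> inj_on \<psi> (carrier M) \<and> \<psi> ` carrier M = L \<and> (\<forall>x\<in>carrier M. \<phi> x = g * \<psi> x)"
proof -
 have "\<exists>r. \<phi> x = g * r" if "x \<in> carrier M" for x using im that by blast
 then obtain \<psi> where \<psi>: "\<And>x. x \<in> carrier M ==> \<phi> x = g * \<psi> x" by metis
 have "linear_R \<psi>"
  unfolding linear_R_def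
 proof (intro conjI ballI)
  fix x y assume xy: "x \<in> carrier M" "y \<in> carrier M"
  have "g * \<psi> (x \<oplus>\<^bsub>M\<^esub> y) = g * (\<psi> x + \<psi> y)" using linear_RD(1)[OF lin xy] \<psi> xy by (simp add: distrib_left)
  then show "\<psi> (x \<oplus>\<^bsub>M\<^esub> y) = \<psi> x + \<psi> y" using g by simp
 next
  fix a :: "'k fps fps fps set" and x assume ax: "a \<in> cA" "x \<in> carrier M"
  have "g * \<psi> (a \<odot>\<^bsub>M\<^esub> x) = g * (A_to_R a * \<psi> x)" using linear_RD(2)[OF lin ax] \<psi> ax by (simp add: mult.left_commute)
  then show "\<psi> (a \<odot>\<^bsub>M\<^esub> x) = A_to_R a * \<psi> x" using g by simp
 qed
 moreover have "inj_on \<psi> (carrier M)" using inj \<psi> by (auto simp: inj_on_def)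
 moreover have "\<psi> ` carrier M = L"
 proof -
  have "(*) g ` (\<psi> ` carrier M) = (*) g ` L" using im \<psi> by (auto simp: image_image cong: image_cong)
  then show ?thesis using g by (subst (asm) inj_image_eq_iff) (auto simp: inj_on_def)
 qed
 ultimately show ?thesis using \<psi> by blast
qed

theorem rank_one_mcm_embedding:
 assumes "maximal_cohen_macaulay ring_A M" "has_rank ring_A M 1"
 obtains \<phi> where "linear_R \<phi>" "inj_on \<phi> (carrier M)"
  "\<phi> ` carrier M = UNIV \<or> (\<exists>p q c. c \<noteq> 0 \<and> min p q = 1 \<and> \<phi> ` carrier M = Lpq p q c)"
proof -
 obtain \<phi> where \<phi>: "linear_R \<phi>" "inj_on \<phi> (carrier M)" using assms by (rule mcm_rank_1_embedding)
 have d: "2 \<le> depth (cA - Units ring_A) M" using assms(1) by (rule mcm_depth)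
 obtain m where m: "m \<in> carrier M" "m \<noteq> \<zero>\<^bsub>M\<^esub>" using ex_nonzero[OF d] by (rule bexE)
 have phm: "\<phi> m \<noteq> 0"
 proof
  assume "\<phi> m = 0"
  then have "\<phi> m = \<phi> \<zero>\<^bsub>M\<^esub>" using linear_RD(3)[OF \<phi>(1)] by simp
  then show False using inj_onD[OF \<phi>(2) _ m(1) M.M.zero_closed] m(2) by simp
 qed
 obtain g where g: "g \<noteq> 0" "\<phi> ` carrier M = range ((*) g) \<or> (\<exists>p q l. l \<noteq> 0 \<and> min p q = 1 \<and> \<phi> ` carrier M = (*) g ` Lpq p q l)"
  using stable_classification[OF image_A_stable[OF \<phi>(1)] mcm_saturated[OF \<phi> d] imageI[OF m(1)] phm] by (elim exE conjE) (rule that)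
 from g(2) show ?thesis
 proof
  assume "\<phi> ` carrier M = range ((*) g)"
  then obtain \<psi> where "linear_R \<psi>" "inj_on \<psi> (carrier M)" "\<psi> ` carrier M = UNIV" using rescale[OF \<phi> g(1)] by blast
  then show ?thesis using that[of \<psi>] by blast
 next
  assume "\<exists>p q l. l \<noteq> 0 \<and> min p q = 1 \<and> \<phi> ` carrier M = (*) g ` Lpq p q l"
  then obtain p q l where l: "l \<noteq> 0" "min p q = 1" "\<phi> ` carrier M = (*) g ` Lpq p q l" by blast
  then obtain \<psi> where "linear_R \<psi>" "inj_on \<psi> (carrier M)" "\<psi> ` carrier M = Lpq p q l" using rescale[OF \<phi> g(1)] by blast
  then show ?thesis using that[of \<psi>] l by blast
 qed
qed

end

text \<open>The conductor is the kernel of A \<rightarrow> k[[z]]. It is not maximal, as z separates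
  it from the ideal of elements without constant term.\<close>

lemma cond_prime:
 "primeideal {a \<in> cA. A_to_R a \<in> cond_A} (ring_A :: 'k::field fps fps fps set ring)"
 "\<not> maximalideal {a \<in> cA. A_to_R a \<in> cond_A} (ring_A :: 'k::field fps fps fps set ring)"
proof -
 interpret cring "ring_A :: 'k fps fps fps set ring" by simp
 have c: "r \<in> cond_A \<longleftrightarrow> res_u r = 0 \<and> res_v r = 0" for r :: "'k fps fps"
  unfolding res_eq_0_iff cond_A_def by (auto simp: dvd_def)
 have m: "A_to_R a \<in> cond_A \<longleftrightarrow> res_u (A_to_R a) = 0" if "a \<in> cA" for a :: "'k fps fps fps set"
  using A_to_R_simps(6)[OF that] c by (auto simp: Asub_def)
 let ?P = "{a \<in> cA. A_to_R a \<in> cond_A} :: 'k fps fps fps set set"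
 have P: "?P = {a \<in> cA. res_u (A_to_R a) = 0}" using m by blast
 show "primeideal ?P ring_A"
  unfolding P
 proof (rule primeidealI)
  show "ideal {a \<in> cA. res_u (A_to_R a) = 0} (ring_A :: 'k fps fps fps set ring)"
   by (rule ideal_criterion) auto
  show "cA \<noteq> {a \<in> cA. res_u (A_to_R a) = (0 :: 'k fps)}" using one_closed by force
 qed auto
 show "\<not> maximalideal ?P ring_A"
 proof
  assume max: "maximalideal ?P ring_A"
  let ?J = "{a \<in> cA. A_to_R a $ 0 $ 0 = 0} :: 'k fps fps fps set set"
  have J: "ideal ?J ring_A" by (rule ideal_criterion) auto
  have "?P \<subseteq> ?J" unfolding P by (auto simp flip: res_nth_0(1))
  then have e: "?J = ?P \<or> ?J = cA" using maximalideal.I_maximal[OF max J] by blast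
  have z: "class_A var_z \<in> carrier (ring_A :: 'k fps fps fps set ring)" "A_to_R (class_A var_z) = (zz :: 'k fps fps)" by (simp_all add: carrier_ring_A)
  have zJ: "class_A var_z \<in> ?J" using z by simp
  have zP: "class_A var_z \<notin> ?P" unfolding P using z by simp
  have oneJ: "\<one>\<^bsub>ring_A\<^esub> \<in> carrier (ring_A :: 'k fps fps fps set ring)" "\<one>\<^bsub>ring_A\<^esub> \<notin> ?J" by auto
  from e show False
  proof
   assume "?J = ?P"
   then show False using zJ zP by (elim equalityE) (erule notE, erule subsetD)
  next
   assume "?J = cA"
   then show False using oneJ by (elim equalityE) (erule notE, erule subsetD)
  qed
 qed
qed

lemma prime_nonmax:
 fixes P :: "'k::field fps fps fps set set"
 assumes P: "primeideal P ring_A" "\<not> maximalideal P ring_A" and x: "xx \<in> A_to_R ` P"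
 shows "A_to_R ` P = cond_A"
proof (rule ccontr)
 assume "A_to_R ` P \<noteq> cond_A"
 then have m: "A_to_R ` P = max_A" using prime_sub_containing_x[OF prime_sub_image[OF P(1)] x] by blast
 interpret primeideal P ring_A by (rule P(1))
 have "maximalideal P ring_A"
 proof (rule maximalidealI[OF is_ideal I_notcarr])
  fix J assume J: "ideal J ring_A" "P \<subseteq> J" "J \<subseteq> cA"
  show "J = P \<or> J = cA"
  proof (rule ccontr)
   assume n: "\<not> ?thesis"
   then obtain j where j: "j \<in> J" "j \<notin> P" using J by blast
   then have jA: "j \<in> cA" using J by blast
   have "A_to_R j \<notin> A_to_R ` P"
   proof
    assume "A_to_R j \<in> A_to_R ` P"
    then obtain p where p: "A_to_R j = A_to_R p" "p \<in> P" by (rule imageE)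
    have "p \<in> cA" using p(2) Icarr by blast
    then have "j = p" using A_to_R_inj[OF jA, of p] p(1) by blast
    then show False using p(2) j(2) by simp
   qed
   then have "j \<in> Units ring_A" using non_unit_A[of j] jA unfolding m max_A_def by auto
   then obtain k where "k \<in> cA" "k \<otimes>\<^bsub>ring_A\<^esub> j = \<one>\<^bsub>ring_A\<^esub>" by (auto simp: Units_def)
   then have "\<one>\<^bsub>ring_A\<^esub> \<in> J" using ideal_closed(4)[OF J(1)] j by metis
   then show False using ideal.one_imp_carrier[OF J(1)] n by blast
  qed
 qed
 then show False using P by blast
qed

lemma Lpq_generators:
 assumes "1 \<le> p" "1 \<le> q"
 shows "xx * r \<in> Lpq p q c" "uu ^ p + fps_const (fps_const c) * vv ^ q \<in> Lpq p q c"
  "res_u (uu ^ p + fps_const (fps_const c) * vv ^ q) = fps_X ^ p"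
  "res_v (uu ^ p + fps_const (fps_const c) * vv ^ q) = fps_const c * fps_X ^ q"
proof -
 show 1: "res_u (uu ^ p + fps_const (fps_const c) * vv ^ q) = fps_X ^ p" using assms by (simp add: power_0_left)
 have "res_v (fps_const (fps_const c)) = fps_const c" by (simp add: res_v_def fps_eq_iff)
 then show 2: "res_v (uu ^ p + fps_const (fps_const c) * vv ^ q) = fps_const c * fps_X ^ q" using assms by (simp add: power_0_left)
 show "uu ^ p + fps_const (fps_const c) * vv ^ q \<in> Lpq p q c" unfolding Lpq_def Line_def mem_Collect_eq 1 2 by (simp add: ac_simps)
 show "xx * r \<in> Lpq p q c" by (simp add: Lpq_def Line_def)
qed

context A_module
begin

text \<open>If a nonmaximal prime P omits x, then uv generates after localization. Otherwise its
  image is the conductor, and G = u^p + c v^q generates: for l on the line the two restrictions of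
  swap(G) l agree, so this product lies in A, and swap(G) G is a denominator outside P because
  neither restriction of G vanishes.\<close>

lemma lfps_I:
 assumes lin: "linear_R \<phi>" and inj: "inj_on \<phi> (carrier M)" and im: "\<phi> ` carrier M = Lpq p q c"
  and pq: "1 \<le> p" "1 \<le> q" and c: "c \<noteq> 0"
 shows "locally_free_on_punctured_spectrum ring_A M"
 unfolding locally_free_on_punctured_spectrum_def localized_module_def
proof (intro allI impI)
 fix P :: "'k fps fps fps set set" assume P: "primeideal P ring_A \<and> \<not> maximalideal P ring_A"
 then interpret P: primeideal P ring_A by blast
 note Pc = ideal_closed[OF P.is_ideal]
 have one: "\<one>\<^bsub>ring_A\<^esub> \<notin> P" using P.one_imp_carrier P.I_notcarr by blast
 have "fraction_data ring_A (cA - P) (iota :: 'k fps fps fps set \<Rightarrow> _)"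
  by (rule fraction_data_A) (use one Pc(2) P.I_prime in auto)
 note fm = fraction_module_A[OF this]
 have notP: "t \<in> cA - P" if "t \<in> cA" "A_to_R t \<notin> A_to_R ` P" for t :: "'k fps fps fps set"
  by (intro DiffI that(1) notI) (rule notE[OF that(2) imageI])
 let ?L = "localization ring_A (cA - P)"
 let ?T = "base_change (to_localization ring_A (cA - P)) ring_A ?L M"
 have main: "free_of_rank ?L ?T 1"
  if G: "G \<in> Lpq p q c" "G \<noteq> 0" and T: "T \<in> Asub" "T \<notin> A_to_R ` P" and h: "\<And>l. l \<in> Lpq p q c ==> \<exists>a\<in>Asub. T * l = a * G" for G T
 proof -
  have "G \<in> \<phi> ` carrier M" using G(1) im by simp
  then obtain g where g: "g \<in> carrier M" "\<phi> g = G" by (elim imageE) (rule that; simp)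
  obtain t where t: "t \<in> cA" "A_to_R t = T" using ex_A[OF T(1)] by (rule bexE)
  show ?thesis
  proof (rule fraction_module.free_of_rank_1I[OF fm g(1) linear_to_fract[OF fm lin]])
   show "to_fract (\<phi> g) \<noteq> 0" using g G by simp
   fix x assume x: "x \<in> carrier M"
   then have "\<phi> x \<in> Lpq p q c" using im by blast
   then obtain a where a: "a \<in> Asub" "T * \<phi> x = a * G" using h by (elim bexE[OF h]) (rule that)
   obtain b where b: "b \<in> cA" "A_to_R b = a" using ex_A[OF a(1)] by (rule bexE)
   have bT: "T * \<phi> x = A_to_R b * G" using a b by simp
   have "t \<odot>\<^bsub>M\<^esub> x = b \<odot>\<^bsub>M\<^esub> g" by (rule inj_eqI[OF inj lin t(1) b(1) x g(1)]) (simp only: t(2) g(2) bT)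
   then show "\<exists>t\<in>cA - P. \<exists>a\<in>cA. t \<odot>\<^bsub>M\<^esub> x = a \<odot>\<^bsub>M\<^esub> g"
    using b(1) notP[OF t(1)] T(2) unfolding t(2) by (intro bexI[of _ t] bexI[of _ b])
  qed
 qed
 note gen = Lpq_generators[OF pq]
 show "\<exists>n. free_of_rank ?L ?T n"
 proof (cases "xx \<in> A_to_R ` P")
  case False
  have "free_of_rank ?L ?T 1"
  proof (rule main[of "xx * 1" "xx * xx"])
   show "xx * 1 \<in> Lpq p q c" by (rule gen(1))
   show "xx * xx \<notin> A_to_R ` P" using prime_subD(6)[OF prime_sub_image[OF conjunct1[OF P]], of xx xx] False Asub_closed(9) by blast
   fix l
   show "\<exists>a\<in>Asub. xx * xx * l = a * (xx * 1)" by (rule bexI[OF _ Asub_closed(8)[of l]]) (simp only: ac_simps mult_1_right)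
  qed (auto)
  then show ?thesis by blast
 next
  case True
  then have Pe: "A_to_R ` P = cond_A" using prime_nonmax[OF conjunct1[OF P] conjunct2[OF P]] by simp
  define G where "G = uu ^ p + fps_const (fps_const c) * vv ^ q"
  have rG: "res_u G = fps_X ^ p" "res_v G = fps_const c * fps_X ^ q" using gen(3,4)[of c] by (simp_all add: G_def)
  have "free_of_rank ?L ?T 1"
  proof (rule main[of G "swap_uv G * G"])
   show "G \<in> Lpq p q c" unfolding G_def by (rule gen(2))
   show "G \<noteq> 0" using rG(1) by auto
   show "swap_uv G * G \<in> Asub" by (simp add: Asub_def mult.commute)
   show "swap_uv G * G \<notin> A_to_R ` P"
   proof
    assume "swap_uv G * G \<in> A_to_R ` P"
    then obtain r where "swap_uv G * G = xx * r" unfolding Pe cond_A_def by (rule rangeE)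
    then have "res_u (swap_uv G * G) = 0" by (simp only:) simp
    then show False using rG c by simp
   qed
   fix l assume l: "l \<in> Lpq p q c"
   have "swap_uv G * l \<in> Asub" using l rG by (simp add: Asub_def Lpq_def Line_def)
   moreover have "swap_uv G * G * l = (swap_uv G * l) * G" by (simp add: ac_simps)
   ultimately show "\<exists>a\<in>Asub. swap_uv G * G * l = a * G" by (intro bexI[of _ "swap_uv G * l"])
  qed
  then show ?thesis by blast
 qed
qed

text \<open>At the conductor prime a free localization would have rank one, and a generator would
  divide both 1 and u up to denominators outside P. From 1, its restriction to u = 0 is nonzero.
  Hence the coefficient in A that produces u vanishes at u = 0, so, being in A, also at v = 0, where
  u does not vanish.\<close>

lemma not_lfps:
 assumes lin: "linear_R \<phi>" and inj: "inj_on \<phi> (carrier M)" and im: "\<phi> ` carrier M = UNIV"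
 shows "\<not> locally_free_on_punctured_spectrum ring_A M"
proof
 assume lf: "locally_free_on_punctured_spectrum ring_A M"
 define P :: "'k fps fps fps set set" where "P = {a \<in> cA. A_to_R a \<in> cond_A}"
 define S where "S = cA - P"
 interpret P: primeideal P ring_A unfolding P_def by (rule cond_prime)
 note Pc = ideal_closed[OF P.is_ideal]
 have one: "\<one>\<^bsub>ring_A\<^esub> \<notin> P" using P.one_imp_carrier P.I_notcarr by blast
 have "fraction_data ring_A S (iota :: 'k fps fps fps set \<Rightarrow> _)"
  unfolding S_def by (rule fraction_data_A) (use one Pc(2) P.I_prime in auto)
 then interpret fm: fraction_module ring_A S iota M by (rule fraction_module_A)
 have lin': "fm.linear (\<lambda>x. to_fract (\<phi> x))" by (rule linear_to_fract[OF fm.fraction_module_axioms lin])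
 have inj': "inj_on (\<lambda>x. to_fract (\<phi> x)) (carrier M)" using inj by (auto simp: inj_on_def)
 obtain n where n: "free_of_rank fm.L fm.T n"
  using lf[unfolded locally_free_on_punctured_spectrum_def localized_module_def, rule_format, OF conjI[OF cond_prime], folded P_def, folded S_def]
  by (rule exE)
 have "n \<le> 1"
 proof (rule fm.free_imp_rank_le_1[OF n lin' inj'])
  fix x y assume xy: "x \<in> carrier M" "y \<in> carrier M" "to_fract (\<phi> x) \<noteq> 0"
  obtain a where a: "a \<in> cA" "A_to_R a = xx * \<phi> y" using ex_A Asub_closed(8) by metis
  obtain b where b: "b \<in> cA" "A_to_R b = xx * \<phi> x" using ex_A Asub_closed(8) by metis
  have "iota a * to_fract (\<phi> x) = iota b * to_fract (\<phi> y)" "iota b \<noteq> 0"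
   using a b xy by (simp_all add: iota_def ac_simps)
  then show "\<exists>a\<in>cA. \<exists>b\<in>cA. iota a * to_fract (\<phi> x) = iota b * to_fract (\<phi> y) \<and> iota b \<noteq> 0" using a b by blast
 qed
 obtain m1 where m1: "m1 \<in> carrier M" "\<phi> m1 = 1" using im by (metis UNIV_I imageE)
 obtain mu where mu: "mu \<in> carrier M" "\<phi> mu = uu" using im by (metis UNIV_I imageE)
 have oneL: "\<one>\<^bsub>fm.L\<^esub> \<in> carrier fm.L" "fm.val \<one>\<^bsub>fm.L\<^esub> = 1" using fm.val_hom(4) by auto
 have ext: "fm.extend (\<lambda>x. to_fract (\<phi> x)) (fm.pt \<one>\<^bsub>fm.L\<^esub> m) = to_fract (\<phi> m)" if "m \<in> carrier M" for m
  using fm.extend_props(1)[OF lin' oneL(1) that] oneL(2) by simp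
 show False
 proof (cases "n = 0")
  case True
  then obtain B where "basis fm.L fm.T B" "card B = 0" using n unfolding free_of_rank_def by (elim exE conjE) simp
  then have "B = {}" unfolding basis_def using card_0_eq by blast
  then have B: "basis fm.L fm.T {}" using \<open>basis fm.L fm.T B\<close> by simp
  have T0: "t = \<zero>\<^bsub>fm.T\<^esub>" if "t \<in> carrier fm.T" for t
   using B[unfolded basis_def, THEN conjunct2, THEN conjunct2, rule_format, OF that] by (auto elim!: ex1E)
  have "fm.pt \<one>\<^bsub>fm.L\<^esub> m1 = fm.pt \<one>\<^bsub>fm.L\<^esub> \<zero>\<^bsub>M\<^esub>" using T0 fm.pt_closed oneL(1) m1 M.M.zero_closed by metis
  then have "to_fract (\<phi> m1) = to_fract (\<phi> \<zero>\<^bsub>M\<^esub>)" using ext m1 M.M.zero_closed by metis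
  then show False using m1 linear_RD(3)[OF lin] by simp
 next
  case False
  then have "free_of_rank fm.L fm.T 1" using n \<open>n \<le> 1\<close> by (simp add: le_Suc_eq)
  then obtain e where e: "e \<in> carrier fm.T" "\<And>t. t \<in> carrier fm.T ==> \<exists>b\<in>carrier fm.L. t = b \<odot>\<^bsub>fm.T\<^esub> e"
   by (rule fm.basis_1D) blast
  obtain s x where sx: "s \<in> S" "x \<in> carrier M" "e = fm.pt (fraction ring_A S \<one>\<^bsub>ring_A\<^esub> s) x" using fm.T_elements[OF e(1)] by blast
  have fracrel: "\<exists>b\<in>cA. \<exists>t\<in>S. A_to_R s * A_to_R t * \<phi> m = A_to_R b * \<phi> x" if m: "m \<in> carrier M" for m
  proof -
   obtain bb where bb: "bb \<in> carrier fm.L" "fm.pt \<one>\<^bsub>fm.L\<^esub> m = bb \<odot>\<^bsub>fm.T\<^esub> e" using e(2)[OF fm.pt_closed[OF oneL(1) m]] by blast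
   obtain b t where bt: "bb = fraction ring_A S b t" "b \<in> cA" "t \<in> S" using bb(1) fm.carrier_L by auto
   have "to_fract (\<phi> m) = fm.val bb * fm.extend (\<lambda>x. to_fract (\<phi> x)) e" using ext[OF m] bb(2) fm.extend_props(3)[OF lin' bb(1) e(1)] by simp
   also have "fm.extend (\<lambda>x. to_fract (\<phi> x)) e = to_fract (\<phi> x) / iota s"
    using fm.extend_props(1)[OF lin' fm.frac_closed[OF M.R.one_closed sx(1)] sx(2)] sx(3) fm.val_frac[OF M.R.one_closed sx(1)] by (simp add: iota_def)
   also have "fm.val bb = iota b / iota t" using fm.val_frac bt by simp
   finally have "to_fract (\<phi> m) * (iota s * iota t) = iota b * to_fract (\<phi> x)"
    using fm.\<iota>_S[OF sx(1)] fm.\<iota>_S[OF bt(3)] by (simp add: field_simps)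
   then have "to_fract (A_to_R s * A_to_R t * \<phi> m) = to_fract (A_to_R b * \<phi> x)" by (simp add: iota_def ac_simps)
   then have "A_to_R s * A_to_R t * \<phi> m = A_to_R b * \<phi> x" by (simp only: to_fract_eq_iff)
   then show ?thesis using bt(2,3) by (intro bexI[of _ b] bexI[of _ t])
  qed
  have Sres: "res_u (A_to_R t) \<noteq> 0" "res_v (A_to_R t) \<noteq> 0" "t \<in> cA" if "t \<in> S" for t
  proof -
   have t: "t \<in> cA" "A_to_R t \<notin> cond_A" using that unfolding S_def P_def mem_Collect_eq Diff_iff by argo+
   have "\<not> xx dvd A_to_R t" using t(2) unfolding cond_A_def by (intro notI) (elim notE dvdE, simp only: rangeI)
   moreover have "res_u (A_to_R t) = res_v (A_to_R t)" using A_to_R_simps(6)[OF t(1)] by (simp add: Asub_def)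
   ultimately show "res_u (A_to_R t) \<noteq> 0" "res_v (A_to_R t) \<noteq> 0" using res_eq_0_iff[of "A_to_R t"] by (metis, metis)
   show "t \<in> cA" by (rule t(1))
  qed
  obtain b t where bt: "b \<in> cA" "t \<in> S" "A_to_R s * A_to_R t = A_to_R b * \<phi> x"
   using fracrel[OF m1(1)] unfolding m1(2) mult_1_right by (elim bexE) (rule that)
  obtain b' t' where bt': "b' \<in> cA" "t' \<in> S" "A_to_R s * A_to_R t' * uu = A_to_R b' * \<phi> x"
   using fracrel[OF mu(1)] unfolding mu(2) by (elim bexE) (rule that)
  have "res_v (A_to_R s) * res_v (A_to_R t) = res_v (A_to_R b) * res_v (\<phi> x)" using arg_cong[OF bt(3), of res_v] by (simp only: res_v_simps)
  then have x: "res_v (\<phi> x) \<noteq> 0" using Sres(2)[OF sx(1)] Sres(2)[OF bt(2)] by (metis mult_eq_0_iff)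
  have "res_v (A_to_R s) * res_v (A_to_R t') * 0 = res_v (A_to_R b') * res_v (\<phi> x)" using arg_cong[OF bt'(3), of res_v] by simp
  then have "res_v (A_to_R b') = 0" using x by simp
  then have "res_u (A_to_R b') = 0" using A_to_R_simps(6)[OF bt'(1)] by (simp add: Asub_def)
  moreover have "res_u (A_to_R s) * res_u (A_to_R t') * fps_X = res_u (A_to_R b') * res_u (\<phi> x)" using arg_cong[OF bt'(3), of res_u] by simp
  ultimately show False using Sres(1)[OF sx(1)] Sres(1)[OF bt'(2)] by simp
 qed
qed

end

lemma isomorphic_if_same_image:
 fixes M :: "('k::field fps fps fps set, 'm) module" and N :: "('k fps fps fps set, 'n) module"
 assumes M: "A_module M" "A_module.linear_R M \<phi>" "inj_on \<phi> (carrier M)"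
  and N: "A_module N" "A_module.linear_R N \<psi>" "inj_on \<psi> (carrier N)"
  and im: "\<phi> ` carrier M = \<psi> ` carrier N"
 shows "isomorphic ring_A M N"
proof -
 interpret M: A_module M by (rule M)
 interpret N: A_module N by (rule N)
 note lM = M.linear_RD[OF M(2)] and lN = N.linear_RD[OF N(2)]
 define f where "f x = inv_into (carrier N) \<psi> (\<phi> x)" for x
 have f: "f x \<in> carrier N" "\<psi> (f x) = \<phi> x" if "x \<in> carrier M" for x
  using that im unfolding f_def by (metis imageI inv_into_into, metis imageI f_inv_into_f)
 have eqI: "a = b" if "\<psi> a = \<psi> b" "a \<in> carrier N" "b \<in> carrier N" for a b using N(3) that by (auto dest: inj_onD)
 have "f \<in> module_hom ring_A M N"
  unfolding module_hom_def
 proof (intro CollectI conjI ballI)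
  show "f \<in> carrier M \<rightarrow> carrier N" using f by auto
  fix x y assume "x \<in> carrier M" "y \<in> carrier M"
  then show "f (x \<oplus>\<^bsub>M\<^esub> y) = f x \<oplus>\<^bsub>N\<^esub> f y" using f lM lN by (intro eqI) auto
 next
  fix a :: "'k fps fps fps set" and x assume "a \<in> cA" "x \<in> carrier M"
  then show "f (a \<odot>\<^bsub>M\<^esub> x) = a \<odot>\<^bsub>N\<^esub> f x" using f lM lN by (intro eqI) auto
 qed
 moreover have "bij_betw f (carrier M) (carrier N)"
  unfolding bij_betw_def
 proof
  show "inj_on f (carrier M)" using f M(3) unfolding inj_on_def by metis
  show "f ` carrier M = carrier N"
  proof (intro equalityI subsetI)
   fix y assume y: "y \<in> carrier N"
   then obtain x where "x \<in> carrier M" "\<phi> x = \<psi> y" using im by (metis imageE imageI)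
   then have "f x = y" using f y eqI by metis
   then show "y \<in> f ` carrier M" using \<open>x \<in> carrier M\<close> by blast
  qed (use f in auto)
 qed
 ultimately show ?thesis unfolding isomorphic_def module_iso_def by blast
qed

section \<open>Generators of rank one modules\<close>

definition span2 :: "'k::field fps fps \<Rightarrow> 'k fps fps \<Rightarrow> 'k fps fps set" where
 "span2 f g = {r * f + s * g | r s. r \<in> Asub \<and> s \<in> Asub}"

lemma span2I: "r \<in> Asub ==> s \<in> Asub ==> t = r * f + s * g ==> t \<in> span2 f g"
 unfolding span2_def by blast

lemma span2_stable: "A_stable (span2 f (g :: 'k::field fps fps))" "f \<in> span2 f g" "g \<in> span2 f g"
proof -
 have "\<And>c d. c \<in> span2 f g ==> d \<in> span2 f g ==> c + d \<in> span2 f g"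
 proof -
  fix c d :: "'k fps fps" assume "c \<in> span2 f g" "d \<in> span2 f g"
  then obtain r s r' s' where "r \<in> Asub" "s \<in> Asub" "r' \<in> Asub" "s' \<in> Asub" "c = r * f + s * g" "d = r' * f + s' * g"
   unfolding span2_def by blast
  then show "c + d \<in> span2 f g" by (intro span2I[OF Asub_closed(3) Asub_closed(3), of r r' s s']) (auto simp: algebra_simps)
 qed
 moreover have "\<And>a d. a \<in> Asub ==> d \<in> span2 f g ==> a * d \<in> span2 f g"
 proof -
  fix a d :: "'k fps fps" assume a: "a \<in> Asub" "d \<in> span2 f g"
  then obtain r s where "r \<in> Asub" "s \<in> Asub" "d = r * f + s * g" unfolding span2_def by blast
  then show "a * d \<in> span2 f g" using a by (intro span2I[OF Asub_closed(6) Asub_closed(6), of a r a s]) (auto simp: algebra_simps)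
 qed
 moreover have "0 \<in> span2 f g" by (rule span2I[OF Asub_closed(1) Asub_closed(1)]) simp
 ultimately show "A_stable (span2 f g)" unfolding A_stable_def by blast
 show "f \<in> span2 f g" by (rule span2I[OF Asub_closed(2) Asub_closed(1)]) simp
 show "g \<in> span2 f g" by (rule span2I[OF Asub_closed(1) Asub_closed(2)]) simp
qed

lemma scale_span2: "(*) h ` span2 f g = span2 (h * f) (h * (g :: 'k::field fps fps))"
proof (intro equalityI subsetI)
 fix t assume "t \<in> (*) h ` span2 f g"
 then obtain r s where "r \<in> Asub" "s \<in> Asub" "t = h * (r * f + s * g)" unfolding span2_def by blast
 then show "t \<in> span2 (h * f) (h * g)" by (intro span2I[of r s]) (auto simp: algebra_simps)
next
 fix t assume "t \<in> span2 (h * f) (h * g)"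
 then obtain r s where rs: "r \<in> Asub" "s \<in> Asub" "t = r * (h * f) + s * (h * g)" unfolding span2_def by blast
 then have "t = h * (r * f + s * g)" by (simp add: algebra_simps)
 then show "t \<in> (*) h ` span2 f g" using span2I[OF rs(1,2) refl] by (rule image_eqI)
qed

lemma span2_1_u: "span2 1 (uu :: 'k::field fps fps) = UNIV"
proof -
 have "r \<in> span2 1 uu" for r :: "'k fps fps"
 proof -
  obtain a b where "a \<in> Asub" "b \<in> Asub" "r = a + uu * b" using R_decomp[of r] by (elim bexE) (rule that)
  then show ?thesis by (intro span2I[of a b]) (auto simp: mult.commute)
 qed
 then show ?thesis by blast
qed

lemma span2_1_1: "span2 1 1 = (Asub :: 'k::field fps fps set)"
proof (intro equalityI subsetI)
 fix a :: "'k fps fps" assume "a \<in> Asub"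
 then show "a \<in> span2 1 1" by (intro span2I[OF _ Asub_closed(1)]) auto
qed (auto simp: span2_def)

text \<open>A + A v is stable under v because v^2 = z v - x. The constant term of b is tracked
  because it decides in \<open>Lpq_span2_1\<close> whether 1 - c b is a unit.\<close>

lemma var_v_power_decomp:
 "\<exists>a\<in>Asub. \<exists>b\<in>Asub. (vv :: 'k::field fps fps) ^ Suc n = a + b * vv \<and> a $ 0 $ 0 = 0 \<and> b $ 0 $ 0 = (if n = 0 then 1 else 0)"
proof (induction n)
 case 0
 show ?case by (intro bexI[OF _ Asub_closed(1)] bexI[OF _ Asub_closed(2)]) simp
next
 case (Suc n)
 then obtain a b :: "'k fps fps" where ab: "a \<in> Asub" "b \<in> Asub" "vv ^ Suc n = a + b * vv" "a $ 0 $ 0 = 0" by blast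
 have "vv ^ Suc (Suc n) = (a + b * vv) * vv" using ab(3) by simp
 also have "\<dots> = - (xx * b) + (a + b * zz) * vv" by (simp add: algebra_simps power2_eq_square)
 finally have e: "vv ^ Suc (Suc n) = - (xx * b) + (a + b * zz) * vv" .
 show ?case
  by (rule bexI[OF _ Asub_closed(5)[OF Asub_closed(8)[of b]]], rule bexI[OF _ Asub_closed(3)[OF ab(1) Asub_closed(6)[OF ab(2) Asub_closed(10)]]])
   (use e ab(4) in \<open>simp add: fps_mult_nth\<close>)
qed

abbreviation "cst c \<equiv> fps_const (fps_const c) :: 'k::field fps fps"

lemma res_cst [simp]: "res_u (cst c) = fps_const c" "res_v (cst c) = fps_const c" "swap_uv (cst c) = cst c"
 by (simp_all add: res_u_def res_v_def swap_uv_def fps_eq_iff)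

lemma cst_Asub: "cst c \<in> Asub" by (simp add: Asub_def)

text \<open>With v^m = a + b v and v = z - u, the generator G becomes (1 - c b) u plus an element of
  A. The constant term of 1 - c b is 1 for m > 1 and 1 - c for m = 1, so exactly the admissible c
  make it a unit. Then x u, and with it uv R, lies in the span of x and G; modulo uv R an element of
  the line is an A-multiple of G.\<close>

lemma Lpq_span2_1:
 fixes c :: "'k::field"
 assumes m: "1 \<le> m" and c: "c \<noteq> 0" "m = 1 ==> c \<noteq> 1"
 shows "Lpq 1 m c = span2 xx (uu + cst c * vv ^ m)"
proof -
 let ?G = "uu + cst c * vv ^ m"
 let ?L = "span2 xx ?G"
 note st = A_stableD[OF span2_stable(1)[of xx ?G]]
 obtain n where n: "m = Suc n" using m by (cases m) auto
 obtain a b :: "'k fps fps" where ab: "a \<in> Asub" "b \<in> Asub" "vv ^ m = a + b * vv" "a $ 0 $ 0 = 0" "b $ 0 $ 0 = (if n = 0 then 1 else 0)"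
  using var_v_power_decomp[of n] unfolding n by blast
 have e: "1 - cst c * b \<in> Asub" using ab(2) cst_Asub by (intro Asub_closed)
 have "(1 - cst c * b) $ 0 $ 0 \<noteq> 0" using ab(5) c n by (auto simp: fps_mult_nth)
 then obtain w where w: "w \<in> Asub" "(1 - cst c * b) * w = 1" using Asub_unit[OF e] by blast
 have ww: "w - cst c * b * w = 1" using w(2) by (simp add: algebra_simps)
 have "w * (?G - (cst c * a + cst c * b * zz)) = (w - cst c * b * w) * uu" unfolding ab(3) by (simp add: algebra_simps)
 then have u: "uu = w * (?G - (cst c * a + cst c * b * zz))" unfolding ww by simp
 define d where "d = w * (cst c * a + cst c * b * zz)"
 have d: "d \<in> Asub" unfolding d_def using w(1) ab cst_Asub by (intro Asub_closed)
 have xu: "xx * uu \<in> ?L"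
 proof (rule span2I)
  show "- d \<in> Asub" using d by (rule Asub_closed(5))
  show "w * xx \<in> Asub" using w(1) by (intro Asub_closed)
  have "xx * uu = xx * (w * (?G - (cst c * a + cst c * b * zz)))" by (rule arg_cong[OF u])
  also have "\<dots> = - d * xx + w * xx * ?G" by (simp add: d_def algebra_simps)
  finally show "xx * uu = - d * xx + w * xx * ?G" .
 qed
 have all: "xx * r \<in> ?L" for r
 proof -
  obtain p q where pq: "p \<in> Asub" "q \<in> Asub" "r = p + uu * q" using R_decomp[of r] by (elim bexE) (rule that)
  have "xx * r = p * xx + q * (xx * uu)" using pq(3) by (simp add: algebra_simps)
  then show ?thesis using st(2)[OF st(3)[OF pq(1) span2_stable(2)] st(3)[OF pq(2) xu]] by simp
 qed
 have rG: "res_u ?G = fps_X" "res_v ?G = fps_const c * fps_X ^ m" using m by (simp_all add: power_0_left)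
 show ?thesis
 proof (intro equalityI subsetI)
  fix l assume l: "l \<in> Lpq 1 m c"
  then have "fps_X * (fps_const c * fps_X ^ n * res_u l) = fps_X * res_v l" by (simp add: Lpq_def Line_def n ac_simps)
  then have lv: "res_v l = fps_const c * fps_X ^ n * res_u l" by simp
  then have "res_v l $ 0 = (if n = 0 then c else 0) * res_u l $ 0" by (simp add: fps_mult_nth fps_X_power_nth)
  then have l0: "res_u l $ 0 = 0" using c n by (auto simp: res_nth_0 split: if_splits)
  define \<sigma> where "\<sigma> = fps_shift 1 (res_u l)"
  have \<sigma>: "res_u l = fps_X * \<sigma>" using l0 by (intro fps_ext) (auto simp: \<sigma>_def)
  obtain s :: "'k fps fps" where s: "s \<in> Asub" "res_u s = \<sigma>" "res_v s = \<sigma>" using ex_Asub by blast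
  have "res_u (l - s * ?G) = 0" using s \<sigma> rG by simp
  moreover have "res_v (l - s * ?G) = 0" using s \<sigma> rG lv n by (simp add: ac_simps)
  ultimately have "xx dvd l - s * ?G" using res_eq_0_iff by blast
  then obtain r where r: "l - s * ?G = xx * r" by (rule dvdE)
  then have "l = xx * r + s * ?G" by (simp add: algebra_simps)
  then show "l \<in> ?L" using st(2)[OF all[of r] st(3)[OF s(1) span2_stable(3)]] by (simp only:)
 next
  fix l assume "l \<in> ?L"
  then obtain r s where "r \<in> Asub" "s \<in> Asub" "l = r * xx + s * ?G" unfolding span2_def by blast
  then show "l \<in> Lpq 1 m c" using rG by (simp add: Lpq_def Line_def Asub_def ac_simps)
 qed
qed

lemma swap_Asub: "a \<in> Asub ==> swap_uv a \<in> Asub" by (simp add: Asub_def)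

text \<open>Mirror image of \<open>Lpq_span2_1\<close>: exchanging u and v exchanges p and q and
  inverts c.\<close>

lemma Lpq_span2_2:
 fixes c :: "'k::field"
 assumes m: "1 \<le> m" and c: "c \<noteq> 0" "m = 1 ==> c \<noteq> 1"
 shows "Lpq m 1 c = span2 xx (uu ^ m + cst c * vv)"
proof -
 let ?G = "uu ^ m + cst c * vv" and ?H = "uu + cst (inverse c) * vv ^ m"
 have H: "Lpq 1 m (inverse c) = span2 xx ?H" by (rule Lpq_span2_1) (use assms in auto)
 have sw: "swap_uv xx = xx" by (simp add: mult.commute)
 have GH: "swap_uv ?H = cst (inverse c) * ?G" "swap_uv ?G = cst c * ?H" using c by (simp_all add: algebra_simps)
 show ?thesis
 proof (intro equalityI subsetI)
  fix l assume "l \<in> Lpq m 1 c"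
  then have "fps_const c * (fps_X * res_u l) = fps_X ^ m * res_v l" by (simp add: Lpq_def Line_def ac_simps)
  then have "fps_const (inverse c) * (fps_const c * (fps_X * res_u l)) = fps_const (inverse c) * (fps_X ^ m * res_v l)" by simp
  then have "swap_uv l \<in> Lpq 1 m (inverse c)" using c by (simp add: Lpq_def Line_def flip: mult.assoc)
  then obtain r s where rs: "r \<in> Asub" "s \<in> Asub" "swap_uv l = r * xx + s * ?H" unfolding H span2_def by blast
  have "l = swap_uv (r * xx + s * ?H)" using rs(3) by (metis swap_uv_simps(8))
  also have "\<dots> = swap_uv r * swap_uv xx + swap_uv s * swap_uv ?H"
   using swap_uv_simps(3,5) by metis
  finally have "l = swap_uv r * xx + (swap_uv s * cst (inverse c)) * ?G" unfolding sw GH(1) by (simp only: mult.assoc)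
  then show "l \<in> span2 xx ?G" by (rule span2I[OF swap_Asub[OF rs(1)] Asub_closed(6)[OF swap_Asub[OF rs(2)] cst_Asub]])
 next
  fix l assume "l \<in> span2 xx ?G"
  then obtain r s where "r \<in> Asub" "s \<in> Asub" "l = r * xx + s * ?G" unfolding span2_def by blast
  then show "l \<in> Lpq m 1 c" using m by (simp add: Lpq_def Line_def Asub_def power_0_left ac_simps)
 qed
qed

lemma Lpq_eq_Asub: "Lpq 1 1 1 = Asub"
 by (simp add: Lpq_def Line_def Asub_def)

lemma Lpq_saturated: "saturated (Lpq p q (c :: 'k::field))"
 unfolding saturated_def
proof (intro allI impI)
 fix r :: "'k fps fps" and n assume "xx ^ n * r \<in> Lpq p q c \<and> zz ^ n * r \<in> Lpq p q c"
 then have "fps_X ^ n * (fps_const c * fps_X ^ q * res_u r) = fps_X ^ n * (fps_X ^ p * res_v r)"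
  by (simp add: Lpq_def Line_def ac_simps)
 then show "r \<in> Lpq p q c" by (simp add: Lpq_def Line_def)
qed

lemma genideal_image:
 fixes a b :: "'k::field fps fps fps set"
 assumes ab: "a \<in> cA" "b \<in> cA"
 shows "A_to_R ` (Idl\<^bsub>ring_A\<^esub> {a, b}) = span2 (A_to_R a) (A_to_R b)"
proof -
 interpret cring "ring_A :: 'k fps fps fps set ring" by simp
 note st = A_stableD[OF span2_stable(1)[of "A_to_R a" "A_to_R b"]]
 let ?K = "{x \<in> cA. A_to_R x \<in> span2 (A_to_R a) (A_to_R b)}"
 have "ideal ?K ring_A" by (rule ideal_criterion) (auto intro: st(1-3))
 moreover have "{a, b} \<subseteq> ?K" using ab span2_stable(2,3) by blast
 ultimately have sub: "Idl\<^bsub>ring_A\<^esub> {a, b} \<subseteq> ?K" by (rule genideal_minimal)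
 have ab_sub: "{a, b} \<subseteq> cA" using ab by blast
 note Ic = ideal_closed[OF genideal_ideal[OF ab_sub]]
 have gen: "a \<in> Idl\<^bsub>ring_A\<^esub> {a, b}" "b \<in> Idl\<^bsub>ring_A\<^esub> {a, b}" using genideal_self[OF ab_sub] by blast+
 show ?thesis
 proof (intro equalityI subsetI)
  fix t assume "t \<in> A_to_R ` (Idl\<^bsub>ring_A\<^esub> {a, b})"
  then show "t \<in> span2 (A_to_R a) (A_to_R b)" using sub by blast
 next
  fix t assume "t \<in> span2 (A_to_R a) (A_to_R b)"
  then obtain r s where rs: "r \<in> Asub" "s \<in> Asub" "t = r * A_to_R a + s * A_to_R b" unfolding span2_def by blast
  obtain r' where r': "r' \<in> cA" "A_to_R r' = r" using ex_A[OF rs(1)] by (rule bexE)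
  obtain s' where s': "s' \<in> cA" "A_to_R s' = s" using ex_A[OF rs(2)] by (rule bexE)
  have "t = A_to_R (r' \<otimes>\<^bsub>ring_A\<^esub> a \<oplus>\<^bsub>ring_A\<^esub> s' \<otimes>\<^bsub>ring_A\<^esub> b)" using r' s' ab rs(3) by simp
  then show "t \<in> A_to_R ` (Idl\<^bsub>ring_A\<^esub> {a, b})" using Ic(3)[OF Ic(4)[OF r'(1) gen(1)] Ic(4)[OF s'(1) gen(2)]] by (rule image_eqI)
 qed
qed

lemma ideal_xy_image: "A_to_R ` ideal_xy = (*) xx ` (UNIV :: 'k::field fps fps set)"
proof -
 have "A_to_R ` ideal_xy = span2 (A_to_R (class_A var_x)) (A_to_R (class_A var_y) :: 'k fps fps)"
  unfolding ideal_xy_def by (rule genideal_image) (auto simp: class_A_simps)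
 also have "\<dots> = span2 (xx * 1) (xx * uu)" by (simp add: power2_eq_square ac_simps)
 finally show ?thesis by (simp only: span2_1_u flip: scale_span2)
qed

text \<open>Inside R one has y = x u and x z - y = x v. Hence the second generator is x^m (u + l
  v^m), and x^m splits off the whole ideal.\<close>

lemma ideal_I_image:
 fixes l :: "'k::field"
 assumes "admissible m l"
 shows "A_to_R ` ideal_I m l = (*) (xx ^ m) ` Lpq 1 m l"
proof -
 have m: "1 \<le> m" "l \<noteq> 0" "m = 1 ==> l \<noteq> 1" using assms by (auto simp: admissible_def)
 obtain n where n: "m = Suc n" using m by (cases m) auto
 have 1: "subst_uv (var_y * var_x ^ (m - 1) + scalar l * (var_x * var_z - var_y) ^ m) = xx ^ m * (uu + cst l * vv ^ m)"
 proof -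
  have "xx * zz - uu ^ 2 * vv = xx * (vv :: 'k fps fps)" by (simp add: algebra_simps power2_eq_square)
  then have "subst_uv (var_y * var_x ^ (m - 1) + scalar l * (var_x * var_z - var_y) ^ m) = uu ^ 2 * vv * xx ^ n + cst l * (xx * vv) ^ m"
   by (simp add: n)
  also have "\<dots> = xx ^ m * (uu + cst l * vv ^ m)" by (simp add: n algebra_simps power2_eq_square power_mult_distrib)
  finally show ?thesis .
 qed
 have "A_to_R ` ideal_I m l = span2 (A_to_R (class_A (var_x ^ (m + 1)))) (A_to_R (class_A (var_y * var_x ^ (m - 1) + scalar l * (var_x * var_z - var_y) ^ m)))"
  unfolding ideal_I_def by (rule genideal_image) (auto simp: class_A_simps)
 also have "\<dots> = span2 (xx ^ m * xx) (xx ^ m * (uu + cst l * vv ^ m))"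
  unfolding A_to_R_class 1 by (simp add: ac_simps)
 finally show ?thesis by (simp only: Lpq_span2_1[OF m] flip: scale_span2)
qed

lemma ideal_J_image:
 fixes l :: "'k::field"
 assumes "admissible m l"
 shows "A_to_R ` ideal_J m l = (*) (xx ^ m) ` Lpq m 1 l"
proof -
 have m: "1 \<le> m" "l \<noteq> 0" "m = 1 ==> l \<noteq> 1" using assms by (auto simp: admissible_def)
 obtain n where n: "m = Suc n" using m by (cases m) auto
 have 1: "subst_uv (var_y ^ m + scalar l * var_x ^ (m - 1) * (var_x * var_z - var_y)) = xx ^ m * (uu ^ m + cst l * vv)"
 proof -
  have "xx * zz - uu ^ 2 * vv = xx * (vv :: 'k fps fps)" by (simp add: algebra_simps power2_eq_square)
  then have "subst_uv (var_y ^ m + scalar l * var_x ^ (m - 1) * (var_x * var_z - var_y)) = (uu ^ 2 * vv) ^ m + cst l * xx ^ n * (xx * vv)"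
   by (simp add: n)
  also have "\<dots> = (xx * uu) ^ m + cst l * xx ^ n * (xx * vv)" by (simp add: power2_eq_square ac_simps)
  also have "\<dots> = xx ^ m * (uu ^ m + cst l * vv)" unfolding power_mult_distrib[of xx uu] by (simp add: n algebra_simps)
  finally show ?thesis .
 qed
 have "A_to_R ` ideal_J m l = span2 (A_to_R (class_A (var_x ^ (m + 1)))) (A_to_R (class_A (var_y ^ m + scalar l * var_x ^ (m - 1) * (var_x * var_z - var_y))))"
  unfolding ideal_J_def by (rule genideal_image) (auto simp: class_A_simps)
 also have "\<dots> = span2 (xx ^ m * xx) (xx ^ m * (uu ^ m + cst l * vv))"
  unfolding A_to_R_class 1 by (simp add: ac_simps)
 finally show ?thesis by (simp only: Lpq_span2_2[OF m] flip: scale_span2)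
qed

text \<open>Write u^p + c v^q = b h and uv = a h. A unit b would make uv divide a, and then u^p + c
  v^q would be a unit of R. So b has no constant term, and since one of the restrictions of u^p + c
  v^q has order 1, h is a unit of R. The line equation for h now compares orders, giving p = q, and
  constant terms, giving c = 1.\<close>

lemma Lpq_principal:
 fixes c :: "'k::field"
 assumes pq: "min p q = 1" and c: "c \<noteq> 0" and h: "Lpq p q c = {a * h | a. a \<in> Asub}"
 shows "p = 1 \<and> q = 1 \<and> c = 1"
proof -
 have pq1: "1 \<le> p" "1 \<le> q" using pq by auto
 let ?G = "uu ^ p + cst c * vv ^ q"
 note gen = Lpq_generators[OF pq1, where c = c]
 have "res_u ?G $ 0 = 0" unfolding gen(3) using pq1 by simp
 then have G00: "?G $ 0 $ 0 = 0" by (simp only: res_nth_0)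
 have "?G \<in> {a * h | a. a \<in> Asub}" using gen(2) unfolding h .
 then obtain b where b: "b \<in> Asub" "?G = b * h" by blast
 have "xx * 1 \<in> {a * h | a. a \<in> Asub}" using gen(1) unfolding h .
 then obtain a where a: "a \<in> Asub" "xx * 1 = a * h" by blast
 have bu: "res_u b * res_u h = fps_X ^ p" "res_v b * res_v h = fps_const c * fps_X ^ q"
  using arg_cong[OF b(2), of res_u] arg_cong[OF b(2), of res_v] gen(3,4) by (simp_all only: res_u_simps res_v_simps)
 have rb: "res_u b = res_v b" using b(1) by (simp add: Asub_def)
 have hu: "res_u h \<noteq> 0" "res_v h \<noteq> 0" using bu c by auto
 have "res_u b $ 0 = 0"
 proof (rule ccontr)
  assume "res_u b $ 0 \<noteq> 0"
  then obtain w where w: "w \<in> Asub" "b * w = 1" using Asub_unit[OF b(1)] by (auto simp: res_nth_0)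
  have "res_u a * res_u h = 0" "res_v a * res_v h = 0" using arg_cong[OF a(2), of res_u] arg_cong[OF a(2), of res_v] by simp_all
  then have "res_u a = 0 \<and> res_v a = 0" using hu by simp
  then have "xx dvd a" by (simp only: res_eq_0_iff)
  then obtain a' where a': "a = xx * a'" by (rule dvdE)
  have "xx * 1 = xx * (a' * h)" using a(2) a' by (simp only: mult.assoc)
  then have "a' * h = 1" by (simp only: mult_cancel_left var_uv_nonzero mult_eq_0_iff simp_thms)
  then have "?G * (a' * w) = (b * w) * (a' * h)" using b(2) by (simp add: ac_simps)
  then have "?G * (a' * w) = 1" using w(2) \<open>a' * h = 1\<close> by simp
  from arg_cong[OF this, of "\<lambda>f. f $ 0 $ 0"] show False using G00 by (simp add: fps_mult_nth)
 qed
 then have b0: "res_u b $ 0 = 0" "res_v b $ 0 = 0" using rb by auto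
 have h00: "h $ 0 $ 0 \<noteq> 0"
 proof
  assume h0: "h $ 0 $ 0 = 0"
  have z: "(f * g) $ Suc 0 = 0" if "f $ 0 = 0" "g $ 0 = 0" for f g :: "'k fps" using that by (simp add: fps_mult_nth)
  have "(res_u b * res_u h) $ Suc 0 = 0" "(res_v b * res_v h) $ Suc 0 = 0" using b0 h0 by (intro z; simp add: res_nth_0)+
  then show False unfolding bu using pq c by (auto simp: min_def split: if_splits)
 qed
 have "1 * h \<in> {a * h | a. a \<in> Asub}" using Asub_closed(2) by blast
 then have "h \<in> Lpq p q c" unfolding h by simp
 then have e: "fps_const c * (fps_X ^ q * res_u h) = fps_X ^ p * res_v h" by (simp add: Lpq_def Line_def ac_simps)
 have sh: "subdegree (res_u h) = 0" "subdegree (res_v h) = 0" using h00 by (simp_all add: subdegree_eq_0_iff res_nth_0)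
 have "subdegree (fps_const c * (fps_X ^ q * res_u h)) = q" using c hu sh by (simp add: subdegree_mult subdegree_power)
 moreover have "subdegree (fps_X ^ p * res_v h) = p" using hu sh by (simp add: subdegree_mult subdegree_power)
 ultimately have "p = q" using e by simp
 then have pq': "p = 1" "q = 1" using pq by auto
 have "fps_X * (fps_const c * res_u h) = fps_X * res_v h" using e pq' by (simp add: ac_simps)
 then have "fps_const c * res_u h = res_v h" by simp
 from arg_cong[OF this, of "\<lambda>f. f $ 0"] have "c = 1" using h00 by (simp add: res_nth_0)
 then show ?thesis using pq' by simp
qed

context A_module
begin

lemma rank_one_mcmI:
 assumes lin: "linear_R \<phi>" and inj: "inj_on \<phi> (carrier M)" and im: "\<phi> ` carrier M = span2 f g"
  and sat: "saturated (span2 f g)" and nz: "f \<noteq> 0"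
 shows "rank_one_mcm M"
proof -
 have "f \<in> \<phi> ` carrier M" "g \<in> \<phi> ` carrier M" unfolding im by (rule span2_stable)+
 then obtain e1 e2 where e: "e1 \<in> carrier M" "\<phi> e1 = f" "e2 \<in> carrier M" "\<phi> e2 = g" by (elim imageE) (rule that; simp)
 have gen: "\<exists>a\<in>cA. \<exists>b\<in>cA. x = a \<odot>\<^bsub>M\<^esub> e1 \<oplus>\<^bsub>M\<^esub> b \<odot>\<^bsub>M\<^esub> e2" if x: "x \<in> carrier M" for x
 proof -
  have "\<phi> x \<in> span2 f g" using x im by blast
  then obtain r s where rs: "r \<in> Asub" "s \<in> Asub" "\<phi> x = r * f + s * g" unfolding span2_def by blast
  obtain a where a: "a \<in> cA" "A_to_R a = r" using ex_A[OF rs(1)] by (rule bexE)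
  obtain b where b: "b \<in> cA" "A_to_R b = s" using ex_A[OF rs(2)] by (rule bexE)
  have "\<phi> (a \<odot>\<^bsub>M\<^esub> e1 \<oplus>\<^bsub>M\<^esub> b \<odot>\<^bsub>M\<^esub> e2) = \<phi> x" using a b e rs by (simp add: linear_RD(1,2)[OF lin])
  then have "x = a \<odot>\<^bsub>M\<^esub> e1 \<oplus>\<^bsub>M\<^esub> b \<odot>\<^bsub>M\<^esub> e2" using x a b e by (intro inj_onD[OF inj]) auto
  then show ?thesis using a b by (intro bexI)
 qed
 have "finitely_generated ring_A M"
  unfolding finitely_generated_def
 proof (intro exI[of _ "{e1, e2}"] conjI allI impI)
  fix N assume N: "submodule N ring_A M \<and> {e1, e2} \<subseteq> N"
  note Nc = M.submodule_closed[OF conjunct1[OF N]]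
  have "x \<in> N" if x: "x \<in> carrier M" for x
  proof -
   obtain a b where ab: "a \<in> cA" "b \<in> cA" "x = a \<odot>\<^bsub>M\<^esub> e1 \<oplus>\<^bsub>M\<^esub> b \<odot>\<^bsub>M\<^esub> e2" using gen[OF x] by (elim bexE) (rule that)
   show ?thesis unfolding ab(3) using N by (intro Nc(3) Nc(4) ab(1,2)) auto
  qed
  then show "N = carrier M" using Nc(1) by blast
 qed (use e in auto)
 moreover have "2 \<le> depth (cA - Units ring_A) M" by (rule depth_ge_2[OF lin inj _ e(1)]) (use sat im e nz in simp_all)
 moreover have "has_rank ring_A M 1" by (rule rank_1I[OF lin inj e(1)]) (use e nz in simp)
 ultimately show ?thesis unfolding rank_one_mcm_def mcm_iff by blast
qed

end

section \<open>Modules realized by a submodule of R\<close>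

lemma A_module_ideal:
 assumes "ideal J (ring_A :: 'k::field fps fps fps set ring)"
 shows "A_module (ideal_module ring_A J)" "A_module.linear_R (ideal_module ring_A J) A_to_R"
  "inj_on A_to_R (carrier (ideal_module ring_A J))" "A_to_R ` carrier (ideal_module ring_A J) = A_to_R ` J"
proof -
 interpret S: Module.module ring_A "self_module (ring_A :: 'k fps fps fps set ring)" by (rule module_self[OF cring_ring_A])
 note Jc = ideal_closed[OF assms]
 have c: "carrier (ideal_module ring_A J) = J" by (simp add: ideal_module_def)
 have "submodule J ring_A (self_module ring_A)"
  by (rule S.submodule_criterion) (use Jc in \<open>auto simp: self_module_def restrict_scalars_def\<close>)
 then have m: "Module.module ring_A (ideal_module ring_A J)"
  unfolding ideal_module_def by (rule submodule.submodule_is_module[OF _ S.module_axioms])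
 then interpret A_module "ideal_module ring_A J" by (rule A_module.intro)
 show "A_module (ideal_module ring_A J)" by (rule A_module_axioms)
 have JA: "x \<in> cA" if "x \<in> J" for x using Jc(1) that by blast
 show "linear_R A_to_R" unfolding linear_R_def c by (auto simp: ideal_module_def self_module_def restrict_scalars_def JA)
 show "inj_on A_to_R (carrier (ideal_module ring_A J))"
  unfolding c by (rule inj_on_subset[OF bij_betw_imp_inj_on[OF bij_A_to_R] Jc(1)])
 show "A_to_R ` carrier (ideal_module ring_A J) = A_to_R ` J" unfolding c ..
qed

lemma ideal_ideal_xy: "ideal ideal_xy (ring_A :: 'k::field fps fps fps set ring)"
 and ideal_ideal_I: "ideal (ideal_I m l) (ring_A :: 'k::field fps fps fps set ring)"
 and ideal_ideal_J: "ideal (ideal_J m l) (ring_A :: 'k::field fps fps fps set ring)"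
proof -
 interpret cring "ring_A :: 'k fps fps fps set ring" by simp
 show "ideal ideal_xy (ring_A :: 'k fps fps fps set ring)" "ideal (ideal_I m l) (ring_A :: 'k fps fps fps set ring)"
  "ideal (ideal_J m l) (ring_A :: 'k fps fps fps set ring)"
  unfolding ideal_xy_def ideal_I_def ideal_J_def by (rule genideal_ideal; simp add: class_A_simps)+
qed

text \<open>The link between abstract modules and subsets of R: rank, depth, local freeness and
  isomorphism are all decided from L, and \<open>realizes_isomorphic\<close> says that L determines
  M.\<close>

definition realizes :: "('k::field fps fps fps set, 'm) module \<Rightarrow> ('m \<Rightarrow> 'k fps fps) \<Rightarrow> 'k fps fps set \<Rightarrow> bool" where
 "realizes M \<phi> L \<longleftrightarrow> A_module M \<and> A_module.linear_R M \<phi> \<and> inj_on \<phi> (carrier M) \<and> \<phi> ` carrier M = L"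

lemma realizesD:
 assumes "realizes M \<phi> L"
 shows "A_module M" "A_module.linear_R M \<phi>" "inj_on \<phi> (carrier M)" "\<phi> ` carrier M = L"
 using assms unfolding realizes_def by blast+

lemma realizes_ideal:
 assumes J: "ideal J (ring_A :: 'k::field fps fps fps set ring)" "A_to_R ` J = (*) h ` L" "h \<noteq> 0"
 shows "\<exists>\<phi>. realizes (ideal_module ring_A J) \<phi> L"
proof -
 note m = A_module_ideal[OF J(1)]
 obtain \<psi> where "A_module.linear_R (ideal_module ring_A J) \<psi> \<and> inj_on \<psi> (carrier (ideal_module ring_A J)) \<and> \<psi> ` carrier (ideal_module ring_A J) = L \<and> (\<forall>x\<in>carrier (ideal_module ring_A J). A_to_R x = h * \<psi> x)"
  using A_module.rescale[OF m(1,2,3) J(3) trans[OF m(4) J(2)]] by (rule exE)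
 then show ?thesis unfolding realizes_def using m(1) by (intro exI[of _ \<psi>]) blast
qed

lemma realizes_ideal_xy: "\<exists>\<phi>. realizes (ideal_module ring_A (ideal_xy :: 'k::field fps fps fps set set)) \<phi> UNIV"
 by (rule realizes_ideal[OF ideal_ideal_xy ideal_xy_image]) simp

lemma realizes_ideal_I: "admissible m l ==> \<exists>\<phi>. realizes (ideal_module ring_A (ideal_I m l)) \<phi> (Lpq 1 m (l :: 'k::field))"
 by (rule realizes_ideal[OF ideal_ideal_I ideal_I_image]) simp_all

lemma realizes_ideal_J: "admissible m l ==> \<exists>\<phi>. realizes (ideal_module ring_A (ideal_J m l)) \<phi> (Lpq m 1 (l :: 'k::field))"
 by (rule realizes_ideal[OF ideal_ideal_J ideal_J_image]) simp_all

lemma realizes_self: "realizes (self_module (ring_A :: 'k::field fps fps fps set ring)) A_to_R Asub"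
proof -
 interpret A_module "self_module (ring_A :: 'k fps fps fps set ring)" by (rule A_module.intro[OF module_self[OF cring_ring_A]])
 have c: "carrier (self_module (ring_A :: 'k fps fps fps set ring)) = cA" by (simp add: self_module_def restrict_scalars_def)
 have "linear_R A_to_R" unfolding linear_R_def c by (simp add: self_module_def restrict_scalars_def)
 then show ?thesis unfolding realizes_def c using A_module_axioms bij_betw_imp_inj_on[OF bij_A_to_R] image_A by blast
qed

lemma realizes_R: "realizes (restrict_scalars A_to_R (ring_R :: 'k::field fps fps ring)) (\<lambda>x. x) UNIV"
proof -
 interpret A_module "restrict_scalars A_to_R (ring_R :: 'k fps fps ring)"
  by (rule A_module.intro[OF module_restrict_scalars[OF cring_ring_A cring_type A_to_R_hom]])
 have "linear_R (\<lambda>x. x)" unfolding linear_R_def by (simp add: restrict_scalars_def)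
 then show ?thesis unfolding realizes_def using A_module_axioms by (simp add: restrict_scalars_def)
qed

lemma saturated_UNIV: "saturated UNIV"
 by (simp add: saturated_def)

lemma realizes_UNIV:
 assumes "realizes M \<phi> UNIV"
 shows "rank_one_mcm M" "\<not> lfps M"
proof -
 note r = realizesD[OF assms]
 show "rank_one_mcm M" by (rule A_module.rank_one_mcmI[OF r(1-3), of 1 uu]) (simp_all add: r(4) span2_1_u saturated_UNIV)
 show "\<not> lfps M" by (rule A_module.not_lfps[OF r])
qed

lemma realizes_Lpq:
 assumes M: "realizes M \<phi> (Lpq p q c)" and pq: "min p q = 1" and c: "(c :: 'k::field) \<noteq> 0"
 shows "rank_one_mcm M" "lfps M" "isomorphic ring_A M (self_module ring_A) ==> p = 1 \<and> q = 1 \<and> c = 1"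
proof -
 note r = realizesD[OF M]
 have pq1: "1 \<le> p" "1 \<le> q" using pq by auto
 show "lfps M" by (rule A_module.lfps_I[OF r pq1 c])
 show "rank_one_mcm M"
 proof (cases "p = 1 \<and> q = 1 \<and> c = 1")
  case True
  then have "Lpq p q c = span2 1 1" by (simp add: span2_1_1 Lpq_eq_Asub del: One_nat_def)
  then show ?thesis using Lpq_saturated[of p q c] by (intro A_module.rank_one_mcmI[OF r(1-3), of 1 1]) (simp_all add: r(4))
 next
  case False
  have "\<exists>g. Lpq p q c = span2 xx g"
  proof (cases "p = 1")
   case True then show ?thesis using Lpq_span2_1[OF pq1(2) c] False by (intro exI) auto
  next
   case p: False
   then have "q = 1" using pq by (auto simp: min_def split: if_splits)
   then show ?thesis using Lpq_span2_2[OF pq1(1) c] p by (intro exI) auto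
  qed
  then obtain g where "Lpq p q c = span2 xx g" by (rule exE)
  then show ?thesis using Lpq_saturated[of p q c] by (intro A_module.rank_one_mcmI[OF r(1-3), of xx g]) (simp_all add: r(4))
 qed
 assume "isomorphic ring_A M (self_module ring_A)"
 then obtain f where f: "f \<in> module_iso ring_A M (self_module ring_A)" unfolding isomorphic_def by blast
 then have bij: "bij_betw f (carrier M) (cA)" and
  fs: "\<And>a x. a \<in> cA ==> x \<in> carrier M ==> f (a \<odot>\<^bsub>M\<^esub> x) = a \<otimes>\<^bsub>ring_A\<^esub> f x"
  unfolding module_iso_def module_hom_def by (auto simp: self_module_def restrict_scalars_def)
 interpret A_module M by (rule r)
 obtain e where e: "e \<in> carrier M" "f e = \<one>\<^bsub>ring_A\<^esub>" using bij_betw_imp_surj_on[OF bij] M.R.one_closed by (metis imageE)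
 have fc: "f x \<in> cA" if "x \<in> carrier M" for x using bij_betwE[OF bij] that by blast
 have ex: "x = f x \<odot>\<^bsub>M\<^esub> e" if x: "x \<in> carrier M" for x
  by (rule inj_onD[OF bij_betw_imp_inj_on[OF bij]]) (use fs[OF fc[OF x] e(1)] e fc x in \<open>auto simp: M.R.r_one\<close>)
 have "Lpq p q c = {a * \<phi> e | a. a \<in> Asub}"
 proof (intro equalityI subsetI)
  fix l assume "l \<in> Lpq p q c"
  then have "l \<in> \<phi> ` carrier M" using r(4) by simp
  then obtain x where x: "x \<in> carrier M" "l = \<phi> x" by (rule imageE) simp
  have "l = A_to_R (f x) * \<phi> e" unfolding x(2) by (subst ex[OF x(1)]) (rule linear_RD(2)[OF r(2) fc[OF x(1)] e(1)])
  then show "l \<in> {a * \<phi> e | a. a \<in> Asub}" using A_to_R_simps(6)[OF fc[OF x(1)]] by blast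
 next
  fix l assume "l \<in> {a * \<phi> e | a. a \<in> Asub}"
  then obtain a where a: "l = a * \<phi> e" "a \<in> Asub" by blast
  obtain b where b: "b \<in> cA" "A_to_R b = a" using ex_A[OF a(2)] by (rule bexE)
  have "l = \<phi> (b \<odot>\<^bsub>M\<^esub> e)" using a b linear_RD(2)[OF r(2) b(1) e(1)] by simp
  then have "l \<in> \<phi> ` carrier M" using M.smult_closed[OF b(1) e(1)] by (rule image_eqI)
  then show "l \<in> Lpq p q c" using r(4) by simp
 qed
 then show "p = 1 \<and> q = 1 \<and> c = 1" by (rule Lpq_principal[OF pq c])
qed

lemma rank_one_mcm_realizes:
 assumes M: "rank_one_mcm (M :: ('k::field fps fps fps set, 'm) module)"
 shows "\<exists>\<phi>. realizes M \<phi> UNIV \<or> (\<exists>p q c. c \<noteq> 0 \<and> min p q = 1 \<and> realizes M \<phi> (Lpq p q c))"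
proof -
 have am: "A_module M" using M unfolding rank_one_mcm_def maximal_cohen_macaulay_def by (intro A_module.intro) blast
 have mcm: "maximal_cohen_macaulay ring_A M" "has_rank ring_A M 1" using M unfolding rank_one_mcm_def by blast+
 obtain \<phi> where p: "A_module.linear_R M \<phi>" "inj_on \<phi> (carrier M)" "\<phi> ` carrier M = UNIV \<or> (\<exists>p q c. c \<noteq> 0 \<and> min p q = 1 \<and> \<phi> ` carrier M = Lpq p q c)"
  using A_module.rank_one_mcm_embedding[OF am mcm] by blast
 show ?thesis using p(3) unfolding realizes_def by (intro exI[of _ \<phi>]) (simp only: p(1,2) am simp_thms)
qed

lemma realizes_isomorphic:
 assumes "realizes M \<phi> L" "realizes N \<psi> L"
 shows "isomorphic ring_A M N"
 by (rule isomorphic_if_same_image[OF realizesD(1-3)[OF assms(1)] realizesD(1-3)[OF assms(2)]])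
  (simp only: realizesD(4)[OF assms(1)] realizesD(4)[OF assms(2)])

text \<open>Testing against the single element u suffices: a u has restriction 0 at u = 0, so a u in
  A forces the restriction of a to v = 0 to vanish, and for a in A then both.\<close>

lemma conductor_eq: "conductor A_to_R ring_A (ring_R :: 'k::field fps fps ring) = ideal_xy"
proof -
 have c: "r \<in> (*) xx ` UNIV \<longleftrightarrow> res_u r = 0 \<and> res_v r = 0" for r :: "'k fps fps"
  unfolding res_eq_0_iff by (auto simp: dvd_def)
 have sub: "ideal_xy \<subseteq> carrier (ring_A :: 'k fps fps fps set ring)" by (rule ideal_closed(1)[OF ideal_ideal_xy])
 show ?thesis
 proof (intro equalityI subsetI)
  fix a :: "'k fps fps fps set" assume a: "a \<in> conductor A_to_R ring_A ring_R"
  then have aA: "a \<in> cA" and "A_to_R a * uu \<in> A_to_R ` cA" by (auto simp: conductor_def)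
  then have "A_to_R a * uu \<in> Asub" unfolding image_A by blast
  then have "res_u (A_to_R a) = 0" by (simp add: Asub_def)
  moreover then have "res_v (A_to_R a) = 0" using A_to_R_simps(6)[OF aA] by (simp add: Asub_def)
  ultimately have "A_to_R a \<in> A_to_R ` ideal_xy" unfolding ideal_xy_image c by blast
  then obtain b where b: "b \<in> ideal_xy" "A_to_R a = A_to_R b" by (rule imageE)
  then have "a = b" using A_to_R_inj[OF aA, of b] sub by blast
  then show "a \<in> ideal_xy" using b by simp
 next
  fix a :: "'k fps fps fps set" assume a: "a \<in> ideal_xy"
  then have "A_to_R a \<in> (*) xx ` UNIV" unfolding ideal_xy_image[symmetric] by (rule imageI)
  then have "A_to_R a * r \<in> Asub" for r unfolding c by (simp add: Asub_def)
  then show "a \<in> conductor A_to_R ring_A ring_R" using a sub by (auto simp: conductor_def image_A)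
 qed
qed

section \<open>Integral closedness of R and the normalization of A\<close>

lemma power_dvd_coprime:
 fixes w :: "'k::field fps fps"
 shows "uu ^ n dvd vv ^ m * w ==> uu ^ n dvd w"
proof (induction n arbitrary: w)
 case (Suc n)
 have "uu dvd vv ^ m * w" using Suc(2) by (metis power_Suc dvd_mult_left)
 then have "res_v (vv ^ m * w) = 0" unfolding res_v_eq_0_iff .
 then have "res_v w = 0" by simp
 then obtain w' where w: "w = uu * w'" unfolding res_v_eq_0_iff by (rule dvdE)
 have "uu * uu ^ n dvd uu * (vv ^ m * w')" using Suc(2) by (simp add: w mult.left_commute)
 then have "uu ^ n dvd vv ^ m * w'" by (simp only: dvd_mult_cancel_left var_uv_nonzero simp_thms)
 then have "uu ^ n dvd w'" by (rule Suc(1))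
 then show ?case by (simp add: w)
qed simp

text \<open>The reflexive hull of the ideal (r,s) is principal by
  \<open>reflexive_ideal_principal\<close>, and its generator g acts as a greatest common divisor.
  After division by g the ideal (r',s') contains powers of u and of v.\<close>

lemma coprime_fraction:
 fixes r s :: "'k::field fps fps"
 assumes "s \<noteq> 0"
 shows "\<exists>g r' s' k. r = g * r' \<and> s = g * s' \<and> (\<exists>a b. uu ^ k = r' * a + s' * b) \<and> (\<exists>a b. vv ^ k = r' * a + s' * b)"
proof -
 define I where "I = {r * a + s * b | a b. True}"
 have I1: "c + d \<in> I" if tg: "c \<in> I" "d \<in> I" for c d
 proof -
  obtain a b a' b' where "c = r * a + s * b" "d = r * a' + s * b'" using tg unfolding I_def by blast
  then have "c + d = r * (a + a') + s * (b + b')" by (simp add: algebra_simps)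
  then show ?thesis unfolding I_def by blast
 qed
 have I2: "t * c \<in> I" if tg: "c \<in> I" for c t
 proof -
  obtain a b where "c = r * a + s * b" using tg unfolding I_def by blast
  then have "t * c = r * (t * a) + s * (t * b)" by (simp add: algebra_simps)
  then show ?thesis unfolding I_def by blast
 qed
 note I = I1 I2
 define L where "L = {t. \<exists>k. uu ^ k * t \<in> I \<and> vv ^ k * t \<in> I}"
 have up: "uu ^ (k + j) * t \<in> I \<and> vv ^ (k + j) * t \<in> I" if tg: "uu ^ k * t \<in> I" "vv ^ k * t \<in> I" for k j t
  using I(2)[OF tg(1), of "uu ^ j"] I(2)[OF tg(2), of "vv ^ j"] by (simp add: power_add ac_simps)
 have L1: "c + d \<in> L" if tg: "c \<in> L" "d \<in> L" for c d
 proof -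
  obtain k j where kj: "uu ^ k * c \<in> I" "vv ^ k * c \<in> I" "uu ^ j * d \<in> I" "vv ^ j * d \<in> I" using tg unfolding L_def by blast
  have "uu ^ (k + j) * (c + d) \<in> I \<and> vv ^ (k + j) * (c + d) \<in> I"
   using up[OF kj(1,2), of j] up[OF kj(3,4), of k] unfolding distrib_left add.commute[of j k] by (intro conjI I1) (elim conjE, assumption)+
  then show ?thesis unfolding L_def by blast
 qed
 have L2: "t * c \<in> L" if tg: "c \<in> L" for c t
 proof -
  obtain k where k: "uu ^ k * c \<in> I" "vv ^ k * c \<in> I" using tg unfolding L_def by blast
  have "uu ^ k * (t * c) \<in> I \<and> vv ^ k * (t * c) \<in> I"
   using I2[OF k(1), of t] I2[OF k(2), of t] by (simp only: mult.left_commute[of _ t] simp_thms)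
  then show ?thesis unfolding L_def by blast
 qed
 have L3: "t \<in> L" if t: "uu ^ n * t \<in> L" "vv ^ n * t \<in> L" for t n
 proof -
  obtain k j where kj: "uu ^ k * (uu ^ n * t) \<in> I" "vv ^ j * (vv ^ n * t) \<in> I" using t unfolding L_def by blast
  have "uu ^ j * (uu ^ k * (uu ^ n * t)) \<in> I" "vv ^ k * (vv ^ j * (vv ^ n * t)) \<in> I" using I2[OF kj(1)] I2[OF kj(2)] by simp_all
  then have "uu ^ (n + k + j) * t \<in> I" "vv ^ (n + k + j) * t \<in> I" by (simp_all add: power_add ac_simps)
  then show ?thesis unfolding L_def by blast
 qed
 have rI: "r \<in> I" "s \<in> I" unfolding I_def by (intro CollectI exI[of _ 1] exI[of _ 0]; simp) (intro CollectI exI[of _ 0] exI[of _ 1]; simp)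
 have rL: "r \<in> L" "s \<in> L" unfolding L_def using rI by (intro CollectI exI[of _ 0]; simp)+
 have "\<exists>g. g \<noteq> 0 \<and> L = range ((*) g)"
  by (rule reflexive_ideal_principal[OF _ _ _ rL(2) assms]) (rule L1, assumption+, rule L2, assumption, rule L3, assumption+)
 then obtain g where g: "g \<noteq> 0" "L = range ((*) g)" by blast
 obtain r' where r': "r = g * r'" using rL(1) unfolding g(2) by (rule rangeE)
 obtain s' where s': "s = g * s'" using rL(2) unfolding g(2) by (rule rangeE)
 have "g \<in> L" unfolding g(2) by (rule range_eqI[of _ _ 1]) simp
 then obtain k where k: "uu ^ k * g \<in> I" "vv ^ k * g \<in> I" unfolding L_def by blast
 have "\<exists>a b. t = r' * a + s' * b" if tg: "t * g \<in> I" for t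
 proof -
  obtain a b where "t * g = r * a + s * b" using tg unfolding I_def by blast
  then have "g * t = g * (r' * a + s' * b)" by (simp add: r' s' algebra_simps)
  then have "t = r' * a + s' * b" using g(1) mult_cancel_left by blast
  then show ?thesis by blast
 qed
 then show ?thesis using r' s' k by blast
qed

lemma to_fract_power: "to_fract (a ^ n) = to_fract a ^ n"
 by (induction n) simp_all

text \<open>For q = r'/s' in reduced form the integral equation gives s' dividing r'^n, so s'
  divides a power of every element of (r',s'), in particular a power of u and a power of v. Hence s'
  is a unit.\<close>

lemma R_normal:
 fixes q :: "'k::field fps fps fract"
 assumes q: "q ^ n + (\<Sum>i<n. to_fract (c i) * q ^ i) = 0"
 shows "q \<in> range to_fract"
proof -
 obtain r s where "s \<noteq> 0" "q = Fract r s" by (cases q) auto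
 then have rs: "s \<noteq> 0" "q = to_fract r / to_fract s" by (simp_all add: Fract_conv_to_fract)
 obtain g r' s' k where g: "r = g * r'" "s = g * s'" "\<exists>a b. uu ^ k = r' * a + s' * b" "\<exists>a b. vv ^ k = r' * a + s' * b"
  using coprime_fraction[OF rs(1), of r] by blast
 have nz: "g \<noteq> 0" "s' \<noteq> 0" using rs g by auto
 then have qe: "q = to_fract r' / to_fract s'" using rs g by simp
 have p: "q ^ i * to_fract s' ^ n = to_fract (r' ^ i * s' ^ (n - i))" if tg: "i \<le> n" for i
 proof -
  have "to_fract s' ^ n = to_fract s' ^ i * to_fract s' ^ (n - i)" using tg by (simp flip: power_add)
  then show ?thesis using nz by (simp add: qe power_divide to_fract_power)
 qed
 have "0 = (q ^ n + (\<Sum>i<n. to_fract (c i) * q ^ i)) * to_fract s' ^ n" using q by simp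
 also have "\<dots> = q ^ n * to_fract s' ^ n + (\<Sum>i<n. to_fract (c i) * (q ^ i * to_fract s' ^ n))"
  by (simp add: distrib_right sum_distrib_right mult.assoc)
 also have "\<dots> = to_fract (r' ^ n + (\<Sum>i<n. c i * (r' ^ i * s' ^ (n - i))))" by (simp add: p)
 finally have "to_fract (r' ^ n + (\<Sum>i<n. c i * (r' ^ i * s' ^ (n - i)))) = 0" by (rule sym)
 then have "r' ^ n + (\<Sum>i<n. c i * (r' ^ i * s' ^ (n - i))) = 0" by (simp only: to_fract_eq_0_iff)
 then have "r' ^ n = - (\<Sum>i<n. c i * (r' ^ i * s' ^ (n - i)))" by (simp add: eq_neg_iff_add_eq_0)
 moreover have "s' dvd (\<Sum>i<n. c i * (r' ^ i * s' ^ (n - i)))" by (intro dvd_sum dvd_mult) (simp add: dvd_power)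
 ultimately have d: "s' dvd r' ^ n" by simp
 have pw: "s' dvd w ^ (n + 1)" if tg: "\<exists>a b. w = r' * a + s' * b" for w
 proof -
  obtain a b where ab: "w = r' * a + s' * b" using tg by blast
  obtain P Q where "(r' * a + s' * b) ^ (n + 1) = (r' * a) ^ n * P + (s' * b) ^ 1 * Q" using add_power_in_ideal by blast
  then have "w ^ (n + 1) = r' ^ n * (a ^ n * P) + s' * (b * Q)" by (simp add: ab power_mult_distrib mult.assoc)
  then show ?thesis using d by (simp add: dvd_mult2)
 qed
 obtain w where w: "(uu ^ k) ^ (n + 1) = s' * w" using pw[OF g(3)] by (rule dvdE)
 obtain w' where w': "(vv ^ k) ^ (n + 1) = s' * w'" using pw[OF g(4)] by (rule dvdE)
 have "s' * ((vv ^ k) ^ (n + 1) * w) = s' * ((uu ^ k) ^ (n + 1) * w')" unfolding w w' by (simp add: ac_simps)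
 then have "(vv ^ k) ^ (n + 1) * w = (uu ^ k) ^ (n + 1) * w'" using nz(2) mult_cancel_left by blast
 then have "uu ^ (k * (n + 1)) dvd vv ^ (k * (n + 1)) * w" unfolding power_mult by simp
 then have "uu ^ (k * (n + 1)) dvd w" by (rule power_dvd_coprime)
 then obtain t where t: "w = uu ^ (k * (n + 1)) * t" by (rule dvdE)
 have "uu ^ (k * (n + 1)) * 1 = uu ^ (k * (n + 1)) * (s' * t)" using w unfolding t power_mult by (simp add: ac_simps)
 then have one: "1 = s' * t" by (simp only: mult_cancel_left power_eq_0_iff var_uv_nonzero simp_thms)
 then have "to_fract s' * to_fract t = 1" by (metis to_fract_mult to_fract_1)
 then have "q = to_fract (r' * t)" using nz by (simp add: qe field_simps)
 then show ?thesis by (rule range_eqI)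
qed

text \<open>R lies in the fraction field of A since r = (x r) / x, and r is integral as a root of
  T^2 - (r + swap r) T + r swap r, whose coefficients are symmetric and hence in A. The converse is
  \<open>R_normal\<close>.\<close>

lemma normalization_A: "is_normalization A_to_R ring_A (ring_R :: 'k::field fps fps ring)"
proof -
 let ?A = "ring_A :: 'k fps fps fps set ring"
 define S where "S = nonzerodivisors ?A"
 define j where "j = to_localization ?A S"
 interpret dom: domain ?A by (rule domain_ring_A)
 interpret fraction_data ?A S iota
  unfolding S_def nonzerodivisors_A by (rule fraction_data_A) (use dom.integral in auto)
 interpret Q: cring L by (rule cring_L)
 have jc: "j a \<in> carrier L" "val (j a) = to_fract (A_to_R a)" if tg: "a \<in> carrier ?A" for a
  using ring_hom_closed[OF to_loc_hom that] val_to_loc[OF tg] by (simp_all add: j_def iota_def)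
 have sur: "\<exists>x\<in>carrier L. val x = to_fract r" for r
 proof -
  obtain a where a: "a \<in> carrier ?A" "A_to_R a = xx * r" using ex_A[OF Asub_closed(8)] by (rule bexE)
  obtain b where b: "b \<in> carrier ?A" "A_to_R b = xx" using ex_A[OF Asub_closed(9)] by (rule bexE)
  have "b \<noteq> \<zero>\<^bsub>?A\<^esub>" using b A_to_R_simps(5)[OF b(1)] by auto
  then have bS: "b \<in> S" using b(1) unfolding S_def nonzerodivisors_A by blast
  have "val (frc a b) = to_fract r" using val_frac[OF a(1) bS] a b by (simp add: iota_def)
  then show ?thesis using frac_closed[OF a(1) bS] by (intro bexI)
 qed
 define h where "h r = inv_into (carrier L) val (to_fract r)" for r
 have h: "h r \<in> carrier L" "val (h r) = to_fract r" for r
 proof -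
  obtain x where "x \<in> carrier L" "val x = to_fract r" using sur[of r] by (rule bexE)
  then have "to_fract r \<in> val ` carrier L" by (metis imageI)
  then show "h r \<in> carrier L" "val (h r) = to_fract r" unfolding h_def by (rule inv_into_into, rule f_inv_into_f)
 qed
 have eqI: "x = y" if tg: "val x = val y" "x \<in> carrier L" "y \<in> carrier L" for x y using inj_onD[OF inj_val tg] .
 have zero_iff: "y = \<zero>\<^bsub>L\<^esub> \<longleftrightarrow> val y = 0" if tg: "y \<in> carrier L" for y
 proof
  assume "val y = 0"
  then show "y = \<zero>\<^bsub>L\<^esub>" using val_hom(3) tg by (intro eqI) simp_all
 qed (use val_hom(3) in simp)
 have hj: "h (A_to_R a) = j a" if tg: "a \<in> carrier ?A" for a by (rule eqI) (use h jc[OF tg] in simp_all)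
 have vpow: "val (x [^]\<^bsub>L\<^esub> (i::nat)) = val x ^ i" if tg: "x \<in> carrier L" for x i
  by (induction i) (use tg val_hom Q.nat_pow_closed in \<open>auto simp: mult.commute\<close>)
 have vsum: "val (\<Oplus>\<^bsub>L\<^esub>i\<in>I. f i) = (\<Sum>i\<in>I. val (f i))" if tg: "finite I" "f \<in> I \<rightarrow> carrier L" for I f
  using tg by (induction I rule: finite_induct) (use val_hom in \<open>auto simp: Q.finsum_insert\<close>)
 have int_iff: "x \<in> integral_closure j ?A L \<longleftrightarrow> x \<in> carrier L \<and> (\<exists>n. \<exists>c \<in> {..<n} \<rightarrow> carrier ?A. val x ^ n + (\<Sum>i<n. to_fract (A_to_R (c i)) * val x ^ i) = 0)" for x
 proof -
  have "x [^]\<^bsub>L\<^esub> n \<oplus>\<^bsub>L\<^esub> (\<Oplus>\<^bsub>L\<^esub>i\<in>{..<n}. j (c i) \<otimes>\<^bsub>L\<^esub> x [^]\<^bsub>L\<^esub> i) = \<zero>\<^bsub>L\<^esub> \<longleftrightarrow> val x ^ n + (\<Sum>i<n. to_fract (A_to_R (c i)) * val x ^ i) = 0"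
   if x: "x \<in> carrier L" and c: "c \<in> {..<n} \<rightarrow> carrier ?A" for n c
  proof -
   have f: "(\<lambda>i. j (c i) \<otimes>\<^bsub>L\<^esub> x [^]\<^bsub>L\<^esub> i) \<in> {..<n} \<rightarrow> carrier L" using c jc x by (auto intro!: Q.m_closed)
   have cl: "x [^]\<^bsub>L\<^esub> n \<oplus>\<^bsub>L\<^esub> (\<Oplus>\<^bsub>L\<^esub>i\<in>{..<n}. j (c i) \<otimes>\<^bsub>L\<^esub> x [^]\<^bsub>L\<^esub> i) \<in> carrier L" using f x by (intro Q.a_closed Q.finsum_closed) auto
   have "val (j (c i) \<otimes>\<^bsub>L\<^esub> x [^]\<^bsub>L\<^esub> i) = to_fract (A_to_R (c i)) * val x ^ i" if tg: "i < n" for i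
   proof -
    have "c i \<in> carrier ?A" using c tg by (simp add: Pi_iff)
    then show ?thesis using jc[of "c i"] val_hom(2)[of "j (c i)" "x [^]\<^bsub>L\<^esub> i"] vpow[OF x, of i] Q.nat_pow_closed[OF x, of i] by simp
   qed
   then have "(\<Sum>i<n. val (j (c i) \<otimes>\<^bsub>L\<^esub> x [^]\<^bsub>L\<^esub> i)) = (\<Sum>i<n. to_fract (A_to_R (c i)) * val x ^ i)" by (intro sum.cong) auto
   then have ve: "val (x [^]\<^bsub>L\<^esub> n \<oplus>\<^bsub>L\<^esub> (\<Oplus>\<^bsub>L\<^esub>i\<in>{..<n}. j (c i) \<otimes>\<^bsub>L\<^esub> x [^]\<^bsub>L\<^esub> i)) = val x ^ n + (\<Sum>i<n. to_fract (A_to_R (c i)) * val x ^ i)"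
    using val_hom(1)[OF Q.nat_pow_closed[OF x] Q.finsum_closed[OF f]] vsum[OF _ f] vpow[OF x] by simp
   show ?thesis unfolding zero_iff[OF cl] ve ..
  qed
  then show ?thesis unfolding integral_closure_def by blast
 qed
 have range_h: "range h = integral_closure j ?A L"
 proof (intro equalityI subsetI)
  fix x assume "x \<in> integral_closure j ?A L"
  then obtain n c where x: "x \<in> carrier L" "val x ^ n + (\<Sum>i<n. to_fract (A_to_R (c i)) * val x ^ i) = 0" unfolding int_iff by blast
  obtain r where r: "val x = to_fract r" using R_normal[OF x(2)] by (rule rangeE)
  have "x = h r" by (rule eqI) (use x h r in simp_all)
  then show "x \<in> range h" by (rule range_eqI)
 next
  fix x assume "x \<in> range h"
  then obtain r where r: "x = h r" by (rule rangeE)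
  have 1: "r + swap_uv r \<in> Asub" "r * swap_uv r \<in> Asub" by (simp_all add: Asub_def add.commute mult.commute)
  obtain a where a: "a \<in> carrier ?A" "A_to_R a = - (r + swap_uv r)" using ex_A[OF Asub_closed(5)[OF 1(1)]] by (rule bexE)
  obtain b where b: "b \<in> carrier ?A" "A_to_R b = r * swap_uv r" using ex_A[OF 1(2)] by (rule bexE)
  define c where "c i = (if i = 0 then b else a)" for i :: nat
  have "(\<Sum>i<2. to_fract (A_to_R (c i)) * to_fract r ^ i) = to_fract (r * swap_uv r + - (r + swap_uv r) * r)"
   using a b by (simp add: c_def numeral_2_eq_2)
  then have "to_fract r ^ 2 + (\<Sum>i<2. to_fract (A_to_R (c i)) * to_fract r ^ i) = to_fract (r ^ 2 + (r * swap_uv r + - (r + swap_uv r) * r))" by (simp add: to_fract_power)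
  also have "r ^ 2 + (r * swap_uv r + - (r + swap_uv r) * r) = 0" by (simp add: power2_eq_square algebra_simps)
  finally have "to_fract r ^ 2 + (\<Sum>i<2. to_fract (A_to_R (c i)) * to_fract r ^ i) = 0" by simp
  moreover have "c \<in> {..<2} \<rightarrow> carrier ?A" using a b by (simp add: c_def)
  ultimately show "x \<in> integral_closure j ?A L" unfolding int_iff r h(2) using h(1) by blast
 qed
 have "h \<in> ring_iso ring_R (L\<lparr>carrier := integral_closure j ?A L\<rparr>)"
  unfolding ring_iso_def
 proof (intro CollectI conjI ring_hom_memI)
  fix x y
  show "h (x \<otimes>\<^bsub>ring_R\<^esub> y) = h x \<otimes>\<^bsub>L\<lparr>carrier := integral_closure j ?A L\<rparr>\<^esub> h y"
   by (simp, rule eqI) (use h val_hom(2)[OF h(1)[of x] h(1)[of y]] in simp_all)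
  show "h (x \<oplus>\<^bsub>ring_R\<^esub> y) = h x \<oplus>\<^bsub>L\<lparr>carrier := integral_closure j ?A L\<rparr>\<^esub> h y"
   by (simp, rule eqI) (use h val_hom(1)[OF h(1)[of x] h(1)[of y]] in simp_all)
  show "h x \<in> carrier (L\<lparr>carrier := integral_closure j ?A L\<rparr>)" using range_h by auto
 next
  show "h \<one>\<^bsub>ring_R\<^esub> = \<one>\<^bsub>L\<lparr>carrier := integral_closure j ?A L\<rparr>\<^esub>" by (simp, rule eqI) (use h val_hom(4) in simp_all)
  have "inj h" by (rule injI) (metis h(2) to_fract_eq_iff)
  then show "bij_betw h (carrier ring_R) (carrier (L\<lparr>carrier := integral_closure j ?A L\<rparr>))"
   using range_h by (simp add: bij_betw_def)
 qed
 then show ?thesis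
  unfolding is_normalization_def Let_def total_quotient_ring_def using A_to_R_hom hj unfolding j_def S_def by blast
qed

section \<open>Triples\<close>

lemma self_module_simps [simp]:
 "carrier (self_module A) = carrier A" "x \<oplus>\<^bsub>self_module A\<^esub> y = x \<oplus>\<^bsub>A\<^esub> y" "\<zero>\<^bsub>self_module A\<^esub> = \<zero>\<^bsub>A\<^esub>"
 "a \<odot>\<^bsub>self_module A\<^esub> x = a \<otimes>\<^bsub>A\<^esub> x"
 by (simp_all add: self_module_def restrict_scalars_def)

lemma mem_dual:
 fixes Y :: "('r::comm_ring_1, 'y) module"
 shows "\<alpha> \<in> carrier (dual ring_of_type_algebra Y) \<longleftrightarrow> \<alpha> \<in> extensional (carrier Y) \<and>
  (\<forall>x\<in>carrier Y. \<forall>y\<in>carrier Y. \<alpha> (x \<oplus>\<^bsub>Y\<^esub> y) = \<alpha> x + \<alpha> y) \<and> (\<forall>a. \<forall>x\<in>carrier Y. \<alpha> (a \<odot>\<^bsub>Y\<^esub> x) = a * \<alpha> x)"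
 by (auto simp: dual_def module_hom_def)

lemma dual_simps:
 fixes Y :: "('r::comm_ring_1, 'y) module"
 shows "\<alpha> \<oplus>\<^bsub>dual ring_of_type_algebra Y\<^esub> \<beta> = (\<lambda>x\<in>carrier Y. \<alpha> x + \<beta> x)" "\<zero>\<^bsub>dual ring_of_type_algebra Y\<^esub> = (\<lambda>x\<in>carrier Y. 0)"
  "a \<odot>\<^bsub>dual ring_of_type_algebra Y\<^esub> \<alpha> = (\<lambda>x\<in>carrier Y. a * \<alpha> x)"
 by (simp_all add: dual_def)

lemma module_dual:
 fixes Y :: "('r::comm_ring_1, 'y) module"
 assumes "Module.module ring_of_type_algebra Y"
 shows "Module.module ring_of_type_algebra (dual ring_of_type_algebra Y)"
proof -
 interpret Y: Module.module ring_of_type_algebra Y by (rule assms)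
 let ?D = "dual ring_of_type_algebra Y"
 have sm: "a \<odot>\<^bsub>Y\<^esub> x \<in> carrier Y" if "x \<in> carrier Y" for a x using Y.smult_closed[of a x] that by simp
 have c: "\<alpha> \<oplus>\<^bsub>?D\<^esub> \<beta> \<in> carrier ?D" "\<zero>\<^bsub>?D\<^esub> \<in> carrier ?D" "a \<odot>\<^bsub>?D\<^esub> \<alpha> \<in> carrier ?D"
  if "\<alpha> \<in> carrier ?D" "\<beta> \<in> carrier ?D" for \<alpha> \<beta> a
  using that sm by (auto simp: mem_dual dual_simps algebra_simps)
 have "\<zero>\<^bsub>?D\<^esub> \<in> carrier ?D" using sm by (auto simp: mem_dual dual_simps)
 then have "abelian_group ?D"
 proof (intro abelian_groupI)
  fix \<alpha> assume l: "\<alpha> \<in> carrier ?D"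
  show "\<zero>\<^bsub>?D\<^esub> \<oplus>\<^bsub>?D\<^esub> \<alpha> = \<alpha>" using l by (auto simp: mem_dual dual_simps restrict_def extensional_def)
  have "(- 1) \<odot>\<^bsub>?D\<^esub> \<alpha> \<oplus>\<^bsub>?D\<^esub> \<alpha> = \<zero>\<^bsub>?D\<^esub>" by (auto simp: dual_simps restrict_def)
  then show "\<exists>\<beta>\<in>carrier ?D. \<beta> \<oplus>\<^bsub>?D\<^esub> \<alpha> = \<zero>\<^bsub>?D\<^esub>" using c(3)[OF l l] by (intro bexI)
 next
  fix \<alpha> \<beta> \<gamma>
  show "\<alpha> \<oplus>\<^bsub>?D\<^esub> \<beta> \<oplus>\<^bsub>?D\<^esub> \<gamma> = \<alpha> \<oplus>\<^bsub>?D\<^esub> (\<beta> \<oplus>\<^bsub>?D\<^esub> \<gamma>)" "\<alpha> \<oplus>\<^bsub>?D\<^esub> \<beta> = \<beta> \<oplus>\<^bsub>?D\<^esub> \<alpha>" by (auto simp: dual_simps restrict_def algebra_simps)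
 qed (auto intro: c)
 then show ?thesis
 proof (intro moduleI)
  fix a b \<alpha> \<beta> assume l: "\<alpha> \<in> carrier ?D"
  show "(a \<oplus>\<^bsub>ring_of_type_algebra\<^esub> b) \<odot>\<^bsub>?D\<^esub> \<alpha> = a \<odot>\<^bsub>?D\<^esub> \<alpha> \<oplus>\<^bsub>?D\<^esub> b \<odot>\<^bsub>?D\<^esub> \<alpha>"
   "a \<odot>\<^bsub>?D\<^esub> (\<alpha> \<oplus>\<^bsub>?D\<^esub> \<beta>) = a \<odot>\<^bsub>?D\<^esub> \<alpha> \<oplus>\<^bsub>?D\<^esub> a \<odot>\<^bsub>?D\<^esub> \<beta>"
   "(a \<otimes>\<^bsub>ring_of_type_algebra\<^esub> b) \<odot>\<^bsub>?D\<^esub> \<alpha> = a \<odot>\<^bsub>?D\<^esub> (b \<odot>\<^bsub>?D\<^esub> \<alpha>)"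
   by (auto simp: dual_simps restrict_def algebra_simps)
  show "\<one>\<^bsub>ring_of_type_algebra\<^esub> \<odot>\<^bsub>?D\<^esub> \<alpha> = \<alpha>" using l by (auto simp: mem_dual dual_simps restrict_def extensional_def)
  show "a \<odot>\<^bsub>?D\<^esub> \<alpha> \<in> carrier ?D" using c(3)[OF l l] .
 qed simp
qed

abbreviation QR_mult :: "'k::field fls \<times> 'k fls \<Rightarrow> 'k fls \<times> 'k fls \<Rightarrow> 'k fls \<times> 'k fls" (infixl "\<star>" 70) where
 "a \<star> b \<equiv> a \<otimes>\<^bsub>ring_QR\<^esub> b"

lemma ring_QR_simps [simp]:
 "carrier (ring_QR :: ('k::field fls \<times> 'k fls) ring) = UNIV"
 "(a, b) \<star> (c, d) = (a * c, b * d :: 'k::field fls)"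
 "(a, b) \<oplus>\<^bsub>ring_QR\<^esub> (c, d) = (a + c, b + d :: 'k::field fls)"
 "\<one>\<^bsub>ring_QR\<^esub> = (1, 1 :: 'k::field fls)"
 by (simp_all add: RDirProd_def DirProd_def monoid.defs)

lemma cring_QR: "cring (ring_QR :: ('k::field fls \<times> 'k fls) ring)"
proof -
 have "ring (ring_QR :: ('k fls \<times> 'k fls) ring)" by (intro RDirProd_ring cring.axioms(1) cring_type)
 moreover have "comm_monoid (ring_QR :: ('k fls \<times> 'k fls) ring)"
  by (rule comm_monoidI) (auto simp: algebra_simps)
 ultimately show ?thesis by (intro cring.intro)
qed

lemma R_to_QR_eq: "R_to_QR r = (fps_to_fls (res_u r), fps_to_fls (res_v r))"
 by (simp add: R_to_QR_def res_u_def res_v_def)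

lemma scalar_homs:
 "R_to_QR \<in> ring_hom ring_R (ring_QR :: ('k::field fls \<times> 'k fls) ring)"
 "K_to_QR \<in> ring_hom ring_K (ring_QR :: ('k::field fls \<times> 'k fls) ring)"
 "A_to_K \<in> ring_hom ring_A (ring_K :: 'k::field fls ring)"
proof -
 show "R_to_QR \<in> ring_hom ring_R (ring_QR :: ('k fls \<times> 'k fls) ring)"
  "K_to_QR \<in> ring_hom ring_K (ring_QR :: ('k fls \<times> 'k fls) ring)"
  by (rule ring_hom_memI; simp add: R_to_QR_eq K_to_QR_def fls_times_fps_to_fls)+
 interpret cring "ring_A :: 'k fps fps fps set ring" by simp
 show "A_to_K \<in> ring_hom ring_A (ring_K :: 'k fls ring)"
  by (rule ring_hom_memI) (simp_all add: A_to_K_eq fls_times_fps_to_fls)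
qed

lemma K_to_QR_A_to_K: "a \<in> cA ==> K_to_QR (A_to_K a) = R_to_QR (A_to_R a)"
 using A_to_R_simps(6)[of a] by (simp add: A_to_K_eq K_to_QR_def R_to_QR_eq Asub_def)

lemma base_change_map_pure:
 assumes M: "base_change_data f A B M" and N: "base_change_data f A B N" and h: "\<phi> \<in> module_hom A M N"
 shows "b \<in> carrier B ==> x \<in> carrier M ==> base_change_map f A B N \<phi> (pure_tensor f A B M b x) = pure_tensor f A B N b (\<phi> x)"
  "s \<in> carrier (base_change f A B M) ==> t \<in> carrier (base_change f A B M) ==>
   base_change_map f A B N \<phi> (s \<oplus>\<^bsub>base_change f A B M\<^esub> t) = base_change_map f A B N \<phi> s \<oplus>\<^bsub>base_change f A B N\<^esub> base_change_map f A B N \<phi> t"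
  "t \<in> carrier (base_change f A B M) ==> base_change_map f A B N \<phi> t \<in> carrier (base_change f A B N)"
proof -
 interpret M: base_change_data f A B M by (rule M)
 interpret N: base_change_data f A B N by (rule N)
 have hc: "\<And>x. x \<in> carrier M ==> \<phi> x \<in> carrier N" "\<And>x y. x \<in> carrier M ==> y \<in> carrier M ==> \<phi> (x \<oplus>\<^bsub>M\<^esub> y) = \<phi> x \<oplus>\<^bsub>N\<^esub> \<phi> y"
  "\<And>a x. a \<in> carrier A ==> x \<in> carrier M ==> \<phi> (a \<odot>\<^bsub>M\<^esub> x) = a \<odot>\<^bsub>N\<^esub> \<phi> x"
  using h by (auto simp: module_hom_def)
 have bal: "M.balanced N.T (\<lambda>(b, x). N.pt b (\<phi> x))"
  unfolding M.balanced_def by (auto simp: hc N.pt_add_left N.pt_add_right N.pt_balanced)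
 show "b \<in> carrier B ==> x \<in> carrier M ==> base_change_map f A B N \<phi> (M.pt b x) = N.pt b (\<phi> x)"
  "s \<in> carrier M.T ==> t \<in> carrier M.T ==> base_change_map f A B N \<phi> (s \<oplus>\<^bsub>M.T\<^esub> t) = base_change_map f A B N \<phi> s \<oplus>\<^bsub>N.T\<^esub> base_change_map f A B N \<phi> t"
  "t \<in> carrier M.T ==> base_change_map f A B N \<phi> t \<in> carrier N.T"
  unfolding base_change_map_def
  using M.tensor_lift_pure[OF N.abelian_group_T bal] M.tensor_lift_add[OF N.abelian_group_T bal] M.tensor_lift_closed[OF N.abelian_group_T bal] by auto
qed

text \<open>Every a \<otimes> r equals (a r) \<otimes> 1, and multiplication into Q(R/I) recovers a
  r; so equality of such tensors is tested in Q(R/I).\<close>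

lemma QR_tensor_R:
 fixes r s :: "'k::field fps fps"
 shows "base_change_data R_to_QR ring_R ring_QR (self_module (ring_R :: 'k fps fps ring))"
  "pure_tensor R_to_QR ring_R ring_QR (self_module ring_R) a r = pure_tensor R_to_QR ring_R ring_QR (self_module ring_R) b s \<longleftrightarrow>
   a \<star> R_to_QR r = b \<star> R_to_QR s"
proof -
 show bc: "base_change_data R_to_QR ring_R ring_QR (self_module (ring_R :: 'k fps fps ring))"
  by (intro base_change_data.intro cring_type cring_QR scalar_homs module_self)
 interpret base_change_data R_to_QR ring_R ring_QR "self_module (ring_R :: 'k fps fps ring)" by (rule bc)
 interpret S: Module.module ring_QR "self_module (ring_QR :: ('k fls \<times> 'k fls) ring)" by (rule module_self[OF cring_QR])
 have bal: "balanced (self_module (ring_QR :: ('k fls \<times> 'k fls) ring)) (\<lambda>(b, r). b \<star> R_to_QR r)"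
  unfolding balanced_def by (auto simp: R_to_QR_eq fls_times_fps_to_fls algebra_simps)
 have l: "tensor_lift (self_module ring_QR) (\<lambda>(b, r). b \<star> R_to_QR r) (pt b r) = b \<star> R_to_QR r" for b r
  using tensor_lift_pure[OF S.M.abelian_group_axioms bal, of b r] by simp
 have p: "pt b r = pt (b \<star> R_to_QR r) 1" for b r
  using pt_balanced[of r b 1] by simp
 show "pt a r = pt b s \<longleftrightarrow> a \<star> R_to_QR r = b \<star> R_to_QR s"
  using l[of a r] l[of b s] p[of a r] p[of b s] by metis
qed

context A_module
begin

lemma bc_R: "base_change_data A_to_R ring_A ring_R M"
 by (intro base_change_data.intro cring_type cring_ring_A A_to_R_hom module_A)

lemma bc_K: "base_change_data A_to_K ring_A ring_K M"
 by (intro base_change_data.intro cring_type cring_ring_A scalar_homs module_A)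

sublocale RT: base_change_data A_to_R ring_A ring_R M by (rule bc_R)
sublocale KT: base_change_data A_to_K ring_A ring_K M by (rule bc_K)

lemma R_tensor_eq: "R_tensor M = RT.T" and K_tensor_eq: "K_tensor M = KT.T"
 by (simp_all add: R_tensor_def K_tensor_def)

abbreviation "D \<equiv> dual ring_R (R_tensor M)"

lemma module_D: "Module.module ring_R D" and module_tilde: "Module.module ring_R (tilde M)"
proof -
 show d: "Module.module ring_R D" unfolding R_tensor_eq by (rule module_dual[OF RT.module_T])
 show "Module.module ring_R (tilde M)" unfolding tilde_def by (rule module_dual[OF d])
qed

lemma bc_tilde: "base_change_data R_to_QR ring_R ring_QR (tilde M)"
 by (intro base_change_data.intro cring_type cring_QR scalar_homs module_tilde)

lemma bc_KM: "base_change_data K_to_QR ring_K ring_QR (K_tensor M)"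
 unfolding K_tensor_eq by (intro base_change_data.intro cring_type cring_QR scalar_homs KT.module_T)

sublocale E1: base_change_data R_to_QR ring_R ring_QR "tilde M" by (rule bc_tilde)
sublocale W1: base_change_data K_to_QR ring_K ring_QR "K_tensor M" by (rule bc_KM)

definition EV :: "'m \<Rightarrow> _" where
 "EV x = to_bidual ring_R (R_tensor M) (pure_tensor A_to_R ring_A ring_R M \<one>\<^bsub>ring_R\<^esub> x)"

lemma D_pure: "\<alpha> \<in> carrier D ==> x \<in> carrier M ==> \<alpha> (RT.pt r x) = r * \<alpha> (RT.pt 1 x)"
 "\<alpha> \<in> carrier D ==> s \<in> carrier RT.T ==> t \<in> carrier RT.T ==> \<alpha> (s \<oplus>\<^bsub>RT.T\<^esub> t) = \<alpha> s + \<alpha> t"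
proof -
 assume l: "\<alpha> \<in> carrier D"
 show "\<alpha> (s \<oplus>\<^bsub>RT.T\<^esub> t) = \<alpha> s + \<alpha> t" if "s \<in> carrier RT.T" "t \<in> carrier RT.T" using l that by (simp add: mem_dual R_tensor_eq)
 show "\<alpha> (RT.pt r x) = r * \<alpha> (RT.pt 1 x)" if "x \<in> carrier M"
 proof -
  have "RT.pt r x = r \<odot>\<^bsub>RT.T\<^esub> RT.pt 1 x" using RT.pt_smult[of r 1 x] by simp
  then show ?thesis using l RT.pt_closed[of 1 x] that by (simp add: mem_dual R_tensor_eq)
 qed
qed

lemma EV_apply: "\<alpha> \<in> carrier D ==> EV x \<alpha> = \<alpha> (RT.pt 1 x)"
 by (simp add: EV_def to_bidual_def)

lemma EV_closed: "x \<in> carrier M ==> EV x \<in> carrier (tilde M)"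
proof -
 assume x: "x \<in> carrier M"
 have pc: "RT.pt 1 x \<in> carrier (R_tensor M)" using RT.pt_closed[of 1 x] x by (simp add: R_tensor_eq)
 interpret D: Module.module ring_R D by (rule module_D)
 have sm: "a \<odot>\<^bsub>D\<^esub> \<alpha> \<in> carrier D" if "\<alpha> \<in> carrier D" for a \<alpha> using D.smult_closed[of a \<alpha>] that by simp
 have 1: "EV x \<in> extensional (carrier D)" by (simp add: EV_def to_bidual_def)
 have 2: "EV x (\<alpha> \<oplus>\<^bsub>D\<^esub> \<beta>) = EV x \<alpha> + EV x \<beta>" if "\<alpha> \<in> carrier D" "\<beta> \<in> carrier D" for \<alpha> \<beta>
  using that D.M.a_closed[OF that] pc by (simp add: EV_apply) (simp add: dual_simps)
 have 3: "EV x (a \<odot>\<^bsub>D\<^esub> \<alpha>) = a * EV x \<alpha>" if "\<alpha> \<in> carrier D" for a \<alpha>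
  using that sm[OF that] pc by (simp add: EV_apply) (simp add: dual_simps)
 show ?thesis unfolding tilde_def mem_dual by (intro conjI ballI allI 1 2 3)
qed

lemma EV_hom:
 "x \<in> carrier M ==> y \<in> carrier M ==> EV (x \<oplus>\<^bsub>M\<^esub> y) = EV x \<oplus>\<^bsub>tilde M\<^esub> EV y"
 "a \<in> cA ==> x \<in> carrier M ==> EV (a \<odot>\<^bsub>M\<^esub> x) = A_to_R a \<odot>\<^bsub>tilde M\<^esub> EV x"
proof -
 have ext: "EV z = (\<lambda>\<alpha>\<in>carrier D. \<alpha> (RT.pt 1 z))" for z by (simp add: EV_def to_bidual_def)
 show "EV (x \<oplus>\<^bsub>M\<^esub> y) = EV x \<oplus>\<^bsub>tilde M\<^esub> EV y" if "x \<in> carrier M" "y \<in> carrier M"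
  unfolding tilde_def dual_simps ext using that RT.pt_add_right[of 1 x y]
  by (intro restrict_ext) (simp add: D_pure(2))
 show "EV (a \<odot>\<^bsub>M\<^esub> x) = A_to_R a \<odot>\<^bsub>tilde M\<^esub> EV x" if "a \<in> cA" "x \<in> carrier M"
  unfolding tilde_def dual_simps ext using that RT.pt_balanced[of a 1 x]
  by (intro restrict_ext) (simp flip: D_pure(1))
qed

text \<open>\<open>theta\<close> lifts a map that is itself a lift, so balancedness is proved twice.
  For the outer map, additivity in q and the exchange of scalars from K are clear on pure tensors
  and are extended by induction over K \<otimes> M.\<close>

lemma theta_add: "w \<in> carrier W1.T ==> w' \<in> carrier W1.T ==> theta M (w \<oplus>\<^bsub>W1.T\<^esub> w') = theta M w \<oplus>\<^bsub>E1.T\<^esub> theta M w'"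
 and theta_closed: "w \<in> carrier W1.T ==> theta M w \<in> carrier E1.T"
 and theta_pure: "x \<in> carrier M ==> theta M (W1.pt q (KT.pt f x)) = E1.pt (q \<star> K_to_QR f) (EV x)"
proof -
 note Qc = ring_QR_simps(1)
 define g where "g q = (\<lambda>(f, x). E1.pt (q \<star> K_to_QR f) (EV x))" for q
 have K: "K_to_QR (f + f') = K_to_QR f \<oplus>\<^bsub>ring_QR\<^esub> K_to_QR f'" "K_to_QR (f * f') = K_to_QR f \<star> K_to_QR f'" for f f' :: "'k fls"
  by (simp_all add: K_to_QR_def)
 have gc: "g q (f, x) \<in> carrier E1.T" if "x \<in> carrier M" for q f x
  unfolding g_def using E1.pt_closed[OF _ EV_closed[OF that]] by (simp add: Qc)
 have balg: "KT.balanced E1.T (g q)" for q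
  unfolding KT.balanced_def
 proof (intro conjI ballI)
  fix f f' :: "'k fls" and x x' :: 'm and a :: "'k fps fps fps set" assume x: "x \<in> carrier M"
  show "g q (f, x) \<in> carrier E1.T" by (rule gc[OF x])
  show "g q (f \<oplus>\<^bsub>ring_K\<^esub> f', x) = g q (f, x) \<oplus>\<^bsub>E1.T\<^esub> g q (f', x)"
   unfolding g_def using E1.pt_add_left[OF _ _ EV_closed[OF x]] by (simp add: K E1.B.r_distr Qc)
  show "g q (f, x \<oplus>\<^bsub>M\<^esub> x') = g q (f, x) \<oplus>\<^bsub>E1.T\<^esub> g q (f, x')" if "x' \<in> carrier M"
   unfolding g_def using E1.pt_add_right[OF _ EV_closed[OF x] EV_closed[OF that]] by (simp add: EV_hom x that Qc)
  show "g q (f \<otimes>\<^bsub>ring_K\<^esub> A_to_K a, x) = g q (f, a \<odot>\<^bsub>M\<^esub> x)" if "a \<in> cA"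
   unfolding g_def using E1.pt_balanced[of "A_to_R a" "q \<star> K_to_QR f", OF _ _ EV_closed[OF x]]
   by (simp add: EV_hom x that K K_to_QR_A_to_K Qc E1.B.m_assoc)
 qed
 note lp = KT.tensor_lift_pure[OF E1.abelian_group_T balg] and la = KT.tensor_lift_add[OF E1.abelian_group_T balg]
  and lc = KT.tensor_lift_closed[OF E1.abelian_group_T balg]
 have lp': "tensor_lift E1.T (g q) (KT.pt f x) = E1.pt (q \<star> K_to_QR f) (EV x)" if "x \<in> carrier M" for q f x
  using lp[of f x q] that by (simp add: g_def)
 define G where "G = (\<lambda>(q, w). tensor_lift E1.T (g q) w)"
 have balG: "W1.balanced E1.T G"
  unfolding W1.balanced_def
 proof (intro conjI ballI)
  fix q q' :: "'k fls \<times> 'k fls" and w w' and k :: "'k fls" assume w: "w \<in> carrier (K_tensor M)"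
  then have wT: "w \<in> carrier KT.T" by (simp add: K_tensor_eq)
  show "G (q, w) \<in> carrier E1.T" using lc[OF wT] by (simp add: G_def)
  show "G (q, w \<oplus>\<^bsub>K_tensor M\<^esub> w') = G (q, w) \<oplus>\<^bsub>E1.T\<^esub> G (q, w')" if "w' \<in> carrier (K_tensor M)"
   using la[OF wT, of w'] that by (simp add: G_def K_tensor_eq)
  have "tensor_lift E1.T (g (q \<oplus>\<^bsub>ring_QR\<^esub> q')) w = tensor_lift E1.T (g q) w \<oplus>\<^bsub>E1.T\<^esub> tensor_lift E1.T (g q') w"
   using wT
  proof (induction w rule: KT.T_induct)
   case (pure f x)
   then show ?case using E1.pt_add_left[OF _ _ EV_closed[OF pure(2)]] by (simp add: lp' E1.B.l_distr Qc)
  next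
   case (add s t)
   then show ?case using la lc by (simp add: E1.T.add.m_ac)
  qed
  then show "G (q \<oplus>\<^bsub>ring_QR\<^esub> q', w) = G (q, w) \<oplus>\<^bsub>E1.T\<^esub> G (q', w)" by (simp add: G_def)
  note kt = Module.module.smult_closed[OF KT.module_T] Module.module.smult_r_distr[OF KT.module_T]
  have "tensor_lift E1.T (g (q \<star> K_to_QR k)) w = tensor_lift E1.T (g q) (k \<odot>\<^bsub>KT.T\<^esub> w)"
   using wT
  proof (induction w rule: KT.T_induct)
   case (pure f x)
   then show ?case using KT.pt_smult[of k f x] by (simp add: lp' K Qc E1.B.m_assoc)
  next
   case (add s t)
   then show ?case using la kt(1)[of k s] kt(1)[of k t] by (simp add: kt(2))
  qed
  then show "G (q \<star> K_to_QR k, w) = G (q, k \<odot>\<^bsub>K_tensor M\<^esub> w)" by (simp add: G_def K_tensor_eq)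
 qed
 have th: "theta M w = tensor_lift E1.T G w" for w
  by (simp add: theta_def Let_def G_def g_def EV_def)
 show "w \<in> carrier W1.T ==> w' \<in> carrier W1.T ==> theta M (w \<oplus>\<^bsub>W1.T\<^esub> w') = theta M w \<oplus>\<^bsub>E1.T\<^esub> theta M w'"
  unfolding th by (rule W1.tensor_lift_add[OF E1.abelian_group_T balG])
 show "w \<in> carrier W1.T ==> theta M w \<in> carrier E1.T"
  unfolding th by (rule W1.tensor_lift_closed[OF E1.abelian_group_T balG])
 show "theta M (W1.pt q (KT.pt f x)) = E1.pt (q \<star> K_to_QR f) (EV x)" if "x \<in> carrier M"
  unfolding th using W1.tensor_lift_pure[OF E1.abelian_group_T balG, of q "KT.pt f x"] that
  by (simp add: K_tensor_eq Qc G_def lp')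
qed

end

text \<open>The gluing map of \<open>rank_one_triple\<close> with the pair (u^m, l v^n) replaced by
  an arbitrary \<open>c0\<close>.\<close>

definition eta :: "'k::field fls \<times> 'k fls \<Rightarrow> _" where
 "eta c0 = tensor_lift (base_change R_to_QR ring_R ring_QR (self_module (ring_R :: 'k fps fps ring)))
    (\<lambda>(q, f). pure_tensor R_to_QR ring_R ring_QR (self_module ring_R) (q \<star> K_to_QR f \<star> c0) \<one>\<^bsub>ring_R\<^esub>)"

lemma bc_KK: "base_change_data K_to_QR ring_K ring_QR (self_module (ring_K :: 'k::field fls ring))"
 by (intro base_change_data.intro cring_type cring_QR scalar_homs module_self)

lemma eta_props:
 fixes c0 :: "'k::field fls \<times> 'k fls"
 defines "W \<equiv> base_change K_to_QR ring_K ring_QR (self_module (ring_K :: 'k fls ring))"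
  and "E \<equiv> base_change R_to_QR ring_R ring_QR (self_module (ring_R :: 'k fps fps ring))"
 shows "eta c0 (pure_tensor K_to_QR ring_K ring_QR (self_module ring_K) q f) = pure_tensor R_to_QR ring_R ring_QR (self_module ring_R) (q \<star> K_to_QR f \<star> c0) 1"
  "w \<in> carrier W ==> w' \<in> carrier W ==> eta c0 (w \<oplus>\<^bsub>W\<^esub> w') = eta c0 w \<oplus>\<^bsub>E\<^esub> eta c0 w'"
proof -
 interpret W: base_change_data K_to_QR ring_K ring_QR "self_module (ring_K :: 'k fls ring)" by (rule bc_KK)
 interpret E: base_change_data R_to_QR ring_R ring_QR "self_module (ring_R :: 'k fps fps ring)" by (rule QR_tensor_R)
 have bal: "W.balanced E.T (\<lambda>(q, f). E.pt (q \<star> K_to_QR f \<star> c0) \<one>\<^bsub>ring_R\<^esub>)"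
  unfolding W.balanced_def
 proof (intro conjI ballI)
  let ?g = "\<lambda>(q, f). E.pt (q \<star> K_to_QR f \<star> c0) \<one>\<^bsub>ring_R\<^esub>"
  fix q q' :: "'k fls \<times> 'k fls" and f f' :: "'k fls"
  have add: "E.pt (a \<oplus>\<^bsub>ring_QR\<^esub> b) 1 = E.pt a 1 \<oplus>\<^bsub>E.T\<^esub> E.pt b 1" for a b using E.pt_add_left[of a b 1] by simp
  have e: "(q \<oplus>\<^bsub>ring_QR\<^esub> q') \<star> K_to_QR f \<star> c0 = (q \<star> K_to_QR f \<star> c0) \<oplus>\<^bsub>ring_QR\<^esub> (q' \<star> K_to_QR f \<star> c0)"
   "q \<star> K_to_QR (f + f') \<star> c0 = (q \<star> K_to_QR f \<star> c0) \<oplus>\<^bsub>ring_QR\<^esub> (q \<star> K_to_QR f' \<star> c0)"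
   "q \<star> K_to_QR f' \<star> K_to_QR f \<star> c0 = q \<star> K_to_QR (f' * f) \<star> c0"
   by (cases q; cases q'; cases c0; simp add: K_to_QR_def algebra_simps)+
  show "?g (q, f) \<in> carrier E.T"
   using E.pt_closed[of _ 1] by simp
  show "?g (q \<oplus>\<^bsub>ring_QR\<^esub> q', f) = ?g (q, f) \<oplus>\<^bsub>E.T\<^esub>
   ?g (q', f)"
   unfolding prod.case e(1) type_ring_simps by (rule add)
  show "?g (q, f \<oplus>\<^bsub>self_module ring_K\<^esub> f') = ?g (q, f) \<oplus>\<^bsub>E.T\<^esub>
   ?g (q, f')"
   unfolding prod.case self_module_simps type_ring_simps e(2) by (rule add)
  show "?g (q \<star> K_to_QR f', f) = ?g (q, f' \<odot>\<^bsub>self_module ring_K\<^esub> f)"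
   unfolding prod.case self_module_simps type_ring_simps e(3) ..
 qed
 show "eta c0 (W.pt q f) = E.pt (q \<star> K_to_QR f \<star> c0) 1"
  unfolding eta_def using W.tensor_lift_pure[OF E.abelian_group_T bal, of q f] by simp
 show "w \<in> carrier W ==> w' \<in> carrier W ==> eta c0 (w \<oplus>\<^bsub>W\<^esub> w') = eta c0 w \<oplus>\<^bsub>E\<^esub> eta c0 w'"
  unfolding eta_def W_def E_def by (rule W.tensor_lift_add[OF E.abelian_group_T bal])
qed

context A_module
begin

text \<open>Both sides are additive, and on q \<otimes> (f \<otimes> x) each is q f times its value
  at 1 \<otimes> (1 \<otimes> x). So the compatibility of a triple isomorphism reduces to one
  equation in Q(R/I) for each x in M.\<close>

lemma triple_iff:
 assumes ph: "\<phi> \<in> module_hom ring_R (tilde M) (self_module ring_R)" and ps: "\<psi> \<in> module_hom ring_K (K_tensor M) (self_module ring_K)"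
 shows "(\<forall>w\<in>carrier W1.T. base_change_map R_to_QR ring_R ring_QR (self_module ring_R) \<phi> (theta M w) =
   eta c0 (base_change_map K_to_QR ring_K ring_QR (self_module ring_K) \<psi> w)) \<longleftrightarrow>
  (\<forall>x\<in>carrier M. R_to_QR (\<phi> (EV x)) = K_to_QR (\<psi> (KT.pt 1 x)) \<star> c0)"
  (is "(\<forall>w\<in>_. ?l w = ?r w) \<longleftrightarrow> ?R")
proof -
 note p = base_change_map_pure[OF bc_tilde QR_tensor_R(1) ph] and s = base_change_map_pure[OF bc_KM bc_KK ps]
 have pure: "?l (W1.pt q (KT.pt f x)) = ?r (W1.pt q (KT.pt f x)) \<longleftrightarrow>
   q \<star> K_to_QR f \<star> R_to_QR (\<phi> (EV x)) = q \<star> K_to_QR f \<star> (K_to_QR (\<psi> (KT.pt 1 x)) \<star> c0)"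
  if x: "x \<in> carrier M" for q f x
 proof -
  have kt: "KT.pt f x \<in> carrier (K_tensor M)" "KT.pt 1 x \<in> carrier (K_tensor M)" using x by (simp_all add: K_tensor_eq)
  have e: "f \<odot>\<^bsub>K_tensor M\<^esub> KT.pt 1 x = KT.pt f x" using KT.pt_smult[of f 1 x] by (simp add: K_tensor_eq)
  have "\<psi> (f \<odot>\<^bsub>K_tensor M\<^esub> KT.pt 1 x) = f * \<psi> (KT.pt 1 x)" using ps kt(2) by (simp add: module_hom_def)
  then have "\<psi> (KT.pt f x) = f * \<psi> (KT.pt 1 x)" unfolding e .
  then have 1: "?r (W1.pt q (KT.pt f x)) = pure_tensor R_to_QR ring_R ring_QR (self_module ring_R) (q \<star> K_to_QR (f * \<psi> (KT.pt 1 x)) \<star> c0) 1"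
   using s(1)[OF _ kt(1), of q] eta_props(1)[of c0 q] by simp
  have 2: "?l (W1.pt q (KT.pt f x)) = pure_tensor R_to_QR ring_R ring_QR (self_module ring_R) (q \<star> K_to_QR f) (\<phi> (EV x))"
   unfolding theta_pure[OF x] using p(1)[OF _ EV_closed[OF x]] by simp
  have 3: "q \<star> K_to_QR (f * \<psi> (KT.pt 1 x)) \<star> c0 \<star> R_to_QR 1 = q \<star> K_to_QR f \<star> (K_to_QR (\<psi> (KT.pt 1 x)) \<star> c0)"
   by (cases q; cases c0; simp add: K_to_QR_def R_to_QR_eq algebra_simps)
  show ?thesis unfolding 1 2 QR_tensor_R(2) 3 ..
 qed
 show ?thesis
 proof
  assume l: "\<forall>w\<in>carrier W1.T. ?l w = ?r w"
  show ?R
  proof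
   fix x assume x: "x \<in> carrier M"
   have "W1.pt (1, 1) (KT.pt 1 x) \<in> carrier W1.T" using x by (intro W1.pt_closed) (simp_all add: K_tensor_eq)
   then have "?l (W1.pt (1, 1) (KT.pt 1 x)) = ?r (W1.pt (1, 1) (KT.pt 1 x))" using l by blast
   then show "R_to_QR (\<phi> (EV x)) = K_to_QR (\<psi> (KT.pt 1 x)) \<star> c0"
    unfolding pure[OF x] by (cases c0) (simp add: K_to_QR_def R_to_QR_eq)
  qed
 next
  assume R: ?R
  have pure2: "?l (W1.pt q (KT.pt f x)) = ?r (W1.pt q (KT.pt f x))" if "x \<in> carrier M" for q f x
   unfolding pure[OF that] using R that by simp
  have add0: "?l (w \<oplus>\<^bsub>W1.T\<^esub> w') = ?r (w \<oplus>\<^bsub>W1.T\<^esub> w')" if "w \<in> carrier W1.T" "w' \<in> carrier W1.T" "?l w = ?r w" "?l w' = ?r w'" for w w'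
   using that by (simp add: theta_add s(2,3) p(2) theta_closed eta_props(2))
  show "\<forall>w\<in>carrier W1.T. ?l w = ?r w"
  proof
   fix w assume "w \<in> carrier W1.T"
   then show "?l w = ?r w"
   proof (induction w rule: W1.T_induct)
    case (pure q t)
    then have "t \<in> carrier KT.T" by (simp add: K_tensor_eq)
    then show ?case
    proof (induction t rule: KT.T_induct)
     case (pure f x)
     then show ?case by (intro pure2)
    next
     case (add s t)
     have st: "s \<in> carrier (K_tensor M)" "t \<in> carrier (K_tensor M)" using add by (simp_all add: K_tensor_eq)
     have "W1.pt q (s \<oplus>\<^bsub>KT.T\<^esub> t) = W1.pt q s \<oplus>\<^bsub>W1.T\<^esub> W1.pt q t" using W1.pt_add_right[OF _ st, of q] by (simp add: K_tensor_eq)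
     then show ?case using \<open>?l (W1.pt q s) = ?r (W1.pt q s)\<close> \<open>?l (W1.pt q t) = ?r (W1.pt q t)\<close> W1.pt_closed[OF _ st(1), of q] W1.pt_closed[OF _ st(2), of q]
      by (simp only:) (intro add0; simp)
    qed
   next
    case (add s t)
    then show ?case by (intro add0)
   qed
  qed
 qed
qed

text \<open>One half of Hom_R(R \<otimes> M, R) = Hom_A(M, R); \<open>dual_linear\<close> and
  \<open>dual_eqI\<close> provide restriction to M and its injectivity.\<close>

lemma ex_dual:
 assumes lin: "linear_R \<phi>"
 shows "\<exists>\<alpha>\<in>carrier D. \<forall>x\<in>carrier M. \<forall>r. \<alpha> (RT.pt r x) = r * \<phi> x"
proof -
 note rt = Module.module.smult_closed[OF RT.module_T]
 have sm: "Module.module ring_R (self_module (ring_R :: 'k fps fps ring))" by (rule module_self[OF cring_type])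
 have ag: "abelian_group (self_module (ring_R :: 'k fps fps ring))" by (rule Module.module.axioms(2)[OF sm])
 have bal: "RT.balanced (self_module ring_R) (\<lambda>(r, x). r * \<phi> x)"
  unfolding RT.balanced_def by (auto simp: linear_RD(1,2)[OF lin] algebra_simps)
 define \<alpha> where "\<alpha> = restrict (tensor_lift (self_module ring_R) (\<lambda>(r, x). r * \<phi> x)) (carrier RT.T)"
 have "\<alpha> \<in> carrier D"
  unfolding mem_dual R_tensor_eq \<alpha>_def
  using RT.tensor_lift_add[OF ag bal] RT.tensor_lift_smult[OF sm bal] rt by (auto simp: algebra_simps)
 moreover have "\<alpha> (RT.pt r x) = r * \<phi> x" if "x \<in> carrier M" for r x
  unfolding \<alpha>_def using that RT.tensor_lift_pure[OF ag bal, of r x] RT.pt_closed[of r x] by simp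
 ultimately show ?thesis by (intro bexI[of _ \<alpha>]) blast+
qed

lemma dual_linear: "\<alpha> \<in> carrier D ==> linear_R (\<lambda>x. \<alpha> (RT.pt 1 x))"
proof -
 assume a: "\<alpha> \<in> carrier D"
 have "\<alpha> (RT.pt 1 (b \<odot>\<^bsub>M\<^esub> x)) = A_to_R b * \<alpha> (RT.pt 1 x)" if "b \<in> cA" "x \<in> carrier M" for b :: "'k fps fps fps set" and x
  using RT.pt_balanced[OF that(1) _ that(2), of 1] D_pure(1)[OF a that(2), of "A_to_R b"] by simp
 moreover have "\<alpha> (RT.pt 1 (x \<oplus>\<^bsub>M\<^esub> y)) = \<alpha> (RT.pt 1 x) + \<alpha> (RT.pt 1 y)" if "x \<in> carrier M" "y \<in> carrier M" for x y
  using RT.pt_add_right[OF _ that, of 1] D_pure(2)[OF a RT.pt_closed RT.pt_closed, of 1 x 1 y] that by simp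
 ultimately show ?thesis unfolding linear_R_def by blast
qed

lemma dual_eqI:
 assumes "\<alpha> \<in> carrier D" "\<beta> \<in> carrier D" "\<And>x. x \<in> carrier M ==> \<alpha> (RT.pt 1 x) = \<beta> (RT.pt 1 x)"
 shows "\<alpha> = \<beta>"
proof (rule extensionalityI)
 show "\<alpha> \<in> extensional (carrier RT.T)" using assms(1) unfolding mem_dual R_tensor_eq by (rule conjunct1)
 show "\<beta> \<in> extensional (carrier RT.T)" using assms(2) unfolding mem_dual R_tensor_eq by (rule conjunct1)
 show "\<alpha> t = \<beta> t" if "t \<in> carrier RT.T" for t
  using that
 proof (induction t rule: RT.T_induct)
  case (pure r x)
  then show ?case using D_pure(1)[OF assms(1) pure(2), of r] D_pure(1)[OF assms(2) pure(2), of r] assms(3)[OF pure(2)] by simp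
 next
  case (add s t)
  then show ?case using D_pure(2)[OF assms(1) add(1,2)] D_pure(2)[OF assms(2) add(1,2)] by simp
 qed
qed

text \<open>Since \<open>uv R \<subseteq> L\<close>, every linear map \<open>L \<rightarrow> R\<close> is multiplication by an element of \<open>R\<close>; hence the
 reflexive hull of \<open>R \<otimes> M\<close> is free on one generator.\<close>

lemma linear_R_unique:
 assumes lin: "linear_R \<phi>" and inj: "inj_on \<phi> (carrier M)" and im: "\<phi> ` carrier M = Lpq p q c"
  and pq: "1 \<le> p" "1 \<le> q" and c: "c \<noteq> 0" and psi: "linear_R \<psi>"
 shows "\<exists>d. \<forall>x\<in>carrier M. \<psi> x = d * \<phi> x"
proof -
 note gen = Lpq_generators[OF pq, where c = c]
 have "xx * 1 \<in> \<phi> ` carrier M" unfolding im by (rule gen(1))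
 then obtain x0 where x0: "x0 \<in> carrier M" "\<phi> x0 = xx" by (elim imageE) (rule that; simp)
 \<comment> \<open>A factor uv brings the multipliers \<open>\<phi> x\<close> and uv into A, so that
   A-linearity can compare \<open>\<psi>\<close> at x and at x0.\<close>
 have key: "\<phi> x * \<psi> x0 = xx * \<psi> x" if x: "x \<in> carrier M" for x
 proof -
  obtain a where a: "a \<in> cA" "A_to_R a = xx * \<phi> x" using ex_A[OF Asub_closed(8)] by (rule bexE)
  obtain b :: "'k fps fps fps set" where b: "b \<in> cA" "A_to_R b = xx * xx" using ex_A[OF Asub_closed(8)] by (rule bexE)
  have "a \<odot>\<^bsub>M\<^esub> x0 = b \<odot>\<^bsub>M\<^esub> x" by (rule inj_eqI[OF inj lin a(1) b(1) x0(1) x]) (simp add: a b x0 ac_simps)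
  then have "A_to_R a * \<psi> x0 = A_to_R b * \<psi> x" using linear_RD(2)[OF psi] a b x x0 by metis
  then have "xx * (\<phi> x * \<psi> x0) = xx * (xx * \<psi> x)" unfolding a b by (simp only: mult.assoc)
  then show ?thesis by (simp only: mult_cancel_left mult_eq_0_iff var_uv_nonzero simp_thms)
 qed
 \<comment> \<open>At the preimage of this element neither restriction of \<open>\<phi>\<close>
   vanishes, while uv times anything restricts to zero; so \<open>key\<close> makes both
   restrictions of \<open>\<psi> x0\<close> vanish, and uv divides it.\<close>
 have "uu ^ p + fps_const (fps_const c) * vv ^ q \<in> \<phi> ` carrier M" unfolding im by (rule gen(2))
 then obtain y where y: "y \<in> carrier M" "\<phi> y = uu ^ p + fps_const (fps_const c) * vv ^ q" by (elim imageE) (rule that; simp)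
 have "res_u (\<phi> y) * res_u (\<psi> x0) = res_u (xx * \<psi> y)" "res_v (\<phi> y) * res_v (\<psi> x0) = res_v (xx * \<psi> y)"
  using key[OF y(1)] by (metis res_u_simps(6), metis res_v_simps(6))
 then have "res_u (\<psi> x0) = 0 \<and> res_v (\<psi> x0) = 0" unfolding y(2) gen(3,4) using c by simp
 then have "xx dvd \<psi> x0" by (simp only: res_eq_0_iff)
 then obtain d where d: "\<psi> x0 = xx * d" by (rule dvdE)
 have "\<psi> x = d * \<phi> x" if "x \<in> carrier M" for x
 proof -
  have "xx * (d * \<phi> x) = xx * \<psi> x" using key[OF that] unfolding d by (simp only: ac_simps)
  then have "d * \<phi> x = \<psi> x" by (simp only: mult_cancel_left mult_eq_0_iff var_uv_nonzero simp_thms)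
  then show ?thesis by (rule sym)
 qed
 then show ?thesis by blast
qed

text \<open>The dual of R \<otimes> M is free on the extension \<open>\<chi>\<close> of
  \<open>\<phi>\<close>, by \<open>linear_R_unique\<close>. Evaluation at \<open>\<chi>\<close>
  therefore identifies the bidual with R, and it sends the class of 1 \<otimes> x to
  \<open>\<phi> x\<close>.\<close>

lemma tilde_iso:
 assumes lin: "linear_R \<phi>" and inj: "inj_on \<phi> (carrier M)" and im: "\<phi> ` carrier M = Lpq p q c"
  and pq: "1 \<le> p" "1 \<le> q" and c: "c \<noteq> 0"
 shows "\<exists>\<Phi>\<in>module_iso ring_R (tilde M) (self_module ring_R). \<forall>x\<in>carrier M. \<Phi> (EV x) = \<phi> x"
proof -
 obtain \<chi> where chi: "\<chi> \<in> carrier D" "\<forall>x\<in>carrier M. \<forall>r. \<chi> (RT.pt r x) = r * \<phi> x" using ex_dual[OF lin] by (rule bexE)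
 interpret D: Module.module ring_R D by (rule module_D)
 have sm: "a \<odot>\<^bsub>D\<^esub> \<chi> \<in> carrier D" for a using D.smult_closed[of a \<chi>] chi(1) by simp
 have sa: "(a \<odot>\<^bsub>D\<^esub> \<chi>) (RT.pt 1 x) = a * \<phi> x" if "x \<in> carrier M" for a x
  using chi(2) RT.pt_closed[of 1 x] that by (simp add: dual_simps R_tensor_eq)
 have ex: "\<exists>d. \<alpha> = d \<odot>\<^bsub>D\<^esub> \<chi>" if a: "\<alpha> \<in> carrier D" for \<alpha>
 proof -
  obtain d where d: "\<forall>x\<in>carrier M. \<alpha> (RT.pt 1 x) = d * \<phi> x" using linear_R_unique[OF lin inj im pq c dual_linear[OF a]] by (rule exE)
  have "\<alpha> = d \<odot>\<^bsub>D\<^esub> \<chi>" by (rule dual_eqI[OF a sm]) (use d sa in simp)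
  then show ?thesis by (rule exI)
 qed
 have "xx * 1 \<in> \<phi> ` carrier M" unfolding im by (rule Lpq_generators(1)[OF pq])
 then obtain x0 where x0: "x0 \<in> carrier M" "\<phi> x0 = xx" by (elim imageE) (rule that; simp)
 have uniq: "a = b" if "a \<odot>\<^bsub>D\<^esub> \<chi> = b \<odot>\<^bsub>D\<^esub> \<chi>" for a b
 proof -
  have "a * xx = b * xx" using sa[OF x0(1), of a] sa[OF x0(1), of b] unfolding x0(2) that by (rule trans[OF sym])
  then show ?thesis by (simp only: mult_cancel_right mult_eq_0_iff var_uv_nonzero simp_thms)
 qed
 define dd where "dd \<alpha> = (SOME d. \<alpha> = d \<odot>\<^bsub>D\<^esub> \<chi>)" for \<alpha>
 have dd: "\<alpha> = dd \<alpha> \<odot>\<^bsub>D\<^esub> \<chi>" if "\<alpha> \<in> carrier D" for \<alpha> unfolding dd_def by (rule someI_ex[OF ex[OF that]])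
 have ddI: "dd \<alpha> = e" if "\<alpha> \<in> carrier D" "\<alpha> = e \<odot>\<^bsub>D\<^esub> \<chi>" for \<alpha> e by (rule uniq[OF trans[OF sym[OF dd[OF that(1)]] that(2)]])
 define \<Phi> where "\<Phi> \<tau> = \<tau> \<chi>" for \<tau> :: "_ \<Rightarrow> 'k fps fps"
 have tD: "\<tau> (a \<odot>\<^bsub>D\<^esub> \<alpha>) = a * \<tau> \<alpha>" if "\<tau> \<in> carrier (tilde M)" "\<alpha> \<in> carrier D" for \<tau> a \<alpha>
  using that(1)[unfolded tilde_def mem_dual, THEN conjunct2, THEN conjunct2] that(2) by simp
 have "\<Phi> \<in> module_hom ring_R (tilde M) (self_module ring_R)"
  unfolding module_hom_def using chi(1) by (auto simp: \<Phi>_def tilde_def dual_simps)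
 moreover have "bij_betw \<Phi> (carrier (tilde M)) (carrier (self_module ring_R))"
  unfolding bij_betw_def
 proof
  show "inj_on \<Phi> (carrier (tilde M))"
  proof (rule inj_onI)
   fix \<sigma> \<tau> assume st: "\<sigma> \<in> carrier (tilde M)" "\<tau> \<in> carrier (tilde M)" "\<Phi> \<sigma> = \<Phi> \<tau>"
   show "\<sigma> = \<tau>"
   proof (rule extensionalityI)
    show "\<sigma> \<in> extensional (carrier D)" using st(1) unfolding tilde_def mem_dual by (rule conjunct1)
    show "\<tau> \<in> extensional (carrier D)" using st(2) unfolding tilde_def mem_dual by (rule conjunct1)
    fix \<alpha> assume "\<alpha> \<in> carrier D"
    then obtain d where "\<alpha> = d \<odot>\<^bsub>D\<^esub> \<chi>" using ex by blast
    then show "\<sigma> \<alpha> = \<tau> \<alpha>" using st(3) tD[OF st(1) chi(1), of d] tD[OF st(2) chi(1), of d] by (simp add: \<Phi>_def)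
   qed
  qed
  have "r \<in> \<Phi> ` carrier (tilde M)" for r
  proof -
   define \<tau> where "\<tau> = (\<lambda>\<alpha>\<in>carrier D. r * dd \<alpha>)"
   have add: "dd (\<alpha> \<oplus>\<^bsub>D\<^esub> \<beta>) = dd \<alpha> + dd \<beta>" if ab: "\<alpha> \<in> carrier D" "\<beta> \<in> carrier D" for \<alpha> \<beta>
   proof (rule ddI[OF D.M.a_closed[OF ab]])
    have "\<alpha> \<oplus>\<^bsub>D\<^esub> \<beta> = dd \<alpha> \<odot>\<^bsub>D\<^esub> \<chi> \<oplus>\<^bsub>D\<^esub> dd \<beta> \<odot>\<^bsub>D\<^esub> \<chi>" by (rule arg_cong2[OF dd[OF ab(1)] dd[OF ab(2)], of "\<lambda>x y. x \<oplus>\<^bsub>D\<^esub> y"])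
    then show "\<alpha> \<oplus>\<^bsub>D\<^esub> \<beta> = (dd \<alpha> + dd \<beta>) \<odot>\<^bsub>D\<^esub> \<chi>" using D.smult_l_distr[of "dd \<alpha>" "dd \<beta>" \<chi>] chi(1) by simp
   qed
   have smu: "a \<odot>\<^bsub>D\<^esub> \<alpha> \<in> carrier D \<and> dd (a \<odot>\<^bsub>D\<^esub> \<alpha>) = a * dd \<alpha>" if al: "\<alpha> \<in> carrier D" for a \<alpha>
   proof
    show cl: "a \<odot>\<^bsub>D\<^esub> \<alpha> \<in> carrier D" using D.smult_closed[of a \<alpha>] al by simp
    have "a \<odot>\<^bsub>D\<^esub> \<alpha> = a \<odot>\<^bsub>D\<^esub> (dd \<alpha> \<odot>\<^bsub>D\<^esub> \<chi>)" by (rule arg_cong[OF dd[OF al], of "\<lambda>x. a \<odot>\<^bsub>D\<^esub> x"])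
    then show "dd (a \<odot>\<^bsub>D\<^esub> \<alpha>) = a * dd \<alpha>" using D.smult_assoc1[of a "dd \<alpha>" \<chi>] chi(1) by (intro ddI[OF cl]) simp
   qed
   have "\<tau> \<in> carrier (tilde M)"
    unfolding tilde_def mem_dual \<tau>_def using add smu D.M.a_closed by (simp add: algebra_simps)
   moreover have "dd \<chi> = 1" using D.smult_one[OF chi(1)] by (intro ddI[OF chi(1)]) simp
   then have "\<Phi> \<tau> = r" using chi(1) by (simp add: \<Phi>_def \<tau>_def)
   ultimately show ?thesis by (intro image_eqI[of r \<Phi> \<tau>]) simp_all
  qed
  then show "\<Phi> ` carrier (tilde M) = carrier (self_module ring_R)" by auto
 qed
 moreover have "\<Phi> (EV x) = \<phi> x" if "x \<in> carrier M" for x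
  using chi(2) that by (simp add: \<Phi>_def EV_apply[OF chi(1)])
 ultimately show ?thesis unfolding module_iso_def by (intro bexI[of _ \<Phi>]) blast+
qed

end

context A_module
begin

text \<open>Some power of z times x is an A-combination of g and of the preimage x0 of uv in which
  the coefficient of x0 lies in the conductor. Over K the power of z is invertible and the conductor
  acts as zero, so only a multiple of g remains.\<close>

lemma K_tensor_generator:
 assumes lin: "linear_R \<phi>" and inj: "inj_on \<phi> (carrier M)" and im: "\<phi> ` carrier M = Lpq p q c"
  and pq: "1 \<le> p" "1 \<le> q" and c: "c \<noteq> 0"
  and g: "g \<in> carrier M" "\<phi> g = uu ^ p + cst c * vv ^ q" and x: "x \<in> carrier M"
 shows "\<exists>h. KT.pt f x = KT.pt h g"
proof -
 let ?G = "uu ^ p + cst c * vv ^ q"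
 note gen = Lpq_generators[OF pq, where c = c]
 have "xx * 1 \<in> \<phi> ` carrier M" unfolding im by (rule gen(1))
 then obtain x0 where x0: "x0 \<in> carrier M" "\<phi> x0 = xx" by (elim imageE) (rule that; simp)
 have "\<phi> x \<in> Lpq p q c" unfolding im[symmetric] using x by (rule imageI)
 then have l: "fps_const c * fps_X ^ q * res_u (\<phi> x) = fps_X ^ p * res_v (\<phi> x)" by (simp add: Lpq_def Line_def)
 define N where "N = p + q + 1"
 \<comment> \<open>Chosen so that s1 G and z^N agree on both axes: its restrictions complement t^p
   and c t^q to t^N. Without the factor z^N the remainder would be uv r with r merely in R, which
   need not be a conductor multiple of x0.\<close>
 define s1 where "s1 = uu ^ (q + 1) + cst (inverse c) * vv ^ (p + 1)"
 have ci: "fps_const (inverse c) * fps_const c = 1" using c by simp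
 have rs: "res_u s1 = fps_X ^ (q + 1)" "res_v s1 = fps_const (inverse c) * fps_X ^ (p + 1)" by (simp_all add: s1_def)
 have "res_u (zz ^ N - s1 * ?G) = 0" unfolding res_u_simps(4,6) gen(3) rs by (simp add: N_def power_add ac_simps)
 moreover have "res_v (zz ^ N - s1 * ?G) = 0"
 proof -
  have "fps_const (inverse c) * fps_X ^ (p + 1) * (fps_const c * fps_X ^ q) = (fps_const (inverse c) * fps_const c) * fps_X ^ N"
   unfolding N_def power_add by (simp only: ac_simps)
  then show ?thesis unfolding res_v_simps(4,6) gen(4) rs ci by simp
 qed
 ultimately have "xx dvd zz ^ N - s1 * ?G" using res_eq_0_iff by blast
 then obtain s2 where s2: "zz ^ N - s1 * ?G = xx * s2" by (rule dvdE)
 obtain a :: "'k fps fps" where a: "a \<in> Asub" "res_u a = res_u (\<phi> x)" "res_v a = res_u (\<phi> x)" using ex_Asub by blast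
 have "res_u (zz ^ p * \<phi> x - a * ?G) = 0" unfolding res_u_simps(4,6) gen(3) a by simp
 moreover have "res_v (zz ^ p * \<phi> x - a * ?G) = 0" unfolding res_v_simps(4,6) gen(4) a using l by (simp add: ac_simps)
 ultimately have "xx dvd zz ^ p * \<phi> x - a * ?G" using res_eq_0_iff by blast
 then obtain r where r: "zz ^ p * \<phi> x - a * ?G = xx * r" by (rule dvdE)
 have e: "zz ^ (N + p) * \<phi> x = (zz ^ N * a + xx * (r * s1)) * ?G + xx * (r * s2) * xx"
 proof -
  have zN: "zz ^ N = s1 * ?G + xx * s2" and zp: "zz ^ p * \<phi> x = a * ?G + xx * r" using s2 r by (simp_all add: diff_eq_eq add.commute)
  have "zz ^ (N + p) * \<phi> x = zz ^ N * (a * ?G + xx * r)" unfolding power_add mult.assoc zp ..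
  also have "\<dots> = zz ^ N * a * ?G + xx * r * zz ^ N" by (simp only: distrib_left ac_simps)
  also have "xx * r * zz ^ N = xx * r * (s1 * ?G + xx * s2)" unfolding zN ..
  finally show ?thesis by (simp only: distrib_left distrib_right ac_simps)
 qed
 obtain zn :: "'k fps fps fps set" where zn: "zn \<in> cA" "A_to_R zn = zz ^ (N + p)" using ex_A[OF Asub_closed(7)[OF Asub_closed(10)]] by (rule bexE)
 obtain b1 where b1: "b1 \<in> cA" "A_to_R b1 = zz ^ N * a + xx * (r * s1)"
  using ex_A[OF Asub_closed(3)[OF Asub_closed(6)[OF Asub_closed(7)[OF Asub_closed(10)] a(1)] Asub_closed(8)]] by (rule bexE)
 obtain b2 where b2: "b2 \<in> cA" "A_to_R b2 = xx * (r * s2)" using ex_A[OF Asub_closed(8)] by (rule bexE)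
 note cl = M.smult_closed[OF b1(1) g(1)] M.smult_closed[OF b2(1) x0(1)]
 have "zn \<odot>\<^bsub>M\<^esub> x = b1 \<odot>\<^bsub>M\<^esub> g \<oplus>\<^bsub>M\<^esub> b2 \<odot>\<^bsub>M\<^esub> x0"
 proof (rule inj_onD[OF inj _ M.smult_closed[OF zn(1) x] M.M.a_closed[OF cl]])
  show "\<phi> (zn \<odot>\<^bsub>M\<^esub> x) = \<phi> (b1 \<odot>\<^bsub>M\<^esub> g \<oplus>\<^bsub>M\<^esub> b2 \<odot>\<^bsub>M\<^esub> x0)"
   unfolding linear_RD(1)[OF lin cl] linear_RD(2)[OF lin zn(1) x] linear_RD(2)[OF lin b1(1) g(1)] linear_RD(2)[OF lin b2(1) x0(1)] zn(2) b1(2) b2(2) g(2) x0(2)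
   by (rule e)
 qed
 moreover obtain w :: "'k fls" where w: "w * fls_X ^ (N + p) = 1" by (rule that[OF left_inverse]) simp
 moreover define h where "h = f * w"
 have kz: "A_to_K zn = fls_X ^ (N + p)" "A_to_K b2 = 0" unfolding A_to_K_eq[OF zn(1)] A_to_K_eq[OF b2(1)] zn(2) b2(2) by (simp_all add: fps_to_fls_power)
 have "h * A_to_K zn = f" by (simp only: h_def kz(1) mult.assoc w mult_1_right)
 then have "KT.pt f x = KT.pt h (zn \<odot>\<^bsub>M\<^esub> x)" using KT.pt_balanced[OF zn(1) _ x, of h] by simp
 ultimately have "KT.pt f x = KT.pt h (b1 \<odot>\<^bsub>M\<^esub> g) \<oplus>\<^bsub>KT.T\<^esub> KT.pt h (b2 \<odot>\<^bsub>M\<^esub> x0)" using KT.pt_add_right[OF _ cl, of h] by simp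
 also have "KT.pt h (b2 \<odot>\<^bsub>M\<^esub> x0) = \<zero>\<^bsub>KT.T\<^esub>" using KT.pt_balanced[OF b2(1) _ x0(1), of h] KT.pt_zero_left[OF x0(1)] kz(2) by simp
 also have "KT.pt h (b1 \<odot>\<^bsub>M\<^esub> g) = KT.pt (h * A_to_K b1) g" using KT.pt_balanced[OF b1(1) _ g(1), of h] by simp
 also have "KT.pt (h * A_to_K b1) g \<oplus>\<^bsub>KT.T\<^esub> \<zero>\<^bsub>KT.T\<^esub> = KT.pt (h * A_to_K b1) g" using KT.pt_closed[OF _ g(1)] by (intro KT.T.r_zero) simp
 finally show ?thesis by (rule exI)
qed

text \<open>The coordinate of x is t^(-p) times the restriction of \<open>\<phi> x\<close> to v = 0,
  which is 1 at g. By the line equation c^(-1) t^(-q) times the restriction to u = 0 is the same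
  Laurent series; this is the compatibility with (u^p, c v^q).\<close>

lemma K_tensor_iso:
 assumes lin: "linear_R \<phi>" and inj: "inj_on \<phi> (carrier M)" and im: "\<phi> ` carrier M = Lpq p q c"
  and pq: "1 \<le> p" "1 \<le> q" and c: "c \<noteq> 0"
 shows "\<exists>\<psi>\<in>module_iso ring_K (K_tensor M) (self_module ring_K).
  \<forall>x\<in>carrier M. R_to_QR (\<phi> x) = K_to_QR (\<psi> (KT.pt 1 x)) \<star> (fls_X ^ p, fls_const c * fls_X ^ q)"
proof -
 note gen = Lpq_generators[OF pq, where c = c]
 obtain w :: "'k fls" where w: "w * fls_X ^ p = 1" by (rule that[OF left_inverse]) simp
 define \<kappa> where "\<kappa> x = w * fps_to_fls (res_u (\<phi> x))" for x
 have sm: "Module.module ring_K (self_module (ring_K :: 'k fls ring))" by (rule module_self[OF cring_type])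
 have ag: "abelian_group (self_module (ring_K :: 'k fls ring))" by (rule Module.module.axioms(2)[OF sm])
 have bal: "KT.balanced (self_module ring_K) (\<lambda>(f, x). f * \<kappa> x)"
  unfolding KT.balanced_def
  by (auto simp: linear_RD(1,2)[OF lin] \<kappa>_def A_to_K_eq fls_times_fps_to_fls algebra_simps)
 define \<psi> where "\<psi> = tensor_lift (self_module ring_K) (\<lambda>(f, x). f * \<kappa> x)"
 have ps: "\<psi> (KT.pt f x) = f * \<kappa> x" if "x \<in> carrier M" for f x
  unfolding \<psi>_def using KT.tensor_lift_pure[OF ag bal, of f x] that by simp
 have "uu ^ p + cst c * vv ^ q \<in> \<phi> ` carrier M" unfolding im by (rule gen(2))
 then obtain g where g: "g \<in> carrier M" "\<phi> g = uu ^ p + cst c * vv ^ q" by (elim imageE) (rule that; simp)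
 have kg: "\<kappa> g = 1" by (simp only: \<kappa>_def g(2) gen(3) fps_to_fls_power fps_X_to_fls w)
 have all: "\<exists>f. t = KT.pt f g" if "t \<in> carrier KT.T" for t
  using that
 proof (induction t rule: KT.T_induct)
  case (pure f x)
  then show ?case using K_tensor_generator[OF lin inj im pq c g pure(2), of f] by blast
 next
  case (add s t)
  then obtain f f' where "s = KT.pt f g" "t = KT.pt f' g" by blast
  then have "s \<oplus>\<^bsub>KT.T\<^esub> t = KT.pt (f + f') g" using KT.pt_add_left[OF _ _ g(1), of f f'] by simp
  then show ?case by (rule exI)
 qed
 have "\<psi> \<in> module_hom ring_K (K_tensor M) (self_module ring_K)"
  unfolding module_hom_def K_tensor_eq \<psi>_def
  using KT.tensor_lift_add[OF ag bal] KT.tensor_lift_smult[OF sm bal] by (auto simp: mult.assoc)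
 moreover have "bij_betw \<psi> (carrier (K_tensor M)) (carrier (self_module ring_K))"
  unfolding bij_betw_def K_tensor_eq
 proof
  show "inj_on \<psi> (carrier KT.T)"
  proof (rule inj_onI)
   fix s t assume st: "s \<in> carrier KT.T" "t \<in> carrier KT.T" "\<psi> s = \<psi> t"
   obtain f where f: "s = KT.pt f g" using all[OF st(1)] by (rule exE)
   obtain f' where f': "t = KT.pt f' g" using all[OF st(2)] by (rule exE)
   show "s = t" using st(3) unfolding f f' ps[OF g(1)] kg by simp
  qed
  have "f \<in> \<psi> ` carrier KT.T" for f
   using ps[OF g(1), of f] kg KT.pt_closed[OF _ g(1), of f] by (intro image_eqI[of _ _ "KT.pt f g"]) simp_all
  then show "\<psi> ` carrier KT.T = carrier (self_module ring_K)" by auto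
 qed
 moreover have "R_to_QR (\<phi> x) = K_to_QR (\<psi> (KT.pt 1 x)) \<star> (fls_X ^ p, fls_const c * fls_X ^ q)" if x: "x \<in> carrier M" for x
 proof -
  have "\<phi> x \<in> Lpq p q c" unfolding im[symmetric] using x by (rule imageI)
  then have "fps_const c * fps_X ^ q * res_u (\<phi> x) = fps_X ^ p * res_v (\<phi> x)" by (simp add: Lpq_def Line_def)
  then have "fps_to_fls (fps_const c * fps_X ^ q * res_u (\<phi> x)) = fps_to_fls (fps_X ^ p * res_v (\<phi> x))" by simp
  then have e: "fls_const c * fls_X ^ q * fps_to_fls (res_u (\<phi> x)) = fls_X ^ p * fps_to_fls (res_v (\<phi> x))"
   by (simp only: fls_times_fps_to_fls fps_const_to_fls fps_to_fls_power fps_X_to_fls)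
  have "\<kappa> x * (fls_const c * fls_X ^ q) = w * (fls_const c * fls_X ^ q * fps_to_fls (res_u (\<phi> x)))" by (simp only: \<kappa>_def ac_simps)
  also have "\<dots> = (w * fls_X ^ p) * fps_to_fls (res_v (\<phi> x))" unfolding e by (simp only: mult.assoc)
  finally have 1: "\<kappa> x * (fls_const c * fls_X ^ q) = fps_to_fls (res_v (\<phi> x))" by (simp only: w mult_1_left)
  have "\<kappa> x * fls_X ^ p = (w * fls_X ^ p) * fps_to_fls (res_u (\<phi> x))" by (simp only: \<kappa>_def ac_simps)
  then have 2: "\<kappa> x * fls_X ^ p = fps_to_fls (res_u (\<phi> x))" by (simp only: w mult_1_left)
  show ?thesis unfolding ps[OF x] R_to_QR_eq K_to_QR_def ring_QR_simps mult_1_left 1 2 ..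
 qed
 ultimately show ?thesis unfolding module_iso_def by (intro bexI[of _ \<psi>]) blast+
qed

lemma triple_isomorphic_iff:
 "triple_isomorphic (triple_of M) (rank_one_triple p q c) \<longleftrightarrow>
  (\<exists>\<Phi>\<in>module_iso ring_R (tilde M) (self_module ring_R). \<exists>\<psi>\<in>module_iso ring_K (K_tensor M) (self_module ring_K).
   \<forall>x\<in>carrier M. R_to_QR (\<Phi> (EV x)) = K_to_QR (\<psi> (KT.pt 1 x)) \<star> (fls_X ^ p, fls_const c * fls_X ^ q))"
 unfolding triple_of_def rank_one_triple_def triple_isomorphic.simps eta_def[symmetric]
 by (intro bex_cong refl triple_iff) (simp_all add: module_iso_def)

lemma triple_of_Lpq:
 assumes lin: "linear_R \<phi>" and inj: "inj_on \<phi> (carrier M)" and im: "\<phi> ` carrier M = Lpq p q c"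
  and pq: "1 \<le> p" "1 \<le> q" and c: "c \<noteq> 0"
 shows "triple_isomorphic (triple_of M) (rank_one_triple p q c)"
proof -
 obtain \<Phi> where P: "\<Phi> \<in> module_iso ring_R (tilde M) (self_module ring_R)" "\<forall>x\<in>carrier M. \<Phi> (EV x) = \<phi> x"
  using tilde_iso[OF assms] by (rule bexE)
 obtain \<psi> where Q: "\<psi> \<in> module_iso ring_K (K_tensor M) (self_module ring_K)"
  "\<forall>x\<in>carrier M. R_to_QR (\<phi> x) = K_to_QR (\<psi> (KT.pt 1 x)) \<star> (fls_X ^ p, fls_const c * fls_X ^ q)"
  using K_tensor_iso[OF assms] by (rule bexE)
 show ?thesis unfolding triple_isomorphic_iff by (rule bexI[OF _ P(1)], rule bexI[OF _ Q(1)]) (use P(2) Q(2) in simp)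
qed

text \<open>The image of \<open>M\<close> in \<open>R\<close> is not contained in \<open>g R\<close> for a non-unit \<open>g\<close>: dividing by \<open>g\<close> would give a
 functional on \<open>M\<close> at which the generator of the reflexive hull takes the value \<open>1 / g\<close>.\<close>

lemma triple_realizes:
 assumes mcm: "maximal_cohen_macaulay ring_A M" and iso: "triple_isomorphic (triple_of M) (rank_one_triple p q c)"
 shows "\<exists>\<phi>. realizes M \<phi> (Lpq p q c)"
proof -
 obtain \<Phi> where P: "\<Phi> \<in> module_iso ring_R (tilde M) (self_module ring_R)" and
  "\<exists>\<psi>\<in>module_iso ring_K (K_tensor M) (self_module ring_K).
   \<forall>x\<in>carrier M. R_to_QR (\<Phi> (EV x)) = K_to_QR (\<psi> (KT.pt 1 x)) \<star> (fls_X ^ p, fls_const c * fls_X ^ q)"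
  using iso unfolding triple_isomorphic_iff by (rule bexE)
 then obtain \<psi> where Q: "\<forall>x\<in>carrier M. R_to_QR (\<Phi> (EV x)) = K_to_QR (\<psi> (KT.pt 1 x)) \<star> (fls_X ^ p, fls_const c * fls_X ^ q)"
  by blast
 have bij: "bij_betw \<Phi> (carrier (tilde M)) UNIV" and Pa: "\<And>s t. s \<in> carrier (tilde M) ==> t \<in> carrier (tilde M) ==> \<Phi> (s \<oplus>\<^bsub>tilde M\<^esub> t) = \<Phi> s + \<Phi> t"
  and Ps: "\<And>a t. t \<in> carrier (tilde M) ==> \<Phi> (a \<odot>\<^bsub>tilde M\<^esub> t) = a * \<Phi> t"
  using P by (auto simp: module_iso_def module_hom_def)
 note Pinj = inj_onD[OF bij_betw_imp_inj_on[OF bij]]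
 define \<phi> where "\<phi> x = \<Phi> (EV x)" for x
 have lin: "linear_R \<phi>" unfolding linear_R_def \<phi>_def by (simp add: EV_hom EV_closed Pa Ps)
 have "1 \<in> \<Phi> ` carrier (tilde M)" unfolding bij_betw_imp_surj_on[OF bij] by (rule UNIV_I)
 then obtain E where E: "E \<in> carrier (tilde M)" "\<Phi> E = 1" by (elim imageE) (rule that; simp)
 have smE: "a \<odot>\<^bsub>tilde M\<^esub> E \<in> carrier (tilde M)" for a using E1.M.smult_closed[of a E] E(1) by simp
 have ev: "EV x = \<phi> x \<odot>\<^bsub>tilde M\<^esub> E" if "x \<in> carrier M" for x
  by (rule Pinj[OF _ EV_closed[OF that] smE]) (simp add: Ps E \<phi>_def)
 \<comment> \<open>E corresponds to 1, so the image of x in the bidual is \<open>\<phi> x\<close>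
   times E. Evaluated at \<open>\<alpha>\<close>, this shows that every functional on M is
   \<open>\<phi>\<close> times an element of R, which gives the injectivity of \<open>\<phi>\<close>
   and rules out a nonunit common factor of its image.\<close>
 have val: "\<alpha> (RT.pt 1 x) = \<phi> x * E \<alpha>" if "x \<in> carrier M" "\<alpha> \<in> carrier D" for x \<alpha>
  using arg_cong[OF ev[OF that(1)], of "\<lambda>\<tau>. \<tau> \<alpha>"] that(2) unfolding EV_apply[OF that(2)] by (simp add: tilde_def dual_simps)
 have inj: "inj_on \<phi> (carrier M)"
 proof (rule linear_R_inj[OF lin])
  fix x assume x: "x \<in> carrier M" "\<phi> x = 0"
  show "x = \<zero>\<^bsub>M\<^esub>"
  proof (rule ccontr)
   assume "x \<noteq> \<zero>\<^bsub>M\<^esub>"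
   with mcm x(1) obtain \<xi> where xi: "linear_R \<xi>" "\<xi> x \<noteq> 0" by (rule mcm_functional)
   obtain \<alpha> where al: "\<alpha> \<in> carrier D" "\<forall>x\<in>carrier M. \<forall>r. \<alpha> (RT.pt r x) = r * \<xi> x" using ex_dual[OF xi(1)] by (rule bexE)
   show False using val[OF x(1) al(1)] al(2) x xi(2) by simp
  qed
 qed
 have d: "2 \<le> depth (cA - Units ring_A) M" using mcm by (rule mcm_depth)
 obtain m where m: "m \<in> carrier M" "m \<noteq> \<zero>\<^bsub>M\<^esub>" using ex_nonzero[OF d] by (rule bexE)
 have pm: "\<phi> m \<noteq> 0"
 proof
  assume "\<phi> m = 0"
  then have "\<phi> m = \<phi> \<zero>\<^bsub>M\<^esub>" using linear_RD(3)[OF lin] by simp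
  then show False using inj_onD[OF inj _ m(1) M.M.zero_closed] m(2) by simp
 qed
 have "\<phi> ` carrier M = Lpq p q c"
 proof (rule stable_eq_Lpq[OF image_A_stable[OF lin] mcm_saturated[OF lin inj d] imageI[OF m(1)] pm])
  show "\<phi> ` carrier M \<subseteq> Lpq p q c"
  proof
   fix l assume "l \<in> \<phi> ` carrier M"
   then obtain x where x: "l = \<phi> x" "x \<in> carrier M" by (rule imageE)
   have "fps_to_fls (res_u l) = \<psi> (KT.pt 1 x) * fls_X ^ p" "fps_to_fls (res_v l) = \<psi> (KT.pt 1 x) * (fls_const c * fls_X ^ q)"
    using Q[rule_format, OF x(2)] by (simp_all add: x(1) \<phi>_def R_to_QR_eq K_to_QR_def)
   then have "fls_const c * fls_X ^ q * fps_to_fls (res_u l) = fls_X ^ p * fps_to_fls (res_v l)" by (simp add: ac_simps)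
   then have "fps_to_fls (fps_const c * fps_X ^ q * res_u l) = fps_to_fls (fps_X ^ p * res_v l)"
    by (simp only: fls_times_fps_to_fls fps_const_to_fls fps_to_fls_power fps_X_to_fls)
   then show "l \<in> Lpq p q c" by (simp add: Lpq_def Line_def)
  qed
  fix g assume sub: "\<phi> ` carrier M \<subseteq> range ((*) g)"
  have "\<phi> m \<in> range ((*) g)" using sub imageI[OF m(1)] by (rule subsetD)
  then have g: "g \<noteq> 0" using pm by auto
  have "\<phi> ` carrier M = (*) g ` {r. g * r \<in> \<phi> ` carrier M}"
  proof (intro equalityI subsetI)
   fix l assume l: "l \<in> \<phi> ` carrier M"
   then have "l \<in> range ((*) g)" by (rule subsetD[OF sub])
   then obtain r where r: "l = g * r" by (rule rangeE)
   then show "l \<in> (*) g ` {r. g * r \<in> \<phi> ` carrier M}" using l unfolding r by (intro imageI CollectI)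
  next
   fix l assume "l \<in> (*) g ` {r. g * r \<in> \<phi> ` carrier M}"
   then obtain r where r: "l = g * r" "r \<in> {r. g * r \<in> \<phi> ` carrier M}" by (rule imageE)
   show "l \<in> \<phi> ` carrier M" using r(2) unfolding r(1) by (rule CollectD)
  qed
  from rescale[OF lin inj g this] obtain \<xi> where xi: "linear_R \<xi>" "\<forall>x\<in>carrier M. \<phi> x = g * \<xi> x" by (elim exE conjE) (rule that)
  obtain \<alpha> where al: "\<alpha> \<in> carrier D" "\<forall>x\<in>carrier M. \<forall>r. \<alpha> (RT.pt r x) = r * \<xi> x" using ex_dual[OF xi(1)] by (rule bexE)
  have e: "\<xi> m = \<phi> m * E \<alpha>" using val[OF m(1) al(1)] al(2) m(1) by simp
  have pm': "\<phi> m = g * \<xi> m" using xi(2) m(1) by (rule bspec)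
  have "\<phi> m * 1 = \<phi> m * (g * E \<alpha>)" using pm' e by (metis mult.right_neutral mult.left_commute)
  then have "g * E \<alpha> = 1" using pm by simp
  then show "\<exists>h. g * h = 1" by (rule exI)
 qed
 then show ?thesis unfolding realizes_def using A_module_axioms lin inj by (intro exI[of _ \<phi>]) simp
qed

end

section \<open>From triples to lines, and the classification\<close>

lemma is_M_iff:
 fixes M :: "('k::field fps fps fps set, 'm) module"
 assumes pq: "min p q = 1" and c: "c \<noteq> 0"
 shows "is_M (p, q) c M \<longleftrightarrow> (\<exists>\<phi>. realizes M \<phi> (Lpq p q c))"
proof
 assume M: "is_M (p, q) c M"
 then have mcm: "maximal_cohen_macaulay ring_A M" and t: "triple_isomorphic (triple_of M) (rank_one_triple p q c)"
  by (simp_all add: is_M_def)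
 have "A_module M" using mcm unfolding maximal_cohen_macaulay_def by (intro A_module.intro) (rule conjunct1)
 then show "\<exists>\<phi>. realizes M \<phi> (Lpq p q c)" using mcm t by (rule A_module.triple_realizes)
next
 assume "\<exists>\<phi>. realizes M \<phi> (Lpq p q c)"
 then obtain \<phi> where M: "realizes M \<phi> (Lpq p q c)" by (rule exE)
 have pq1: "1 \<le> p" "1 \<le> q" using pq by auto
 have "maximal_cohen_macaulay ring_A M" using realizes_Lpq(1)[OF M pq c] unfolding rank_one_mcm_def by (rule conjunct1)
 then show "is_M (p, q) c M" unfolding is_M_def fst_conv snd_conv using A_module.triple_of_Lpq[OF realizesD[OF M] pq1 c] by (rule conjI)
qed

lemma rank_one_not_lfps:
 fixes N :: "('k::field fps fps fps set, 'm) module"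
 shows "rank_one_mcm (ideal_module ring_A (ideal_xy :: 'k fps fps fps set set))" "\<not> lfps (ideal_module ring_A (ideal_xy :: 'k fps fps fps set set))"
  "isomorphic ring_A (ideal_module ring_A (ideal_xy :: 'k fps fps fps set set)) (restrict_scalars A_to_R ring_R)"
  "rank_one_mcm N ==> \<not> lfps N ==> isomorphic ring_A N (ideal_module ring_A ideal_xy) \<and> isomorphic ring_A N (restrict_scalars A_to_R ring_R)"
proof -
 obtain \<phi> where I: "realizes (ideal_module ring_A (ideal_xy :: 'k fps fps fps set set)) \<phi> UNIV" using realizes_ideal_xy by (rule exE)
 show "rank_one_mcm (ideal_module ring_A (ideal_xy :: 'k fps fps fps set set))" "\<not> lfps (ideal_module ring_A (ideal_xy :: 'k fps fps fps set set))"
  by (rule realizes_UNIV[OF I])+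
 show "isomorphic ring_A (ideal_module ring_A (ideal_xy :: 'k fps fps fps set set)) (restrict_scalars A_to_R ring_R)"
  by (rule realizes_isomorphic[OF I realizes_R])
 assume N: "rank_one_mcm N" "\<not> lfps N"
 obtain \<psi> where "realizes N \<psi> UNIV \<or> (\<exists>p q c. c \<noteq> 0 \<and> min p q = 1 \<and> realizes N \<psi> (Lpq p q c))" using rank_one_mcm_realizes[OF N(1)] by (rule exE)
 then have "realizes N \<psi> UNIV" using realizes_Lpq(2) N(2) by blast
 then show "isomorphic ring_A N (ideal_module ring_A ideal_xy) \<and> isomorphic ring_A N (restrict_scalars A_to_R ring_R)"
  using realizes_isomorphic[OF _ I] realizes_isomorphic[OF _ realizes_R] by blast
qed

lemma rank_one_lfps:
 fixes M :: "('k::field fps fps fps set, 'm) module"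
 assumes M: "rank_one_mcm M" "lfps M"
 shows "isomorphic ring_A M (self_module ring_A) \<or> (\<exists>m l. admissible m l \<and> (is_M (1, m) l M \<or> is_M (m, 1) l M))"
proof -
 obtain \<psi> where "realizes M \<psi> UNIV \<or> (\<exists>p q c. c \<noteq> 0 \<and> min p q = 1 \<and> realizes M \<psi> (Lpq p q c))" using rank_one_mcm_realizes[OF M(1)] by (rule exE)
 then obtain p q c where c: "c \<noteq> 0" "min p q = 1" and r: "realizes M \<psi> (Lpq p q c)" using realizes_UNIV(2) M(2) by blast
 have isM: "is_M (p, q) c M" using r is_M_iff[OF c(2,1)] by blast
 show ?thesis
 proof (cases "p = 1 \<and> q = 1 \<and> c = 1")
  case True
  then have "realizes M \<psi> Asub" using r by (simp only: Lpq_eq_Asub)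
  then show ?thesis using realizes_isomorphic[OF _ realizes_self] by blast
 next
  case False
  show ?thesis
  proof (cases "p = 1")
   case True
   then have "admissible q c" using c False by (auto simp: admissible_def)
   then show ?thesis using isM unfolding True by blast
  next
   case p: False
   then have "q = 1" "admissible p c" using c by (auto simp: admissible_def min_def split: if_splits)
   then show ?thesis using isM by blast
  qed
 qed
qed

text \<open>The disjunction in \<open>pq\<close> treats the two families of ideals by one proof,
  both being realized by a line with minimum exponent 1.\<close>

lemma ideals_are_M:
 fixes l :: "'k::field"
 assumes ml: "admissible m l" and pq: "p = 1 \<and> q = m \<and> J = ideal_I m l \<or> p = m \<and> q = 1 \<and> J = ideal_J m l"
 shows "is_M (p, q) l (ideal_module ring_A J)" "is_M (p, q) l (M :: ('k fps fps fps set, 'm) module) ==> isomorphic ring_A M (ideal_module ring_A J)"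
  "rank_one_mcm (ideal_module ring_A J)" "lfps (ideal_module ring_A J)" "\<not> isomorphic ring_A (ideal_module ring_A J) (self_module ring_A)"
proof -
 have l: "min p q = 1" "l \<noteq> 0" "\<not> (p = 1 \<and> q = 1 \<and> l = 1)" using ml pq unfolding admissible_def by (elim disjE conjE; simp)+
 have ex: "\<exists>\<phi>. realizes (ideal_module ring_A J) \<phi> (Lpq p q l)" using pq by (elim disjE conjE; simp only: realizes_ideal_I[OF ml] realizes_ideal_J[OF ml])
 then obtain \<phi> where r: "realizes (ideal_module ring_A J) \<phi> (Lpq p q l)" by (rule exE)
 show "is_M (p, q) l (ideal_module ring_A J)" unfolding is_M_iff[OF l(1,2)] by (rule ex)
 show "rank_one_mcm (ideal_module ring_A J)" "lfps (ideal_module ring_A J)" "\<not> isomorphic ring_A (ideal_module ring_A J) (self_module ring_A)"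
  using realizes_Lpq[OF r l(1,2)] l(3) by blast+
 assume "is_M (p, q) l M"
 then obtain \<psi> where "realizes M \<psi> (Lpq p q l)" unfolding is_M_iff[OF l(1,2)] by (rule exE)
 then show "isomorphic ring_A M (ideal_module ring_A J)" using r by (rule realizes_isomorphic)
qed

lemma self_module_rank_one:
 "rank_one_mcm (self_module (ring_A :: 'k::field fps fps fps set ring))" "lfps (self_module (ring_A :: 'k fps fps fps set ring))"
proof -
 have r: "realizes (self_module (ring_A :: 'k fps fps fps set ring)) A_to_R (Lpq 1 1 1)" unfolding Lpq_eq_Asub by (rule realizes_self)
 show "rank_one_mcm (self_module (ring_A :: 'k fps fps fps set ring))" "lfps (self_module (ring_A :: 'k fps fps fps set ring))"
  by (rule realizes_Lpq[OF r]; simp)+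
qed

theorem proposition5p3:
  shows
    "\<comment> \<open>part (1)\<close>
     is_normalization A_to_R ring_A (ring_R :: 'k::field fps fps ring) \<and>
     conductor A_to_R ring_A (ring_R :: 'k fps fps ring) = ideal_xy \<and>
     (let I = ideal_module ring_A (ideal_xy :: 'k fps fps fps set set);
          R = restrict_scalars A_to_R (ring_R :: 'k fps fps ring)
      in rank_one_mcm I \<and> \<not> lfps I \<and> isomorphic ring_A I R \<and>
         (\<forall>N :: ('k fps fps fps set, 'm) module. rank_one_mcm N \<and> \<not> lfps N \<longrightarrow>
            isomorphic ring_A N I \<and> isomorphic ring_A N R)) \<and>
     \<comment> \<open>part (2)\<close>
     (let A = self_module (ring_A :: 'k fps fps fps set ring);
          I = (\<lambda>m (l::'k). ideal_module ring_A (ideal_I m l));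
          J = (\<lambda>m (l::'k). ideal_module ring_A (ideal_J m l))
      in (\<forall>M :: ('k fps fps fps set, 'm) module. rank_one_mcm M \<and> lfps M \<longrightarrow>
            isomorphic ring_A M A \<or>
            (\<exists>m l. admissible m l \<and> (is_M (1, m) l M \<or> is_M (m, 1) l M))) \<and>
         (\<forall>m l. admissible m l \<longrightarrow>
            is_M (1, m) l (I m l) \<and> is_M (m, 1) l (J m l) \<and>
            (\<forall>M :: ('k fps fps fps set, 'm) module.
               (is_M (1, m) l M \<longrightarrow> isomorphic ring_A M (I m l)) \<and>
               (is_M (m, 1) l M \<longrightarrow> isomorphic ring_A M (J m l)))) \<and>
         rank_one_mcm A \<and> lfps A \<and>
         (\<forall>m l. admissible m l \<longrightarrow>
            rank_one_mcm (I m l) \<and> lfps (I m l) \<and> \<not> isomorphic ring_A (I m l) A \<and>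
            rank_one_mcm (J m l) \<and> lfps (J m l) \<and> \<not> isomorphic ring_A (J m l) A))"
proof -
 note I = ideals_are_M[OF _ disjI1[OF conjI[OF refl conjI[OF refl refl]]]]
 note J = ideals_are_M[OF _ disjI2[OF conjI[OF refl conjI[OF refl refl]]]]
 have 1: "\<forall>N :: ('k fps fps fps set, 'm) module. rank_one_mcm N \<and> \<not> lfps N \<longrightarrow>
   isomorphic ring_A N (ideal_module ring_A ideal_xy) \<and> isomorphic ring_A N (restrict_scalars A_to_R ring_R)"
  by (intro allI impI rank_one_not_lfps(4)) (erule conjunct1, erule conjunct2)
 have 2: "\<forall>M :: ('k fps fps fps set, 'm) module. rank_one_mcm M \<and> lfps M \<longrightarrow> isomorphic ring_A M (self_module ring_A) \<or>
   (\<exists>m l. admissible m l \<and> (is_M (1, m) l M \<or> is_M (m, 1) l M))"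
  by (intro allI impI rank_one_lfps) (erule conjunct1, erule conjunct2)
 have 3: "\<forall>m (l::'k). admissible m l \<longrightarrow>
   is_M (1, m) l (ideal_module ring_A (ideal_I m l)) \<and> is_M (m, 1) l (ideal_module ring_A (ideal_J m l)) \<and>
   (\<forall>M :: ('k fps fps fps set, 'm) module.
     (is_M (1, m) l M \<longrightarrow> isomorphic ring_A M (ideal_module ring_A (ideal_I m l))) \<and>
     (is_M (m, 1) l M \<longrightarrow> isomorphic ring_A M (ideal_module ring_A (ideal_J m l))))"
  by (intro allI impI conjI) (erule I(1), erule J(1), erule (1) I(2), erule (1) J(2))
 have 4: "\<forall>m (l::'k). admissible m l \<longrightarrow>
   rank_one_mcm (ideal_module ring_A (ideal_I m l)) \<and> lfps (ideal_module ring_A (ideal_I m l)) \<and> \<not> isomorphic ring_A (ideal_module ring_A (ideal_I m l)) (self_module ring_A) \<and>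
   rank_one_mcm (ideal_module ring_A (ideal_J m l)) \<and> lfps (ideal_module ring_A (ideal_J m l)) \<and> \<not> isomorphic ring_A (ideal_module ring_A (ideal_J m l)) (self_module ring_A)"
  by (intro allI impI conjI) (erule I(3), erule I(4), erule I(5), erule J(3), erule J(4), erule J(5))
 show ?thesis
  unfolding Let_def by (intro conjI normalization_A conductor_eq rank_one_not_lfps(1-3) self_module_rank_one 1 2 3 4)
qed

end
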